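(* Let $(M,\mu)$ be a probability space, let $\delta_0>\delta_1>1$, let $C_0>0$, and let $(\rho_\theta(0))_{\theta\in M}$, $(\xi_\theta(0))_{\theta\in M}$ (real- and $\mathbb{R}^3$-valued respectively) and, for $\varepsilon\in(0,1]$, $(E^0_\varepsilon,B^0_\varepsilon)$ ($\mathbb{R}^3$-valued) be functions on $\mathbb{T}^3$ belonging to $B_{\delta_0}$, satisfying $$\nabla\cdot E^0_\varepsilon=\int_M\rho_\theta(0)\,\mu(d\theta)-1,\qquad\nabla\cdot B^0_\varepsilon=0,$$ and such that $$\sup_\theta|\rho_\theta(0)|_{\delta_0}\le C_0,\qquad\sup_\theta|\xi_\theta(0)|_{\delta_0}\le C_0 .$$ Assume also that for some $\gamma\in[0,1]$, $$|E^0_\varepsilon|_{\delta_0}+|B^0_\varepsilon|_{\delta_0}\le C_0\,\varepsilon^{-\gamma}.$$ Then there exists $\varepsilon_0>0$ such that for any $\varepsilon\in(0,\varepsilon_0)$ there exist a time $T>0$ and functions $(\rho^\varepsilon_\theta)_\theta$, $(\xi^\varepsilon_\theta)_\theta$ in $C([0,T],B_{\delta_1})$ which are solutions to the multifluid system (MF) with initial conditions $(\rho_\theta(0))_\theta$, $(\xi_\theta(0))_\theta$, $(E^0_\varepsilon,B^0_\varepsilon)$. Moreover there exists $C>0$ such that for all $\varepsilon\in(0,\varepsilon_0)$, $$\sup_\theta|\rho^\varepsilon_\theta|_{L^\infty(0,T;B_{\delta_1})}+\sup_\theta|\xi^\varepsilon_\theta|_{L^\infty(0,T;B_{\delta_1})}\le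 C,$$ $$|E|_{L^\infty(0,T;B_{\delta_1})}+|B|_{L^\infty(0,T;B_{\delta_1})}\le C\,\varepsilon^{-\gamma},$$ where $E=-\nabla_x\phi-\varepsilon\partial_tA$ and $B=\nabla_x\times A+\langle B^0_\varepsilon\rangle$.
   Context: $\mathbb{T}^3=\mathbb{R}^3/\mathbb{Z}^3$ with normalized Lebesgue measure, $\langle g\rangle=\int_{\mathbb{T}^3}g\,dx$. For $\delta>1$, $B_\delta$ is the space of real functions $f$ on $\mathbb{T}^3$ with $|f|_\delta:=\sum_{k\in\mathbb{Z}^3}|\hat f(k)|\,\delta^{|k|}<+\infty$, $\hat f(k)$ being the Fourier coefficients of $f$ (same notation for vector-valued functions). $v(\xi)=\xi/(1+\varepsilon^2|\xi|^2)^{1/2}$. $\mathbb{P}$ is the Leray projection onto divergence-free vector fields. The multifluid system (MF) (associated with the relativistic Vlasov-Maxwell system through $f(t,x,d\xi)=\int_M\rho_\theta(t,x)\delta(\xi-\xi_\theta(t,x))\mu(d\theta)$), with parameter $\varepsilon$, unknowns $(\rho_\theta,\xi_\theta)_{\theta\in M},\phi,A$ and data $(\rho_\theta(0),\xi_\theta(0))_\theta,E^0,B^0$, is: for all $\theta\in M$, $$\partial_t\rho_\theta+\nabla_x\cdot(v(\xi_\theta)\rho_\theta)=0,$$ $$\partial_t\xi_\theta+(v(\xi_\theta)\cdot\nabla_x)\xi_\theta=-\nabla_x\phi-\varepsilon\partial_tA+\varepsilon v(\xi_\theta)\times(\nabla_x\times A+\langle B^0\rangle),$$ together with $$\varepsilon^2\partial_t^2A-\Delta_xA=\varepsilon\,\mathbb{P}\Big(\int_Mv(\xi_\theta)\rho_\theta\,\mu(d\theta)\Big),\qquad-\Delta_x\phi=\int_M\rho_\theta\,\mu(d\theta)-1,$$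 and initial conditions $\rho_\theta|_{t=0}=\rho_\theta(0)$, $\xi_\theta|_{t=0}=\xi_\theta(0)$, $\varepsilon\partial_tA|_{t=0}=-(E^0+\nabla_x\phi|_{t=0})$, $\nabla\times A|_{t=0}=B^0-\langle B^0\rangle$, $\langle A|_{t=0}\rangle=0$, with the Coulomb gauge $\nabla\cdot A=0$. *)

theory Defs
  imports "HOL-Probability.Probability"
begin

text \<open>
  Functions on the torus are represented by functions on \<open>real ^ 3\<close> that are periodic with respect
  to the integer lattice; the torus itself is represented by the unit cube with Lebesgue measure.
\<close>

definition int_vec :: "int ^ 3 \<Rightarrow> real ^ 3" where
  "int_vec k = (\<chi> i. of_int (k $ i))"

definition periodic :: "(real ^ 3 \<Rightarrow> 'b) \<Rightarrow> bool" where
  "periodic f \<longleftrightarrow> (\<forall>x k. f (x + int_vec k) = f x)"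

definition torus_mean :: "(real ^ 3 \<Rightarrow> 'b :: {banach, second_countable_topology}) \<Rightarrow> 'b" where
  "torus_mean g = set_lebesgue_integral lborel (cbox 0 1) g"

definition fourier :: "(real ^ 3 \<Rightarrow> real) \<Rightarrow> int ^ 3 \<Rightarrow> complex" where
  "fourier f k = torus_mean (\<lambda>x. of_real (f x) * cis (- 2 * pi * (int_vec k \<bullet> x)))"

definition fourier_vec :: "(real ^ 3 \<Rightarrow> real ^ 3) \<Rightarrow> int ^ 3 \<Rightarrow> complex ^ 3" where
  "fourier_vec F k = (\<chi> i. fourier (\<lambda>x. F x $ i) k)"

definition weighted_sum :: "real \<Rightarrow> (int ^ 3 \<Rightarrow> 'b :: real_normed_vector) \<Rightarrow> ennreal" where
  "weighted_sum \<delta> c = (\<Sum>\<^sub>\<infinity>k. ennreal (norm (c k) * \<delta> powr norm (int_vec k)))"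

definition B_norm :: "real \<Rightarrow> (real ^ 3 \<Rightarrow> real) \<Rightarrow> ennreal" where
  "B_norm \<delta> f = weighted_sum \<delta> (fourier f)"

definition B_norm_vec :: "real \<Rightarrow> (real ^ 3 \<Rightarrow> real ^ 3) \<Rightarrow> ennreal" where
  "B_norm_vec \<delta> F = weighted_sum \<delta> (fourier_vec F)"

text \<open>
  A function with a finite norm coincides almost everywhere with its absolutely convergent
  Fourier series; the continuity requirement selects this representative.
\<close>

definition B_space :: "real \<Rightarrow> (real ^ 3 \<Rightarrow> real) set" where
  "B_space \<delta> = {f. periodic f \<and> continuous_on UNIV f \<and> B_norm \<delta> f < \<infinity>}"

definition B_space_vec :: "real \<Rightarrow> (real ^ 3 \<Rightarrow> real ^ 3) set" where
  "B_space_vec \<delta> = {F. periodic F \<and> continuous_on UNIV F \<and> B_norm_vec \<delta> F < \<infinity>}"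

definition continuous_curve ::
  "((real ^ 3 \<Rightarrow> 'b :: ab_group_add) \<Rightarrow> ennreal) \<Rightarrow> (real ^ 3 \<Rightarrow> 'b) set \<Rightarrow>
   real \<Rightarrow> (real \<Rightarrow> real ^ 3 \<Rightarrow> 'b) \<Rightarrow> bool" where
  "continuous_curve N S T u \<longleftrightarrow>
     (\<forall>t\<in>{0..T}. u t \<in> S) \<and>
     (\<forall>t\<in>{0..T}. ((\<lambda>s. N (\<lambda>x. u s x - u t x)) \<longlongrightarrow> 0) (at t within {0..T}))"

text \<open>
  \<open>N\<close> is the norm of the target space; the essential supremum is infinite if the norm is not a
  measurable function of time.
\<close>

definition Linf_norm ::
  "((real ^ 3 \<Rightarrow> 'b) \<Rightarrow> ennreal) \<Rightarrow> real \<Rightarrow> (real \<Rightarrow> real ^ 3 \<Rightarrow> 'b) \<Rightarrow> ennreal" where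
  "Linf_norm N T u = esssup (restrict_space lborel {0<..<T}) (\<lambda>t. N (u t))"

definition pderiv_x :: "3 \<Rightarrow> (real ^ 3 \<Rightarrow> 'b :: real_normed_vector) \<Rightarrow> real ^ 3 \<Rightarrow> 'b" where
  "pderiv_x i f x = frechet_derivative f (at x) (axis i 1)"

text \<open>The time derivative on \<open>[0, T]\<close> is one-sided at the end points.\<close>

definition pderiv_t ::
  "real \<Rightarrow> (real \<Rightarrow> real ^ 3 \<Rightarrow> 'b :: real_normed_vector) \<Rightarrow> real \<Rightarrow> real ^ 3 \<Rightarrow> 'b" where
  "pderiv_t T u t x = vector_derivative (\<lambda>s. u s x) (at t within {0..T})"

definition grad :: "(real ^ 3 \<Rightarrow> real) \<Rightarrow> real ^ 3 \<Rightarrow> real ^ 3" where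
  "grad f x = (\<chi> i. pderiv_x i f x)"

definition divergence :: "(real ^ 3 \<Rightarrow> real ^ 3) \<Rightarrow> real ^ 3 \<Rightarrow> real" where
  "divergence F x = (\<Sum>i\<in>UNIV. pderiv_x i (\<lambda>y. F y $ i) x)"

definition curl :: "(real ^ 3 \<Rightarrow> real ^ 3) \<Rightarrow> real ^ 3 \<Rightarrow> real ^ 3" where
  "curl F x = vector
     [pderiv_x 2 (\<lambda>y. F y $ 3) x - pderiv_x 3 (\<lambda>y. F y $ 2) x,
      pderiv_x 3 (\<lambda>y. F y $ 1) x - pderiv_x 1 (\<lambda>y. F y $ 3) x,
      pderiv_x 1 (\<lambda>y. F y $ 2) x - pderiv_x 2 (\<lambda>y. F y $ 1) x]"

definition laplacian :: "(real ^ 3 \<Rightarrow> 'b :: real_normed_vector) \<Rightarrow> real ^ 3 \<Rightarrow> 'b" where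
  "laplacian f x = (\<Sum>i\<in>UNIV. pderiv_x i (pderiv_x i f) x)"

definition dir_deriv :: "real ^ 3 \<Rightarrow> (real ^ 3 \<Rightarrow> real ^ 3) \<Rightarrow> real ^ 3 \<Rightarrow> real ^ 3" where
  "dir_deriv w F x = (\<Sum>i\<in>UNIV. w $ i *\<^sub>R pderiv_x i F x)"

text \<open>
  The Leray projection as a Fourier multiplier. The zero mode is left unchanged, since constant
  fields are divergence-free (here \<open>k = 0\<close> is covered by \<open>z / 0 = 0\<close>).
\<close>

definition leray_symbol :: "int ^ 3 \<Rightarrow> complex ^ 3 \<Rightarrow> complex ^ 3" where
  "leray_symbol k c =
     (\<chi> i. c $ i - of_int (k $ i) * (\<Sum>j\<in>UNIV. of_int (k $ j) * c $ j) / of_real ((norm (int_vec k))\<^sup>2))"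

definition leray :: "(real ^ 3 \<Rightarrow> real ^ 3) \<Rightarrow> real ^ 3 \<Rightarrow> real ^ 3" where
  "leray F x =
     (\<chi> i. Re (\<Sum>\<^sub>\<infinity>k. leray_symbol k (fourier_vec F k) $ i * cis (2 * pi * (int_vec k \<bullet> x))))"

definition jointly_continuous :: "real \<Rightarrow> (real \<Rightarrow> real ^ 3 \<Rightarrow> 'b :: real_normed_vector) \<Rightarrow> bool" where
  "jointly_continuous T u \<longleftrightarrow> continuous_on ({0..T} \<times> UNIV) (\<lambda>(t, x). u t x)"

definition C1_x :: "real \<Rightarrow> (real \<Rightarrow> real ^ 3 \<Rightarrow> 'b :: real_normed_vector) \<Rightarrow> bool" where
  "C1_x T u \<longleftrightarrow>
     (\<forall>t\<in>{0..T}. periodic (u t) \<and> u t differentiable_on UNIV) \<and>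
     jointly_continuous T u \<and> (\<forall>i. jointly_continuous T (\<lambda>t. pderiv_x i (u t)))"

definition C1_tx :: "real \<Rightarrow> (real \<Rightarrow> real ^ 3 \<Rightarrow> 'b :: real_normed_vector) \<Rightarrow> bool" where
  "C1_tx T u \<longleftrightarrow>
     C1_x T u \<and> (\<forall>t\<in>{0..T}. \<forall>x. (\<lambda>s. u s x) differentiable (at t within {0..T})) \<and>
     jointly_continuous T (pderiv_t T u)"

definition C2_x :: "real \<Rightarrow> (real \<Rightarrow> real ^ 3 \<Rightarrow> 'b :: real_normed_vector) \<Rightarrow> bool" where
  "C2_x T u \<longleftrightarrow> C1_x T u \<and> (\<forall>i. C1_x T (\<lambda>t. pderiv_x i (u t)))"

definition C2_tx :: "real \<Rightarrow> (real \<Rightarrow> real ^ 3 \<Rightarrow> 'b :: real_normed_vector) \<Rightarrow> bool" where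
  "C2_tx T u \<longleftrightarrow>
     C1_tx T u \<and> C1_tx T (pderiv_t T u) \<and> (\<forall>i. C1_tx T (\<lambda>t. pderiv_x i (u t)))"

definition velocity :: "real \<Rightarrow> real ^ 3 \<Rightarrow> real ^ 3" where
  "velocity \<epsilon> \<xi> = \<xi> /\<^sub>R sqrt (1 + \<epsilon>\<^sup>2 * (norm \<xi>)\<^sup>2)"

definition charge_density :: "'a measure \<Rightarrow> ('a \<Rightarrow> real ^ 3 \<Rightarrow> real) \<Rightarrow> real ^ 3 \<Rightarrow> real" where
  "charge_density M \<rho> x = (\<integral>\<theta>. \<rho> \<theta> x \<partial>M)"

definition current_density ::
  "'a measure \<Rightarrow> real \<Rightarrow> ('a \<Rightarrow> real ^ 3 \<Rightarrow> real) \<Rightarrow> ('a \<Rightarrow> real ^ 3 \<Rightarrow> real ^ 3) \<Rightarrow>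
   real ^ 3 \<Rightarrow> real ^ 3" where
  "current_density M \<epsilon> \<rho> \<xi> x = (\<integral>\<theta>. \<rho> \<theta> x *\<^sub>R velocity \<epsilon> (\<xi> \<theta> x) \<partial>M)"

definition measurable_family ::
  "'a measure \<Rightarrow> ('a \<Rightarrow> real ^ 3 \<Rightarrow> 'b :: topological_space) \<Rightarrow> bool" where
  "measurable_family M u \<longleftrightarrow> (\<forall>x. (\<lambda>\<theta>. u \<theta> x) \<in> borel_measurable M)"

definition electric_field ::
  "real \<Rightarrow> real \<Rightarrow> (real \<Rightarrow> real ^ 3 \<Rightarrow> real) \<Rightarrow> (real \<Rightarrow> real ^ 3 \<Rightarrow> real ^ 3) \<Rightarrow>
   real \<Rightarrow> real ^ 3 \<Rightarrow> real ^ 3" where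
  "electric_field \<epsilon> T \<phi> A t x = - grad (\<phi> t) x - \<epsilon> *\<^sub>R pderiv_t T A t x"

definition magnetic_field ::
  "(real ^ 3 \<Rightarrow> real ^ 3) \<Rightarrow> (real \<Rightarrow> real ^ 3 \<Rightarrow> real ^ 3) \<Rightarrow> real \<Rightarrow> real ^ 3 \<Rightarrow> real ^ 3" where
  "magnetic_field B0 A t x = curl (A t) x + torus_mean B0"

text \<open>
  Classical solutions on \<open>[0, T]\<close>. The measurability and integrability clauses make the integrals
  over \<open>M\<close> meaningful. The potential \<open>\<phi>\<close> is only determined up to a function of time.
\<close>

definition MF_solution ::
  "'a measure \<Rightarrow> real \<Rightarrow> real \<Rightarrow>
   ('a \<Rightarrow> real ^ 3 \<Rightarrow> real) \<Rightarrow> ('a \<Rightarrow> real ^ 3 \<Rightarrow> real ^ 3) \<Rightarrow>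
   (real ^ 3 \<Rightarrow> real ^ 3) \<Rightarrow> (real ^ 3 \<Rightarrow> real ^ 3) \<Rightarrow>
   ('a \<Rightarrow> real \<Rightarrow> real ^ 3 \<Rightarrow> real) \<Rightarrow> ('a \<Rightarrow> real \<Rightarrow> real ^ 3 \<Rightarrow> real ^ 3) \<Rightarrow>
   (real \<Rightarrow> real ^ 3 \<Rightarrow> real) \<Rightarrow> (real \<Rightarrow> real ^ 3 \<Rightarrow> real ^ 3) \<Rightarrow> bool" where
  "MF_solution M \<epsilon> T \<rho>0 \<xi>0 E0 B0 \<rho> \<xi> \<phi> A \<longleftrightarrow>
     (\<forall>\<theta>\<in>space M. C1_tx T (\<rho> \<theta>) \<and> C1_tx T (\<xi> \<theta>)) \<and> C2_x T \<phi> \<and> C2_tx T A \<and>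
     (\<forall>t\<in>{0..T}.
        measurable_family M (\<lambda>\<theta>. \<rho> \<theta> t) \<and> measurable_family M (\<lambda>\<theta>. \<xi> \<theta> t) \<and>
        (\<forall>x. integrable M (\<lambda>\<theta>. \<rho> \<theta> t x) \<and>
             integrable M (\<lambda>\<theta>. \<rho> \<theta> t x *\<^sub>R velocity \<epsilon> (\<xi> \<theta> t x)))) \<and>
     (\<forall>\<theta>\<in>space M. \<forall>t\<in>{0..T}. \<forall>x.
        pderiv_t T (\<rho> \<theta>) t x
          + divergence (\<lambda>y. \<rho> \<theta> t y *\<^sub>R velocity \<epsilon> (\<xi> \<theta> t y)) x = 0 \<and>
        pderiv_t T (\<xi> \<theta>) t x + dir_deriv (velocity \<epsilon> (\<xi> \<theta> t x)) (\<xi> \<theta> t) x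
          = - grad (\<phi> t) x - \<epsilon> *\<^sub>R pderiv_t T A t x
            + \<epsilon> *\<^sub>R cross3 (velocity \<epsilon> (\<xi> \<theta> t x)) (curl (A t) x + torus_mean B0)) \<and>
     (\<forall>t\<in>{0..T}. \<forall>x.
        \<epsilon>\<^sup>2 *\<^sub>R pderiv_t T (pderiv_t T A) t x - laplacian (A t) x
          = \<epsilon> *\<^sub>R leray (current_density M \<epsilon> (\<lambda>\<theta>. \<rho> \<theta> t) (\<lambda>\<theta>. \<xi> \<theta> t)) x \<and>
        - laplacian (\<phi> t) x = charge_density M (\<lambda>\<theta>. \<rho> \<theta> t) x - 1 \<and>
        divergence (A t) x = 0) \<and>
     (\<forall>\<theta>\<in>space M. \<forall>x. \<rho> \<theta> 0 x = \<rho>0 \<theta> x \<and> \<xi> \<theta> 0 x = \<xi>0 \<theta> x) \<and>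
     (\<forall>x. \<epsilon> *\<^sub>R pderiv_t T A 0 x = - (E0 x + grad (\<phi> 0) x)) \<and>
     (\<forall>x. curl (A 0) x = B0 x - torus_mean B0) \<and>
     torus_mean (A 0) = 0"

end

theory Submission
  imports Defs
begin

text \<open>
  The existence time may depend on \<open>\<epsilon>\<close>, so for each \<open>\<epsilon>\<close> a Cauchy--Kovalevskaya argument suffices.
  Unknowns are power series in time with coefficients in a Wiener algebra on the torus, and the
  coefficient of \<open>t ^ n\<close> in the Fourier mode \<open>k\<close> is weighted by the supremum of
  \<open>t ^ n * exp ((a - b * t) * |k|)\<close> over \<open>t \<in> {0..R}\<close>. These weights are submultiplicative, so the
  space is an algebra, and integration in time gains one spatial derivative with a factor that is
  small for large \<open>b\<close> and small \<open>R\<close>. The system, written as a polynomial first-order system,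
  determines the time coefficients recursively; no contraction is needed, as the Picard
  iterates stabilise coefficientwise and stay bounded by the norm of the initial value plus one.
  Smallness of \<open>\<epsilon>\<close> enters only through the binomial series for the initial Lorentz factor.
\<close>

subsection \<open>Fourier series on the torus\<close>

text \<open>Transport terms and the coupling of the two field equations lose one spatial derivative.
  The unknowns therefore carry an additional factor \<open>1 + |k|\<close> in their norm and the
  right-hand side does not: differentiation removes the factor, time integration restores it. The
  right-hand side may be of size \<open>1 / \<epsilon>^2\<close>, which only shortens the time
  interval; what must not depend on \<epsilon> is the final bound. For this reason every unknown
  keeps its own initial size instead of one common constant: density and momentum never grow by more
  than one, and the rate of the vector potential starts at order
  \<open>\<epsilon>^(-\<gamma>) / \<epsilon>\<close> but enters the electric field with a factor
  \<epsilon>. The system solved is larger than the given one, so its constraints have to be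
  recovered: conservation of charge, the Coulomb gauge, the relation between magnetic field and
  vector potential, and the algebraic relation defining the Lorentz factor. The first three are
  compared mode by mode at each order in time; the last follows from a linear homogeneous equation
  with zero initial value.\<close>

lemma infsum_conv_suminf:
  fixes f :: "'k::countable \<Rightarrow> 'b::banach"
  assumes "(\<lambda>k. norm (f k)) summable_on UNIV"
  defines "g \<equiv> \<lambda>n. if n \<in> range (to_nat :: 'k \<Rightarrow> nat) then f (from_nat n) else 0"
  shows "summable (\<lambda>n. norm (g n))" "(\<Sum>\<^sub>\<infinity>k. f k) = (\<Sum>n. g n)"
proof -
  have inj: "inj (to_nat :: 'k \<Rightarrow> nat)" by simp
  have eq: "g \<circ> to_nat = f" by (auto simp: g_def)
  have "(\<lambda>n. norm (g n)) summable_on range (to_nat :: 'k \<Rightarrow> nat)"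
    using assms(1) summable_on_reindex[OF inj, of "\<lambda>n. norm (g n)"] by (simp add: o_def g_def)
  then have *: "(\<lambda>n. norm (g n)) summable_on UNIV"
    by (rule summable_on_cong_neutral[THEN iffD1, rotated -1]) (auto simp: g_def)
  then show "summable (\<lambda>n. norm (g n))" by (rule summable_on_imp_summable)
  have "(\<Sum>\<^sub>\<infinity>k. f k) = infsum g (range (to_nat :: 'k \<Rightarrow> nat))"
    unfolding infsum_reindex[OF inj] eq ..
  also have "\<dots> = infsum g UNIV"
    by (rule infsum_cong_neutral) (auto simp: g_def)
  also have "\<dots> = (\<Sum>n. g n)"
    using has_sum_infsum[OF abs_summable_summable[OF *]] has_sum_imp_sums sums_unique by blast
  finally show "(\<Sum>\<^sub>\<infinity>k. f k) = (\<Sum>n. g n)" .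
qed

text \<open>Exchange of integral and unordered sum, transported to a series over the naturals along
  \<open>to_nat\<close>. Only absolute integrability is assumed, so that it also covers averages
  over \<theta>, where the modes have no common summable majorant.\<close>

lemma integral_infsum':
  fixes f :: "'k::countable \<Rightarrow> 'a \<Rightarrow> 'b::{banach,second_countable_topology}"
  assumes fi: "\<And>k. integrable M (f k)"
    and sf: "\<And>x. x \<in> space M \<Longrightarrow> (\<lambda>k. norm (f k x)) summable_on UNIV"
    and si: "(\<lambda>k. \<integral>x. norm (f k x) \<partial>M) summable_on UNIV"
  shows "integrable M (\<lambda>x. \<Sum>\<^sub>\<infinity>k. f k x)"
    and "((\<lambda>k. \<integral>x. f k x \<partial>M) has_sum (\<integral>x. (\<Sum>\<^sub>\<infinity>k. f k x) \<partial>M)) UNIV"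
proof -
  let ?R = "range (to_nat :: 'k \<Rightarrow> nat)"
  define g where "g n x = (if n \<in> ?R then f (from_nat n) x else 0)" for n x
  have eq: "(\<Sum>\<^sub>\<infinity>k. f k x) = (\<Sum>n. g n x)" if "x \<in> space M" for x
    using infsum_conv_suminf(2)[OF sf[OF that]] by (simp add: g_def[abs_def])
  have gi: "integrable M (g n)" for n
    by (cases "n \<in> ?R") (simp_all add: g_def[abs_def] fi)
  have s1: "AE x in M. summable (\<lambda>n. norm (g n x))"
    using infsum_conv_suminf(1)[OF sf] by (auto simp: g_def[abs_def])
  have sI': "(\<lambda>k. norm (\<integral>x. norm (f k x) \<partial>M)) summable_on UNIV"
    using si by simp
  have "norm (if n \<in> ?R then \<integral>x. norm (f (from_nat n) x) \<partial>M else 0) = (\<integral>x. norm (g n x) \<partial>M)" for n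
    by (simp add: g_def[abs_def])
  then have s2: "summable (\<lambda>n. \<integral>x. norm (g n x) \<partial>M)"
    using infsum_conv_suminf(1)[OF sI'] by simp
  have int: "integrable M (\<lambda>x. \<Sum>n. g n x)" by (rule integrable_suminf[OF gi s1 s2])
  then show "integrable M (\<lambda>x. \<Sum>\<^sub>\<infinity>k. f k x)"
    using eq by (simp cong: Bochner_Integration.integrable_cong)
  have sI: "(\<lambda>k. norm (\<integral>x. f k x \<partial>M)) summable_on UNIV"
    by (rule Infinite_Sum.abs_summable_on_comparison_test'[OF si]) simp
  have "(\<integral>x. (\<Sum>\<^sub>\<infinity>k. f k x) \<partial>M) = (\<integral>x. (\<Sum>n. g n x) \<partial>M)"
    by (intro Bochner_Integration.integral_cong eq refl)
  also have "\<dots> = (\<Sum>n. \<integral>x. g n x \<partial>M)"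
    using integral_suminf[OF gi s1 s2] by simp
  also have "\<dots> = (\<Sum>\<^sub>\<infinity>k. \<integral>x. f k x \<partial>M)"
  proof -
    have *: "(if n \<in> ?R then \<integral>x. f (from_nat n) x \<partial>M else 0) = (\<integral>x. g n x \<partial>M)" for n
      by (simp add: g_def[abs_def])
    show ?thesis
      unfolding infsum_conv_suminf(2)[OF sI] * ..
  qed
  finally show "((\<lambda>k. \<integral>x. f k x \<partial>M) has_sum (\<integral>x. (\<Sum>\<^sub>\<infinity>k. f k x) \<partial>M)) UNIV"
    using has_sum_infsum[OF abs_summable_summable[OF sI]] by simp
qed

lemma integral_infsum:
  fixes f :: "'k::countable \<Rightarrow> 'a \<Rightarrow> 'b::{banach,second_countable_topology}"
  assumes M: "finite_measure M" and meas: "\<And>k. f k \<in> borel_measurable M"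
    and le: "\<And>k x. x \<in> space M \<Longrightarrow> norm (f k x) \<le> c k" and c: "c summable_on UNIV"
  shows "((\<lambda>k. \<integral>x. f k x \<partial>M) has_sum (\<integral>x. (\<Sum>\<^sub>\<infinity>k. f k x) \<partial>M)) UNIV"
proof (rule integral_infsum'(2))
  interpret finite_measure M by fact
  show fi: "integrable M (f k)" for k
    by (rule integrable_const_bound[of _ "c k"]) (use le meas in auto)
  show "(\<lambda>k. norm (f k x)) summable_on UNIV" if "x \<in> space M" for x
    by (rule Infinite_Sum.abs_summable_on_comparison_test'[OF c le[OF that]])
  have "norm (\<integral>x. norm (f k x) \<partial>M) \<le> c k * measure M (space M)" for k
  proof -
    have "(\<integral>x. norm (f k x) \<partial>M) \<le> (\<integral>x. c k \<partial>M)"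
      by (rule integral_mono) (use fi le in auto)
    then show ?thesis by (simp add: mult.commute)
  qed
  then have "(\<lambda>k. norm (\<integral>x. norm (f k x) \<partial>M)) summable_on UNIV"
    by (rule Infinite_Sum.abs_summable_on_comparison_test'[OF summable_on_cmult_left[OF c]])
  then show "(\<lambda>k. \<integral>x. norm (f k x) \<partial>M) summable_on UNIV" by simp
qed

section \<open>Characters and the mean over the unit cube\<close>

definition char_fun :: "int ^ 3 \<Rightarrow> real ^ 3 \<Rightarrow> complex" where
  "char_fun k x = cis (2 * pi * (int_vec k \<bullet> x))"

lemma int_vec_simps [simp]:
  "int_vec 0 = 0" "int_vec (k + l) = int_vec k + int_vec l" "int_vec (- k) = - int_vec k"
  "int_vec (k - l) = int_vec k - int_vec l" "int_vec k $ i = of_int (k $ i)"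
  by (simp_all add: int_vec_def vec_eq_iff)

lemma int_vec_eq_0_iff [simp]: "int_vec k = 0 \<longleftrightarrow> k = 0"
  by (simp add: int_vec_def vec_eq_iff)

lemma int_vec_inner: "int_vec k \<bullet> int_vec m = of_int (\<Sum>i\<in>UNIV. k $ i * m $ i)"
  by (simp add: inner_vec_def)

lemma char_fun_simps [simp]: "char_fun 0 x = 1" "norm (char_fun k x) = 1" "char_fun k 0 = 1"
  by (simp_all add: char_fun_def)

lemma char_fun_add: "char_fun (k + l) x = char_fun k x * char_fun l x"
  by (simp add: char_fun_def cis_mult inner_add_left distrib_left)

lemma char_fun_minus: "char_fun (- k) x = cnj (char_fun k x)"
  by (simp add: char_fun_def cis_cnj inner_minus_left)

lemma continuous_char_fun [continuous_intros]:
  "continuous_on S f \<Longrightarrow> continuous_on S (\<lambda>x. char_fun k (f x))"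
  unfolding char_fun_def by (intro continuous_intros)

lemma char_fun_periodic: "char_fun k (x + int_vec m) = char_fun k x"
proof -
  have "cis (2 * pi * (int_vec k \<bullet> int_vec m)) = 1"
    unfolding int_vec_inner by (rule cis_multiple_2pi) (rule Ints_of_int)
  then show ?thesis
    by (simp add: char_fun_def inner_add_right distrib_left flip: cis_mult)
qed

text \<open>The closed cube is compact, so continuous functions are bounded on it; its opposite
  faces are identified on the torus but are null sets.\<close>

definition cube_measure :: "(real ^ 3) measure" where
  "cube_measure = restrict_space lborel (cbox 0 1)"

lemma torus_mean_eq: "torus_mean g = (\<integral>x. g x \<partial>cube_measure)"
  unfolding torus_mean_def cube_measure_def set_lebesgue_integral_def
  by (subst integral_restrict_space) auto

lemma emeasure_cube: "emeasure lborel (cbox (0::real^3) 1) = 1"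
  by (subst emeasure_lborel_cbox) (auto simp: Basis_vec_def inner_axis prod.neutral)

lemma prob_space_cube: "prob_space cube_measure"
proof
  show "emeasure cube_measure (space cube_measure) = 1"
    by (simp add: cube_measure_def emeasure_restrict_space space_restrict_space emeasure_cube)
qed

lemma space_cube [simp]: "space cube_measure = cbox 0 1"
  by (simp add: cube_measure_def space_restrict_space)

lemma measure_cube [simp]: "measure cube_measure (cbox 0 1) = 1"
  using prob_space.prob_space[OF prob_space_cube] by simp

lemma measurable_cube: "continuous_on UNIV f \<Longrightarrow> f \<in> borel_measurable cube_measure"
  unfolding cube_measure_def
  by (intro measurable_restrict_space1) (simp add: borel_measurable_continuous_onI)

lemma continuous_bounded_cube:
  fixes f :: "real ^ 3 \<Rightarrow> 'b::real_normed_vector"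
  assumes "continuous_on UNIV f"
  obtains C where "C \<ge> 0" "\<And>x. x \<in> cbox 0 1 \<Longrightarrow> norm (f x) \<le> C"
proof -
  have "compact (f ` cbox 0 1)"
    by (intro compact_continuous_image continuous_on_subset[OF assms]) auto
  then have "bounded (f ` cbox 0 1)" by (rule compact_imp_bounded)
  then obtain C where "C > 0" "\<And>y. y \<in> f ` cbox 0 1 \<Longrightarrow> norm y \<le> C"
    unfolding bounded_pos by auto
  then show ?thesis using that[of C] by auto
qed

lemma integrable_cube:
  fixes f :: "real ^ 3 \<Rightarrow> 'b::{banach,second_countable_topology}"
  assumes "continuous_on UNIV f"
  shows "integrable cube_measure f"
proof -
  interpret prob_space cube_measure by (rule prob_space_cube)
  obtain C where "C \<ge> 0" "\<And>x. x \<in> cbox 0 1 \<Longrightarrow> norm (f x) \<le> C"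
    using continuous_bounded_cube[OF assms] by blast
  then show ?thesis
    by (intro integrable_const_bound[of _ C] measurable_cube assms AE_I2) auto
qed

lemma norm_torus_mean_le:
  fixes f :: "real ^ 3 \<Rightarrow> 'b::{banach,second_countable_topology}"
  assumes "continuous_on UNIV f" "\<And>x. x \<in> cbox 0 1 \<Longrightarrow> norm (f x) \<le> C"
  shows "norm (torus_mean f) \<le> C"
proof -
  interpret prob_space cube_measure by (rule prob_space_cube)
  have "norm (torus_mean f) \<le> (\<integral>x. norm (f x) \<partial>cube_measure)"
    unfolding torus_mean_eq by simp
  also have "\<dots> \<le> (\<integral>x. C \<partial>cube_measure)"
    by (rule integral_mono) (use assms in \<open>auto intro!: integrable_cube continuous_intros\<close>)
  finally show ?thesis by simp
qed

text \<open>Orthogonality of characters: over the cube the integral factors into one-dimensional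
  integrals, and a coordinate with nonzero frequency runs through a whole number of periods.\<close>

lemma torus_mean_char_fun: "torus_mean (char_fun k) = (if k = 0 then 1 else 0)"
proof (cases "k = 0")
  case True
  interpret prob_space cube_measure by (rule prob_space_cube)
  show ?thesis using True by (simp add: torus_mean_eq)
next
  case False
  then obtain i where i: "k $ i \<noteq> 0" by (auto simp: vec_eq_iff)
  interpret product_sigma_finite "\<lambda>_::real^3. lborel::real measure" ..
  \<comment> \<open>The indicator of the unit interval is absorbed into each factor, which turns the
    integral over the cube into the integral of a product over the whole space.\<close>
  define F where "F b t = indicator {0..1} t *\<^sub>R cis (2 * pi * (int_vec k \<bullet> b) * t)" for b :: "real^3" and t :: real
  have Fi: "integrable lborel (F b)" for b
    unfolding F_def
    by (rule borel_integrable_compact) (auto intro!: continuous_intros)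
  have prodF: "indicator (cbox 0 1) x *\<^sub>R char_fun k x = (\<Prod>b\<in>Basis. F b (x \<bullet> b))" for x :: "real^3"
  proof -
    have 1: "indicator (cbox 0 1) x = (\<Prod>b\<in>Basis. indicator {0..1} (x \<bullet> b) :: real)"
    proof (cases "x \<in> cbox 0 1")
      case True
      then show ?thesis by (auto simp: mem_box Basis_vec_def inner_axis intro!: prod.neutral)
    next
      case False
      then obtain j where "x $ j \<notin> {0..1}"
        by (auto simp: mem_box Basis_vec_def inner_axis)
      then obtain b :: "real^3" where "b \<in> Basis" "x \<bullet> b \<notin> {0..1}"
        using that[of "axis j 1"] by (simp add: inner_axis axis_in_Basis_iff)
      then show ?thesis using False by (auto simp: prod_zero_iff intro!: bexI[of _ b])
    qed
    have 2: "char_fun k x = (\<Prod>b\<in>Basis. cis (2 * pi * (int_vec k \<bullet> b) * (x \<bullet> b)))"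
    proof -
      have "2 * pi * (int_vec k \<bullet> x) = (\<Sum>b\<in>Basis. 2 * pi * (int_vec k \<bullet> b) * (x \<bullet> b))"
        by (subst euclidean_inner) (simp add: sum_distrib_left mult.assoc)
      then show ?thesis by (simp add: char_fun_def cis_conv_exp exp_sum sum_distrib_left)
    qed
    show ?thesis
      unfolding 1 2 F_def by (simp add: scaleR_conv_of_real prod.distrib)
  qed
  have "torus_mean (char_fun k) = (\<integral>x. (\<Prod>b\<in>Basis. F b (x \<bullet> b)) \<partial>(lborel::(real^3) measure))"
    unfolding torus_mean_def set_lebesgue_integral_def prodF ..
  also have "\<dots> = (\<integral>x. (\<Prod>b\<in>Basis. F b (x b)) \<partial>(\<Pi>\<^sub>M b\<in>(Basis::(real^3) set). lborel))"
  proof -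
    have meas: "(\<lambda>x::real^3. \<Prod>b\<in>Basis. F b (x \<bullet> b)) \<in> borel_measurable borel"
    proof (intro borel_measurable_prod)
      fix b :: "real^3"
      have "F b \<in> borel_measurable borel" using borel_measurable_integrable[OF Fi[of b]] by simp
      then show "(\<lambda>x. F b (x \<bullet> b)) \<in> borel_measurable borel"
        by (rule measurable_compose[rotated]) measurable
    qed
    show ?thesis
      apply (subst (1) lborel_eq)
      apply (subst integral_distr[OF _ meas])
       apply (auto simp: inner_sum_left inner_Basis if_distrib sum.delta intro!: Bochner_Integration.integral_cong prod.cong cong: if_cong)
      done
  qed
  also have "\<dots> = (\<Prod>b\<in>Basis. integral\<^sup>L lborel (F b))"
    by (rule product_integral_prod) (use Fi in auto)
  also have "\<dots> = 0"
  proof (rule prod_zero)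
    let ?b = "axis i 1 :: real^3"
    define m where "m = k $ i"
    have m: "m \<noteq> 0" using i by (simp add: m_def)
    \<comment> \<open>\<open>G\<close> is the antiderivative; its values at 0 and 1 agree because
      the frequency \<open>m\<close> is an integer.\<close>
    define G where "G t = cis (2 * pi * m * t) / (\<i> * (2 * pi * m))" for t :: real
    have "(G has_vector_derivative cis (2 * pi * m * t)) (at t within {0..1})" for t
    proof -
      have "((\<lambda>z. exp (\<i> * (2 * pi * m * z)) / (\<i> * (2 * pi * m))) has_field_derivative
              exp (\<i> * (2 * pi * m * of_real t))) (at (of_real t))"
        using m by (auto intro!: derivative_eq_intros)
      from has_vector_derivative_real_field[OF this] show ?thesis
        by (simp add: G_def[abs_def] cis_conv_exp)
    qed
    then have I1: "((\<lambda>t. cis (2 * pi * m * t)) has_integral (G 1 - G 0)) {0..1}"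
      by (intro fundamental_theorem_of_calculus) auto
    have I2: "((\<lambda>t. cis (2 * pi * m * t)) has_integral (integral\<^sup>L lborel (F ?b))) {0..1}"
      proof -
      have Fb: "F ?b = (\<lambda>t. if t \<in> {0..1} then cis (2 * pi * m * t) else 0)"
        by (auto simp: F_def inner_axis m_def indicator_def)
      have "((\<lambda>t. if t \<in> {0..1} then cis (2 * pi * m * t) else 0) has_integral integral\<^sup>L lborel (F ?b)) UNIV"
        using has_integral_integral_lborel[OF Fi[of ?b]] by (simp only: Fb)
      then show ?thesis by (simp only: has_integral_restrict_UNIV)
    qed
    have "G 1 = G 0"
      using cis_multiple_2pi[of m] by (simp add: G_def)
    then have "integral\<^sup>L lborel (F ?b) = 0"
      using has_integral_unique[OF I2 I1] by simp
    then show "\<exists>a\<in>Basis. integral\<^sup>L lborel (F a) = 0"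
      by (intro bexI[of _ ?b]) (auto simp: axis_in_Basis_iff)
  qed auto
  finally show ?thesis using False by simp
qed

lemma fourier_eq: "fourier f k = torus_mean (\<lambda>x. of_real (f x) * char_fun (- k) x)"
  by (simp add: fourier_def char_fun_def inner_minus_left)

lemma fourier_minus: "fourier f (- k) = cnj (fourier f k)"
proof -
  have "fourier f (- k) = torus_mean (\<lambda>x. cnj (of_real (f x) * char_fun (- k) x))"
    by (simp add: fourier_eq char_fun_minus)
  then show ?thesis by (simp only: fourier_eq torus_mean_eq Bochner_Integration.integral_cnj)
qed

section \<open>Absolutely convergent Fourier series\<close>

definition synth :: "(int ^ 3 \<Rightarrow> complex) \<Rightarrow> real ^ 3 \<Rightarrow> complex" where
  "synth c x = (\<Sum>\<^sub>\<infinity>k. c k * char_fun k x)"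

lemma synth_summable:
  assumes "(\<lambda>k. norm (c k)) summable_on UNIV"
  shows "(\<lambda>k. norm (c k * char_fun k x)) summable_on UNIV" "(\<lambda>k. c k * char_fun k x) summable_on UNIV"
proof -
  show "(\<lambda>k. norm (c k * char_fun k x)) summable_on UNIV" using assms by (simp add: norm_mult)
  then show "(\<lambda>k. c k * char_fun k x) summable_on UNIV" by (rule abs_summable_summable)
qed

lemma synth_periodic: "synth c (x + int_vec m) = synth c x"
  by (simp add: synth_def char_fun_periodic)

lemma continuous_synth:
  assumes "(\<lambda>k. norm (c k)) summable_on UNIV"
  shows "continuous_on UNIV (synth c)"
proof -
  have "uniform_limit UNIV (\<lambda>X x. \<Sum>k\<in>X. c k * char_fun k x) (\<lambda>x. \<Sum>\<^sub>\<infinity>k. c k * char_fun k x) (finite_subsets_at_top UNIV)"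
    by (rule Weierstrass_m_test_general[OF _ assms]) (simp add: norm_mult)
  then have "continuous_on UNIV (\<lambda>x. \<Sum>\<^sub>\<infinity>k. c k * char_fun k x)"
    by (rule uniform_limit_theorem[rotated]) (auto intro!: continuous_intros always_eventually)
  then show ?thesis by (simp add: synth_def[abs_def])
qed

text \<open>Used with \<open>g\<close> a character to recover the coefficients of a Fourier series,
  and with \<open>g\<close> a second function times a character to obtain the convolution formula
  for products.\<close>

lemma torus_mean_synth:
  assumes c: "(\<lambda>k. norm (c k)) summable_on UNIV" and g: "continuous_on UNIV g"
  shows "((\<lambda>k. c k * torus_mean (\<lambda>x. g x * char_fun k x)) has_sum
           torus_mean (\<lambda>x. g x * synth c x)) UNIV"
proof -
  interpret prob_space cube_measure by (rule prob_space_cube)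
  obtain C where C: "C \<ge> 0" "\<And>x. x \<in> cbox 0 1 \<Longrightarrow> norm (g x) \<le> C"
    using continuous_bounded_cube[OF g] by blast
  have "((\<lambda>k. \<integral>x. c k * (g x * char_fun k x) \<partial>cube_measure) has_sum
      (\<integral>x. (\<Sum>\<^sub>\<infinity>k. c k * (g x * char_fun k x)) \<partial>cube_measure)) UNIV"
  proof (rule integral_infsum)
    show "finite_measure cube_measure" by unfold_locales
    show "(\<lambda>x. c k * (g x * char_fun k x)) \<in> borel_measurable cube_measure" for k
      by (intro measurable_cube continuous_intros g)
    show "norm (c k * (g x * char_fun k x)) \<le> norm (c k) * C" if "x \<in> space cube_measure" for k x
      using C(2)[of x] that by (simp add: norm_mult mult_left_mono)
    show "(\<lambda>k. norm (c k) * C) summable_on UNIV"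
      by (intro summable_on_cmult_left c)
  qed
  moreover have "(\<Sum>\<^sub>\<infinity>k. c k * (g x * char_fun k x)) = g x * synth c x" for x
    unfolding synth_def by (subst infsum_cmult_right'[symmetric]) (simp add: mult_ac)
  ultimately show ?thesis by (simp add: torus_mean_eq)
qed

lemma torus_mean_synth_char_fun:
  assumes c: "(\<lambda>k. norm (c k)) summable_on UNIV"
  shows "torus_mean (\<lambda>x. synth c x * char_fun (- k) x) = c k"
proof -
  have "((\<lambda>j. c j * torus_mean (char_fun (j - k))) has_sum
           torus_mean (\<lambda>x. synth c x * char_fun (- k) x)) UNIV"
    using torus_mean_synth[OF c, of "char_fun (- k)"]
    by (simp add: continuous_intros mult.commute flip: char_fun_add)
  moreover have "((\<lambda>j. c j * torus_mean (char_fun (j - k))) has_sum c k) UNIV"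
    by (rule has_sum_finite_neutralI[of "{k}"]) (auto simp: torus_mean_char_fun)
  ultimately show ?thesis using has_sum_unique by blast
qed

lemma synth_hermitian:
  assumes "\<And>k. c (- k) = cnj (c k)"
  shows "cnj (synth c x) = synth c x"
proof -
  have "cnj (synth c x) = (\<Sum>\<^sub>\<infinity>k. c (- k) * char_fun (- k) x)"
    unfolding synth_def by (simp add: assms char_fun_minus flip: infsum_cnj)
  also have "\<dots> = synth c x"
    unfolding synth_def by (rule infsum_reindex_bij_witness[of _ uminus uminus]) auto
  finally show ?thesis .
qed

lemma synth_real:
  assumes "\<And>k. c (- k) = cnj (c k)"
  shows "of_real (Re (synth c x)) = synth c x"
  using synth_hermitian[of c x, OF assms] by (simp add: complex_eq_iff)

lemma fourier_synth:
  assumes "(\<lambda>k. norm (c k)) summable_on UNIV" "\<And>k. c (- k) = cnj (c k)"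
  shows "fourier (\<lambda>x. Re (synth c x)) k = c k"
  unfolding fourier_eq synth_real[of c, OF assms(2)] by (rule torus_mean_synth_char_fun[OF assms(1)])

text \<open>In this class the Fourier coefficients determine a function at every point, so that
  identities between functions can be checked mode by mode.\<close>

definition periodic_continuous :: "(real ^ 3 \<Rightarrow> 'b::topological_space) \<Rightarrow> bool" where
  "periodic_continuous f \<longleftrightarrow> periodic f \<and> continuous_on UNIV f"

lemma periodic_continuous_synth:
  assumes "(\<lambda>k. norm (c k)) summable_on UNIV"
  shows "periodic_continuous (\<lambda>x. Re (synth c x))"
  using continuous_synth[OF assms]
  by (auto simp: periodic_continuous_def periodic_def synth_periodic intro!: continuous_intros)

section \<open>Uniqueness of Fourier coefficients\<close>

definition null_modes :: "(real ^ 3 \<Rightarrow> complex) \<Rightarrow> bool" where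
  "null_modes h \<longleftrightarrow> continuous_on UNIV h \<and> (\<forall>k. torus_mean (\<lambda>x. h x * char_fun k x) = 0)"

lemma null_modes_char_fun:
  "null_modes h \<Longrightarrow> null_modes (\<lambda>x. h x * char_fun l x)"
  by (auto simp: null_modes_def mult.assoc intro!: continuous_intros simp flip: char_fun_add)

lemma null_modes_cmult: "null_modes h \<Longrightarrow> null_modes (\<lambda>x. c * h x)"
  by (auto simp: null_modes_def torus_mean_eq mult.assoc intro!: continuous_intros)

lemma null_modes_add: "null_modes h \<Longrightarrow> null_modes h' \<Longrightarrow> null_modes (\<lambda>x. h x + h' x)"
  by (auto simp: null_modes_def torus_mean_eq distrib_right integrable_cube continuous_intros)

lemma null_modes_sum: "(\<And>b. b \<in> B \<Longrightarrow> null_modes (h b)) \<Longrightarrow> null_modes (\<lambda>x. \<Sum>b\<in>B. h b x)"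
proof (induction B rule: infinite_finite_induct)
  case (insert b B)
  then show ?case using null_modes_add[of "h b" "\<lambda>x. \<Sum>b\<in>B. h b x"] by simp
qed (auto simp: null_modes_def torus_mean_eq)

text \<open>The torus as a compact subset of a Euclidean space; polynomials in the real coordinates
  there are trigonometric polynomials on the torus.\<close>

definition torus_emb :: "real ^ 3 \<Rightarrow> complex ^ 3" where
  "torus_emb x = (\<chi> i. char_fun (axis i 1) x)"

lemma continuous_torus_emb: "continuous_on S torus_emb"
  unfolding torus_emb_def by (intro continuous_intros continuous_on_id)

text \<open>Real and imaginary parts of a coordinate of the embedding are linear combinations of one
  character and its conjugate, and multiplication by a character only shifts the modes.\<close>

lemma null_modes_Basis:
  assumes "null_modes h" "b \<in> Basis"
  shows "null_modes (\<lambda>x. h x * of_real (torus_emb x \<bullet> b))"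
proof -
  obtain i u where b: "b = axis i u" and u: "u = 1 \<or> u = \<i>"
    using assms(2) by (auto simp: Basis_vec_def Basis_complex_def)
  have *: "null_modes (\<lambda>x. \<alpha> * (h x * char_fun (axis i 1) x) + \<beta> * (h x * char_fun (- axis i 1) x))" for \<alpha> \<beta>
    by (intro null_modes_add null_modes_cmult null_modes_char_fun assms)
  have Re: "of_real (Re z) = (1/2) * z + (1/2) * cnj z" and Im: "of_real (Im z) = (- \<i>/2) * z + (\<i>/2) * cnj z" for z
    by (auto simp: complex_eq_iff)
  show ?thesis
    using u
  proof
    assume "u = 1"
    then have "h x * of_real (torus_emb x \<bullet> b) = (1/2) * (h x * char_fun (axis i 1) x) + (1/2) * (h x * char_fun (- axis i 1) x)" for x
      by (simp add: b inner_axis torus_emb_def inner_complex_def Re char_fun_minus algebra_simps)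
    then show ?thesis using *[of "1/2" "1/2"] by simp
  next
    assume "u = \<i>"
    then have "h x * of_real (torus_emb x \<bullet> b) = (- \<i>/2) * (h x * char_fun (axis i 1) x) + (\<i>/2) * (h x * char_fun (- axis i 1) x)" for x
      by (simp add: b inner_axis torus_emb_def inner_complex_def Im char_fun_minus algebra_simps)
    then show ?thesis using *[of "- \<i>/2" "\<i>/2"] by simp
  qed
qed

lemma null_modes_polynomial:
  assumes "real_polynomial_function p" "null_modes h"
  shows "null_modes (\<lambda>x. h x * of_real (p (torus_emb x)))"
  using assms
proof (induction p arbitrary: h rule: real_polynomial_function.induct)
  case (linear f)
  have "f (torus_emb x) = (\<Sum>b\<in>Basis. (torus_emb x \<bullet> b) * f b)" for x
    using linear(1) by (subst euclidean_representation[of "torus_emb x", symmetric])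
      (simp only: linear_sum[OF bounded_linear.linear[OF linear(1)]] linear_cmul[OF bounded_linear.linear[OF linear(1)]], simp)
  then have "h x * of_real (f (torus_emb x)) = (\<Sum>b\<in>Basis. of_real (f b) * (h x * of_real (torus_emb x \<bullet> b)))" for x
    by (simp add: sum_distrib_left mult_ac)
  moreover have "null_modes (\<lambda>x. \<Sum>b\<in>Basis. of_real (f b) * (h x * of_real (torus_emb x \<bullet> b)))"
    by (intro null_modes_sum null_modes_cmult null_modes_Basis linear)
  ultimately show ?case by simp
next
  case (const c)
  then show ?case using null_modes_cmult[of h "of_real c"] by (simp add: mult.commute)
next
  case (add f g)
  then show ?case using null_modes_add[OF add(3)[OF add(5)] add(4)[OF add(5)]] by (simp add: distrib_left)
next
  case (mult f g)
  then show ?case using mult(4)[OF mult(3)[OF mult(5)]] by (simp add: mult.assoc)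
qed

text \<open>Injectivity modulo the lattice; by periodicity a function on the torus therefore factors
  through the embedding.\<close>

lemma torus_emb_eqD:
  assumes "torus_emb x = torus_emb y"
  obtains m where "x = y + int_vec m"
proof -
  have "\<exists>n::int. x $ i = y $ i + of_int n" for i
  proof -
    have "char_fun (axis i 1) x = char_fun (axis i 1) y"
      using assms by (simp add: torus_emb_def vec_eq_iff)
    moreover have "int_vec (axis i 1) \<bullet> z = z $ i" for z
    proof -
      have "int_vec (axis i 1) = axis i 1" by (simp add: vec_eq_iff axis_def)
      then show ?thesis by (simp add: inner_axis')
    qed
    ultimately have "exp (\<i> * of_real (2 * pi * x $ i)) = exp (\<i> * of_real (2 * pi * y $ i))"
      by (simp add: char_fun_def cis_conv_exp)
    then obtain n :: int where "\<i> * of_real (2 * pi * x $ i) = \<i> * of_real (2 * pi * y $ i) + (of_int (2 * n) * pi) * \<i>"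
      unfolding exp_eq by auto
    then have "2 * pi * x $ i = 2 * pi * y $ i + 2 * n * pi"
      by (simp add: complex_eq_iff)
    then have "(2 * pi) * x $ i = (2 * pi) * (y $ i + n)" by (simp add: algebra_simps)
    then have "x $ i = y $ i + of_int n" by simp
    then show ?thesis ..
  qed
  then obtain n where "\<And>i. x $ i = y $ i + of_int (n i)" by metis
  then show ?thesis by (intro that[of "\<chi> i. n i"]) (simp add: vec_eq_iff)
qed

lemma int_vec_floor_in_cube: "x + int_vec (\<chi> i. - \<lfloor>x $ i\<rfloor>) \<in> cbox 0 1"
proof -
  have "0 \<le> x $ i + - of_int \<lfloor>x $ i\<rfloor> \<and> x $ i + - of_int \<lfloor>x $ i\<rfloor> \<le> 1" for i
    by linarith
  then show ?thesis by (auto simp: mem_box Basis_vec_def inner_axis)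
qed

text \<open>
  Products of a function without Fourier modes with polynomials in the coordinates of the embedded
  torus have no Fourier modes either, so Stone--Weierstrass makes the function orthogonal to itself.
\<close>

lemma fourier_zero_imp_zero:
  assumes f: "periodic_continuous f" and z: "\<And>k. fourier f k = 0"
  shows "f x = 0"
proof -
  have per: "f (x + int_vec m) = f x" for x m using f by (simp add: periodic_continuous_def periodic_def)
  have cont: "continuous_on S f" for S using f by (auto simp: periodic_continuous_def intro: continuous_on_subset)
  define S where "S = torus_emb ` cbox 0 1"
  have "compact S" unfolding S_def by (intro compact_continuous_image continuous_torus_emb) auto
  \<comment> \<open>\<open>G\<close> is the function that \<open>f\<close> induces on the embedded
    torus; the choice of the preimage does not affect its value.\<close>
  define G where "G y = f (SOME x. x \<in> cbox 0 1 \<and> torus_emb x = y)" for y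
  have G: "G (torus_emb x) = f x" if "x \<in> cbox 0 1" for x
  proof -
    have "\<exists>z. z \<in> cbox 0 1 \<and> torus_emb z = torus_emb x" using that by blast
    then have "torus_emb (SOME z. z \<in> cbox 0 1 \<and> torus_emb z = torus_emb x) = torus_emb x"
      using someI_ex by (metis (mono_tags, lifting))
    then show ?thesis unfolding G_def using per by (metis torus_emb_eqD)
  qed
  \<comment> \<open>Preimages under \<open>G\<close> of closed sets are images of compact sets under
    the embedding, hence closed.\<close>
  have "continuous_on S G"
  proof (subst continuous_on_closed_vimage)
    show "closed S" using \<open>compact S\<close> by (rule compact_imp_closed)
    show "\<forall>B. closed B \<longrightarrow> closed (G -` B \<inter> S)"
    proof safe
      fix B :: "real set" assume "closed B"
      then have "closed (f -` B)"
        using cont[of UNIV] by (simp add: continuous_on_closed_vimage)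
      then have "compact (torus_emb ` (f -` B \<inter> cbox 0 1))"
        by (intro compact_continuous_image continuous_torus_emb closed_Int_compact) auto
      moreover have "G -` B \<inter> S = torus_emb ` (f -` B \<inter> cbox 0 1)"
        using G by (auto simp: S_def)
      ultimately show "closed (G -` B \<inter> S)" by (simp add: compact_imp_closed)
    qed
  qed
  obtain C where C: "C \<ge> 0" "\<And>x. x \<in> cbox 0 1 \<Longrightarrow> norm (f x) \<le> C"
    using continuous_bounded_cube[OF cont] by blast
  have nm: "null_modes (\<lambda>x. of_real (f x))"
    unfolding null_modes_def using cont[of UNIV] z[of "- k" for k] unfolding fourier_eq
    by (auto intro!: continuous_intros)
  have small: "norm (torus_mean (\<lambda>x. f x * f x)) \<le> C * e" if e: "e > 0" for e
  proof -
    obtain p where p: "real_polynomial_function p" "\<And>y. y \<in> S \<Longrightarrow> \<bar>G y - p y\<bar> < e"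
      using Stone_Weierstrass_real_polynomial_function[OF \<open>compact S\<close> \<open>continuous_on S G\<close> e] by blast
    have pc: "continuous_on UNIV (\<lambda>x. p (torus_emb x))"
      by (rule continuous_on_compose2[OF _ continuous_torus_emb])
         (use p(1) in \<open>auto intro: continuous_on_polymonial_function simp: real_polynomial_function_eq\<close>)
    have "of_real (torus_mean (\<lambda>x. f x * p (torus_emb x))) = torus_mean (\<lambda>x. of_real (f x) * of_real (p (torus_emb x)) * char_fun 0 x)"
      unfolding torus_mean_eq by (simp flip: of_real_mult)
    also have "\<dots> = 0"
      using null_modes_polynomial[OF p(1) nm] unfolding null_modes_def by blast
    finally have "torus_mean (\<lambda>x. f x * p (torus_emb x)) = 0" by simp
    then have "torus_mean (\<lambda>x. f x * f x) = torus_mean (\<lambda>x. f x * (f x - p (torus_emb x)))"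
      unfolding torus_mean_eq right_diff_distrib
      by (subst Bochner_Integration.integral_diff) (auto intro!: integrable_cube continuous_intros cont pc)
    also have "norm \<dots> \<le> C * e"
    proof (rule norm_torus_mean_le)
      show "norm (f x * (f x - p (torus_emb x))) \<le> C * e" if "x \<in> cbox 0 1" for x
        using C(2)[OF that] p(2)[of "torus_emb x"] G[OF that] that C(1)
        by (auto simp: abs_mult S_def intro!: mult_mono)
    qed (intro continuous_intros cont pc)
    finally show ?thesis .
  qed
  have zero: "torus_mean (\<lambda>x. f x * f x) = 0"
  proof (rule ccontr)
    assume *: "torus_mean (\<lambda>x. f x * f x) \<noteq> 0"
    define I where "I = norm (torus_mean (\<lambda>x. f x * f x))"
    have "I > 0" using * by (simp add: I_def)
    \<comment> \<open>This choice of \<open>e\<close> makes the right-hand side at most half of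
      \<open>I\<close>.\<close>
    then have "I \<le> C * (I / (2 * (C + 1)))" using small[of "I / (2 * (C + 1))"] C(1) by (simp add: I_def)
    then have "I * (C + 2) \<le> 0" using C(1) by (simp add: field_simps)
    then show False using \<open>I > 0\<close> C(1) by (simp add: mult_le_0_iff)
  qed
  have "((\<lambda>x. f x * f x) has_integral torus_mean (\<lambda>x. f x * f x)) (cbox 0 1)"
  proof -
    have "set_integrable lborel (cbox 0 1) (\<lambda>x. f x * f x)"
      unfolding set_integrable_def
      by (rule borel_integrable_compact) (auto intro!: continuous_intros cont)
    then show ?thesis
      unfolding torus_mean_def using set_borel_integral_eq_integral by (metis has_integral_integral)
  qed
  then have "f x * f x = 0" if "x \<in> cbox 0 1" for x
    using that unfolding zero
    by (intro has_integral_0_cbox_imp_0[where f = "\<lambda>x. f x * f x" and a = 0 and b = 1])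
       (auto intro!: continuous_intros cont simp: box_ne_empty Basis_vec_def inner_axis)
  then have "f (x + int_vec (\<chi> i. - \<lfloor>x $ i\<rfloor>)) = 0" using int_vec_floor_in_cube by fastforce
  then show ?thesis by (simp only: per)
qed

lemma fourier_diff:
  assumes "continuous_on UNIV f" "continuous_on UNIV g"
  shows "fourier (\<lambda>x. f x - g x) k = fourier f k - fourier g k"
  unfolding fourier_eq torus_mean_eq
  by (subst Bochner_Integration.integral_diff[symmetric])
     (auto intro!: integrable_cube continuous_intros assms simp: algebra_simps)

lemma fourier_inject:
  assumes "periodic_continuous f" "periodic_continuous g" "\<And>k. fourier f k = fourier g k"
  shows "f = g"
proof
  fix x
  have "periodic_continuous (\<lambda>x. f x - g x)"
    using assms by (auto simp: periodic_continuous_def periodic_def intro!: continuous_intros)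
  then have "f x - g x = 0"
    by (rule fourier_zero_imp_zero) (use assms in \<open>auto simp: fourier_diff periodic_continuous_def\<close>)
  then show "f x = g x" by simp
qed

text \<open>The Fourier series is a continuous periodic function with the same coefficients, hence
  equals \<open>f\<close> by uniqueness.\<close>

theorem fourier_inversion:
  assumes "periodic_continuous f" "(\<lambda>k. norm (fourier f k)) summable_on UNIV"
  shows "of_real (f x) = synth (fourier f) x"
proof -
  have "f = (\<lambda>x. Re (synth (fourier f) x))"
    by (rule fourier_inject[OF assms(1) periodic_continuous_synth[OF assms(2)]])
       (simp add: fourier_synth[OF assms(2)] fourier_minus)
  then have "f x = Re (synth (fourier f) x)" by (rule fun_cong)
  then show ?thesis using synth_real[of "fourier f" x] by (simp add: fourier_minus)
qed

section \<open>Weighted sums of Fourier coefficients\<close>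

lemma ennreal_infsum_conv_suminf:
  fixes f :: "'k::countable \<Rightarrow> ennreal"
  defines "g \<equiv> \<lambda>n. if n \<in> range (to_nat :: 'k \<Rightarrow> nat) then f (from_nat n) else 0"
  shows "(\<Sum>\<^sub>\<infinity>k. f k) = (\<Sum>n. g n)" "(\<integral>\<^sup>+k. f k \<partial>count_space UNIV) = (\<Sum>n. g n)"
proof -
  have inj: "inj (to_nat :: 'k \<Rightarrow> nat)" by simp
  have eq: "g \<circ> to_nat = f" by (auto simp: g_def)
  have "(\<Sum>\<^sub>\<infinity>k. f k) = infsum g (range (to_nat :: 'k \<Rightarrow> nat))"
    unfolding infsum_reindex[OF inj] eq ..
  also have "\<dots> = infsum g UNIV"
    by (rule infsum_cong_neutral) (auto simp: g_def)
  also have "\<dots> = (\<Sum>n. g n)"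
  proof (rule sums_unique, rule has_sum_imp_sums)
    show "(g has_sum infsum g UNIV) UNIV" by (intro has_sum_infsum nonneg_summable_on_complete) simp
  qed
  finally show "(\<Sum>\<^sub>\<infinity>k. f k) = (\<Sum>n. g n)" .
  have "(\<integral>\<^sup>+k. f k \<partial>count_space UNIV) = (\<integral>\<^sup>+(k::'k). g (to_nat k) \<partial>count_space UNIV)"
    unfolding eq[symmetric] by simp
  also have "\<dots> = (\<integral>\<^sup>+n. g n \<partial>count_space (range (to_nat :: 'k \<Rightarrow> nat)))"
    by (rule nn_integral_bij_count_space) (simp add: inj_on_imp_bij_betw)
  also have "\<dots> = (\<integral>\<^sup>+n. g n * indicator (range (to_nat :: 'k \<Rightarrow> nat)) n \<partial>count_space UNIV)"
    by (rule nn_integral_count_space_indicator) simp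
  also have "\<dots> = (\<integral>\<^sup>+n. g n \<partial>count_space UNIV)"
    by (rule nn_integral_cong) (auto simp: g_def indicator_def)
  also have "\<dots> = (\<Sum>n. g n)" by (rule nn_integral_count_space_nat)
  finally show "(\<integral>\<^sup>+k. f k \<partial>count_space UNIV) = (\<Sum>n. g n)" .
qed

lemma infsum_ennreal_eq_nn_integral:
  fixes f :: "'k::countable \<Rightarrow> ennreal"
  shows "(\<Sum>\<^sub>\<infinity>k. f k) = (\<integral>\<^sup>+k. f k \<partial>count_space UNIV)"
  by (simp add: ennreal_infsum_conv_suminf)

lemma summable_on_iff_nn_integral:
  fixes f :: "'k \<Rightarrow> 'b::{banach,second_countable_topology}"
  shows "(\<lambda>k. norm (f k)) summable_on UNIV \<longleftrightarrow> (\<integral>\<^sup>+k. ennreal (norm (f k)) \<partial>count_space UNIV) < \<infinity>"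
  using abs_summable_equivalent[of f UNIV] by (simp add: Infinite_Set_Sum.abs_summable_on_def integrable_iff_bounded)

lemma ennreal_norm_infsum_le:
  fixes f :: "'k::countable \<Rightarrow> 'b::{banach,second_countable_topology}"
  shows "ennreal (norm (\<Sum>\<^sub>\<infinity>k. f k)) \<le> (\<integral>\<^sup>+k. ennreal (norm (f k)) \<partial>count_space UNIV)"
proof (cases "(\<lambda>k. norm (f k)) summable_on UNIV")
  case True
  define g where "g n = (if n \<in> range (to_nat :: 'k \<Rightarrow> nat) then f (from_nat n) else 0)" for n
  have s: "summable (\<lambda>n. norm (g n))" and e: "(\<Sum>\<^sub>\<infinity>k. f k) = (\<Sum>n. g n)"
    using infsum_conv_suminf[OF True] by (simp_all add: g_def)
  have "ennreal (norm (\<Sum>\<^sub>\<infinity>k. f k)) \<le> ennreal (\<Sum>n. norm (g n))"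
    unfolding e by (intro ennreal_leI summable_norm s)
  also have "\<dots> = (\<Sum>n. ennreal (norm (g n)))"
    using s by (intro suminf_ennreal2[symmetric]) auto
  also have "\<dots> = (\<integral>\<^sup>+k. ennreal (norm (f k)) \<partial>count_space UNIV)"
    unfolding ennreal_infsum_conv_suminf(2) by (intro suminf_cong) (auto simp: g_def)
  finally show ?thesis .
next
  case False
  then show ?thesis by (simp add: summable_on_iff_nn_integral not_less top_unique)
qed

lemma nn_integral_count_space_swap:
  "(\<integral>\<^sup>+x. (\<integral>\<^sup>+y. f x y \<partial>count_space UNIV) \<partial>count_space UNIV) =
   (\<integral>\<^sup>+y. (\<integral>\<^sup>+x. f x y \<partial>count_space UNIV) \<partial>count_space UNIV)"
  using nn_integral_fst_count_space[of "\<lambda>(x, y). f x y"] nn_integral_snd_count_space[of "\<lambda>(x, y). f x y"]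
  by simp

lemma nn_integral_count_space_shift:
  "(\<integral>\<^sup>+k. f (k - j) \<partial>count_space UNIV) = (\<integral>\<^sup>+k. f k \<partial>count_space (UNIV :: (int^3) set))"
  by (rule nn_integral_bij_count_space[of "\<lambda>k. k - j"])
     (auto intro!: bij_betw_byWitness[where f' = "\<lambda>k. k + j"])

text \<open>Weights and values are extended nonnegative reals and the sum is an integral over
  counting measure: exchange of sums and monotonicity then need no summability, and a supremum of
  functions may serve as weight.\<close>

definition fsum :: "(int ^ 3 \<Rightarrow> ennreal) \<Rightarrow> (real ^ 3 \<Rightarrow> real) \<Rightarrow> ennreal" where
  "fsum \<omega> f = (\<integral>\<^sup>+k. ennreal (cmod (fourier f k)) * \<omega> k \<partial>count_space UNIV)"

lemma B_norm_eq_fsum: "\<delta> \<ge> 0 \<Longrightarrow> B_norm \<delta> f = fsum (\<lambda>k. ennreal (\<delta> powr norm (int_vec k))) f"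
  by (simp add: B_norm_def weighted_sum_def fsum_def infsum_ennreal_eq_nn_integral ennreal_mult)

lemma fsum_mono: "(\<And>k. \<omega> k \<le> \<omega>' k) \<Longrightarrow> fsum \<omega> f \<le> fsum \<omega>' f"
  unfolding fsum_def by (intro nn_integral_mono mult_left_mono) auto

lemma fsum_cmult: "fsum (\<lambda>k. c * \<omega> k) f = c * fsum \<omega> f"
  unfolding fsum_def by (subst nn_integral_cmult[symmetric]) (auto simp: mult_ac)

lemma fsum_le_multiplier:
  assumes "\<And>k. ennreal (cmod (fourier g k)) * \<omega> k \<le> C * (ennreal (cmod (fourier f k)) * \<omega>' k)"
  shows "fsum \<omega> g \<le> C * fsum \<omega>' f"
  unfolding fsum_def
  by (subst nn_integral_cmult[symmetric]) (auto intro!: nn_integral_mono assms)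

lemma periodic_continuousD:
  assumes "periodic_continuous f"
  shows "continuous_on S f" "f (x + int_vec m) = f x"
  using assms by (auto simp: periodic_continuous_def periodic_def intro: continuous_on_subset)

lemma fourier_add:
  assumes "continuous_on UNIV f" "continuous_on UNIV g"
  shows "fourier (\<lambda>x. f x + g x) k = fourier f k + fourier g k"
  unfolding fourier_eq torus_mean_eq
  by (subst Bochner_Integration.integral_add[symmetric])
     (auto intro!: integrable_cube continuous_intros assms simp: algebra_simps)

lemma fourier_cmult: "fourier (\<lambda>x. c * f x) k = of_real c * fourier f k"
  unfolding fourier_eq torus_mean_eq by (simp add: mult.assoc)

lemma fourier_uminus: "fourier (\<lambda>x. - f x) k = - fourier f k"
  using fourier_cmult[of "-1" f k] by simp

lemma fourier_const: "fourier (\<lambda>x. c) k = (if k = 0 then of_real c else 0)"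
  unfolding fourier_eq torus_mean_eq using torus_mean_char_fun[of "- k"] by (simp add: torus_mean_eq)

lemma fourier_sum:
  assumes "\<And>i. i \<in> I \<Longrightarrow> continuous_on UNIV (f i)"
  shows "fourier (\<lambda>x. \<Sum>i\<in>I. f i x) k = (\<Sum>i\<in>I. fourier (f i) k)"
  using assms
proof (induction I rule: infinite_finite_induct)
  case (insert i I)
  then show ?case
    using fourier_add[of "f i" "\<lambda>x. \<Sum>i\<in>I. f i x" k] by (simp add: continuous_on_sum)
qed (simp_all add: fourier_const)

lemma fourier_mult:
  assumes f: "periodic_continuous f" "(\<lambda>k. norm (fourier f k)) summable_on UNIV"
    and g: "continuous_on UNIV g"
  shows "((\<lambda>j. fourier f j * fourier g (k - j)) has_sum fourier (\<lambda>x. f x * g x) k) UNIV"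
proof -
  have "((\<lambda>j. fourier f j * torus_mean (\<lambda>x. of_real (g x) * char_fun (- k) x * char_fun j x)) has_sum
     torus_mean (\<lambda>x. of_real (g x) * char_fun (- k) x * synth (fourier f) x)) UNIV"
    by (rule torus_mean_synth[OF f(2)]) (auto intro!: continuous_intros g)
  moreover have "torus_mean (\<lambda>x. of_real (g x) * char_fun (- k) x * char_fun j x) = fourier g (k - j)" for j
    unfolding fourier_eq by (simp add: mult.assoc add.commute flip: char_fun_add)
  moreover have "torus_mean (\<lambda>x. of_real (g x) * char_fun (- k) x * synth (fourier f) x) = fourier (\<lambda>x. f x * g x) k"
    unfolding fourier_eq fourier_inversion[OF f, symmetric] by (simp add: mult_ac)
  ultimately show ?thesis by simp
qed

text \<open>Convolution estimate. The three weights may differ because the order in time is part of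
  the weight: orders \<open>i\<close> and \<open>n - i\<close> of the factors contribute to order
  \<open>n\<close> of the product.\<close>

lemma fsum_mult:
  assumes f: "periodic_continuous f" "(\<lambda>k. norm (fourier f k)) summable_on UNIV"
    and g: "continuous_on UNIV g"
    and \<omega>: "\<And>i j. \<omega> (i + j) \<le> \<omega>1 i * \<omega>2 j"
  shows "fsum \<omega> (\<lambda>x. f x * g x) \<le> fsum \<omega>1 f * fsum \<omega>2 g"
proof -
  let ?a = "\<lambda>j. ennreal (cmod (fourier f j)) * \<omega>1 j" and ?b = "\<lambda>j. ennreal (cmod (fourier g j)) * \<omega>2 j"
  have "ennreal (cmod (fourier (\<lambda>x. f x * g x) k)) * \<omega> k \<le> (\<integral>\<^sup>+j. ?a j * ?b (k - j) \<partial>count_space UNIV)" for k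
  proof -
    have "ennreal (cmod (fourier (\<lambda>x. f x * g x) k)) \<le>
        (\<integral>\<^sup>+j. ennreal (cmod (fourier f j)) * ennreal (cmod (fourier g (k - j))) \<partial>count_space UNIV)"
      using ennreal_norm_infsum_le[of "\<lambda>j. fourier f j * fourier g (k - j)"] infsumI[OF fourier_mult[OF f g, of k]]
      by (simp add: norm_mult ennreal_mult)
    then have "ennreal (cmod (fourier (\<lambda>x. f x * g x) k)) * \<omega> k \<le>
        (\<integral>\<^sup>+j. ennreal (cmod (fourier f j)) * ennreal (cmod (fourier g (k - j))) \<partial>count_space UNIV) * \<omega> k"
      by (rule mult_right_mono) simp
    also have "\<dots> = (\<integral>\<^sup>+j. ennreal (cmod (fourier f j)) * ennreal (cmod (fourier g (k - j))) * \<omega> k \<partial>count_space UNIV)"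
      by (subst nn_integral_multc) auto
    also have "\<dots> \<le> (\<integral>\<^sup>+j. ?a j * ?b (k - j) \<partial>count_space UNIV)"
    proof (intro nn_integral_mono)
      fix j
      have "ennreal (cmod (fourier f j)) * ennreal (cmod (fourier g (k - j))) * \<omega> k \<le>
         ennreal (cmod (fourier f j)) * ennreal (cmod (fourier g (k - j))) * (\<omega>1 j * \<omega>2 (k - j))"
        using \<omega>[of j "k - j"] by (intro mult_left_mono) auto
      then show "ennreal (cmod (fourier f j)) * ennreal (cmod (fourier g (k - j))) * \<omega> k \<le> ?a j * ?b (k - j)"
        by (simp add: mult_ac)
    qed
    finally show ?thesis .
  qed
  then have "fsum \<omega> (\<lambda>x. f x * g x) \<le> (\<integral>\<^sup>+k. (\<integral>\<^sup>+j. ?a j * ?b (k - j) \<partial>count_space UNIV) \<partial>count_space UNIV)"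
    unfolding fsum_def by (intro nn_integral_mono) auto
  also have "\<dots> = (\<integral>\<^sup>+j. (\<integral>\<^sup>+k. ?a j * ?b (k - j) \<partial>count_space UNIV) \<partial>count_space UNIV)"
    by (rule nn_integral_count_space_swap)
  also have "\<dots> = (\<integral>\<^sup>+j. ?a j * fsum \<omega>2 g \<partial>count_space UNIV)"
    by (simp add: nn_integral_cmult fsum_def nn_integral_count_space_shift[of "\<lambda>k. ennreal (cmod (fourier g k)) * \<omega>2 k"])
  also have "\<dots> = fsum \<omega>1 f * fsum \<omega>2 g"
    by (simp add: nn_integral_multc fsum_def)
  finally show ?thesis .
qed

lemma fsum_add:
  assumes "continuous_on UNIV f" "continuous_on UNIV g"
  shows "fsum \<omega> (\<lambda>x. f x + g x) \<le> fsum \<omega> f + fsum \<omega> g"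
  unfolding fsum_def fourier_add[OF assms]
  by (subst nn_integral_add[symmetric])
     (auto intro!: nn_integral_mono mult_right_mono simp: norm_triangle_ineq simp flip: ennreal_plus distrib_right)

lemma fsum_summable:
  assumes "fsum \<omega> f < \<infinity>" "\<And>k. ennreal (v k) \<le> \<omega> k" "\<And>k. v k \<ge> 0"
  shows "(\<lambda>k. cmod (fourier f k) * v k) summable_on UNIV"
proof -
  have "(\<integral>\<^sup>+k. ennreal (norm (cmod (fourier f k) * v k)) \<partial>count_space UNIV) \<le> fsum \<omega> f"
    unfolding fsum_def
    by (intro nn_integral_mono) (auto simp: abs_mult ennreal_mult assms(3) intro!: mult_left_mono assms(2))
  then have "(\<lambda>k. norm (cmod (fourier f k) * v k)) summable_on UNIV"
    using assms(1) unfolding summable_on_iff_nn_integral by (rule le_less_trans)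
  then show ?thesis using assms(3) by (simp add: abs_mult)
qed

lemma abs_le_fsum:
  assumes "periodic_continuous f" "(\<lambda>k. norm (fourier f k)) summable_on UNIV"
  shows "ennreal \<bar>f x\<bar> \<le> fsum (\<lambda>_. 1) f"
proof -
  have "ennreal \<bar>f x\<bar> = ennreal (norm (synth (fourier f) x))"
    by (simp flip: fourier_inversion[OF assms])
  also have "\<dots> \<le> (\<integral>\<^sup>+k. ennreal (norm (fourier f k * char_fun k x)) \<partial>count_space UNIV)"
    unfolding synth_def by (rule ennreal_norm_infsum_le)
  finally show ?thesis by (simp add: fsum_def norm_mult)
qed

section \<open>Termwise differentiation of Fourier series\<close>

definition deriv_symbol :: "3 \<Rightarrow> int ^ 3 \<Rightarrow> complex" where
  "deriv_symbol i k = 2 * pi * \<i> * of_int (k $ i)"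

lemma has_sum_diff:
  fixes f g :: "'a \<Rightarrow> 'b::real_normed_vector"
  assumes "(f has_sum a) A" "(g has_sum b) A"
  shows "((\<lambda>x. f x - g x) has_sum (a - b)) A"
  using has_sum_add[OF assms(1), of "\<lambda>x. - g x" "- b"] assms(2) by (simp add: has_sum_uminus)

lemma summable_on_diff':
  fixes f g :: "'a \<Rightarrow> 'b::real_normed_vector"
  shows "f summable_on A \<Longrightarrow> g summable_on A \<Longrightarrow> (\<lambda>x. f x - g x) summable_on A"
  unfolding summable_on_def using has_sum_diff by blast

text \<open>Each mode is expanded to first order at \<open>x\<close>; the remainder of the complex
  exponential is quadratic in the increment with a factor \<open>|k|^2\<close>, which is why the
  square of \<open>1 + |k|\<close> must be summable against the coefficients.\<close>

lemma norm_synth_remainder: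
  assumes c: "(\<lambda>k. norm (c k) * (1 + norm (int_vec k))\<^sup>2) summable_on UNIV"
  defines "L \<equiv> \<lambda>x h. \<Sum>\<^sub>\<infinity>k. c k * (2 * pi * \<i> * (int_vec k \<bullet> h)) * char_fun k x"
  obtains K where "\<And>x h. norm (synth c (x + h) - synth c x - L x h) \<le> K * (norm h)\<^sup>2"
    "\<And>x. bounded_linear (L x)"
proof -
  let ?w = "\<lambda>k. norm (c k) * (1 + norm (int_vec k))\<^sup>2"
  have w1: "norm (c k) \<le> ?w k" and w2: "norm (c k) * norm (int_vec k) \<le> ?w k"
    and w3: "norm (c k) * (norm (int_vec k))\<^sup>2 \<le> ?w k" for k
  proof -
    have "1 \<le> (1 + norm (int_vec k))\<^sup>2" "norm (int_vec k) \<le> (1 + norm (int_vec k))\<^sup>2"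
      "(norm (int_vec k))\<^sup>2 \<le> (1 + norm (int_vec k))\<^sup>2"
      by (auto simp: power2_eq_square algebra_simps)
    then show "norm (c k) \<le> ?w k" "norm (c k) * norm (int_vec k) \<le> ?w k" "norm (c k) * (norm (int_vec k))\<^sup>2 \<le> ?w k"
      by (auto intro!: mult_left_mono simp: mult_le_cancel_left1)
  qed
  have c0: "(\<lambda>k. norm (c k)) summable_on UNIV"
    by (rule Infinite_Sum.abs_summable_on_comparison_test'[OF c]) (use w1 in auto)
  have L0: "norm (c k * (2 * pi * \<i> * (int_vec k \<bullet> h)) * char_fun k x) \<le> (2 * pi * norm h) * ?w k" for h x k
  proof -
    have "norm (c k * (2 * pi * \<i> * (int_vec k \<bullet> h)) * char_fun k x) = 2 * pi * (norm (c k) * \<bar>int_vec k \<bullet> h\<bar>)"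
      by (simp add: norm_mult)
    also have "\<dots> \<le> 2 * pi * (norm (c k) * (norm (int_vec k) * norm h))"
      by (intro mult_left_mono Cauchy_Schwarz_ineq2) auto
    also have "\<dots> \<le> 2 * pi * norm h * ?w k"
      using w2[of k] mult_left_mono[OF w2[of k], of "2 * pi * norm h"] by (simp add: mult_ac)
    finally show ?thesis .
  qed
  have Ls': "(\<lambda>k. norm (c k * (2 * pi * \<i> * (int_vec k \<bullet> h)) * char_fun k x)) summable_on UNIV" for h x
    by (rule Infinite_Sum.abs_summable_on_comparison_test'[OF summable_on_cmult_right[OF c, of "2 * pi * norm h"] L0])
  note Ls = abs_summable_summable[OF Ls']
  let ?K = "2 * pi\<^sup>2 * (\<Sum>\<^sub>\<infinity>k. ?w k)"
  have 1: "norm (synth c (x + h) - synth c x - L x h) \<le> ?K * (norm h)\<^sup>2" for x h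
  proof -
    let ?r = "\<lambda>k. c k * char_fun k (x + h) - c k * char_fun k x - c k * (2 * pi * \<i> * (int_vec k \<bullet> h)) * char_fun k x"
    have eq: "synth c (x + h) - synth c x - L x h = (\<Sum>\<^sub>\<infinity>k. ?r k)"
      unfolding synth_def L_def
      by (intro infsumI[symmetric] has_sum_diff has_sum_infsum Ls synth_summable(2)[OF c0])
    have r: "norm (?r k) \<le> (2 * pi\<^sup>2 * (norm h)\<^sup>2) * ?w k" for k
    proof -
      let ?s = "2 * pi * (int_vec k \<bullet> h)"
      have "?r k = c k * char_fun k x * (iexp ?s - (\<Sum>n\<le>1. (\<i> * ?s) ^ n / fact n))"
        by (simp add: char_fun_def inner_add_right distrib_left cis_conv_exp exp_add algebra_simps)
      then have "norm (?r k) = norm (c k) * norm (iexp ?s - (\<Sum>n\<le>1. (\<i> * ?s) ^ n / fact n))"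
        by (simp add: norm_mult)
      also have "\<dots> \<le> norm (c k) * (\<bar>?s\<bar> ^ Suc 1 / fact (Suc 1))"
        by (intro mult_left_mono iexp_approx1) auto
      also have "\<dots> = norm (c k) * (2 * pi\<^sup>2) * \<bar>int_vec k \<bullet> h\<bar>\<^sup>2"
        by (simp add: power2_eq_square abs_mult)
      also have "\<dots> \<le> norm (c k) * (2 * pi\<^sup>2) * (norm (int_vec k) * norm h)\<^sup>2"
        by (intro mult_left_mono power_mono Cauchy_Schwarz_ineq2) auto
      also have "\<dots> = (2 * pi\<^sup>2 * (norm h)\<^sup>2) * (norm (c k) * (norm (int_vec k))\<^sup>2)"
        by (simp add: power_mult_distrib)
      also have "\<dots> \<le> (2 * pi\<^sup>2 * (norm h)\<^sup>2) * ?w k" by (intro mult_left_mono w3) auto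
      finally show ?thesis .
    qed
    have "norm (\<Sum>\<^sub>\<infinity>k. ?r k) \<le> (\<Sum>\<^sub>\<infinity>k. (2 * pi\<^sup>2 * (norm h)\<^sup>2) * ?w k)"
    proof (rule norm_infsum_le[OF has_sum_infsum has_sum_infsum r])
      show "?r summable_on UNIV"
        by (intro summable_on_diff' Ls synth_summable(2)[OF c0])
    qed (intro summable_on_cmult_right c)
    also have "\<dots> = ?K * (norm h)\<^sup>2" by (subst infsum_cmult_right') simp
    finally show ?thesis unfolding eq .
  qed
  have 2: "bounded_linear (L x)" for x
  proof (rule bounded_linear_intro)
    show "L x (h + h') = L x h + L x h'" for h h'
      unfolding L_def by (subst infsum_add[OF Ls Ls, symmetric]) (simp add: inner_add_right algebra_simps)
    show "L x (r *\<^sub>R h) = r *\<^sub>R L x h" for r h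
      unfolding L_def scaleR_conv_of_real[where 'a = complex] by (subst infsum_cmult_right'[symmetric]) (simp add: mult_ac)
    show "norm (L x h) \<le> norm h * (2 * pi * (\<Sum>\<^sub>\<infinity>k. ?w k))" for h
    proof -
      have "norm (L x h) \<le> (\<Sum>\<^sub>\<infinity>k. (2 * pi * norm h) * ?w k)"
        unfolding L_def
        by (rule norm_infsum_le[OF has_sum_infsum[OF Ls] has_sum_infsum[OF summable_on_cmult_right[OF c]] L0])
      also have "\<dots> = norm h * (2 * pi * (\<Sum>\<^sub>\<infinity>k. ?w k))" by (subst infsum_cmult_right') simp
      finally show ?thesis .
    qed
  qed
  show ?thesis using that[OF 1 2] .
qed

lemma has_derivative_synth:
  assumes c: "(\<lambda>k. norm (c k) * (1 + norm (int_vec k))\<^sup>2) summable_on UNIV"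
  shows "(synth c has_derivative (\<lambda>h. \<Sum>\<^sub>\<infinity>k. c k * (2 * pi * \<i> * (int_vec k \<bullet> h)) * char_fun k x)) (at x)"
proof -
  let ?L = "\<lambda>x h. \<Sum>\<^sub>\<infinity>k. c k * (2 * pi * \<i> * (int_vec k \<bullet> h)) * char_fun k x"
  obtain K where K: "\<And>x h. norm (synth c (x + h) - synth c x - ?L x h) \<le> K * (norm h)\<^sup>2"
    and L: "\<And>x. bounded_linear (?L x)"
    using norm_synth_remainder[OF c] by blast
  have "((\<lambda>h. norm (synth c (x + h) - synth c x - ?L x h) / norm h) \<longlongrightarrow> 0) (at 0)"
  proof (rule Lim_null_comparison)
    show "\<forall>\<^sub>F h in at 0. norm (norm (synth c (x + h) - synth c x - ?L x h) / norm h) \<le> K * norm h"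
    proof (rule always_eventually, rule allI)
      fix h
      show "norm (norm (synth c (x + h) - synth c x - ?L x h) / norm h) \<le> K * norm h"
        using K[of x h] by (cases "h = 0") (auto simp: divide_simps power2_eq_square)
    qed
    show "((\<lambda>h. K * norm h) \<longlongrightarrow> 0) (at 0)"
      by (auto intro!: tendsto_eq_intros)
  qed
  then show ?thesis using L by (auto simp: has_derivative_at)
qed

text \<open>The function is replaced by its Fourier series, differentiated, and the coefficients of
  the result are read off. In the sequel the weight condition always comes from exponential
  decay.\<close>

lemma pderiv_fourier:
  assumes f: "periodic_continuous f" and s: "(\<lambda>k. cmod (fourier f k) * (1 + norm (int_vec k))\<^sup>2) summable_on UNIV"
  shows "f differentiable (at x)" "periodic_continuous (pderiv_x i f)"
    "fourier (pderiv_x i f) k = deriv_symbol i k * fourier f k"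
proof -
  let ?c = "fourier f" and ?d = "\<lambda>k. deriv_symbol i k * fourier f k"
  have w: "1 \<le> (1 + norm (int_vec k))\<^sup>2" "norm (int_vec k) \<le> (1 + norm (int_vec k))\<^sup>2" for k
    by (auto simp: power2_eq_square algebra_simps)
  have c0: "(\<lambda>k. norm (fourier f k)) summable_on UNIV"
    by (rule Infinite_Sum.abs_summable_on_comparison_test'[OF s]) (use w in \<open>auto simp: mult_le_cancel_left1\<close>)
  have d0: "(\<lambda>k. norm (?d k)) summable_on UNIV"
  proof (rule Infinite_Sum.abs_summable_on_comparison_test'[OF summable_on_cmult_right[OF s, of "2 * pi"]])
    fix k
    have "\<bar>of_int (k $ i)\<bar> \<le> norm (int_vec k)" using component_le_norm_cart[of "int_vec k" i] by simp
    also have "\<dots> \<le> (1 + norm (int_vec k))\<^sup>2" by (rule w)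
    finally show "norm (?d k) \<le> 2 * pi * (cmod (fourier f k) * (1 + norm (int_vec k))\<^sup>2)"
      by (simp add: deriv_symbol_def norm_mult mult_left_mono mult_ac)
  qed
  have feq: "f = (\<lambda>x. Re (synth ?c x))"
    using fourier_inversion[OF f c0] by (metis Re_complex_of_real)
  let ?L = "\<lambda>x h. \<Sum>\<^sub>\<infinity>k. ?c k * (2 * pi * \<i> * (int_vec k \<bullet> h)) * char_fun k x"
  have D: "(f has_derivative (\<lambda>h. Re (?L x h))) (at x)" for x
    by (subst feq) (rule bounded_linear.has_derivative[OF bounded_linear_Re has_derivative_synth[OF s]])
  then show "f differentiable (at x)" by (auto simp: differentiable_def)
  have P: "pderiv_x i f = (\<lambda>x. Re (synth ?d x))"
  proof
    fix x
    have "pderiv_x i f x = Re (?L x (axis i 1))"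
      unfolding pderiv_x_def using frechet_derivative_at[OF D[of x], symmetric] by (rule fun_cong)
    also have "?L x (axis i 1) = synth ?d x"
      unfolding synth_def by (rule infsum_cong) (simp add: inner_axis deriv_symbol_def)
    finally show "pderiv_x i f x = Re (synth ?d x)" .
  qed
  show "periodic_continuous (pderiv_x i f)" unfolding P by (rule periodic_continuous_synth[OF d0])
  show "fourier (pderiv_x i f) k = deriv_symbol i k * fourier f k"
    unfolding P by (rule fourier_synth[OF d0]) (simp add: deriv_symbol_def fourier_minus)
qed

lemma ennreal_suminf_split_head: "(\<Sum>n. f n) = f 0 + (\<Sum>n. f (Suc n) :: ennreal)"
  using suminf_offset[of f 1] by (simp add: add.commute)

text \<open>Partial sums of the product run over a triangle of index pairs contained in a
  square.\<close>

lemma ennreal_Cauchy_product_le: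
  fixes f g :: "nat \<Rightarrow> ennreal"
  shows "(\<Sum>n. \<Sum>i\<le>n. f i * g (n - i)) \<le> (\<Sum>n. f n) * (\<Sum>n. g n)"
proof (rule suminf_le_const)
  fix N
  have "(\<Sum>n<N. \<Sum>i\<le>n. f i * g (n - i)) = (\<Sum>(i, j)\<in>{(i, j). i + j < N}. f i * g j)"
    by (rule sum.triangle_reindex[symmetric])
  also have "\<dots> \<le> (\<Sum>(i, j)\<in>{..<N} \<times> {..<N}. f i * g j)"
    by (rule sum_mono2) auto
  also have "\<dots> = (\<Sum>i<N. f i) * (\<Sum>j<N. g j)"
    by (simp add: sum_product sum.cartesian_product)
  also have "\<dots> \<le> (\<Sum>n. f n) * (\<Sum>n. g n)"
    by (intro mult_mono sum_le_suminf) auto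
  finally show "(\<Sum>n<N. \<Sum>i\<le>n. f i * g (n - i)) \<le> (\<Sum>n. f n) * (\<Sum>n. g n)" .
qed auto

lemma fsum_sum:
  assumes "\<And>i. i \<in> I \<Longrightarrow> continuous_on UNIV (f i)"
  shows "fsum \<omega> (\<lambda>x. \<Sum>i\<in>I. f i x) \<le> (\<Sum>i\<in>I. fsum \<omega> (f i))"
  using assms
proof (induction I rule: infinite_finite_induct)
  case (insert i I)
  have "fsum \<omega> (\<lambda>x. f i x + (\<Sum>i\<in>I. f i x)) \<le> fsum \<omega> (f i) + fsum \<omega> (\<lambda>x. \<Sum>i\<in>I. f i x)"
    by (rule fsum_add) (auto intro!: continuous_on_sum insert.prems)
  also have "\<dots> \<le> fsum \<omega> (f i) + (\<Sum>i\<in>I. fsum \<omega> (f i))"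
    by (intro add_left_mono insert.IH insert.prems) auto
  finally show ?case using insert by simp
qed (simp_all add: fsum_def fourier_const cong: if_cong)

lemma periodic_continuous_intros:
  fixes f g :: "real^3 \<Rightarrow> real"
  shows "periodic_continuous (\<lambda>x. c)"
    "periodic_continuous f \<Longrightarrow> periodic_continuous g \<Longrightarrow> periodic_continuous (\<lambda>x. f x + g x)"
    "periodic_continuous f \<Longrightarrow> periodic_continuous g \<Longrightarrow> periodic_continuous (\<lambda>x. f x - g x)"
    "periodic_continuous f \<Longrightarrow> periodic_continuous g \<Longrightarrow> periodic_continuous (\<lambda>x. f x * g x)"
    "periodic_continuous f \<Longrightarrow> periodic_continuous (\<lambda>x. - f x)"
  by (auto simp: periodic_continuous_def periodic_def intro!: continuous_intros)

lemma periodic_continuous_sum: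
  fixes h :: "'i \<Rightarrow> real^3 \<Rightarrow> real"
  assumes "\<And>i. i \<in> I \<Longrightarrow> periodic_continuous (h i)"
  shows "periodic_continuous (\<lambda>x. \<Sum>i\<in>I. h i x)"
  using assms continuous_on_sum[of I UNIV h]
  by (simp add: periodic_continuous_def periodic_def)

subsection \<open>Averages over a probability space\<close>

text \<open>By continuity in \<open>x\<close> the function is a pointwise limit of functions that
  depend on \<open>x\<close> only through a countable grid, and for those measurability in \<theta>
  is enough.\<close>

lemma measurable_caratheodory:
  fixes f :: "'a \<Rightarrow> real ^ 3 \<Rightarrow> real"
  assumes meas: "\<And>x. (\<lambda>\<theta>. f \<theta> x) \<in> borel_measurable M"
    and cont: "\<And>\<theta>. \<theta> \<in> space M \<Longrightarrow> continuous_on UNIV (f \<theta>)"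
  shows "(\<lambda>(\<theta>, x). f \<theta> x) \<in> borel_measurable (M \<Otimes>\<^sub>M cube_measure)"
proof -
  \<comment> \<open>Rounding down to the grid of mesh \<open>1 / (m + 1)\<close>; each coordinate is
    moved by at most one mesh width.\<close>
  define q :: "nat \<Rightarrow> real^3 \<Rightarrow> int^3" where "q m x = (\<chi> i. \<lfloor>of_nat (Suc m) * x $ i\<rfloor>)" for m x
  define h where "h m k = int_vec k /\<^sub>R of_nat (Suc m)" for m k
  have lim: "(\<lambda>m. h m (q m x)) \<longlonglongrightarrow> x" for x
  proof (rule vec_tendstoI)
    fix i
    have "(\<lambda>m. x $ i - h m (q m x) $ i) \<longlonglongrightarrow> 0"
    proof (rule Lim_null_comparison)
      show "\<forall>\<^sub>F m in sequentially. norm (x $ i - h m (q m x) $ i) \<le> inverse (real (Suc m))"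
      proof (rule always_eventually, rule allI)
        fix m
        have "x $ i - h m (q m x) $ i = (of_nat (Suc m) * x $ i - of_int \<lfloor>of_nat (Suc m) * x $ i\<rfloor>) / of_nat (Suc m)"
          by (simp add: h_def q_def field_simps del: of_nat_Suc)
        moreover have "\<bar>of_nat (Suc m) * x $ i - of_int \<lfloor>of_nat (Suc m) * x $ i\<rfloor>\<bar> \<le> 1"
          by linarith
        ultimately show "norm (x $ i - h m (q m x) $ i) \<le> inverse (real (Suc m))"
          by (simp add: abs_div divide_inverse mult_le_cancel_right1 del: of_nat_Suc)
      qed
    qed (rule LIMSEQ_inverse_real_of_nat)
    then show "(\<lambda>m. h m (q m x) $ i) \<longlonglongrightarrow> x $ i"
      using tendsto_diff[OF tendsto_const[of "x $ i"]] by fastforce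
  qed
  have qm: "q m \<in> measurable cube_measure (count_space UNIV)" for m
  proof -
    have "q m \<in> measurable borel (count_space UNIV)"
    proof (rule measurable_count_space_eq_countable[THEN iffD2, OF countableI_type], intro conjI ballI)
      fix k :: "int^3"
      have "q m -` {k} \<inter> space borel = (\<Inter>i. {x \<in> space borel. \<lfloor>of_nat (Suc m) * x $ i\<rfloor> = k $ i})"
        by (auto simp: q_def vec_eq_iff)
      also have "\<dots> \<in> sets borel"
        by (intro sets.countable_INT'' ) measurable
      finally show "q m -` {k} \<inter> space borel \<in> sets borel" .
    qed auto
    then show ?thesis unfolding cube_measure_def by (intro measurable_restrict_space1) simp
  qed
  show ?thesis
  proof (rule borel_measurable_LIMSEQ_real)
    show "(\<lambda>m. case p of (\<theta>, x) \<Rightarrow> f \<theta> (h m (q m x))) \<longlonglongrightarrow> (case p of (\<theta>, x) \<Rightarrow> f \<theta> x)"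
      if "p \<in> space (M \<Otimes>\<^sub>M cube_measure)" for p
    proof -
      obtain \<theta> x where p: "p = (\<theta>, x)" "\<theta> \<in> space M" using \<open>p \<in> _\<close> by (auto simp: space_pair_measure)
      show ?thesis
        unfolding p(1) prod.case by (rule continuous_on_tendsto_compose[OF cont[OF p(2)] lim]) auto
    qed
    show "(\<lambda>p. case p of (\<theta>, x) \<Rightarrow> f \<theta> (h m (q m x))) \<in> borel_measurable (M \<Otimes>\<^sub>M cube_measure)" for m
      unfolding case_prod_unfold
      by (rule measurable_compose_countable[where f = "\<lambda>k p. f (fst p) (h m k)" and g = "\<lambda>p. q m (snd p)"])
         (auto intro!: measurable_compose[OF measurable_fst meas] measurable_compose[OF measurable_snd qm])
  qed
qed

lemma measurable_fourier:
  fixes f :: "'a \<Rightarrow> real ^ 3 \<Rightarrow> real"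
  assumes "\<And>x. (\<lambda>\<theta>. f \<theta> x) \<in> borel_measurable M"
    and "\<And>\<theta>. \<theta> \<in> space M \<Longrightarrow> continuous_on UNIV (f \<theta>)"
  shows "(\<lambda>\<theta>. fourier (f \<theta>) k) \<in> borel_measurable M"
proof -
  interpret prob_space cube_measure by (rule prob_space_cube)
  have [measurable]: "(\<lambda>(\<theta>, x). f \<theta> x) \<in> borel_measurable (M \<Otimes>\<^sub>M cube_measure)"
    by (rule measurable_caratheodory[OF assms])
  have [measurable]: "char_fun (- k) \<in> borel_measurable cube_measure"
    by (intro measurable_cube continuous_intros)
  have "(\<lambda>(\<theta>, x). of_real (f \<theta> x) * char_fun (- k) x) \<in> borel_measurable (M \<Otimes>\<^sub>M cube_measure)"
    by measurable
  then show ?thesis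
    unfolding fourier_eq torus_mean_eq by (rule borel_measurable_lebesgue_integral)
qed

lemma measurable_nn_integral_count_space:
  fixes f :: "'k::countable \<Rightarrow> 'a \<Rightarrow> ennreal"
  assumes "\<And>k. f k \<in> borel_measurable M"
  shows "(\<lambda>\<theta>. \<integral>\<^sup>+k. f k \<theta> \<partial>count_space UNIV) \<in> borel_measurable M"
    "(\<integral>\<^sup>+\<theta>. (\<integral>\<^sup>+k. f k \<theta> \<partial>count_space UNIV) \<partial>M) = (\<integral>\<^sup>+k. (\<integral>\<^sup>+\<theta>. f k \<theta> \<partial>M) \<partial>count_space UNIV)"
proof -
  have [measurable]: "(\<lambda>\<theta>. if n \<in> range (to_nat :: 'k \<Rightarrow> nat) then f (from_nat n) \<theta> else 0) \<in> borel_measurable M" for n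
    using assms by auto
  show "(\<lambda>\<theta>. \<integral>\<^sup>+k. f k \<theta> \<partial>count_space UNIV) \<in> borel_measurable M"
    unfolding ennreal_infsum_conv_suminf(2) by measurable
  have "(\<integral>\<^sup>+\<theta>. (\<Sum>n. if n \<in> range (to_nat :: 'k \<Rightarrow> nat) then f (from_nat n) \<theta> else 0) \<partial>M) =
      (\<Sum>n. (\<integral>\<^sup>+\<theta>. (if n \<in> range (to_nat :: 'k \<Rightarrow> nat) then f (from_nat n) \<theta> else 0) \<partial>M))"
    by (rule nn_integral_suminf) measurable
  also have "\<dots> = (\<Sum>n. if n \<in> range (to_nat :: 'k \<Rightarrow> nat) then (\<integral>\<^sup>+\<theta>. f (from_nat n) \<theta> \<partial>M) else 0)"
    by (intro suminf_cong) auto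
  finally show "(\<integral>\<^sup>+\<theta>. (\<integral>\<^sup>+k. f k \<theta> \<partial>count_space UNIV) \<partial>M) = (\<integral>\<^sup>+k. (\<integral>\<^sup>+\<theta>. f k \<theta> \<partial>M) \<partial>count_space UNIV)"
    unfolding ennreal_infsum_conv_suminf(2) .
qed

lemma measurable_fsum:
  fixes f :: "'a \<Rightarrow> real ^ 3 \<Rightarrow> real"
  assumes "\<And>x. (\<lambda>\<theta>. f \<theta> x) \<in> borel_measurable M"
    and "\<And>\<theta>. \<theta> \<in> space M \<Longrightarrow> continuous_on UNIV (f \<theta>)"
  shows "(\<lambda>\<theta>. fsum \<omega> (f \<theta>)) \<in> borel_measurable M"
proof -
  have [measurable]: "(\<lambda>\<theta>. fourier (f \<theta>) k) \<in> borel_measurable M" for k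
    by (rule measurable_fourier[OF assms])
  show ?thesis unfolding fsum_def by (rule measurable_nn_integral_count_space) measurable
qed

text \<open>The uniform bound on the absolute sums makes the modes summable jointly in \<theta> and
  \<open>k\<close>, so the average of the Fourier series is again an absolutely convergent Fourier
  series. Continuity of the average comes from there and not from equicontinuity in
  \<theta>.\<close>

lemma fourier_average:
  fixes f :: "'a \<Rightarrow> real ^ 3 \<Rightarrow> real"
  assumes "prob_space M" and meas: "\<And>x. (\<lambda>\<theta>. f \<theta> x) \<in> borel_measurable M"
    and pc: "\<And>\<theta>. \<theta> \<in> space M \<Longrightarrow> periodic_continuous (f \<theta>)"
    and bd: "\<And>\<theta>. \<theta> \<in> space M \<Longrightarrow> fsum (\<lambda>_. 1) (f \<theta>) \<le> ennreal C" and "C \<ge> 0"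
  shows "periodic_continuous (\<lambda>x. \<integral>\<theta>. f \<theta> x \<partial>M)"
    and "fourier (\<lambda>x. \<integral>\<theta>. f \<theta> x \<partial>M) k = (\<integral>\<theta>. fourier (f \<theta>) k \<partial>M)"
    and "fsum \<omega> (\<lambda>x. \<integral>\<theta>. f \<theta> x \<partial>M) \<le> (\<integral>\<^sup>+\<theta>. fsum \<omega> (f \<theta>) \<partial>M)"
proof -
  interpret prob_space M by fact
  have fm[measurable]: "(\<lambda>\<theta>. fourier (f \<theta>) k) \<in> borel_measurable M" for k
    by (rule measurable_fourier[OF meas periodic_continuousD(1)[OF pc]])
  have sm: "(\<lambda>k. norm (fourier (f \<theta>) k)) summable_on UNIV" if "\<theta> \<in> space M" for \<theta>
  proof -
    have "fsum (\<lambda>_. 1) (f \<theta>) < \<infinity>" using bd[OF that] by (simp add: le_less_trans)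
    from fsum_summable[OF this, of "\<lambda>_. 1"] show ?thesis by simp
  qed
  have fin: "(\<integral>\<^sup>+k. (\<integral>\<^sup>+\<theta>. ennreal (norm (fourier (f \<theta>) k)) \<partial>M) \<partial>count_space UNIV) \<le> ennreal C"
  proof -
    have "(\<integral>\<^sup>+k. (\<integral>\<^sup>+\<theta>. ennreal (norm (fourier (f \<theta>) k)) \<partial>M) \<partial>count_space UNIV) = (\<integral>\<^sup>+\<theta>. fsum (\<lambda>_. 1) (f \<theta>) \<partial>M)"
      unfolding fsum_def by (subst measurable_nn_integral_count_space(2)) simp_all
    also have "\<dots> \<le> (\<integral>\<^sup>+\<theta>. ennreal C \<partial>M)"
      by (intro nn_integral_mono bd)
    also have "\<dots> = ennreal C" by (simp add: emeasure_space_1)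
    finally show ?thesis .
  qed
  have int: "integrable M (\<lambda>\<theta>. fourier (f \<theta>) k)" for k
  proof (rule integrable_const_bound[of _ C])
    show "AE \<theta> in M. norm (fourier (f \<theta>) k) \<le> C"
    proof (rule AE_I2)
      fix \<theta> assume \<theta>: "\<theta> \<in> space M"
      have "ennreal (norm (fourier (f \<theta>) k)) = (\<integral>\<^sup>+j. ennreal (norm (fourier (f \<theta>) j)) * indicator {k} j \<partial>count_space UNIV)"
        by (subst nn_integral_indicator_singleton) auto
      also have "\<dots> \<le> fsum (\<lambda>_. 1) (f \<theta>)"
        unfolding fsum_def by (intro nn_integral_mono) (auto simp: indicator_def)
      also have "\<dots> \<le> ennreal C" by (rule bd[OF \<theta>])
      finally show "norm (fourier (f \<theta>) k) \<le> C"
        using \<open>C \<ge> 0\<close> by (simp add: ennreal_le_iff)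
    qed
  qed measurable
  have nn: "ennreal (norm (\<integral>\<theta>. norm (fourier (f \<theta>) k) \<partial>M)) = (\<integral>\<^sup>+\<theta>. ennreal (norm (fourier (f \<theta>) k)) \<partial>M)" for k
    using int[of k] by (subst nn_integral_eq_integral) auto
  have si: "(\<lambda>k. \<integral>\<theta>. norm (fourier (f \<theta>) k) \<partial>M) summable_on UNIV"
  proof -
    have "(\<lambda>k. norm (\<integral>\<theta>. norm (fourier (f \<theta>) k) \<partial>M)) summable_on UNIV"
      unfolding summable_on_iff_nn_integral nn using fin by (simp add: le_less_trans)
    then show ?thesis by simp
  qed
  define c where "c k = (\<integral>\<theta>. fourier (f \<theta>) k \<partial>M)" for k
  have cs: "(\<lambda>k. norm (c k)) summable_on UNIV"
    unfolding c_def by (rule Infinite_Sum.abs_summable_on_comparison_test'[OF si]) simp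
  have avg: "(\<lambda>x. \<integral>\<theta>. f \<theta> x \<partial>M) = (\<lambda>x. Re (synth c x))"
  proof
    fix x
    have "((\<lambda>k. \<integral>\<theta>. fourier (f \<theta>) k * char_fun k x \<partial>M) has_sum
       (\<integral>\<theta>. (\<Sum>\<^sub>\<infinity>k. fourier (f \<theta>) k * char_fun k x) \<partial>M)) UNIV"
      by (rule integral_infsum'(2)) (auto simp: norm_mult sm si intro!: int)
    moreover have "(\<integral>\<theta>. (\<Sum>\<^sub>\<infinity>k. fourier (f \<theta>) k * char_fun k x) \<partial>M) = (\<integral>\<theta>. of_real (f \<theta> x) \<partial>M)"
    proof (rule Bochner_Integration.integral_cong[OF refl])
      fix \<theta> assume "\<theta> \<in> space M"
      from fourier_inversion[OF pc[OF this] sm[OF this], of x]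
      show "(\<Sum>\<^sub>\<infinity>k. fourier (f \<theta>) k * char_fun k x) = of_real (f \<theta> x)" by (simp add: synth_def)
    qed
    ultimately have "synth c x = of_real (\<integral>\<theta>. f \<theta> x \<partial>M)"
      unfolding synth_def c_def by (simp add: infsumI)
    then show "(\<integral>\<theta>. f \<theta> x \<partial>M) = Re (synth c x)" by simp
  qed
  show "periodic_continuous (\<lambda>x. \<integral>\<theta>. f \<theta> x \<partial>M)"
    unfolding avg by (rule periodic_continuous_synth[OF cs])
  have herm: "c (- k) = cnj (c k)" for k
    unfolding c_def fourier_minus by (rule Bochner_Integration.integral_cnj)
  show F: "fourier (\<lambda>x. \<integral>\<theta>. f \<theta> x \<partial>M) k = (\<integral>\<theta>. fourier (f \<theta>) k \<partial>M)" for k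
    unfolding avg fourier_synth[OF cs herm] by (simp add: c_def)
  have "fsum \<omega> (\<lambda>x. \<integral>\<theta>. f \<theta> x \<partial>M) \<le> (\<integral>\<^sup>+k. (\<integral>\<^sup>+\<theta>. ennreal (cmod (fourier (f \<theta>) k)) \<partial>M) * \<omega> k \<partial>count_space UNIV)"
    unfolding fsum_def F
  proof (intro nn_integral_mono mult_right_mono)
    fix k
    show "ennreal (cmod (\<integral>\<theta>. fourier (f \<theta>) k \<partial>M)) \<le> (\<integral>\<^sup>+\<theta>. ennreal (cmod (fourier (f \<theta>) k)) \<partial>M)"
      unfolding nn[symmetric] by (intro ennreal_leI) simp
  qed simp
  also have "\<dots> = (\<integral>\<^sup>+k. (\<integral>\<^sup>+\<theta>. ennreal (cmod (fourier (f \<theta>) k)) * \<omega> k \<partial>M) \<partial>count_space UNIV)"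
    by (simp add: nn_integral_multc)
  also have "\<dots> = (\<integral>\<^sup>+\<theta>. fsum \<omega> (f \<theta>) \<partial>M)"
    unfolding fsum_def by (subst measurable_nn_integral_count_space(2)) auto
  finally show "fsum \<omega> (\<lambda>x. \<integral>\<theta>. f \<theta> x \<partial>M) \<le> (\<integral>\<^sup>+\<theta>. fsum \<omega> (f \<theta>) \<partial>M)" .
qed

subsection \<open>Weighted norms of time series\<close>

text \<open>A series assigns to each point a formal power series in time, so that products and time
  derivatives are those of \<open>fps\<close>; the spatial estimates concern the function of
  \<open>x\<close> at a fixed order in time.\<close>

definition coeff :: "(real ^ 3 \<Rightarrow> real fps) \<Rightarrow> nat \<Rightarrow> real ^ 3 \<Rightarrow> real" where
  "coeff U n = (\<lambda>x. fps_nth (U x) n)"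

definition lift_op :: "((real ^ 3 \<Rightarrow> real) \<Rightarrow> real ^ 3 \<Rightarrow> real) \<Rightarrow> (real ^ 3 \<Rightarrow> real fps) \<Rightarrow> real ^ 3 \<Rightarrow> real fps" where
  "lift_op L U x = Abs_fps (\<lambda>n. L (coeff U n) x)"

lemma coeff_simps [simp]:
  "coeff (lift_op L U) n = L (coeff U n)"
  "coeff (\<lambda>x. Abs_fps (\<lambda>n. h n x)) n = h n"
  "coeff (\<lambda>x. U x + V x) n = (\<lambda>x. coeff U n x + coeff V n x)"
  "coeff (\<lambda>x. U x - V x) n = (\<lambda>x. coeff U n x - coeff V n x)"
  "coeff (\<lambda>x. - U x) n = (\<lambda>x. - coeff U n x)"
  "coeff (\<lambda>x. fps_const c * U x) n = (\<lambda>x. c * coeff U n x)"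
  "coeff (\<lambda>x. \<Sum>i\<in>I. W i x) n = (\<lambda>x. \<Sum>i\<in>I. coeff (W i) n x)"
  "coeff (\<lambda>x. fps_deriv (U x)) n = (\<lambda>x. real (Suc n) * coeff U (Suc n) x)"
  by (auto simp: coeff_def lift_op_def fps_sum_nth)

lemma coeff_const: "coeff (\<lambda>x. fps_const (f x)) n = (\<lambda>x. if n = 0 then f x else 0)"
  by (auto simp: coeff_def)

lemma coeff_mult: "coeff (\<lambda>x. U x * V x) n = (\<lambda>x. \<Sum>i\<le>n. coeff U i x * coeff V (n - i) x)"
  by (auto simp: coeff_def fps_mult_nth atLeast0AtMost)

lemma coeff_integral_Suc: "coeff (\<lambda>x. fps_integral (F x) (u x)) (Suc n) = (\<lambda>x. inverse (real (Suc n)) * coeff F n x)"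
  by (auto simp: coeff_def)

lemma coeff_integral_0 [simp]: "coeff (\<lambda>x. fps_integral (F x) (u x)) 0 = u"
  by (auto simp: coeff_def)

text \<open>\<open>a\<close> is the exponential decay rate in \<open>|k|\<close> at time zero,
  \<open>b\<close> the speed at which it shrinks, \<open>R\<close> the length of the time interval;
  \<open>b * R < a\<close> leaves a positive rate throughout.\<close>

locale time_weight =
  fixes a b R :: real
  assumes R_pos: "R > 0" and b_pos: "b > 0" and bR: "b * R < a"
begin

definition weight :: "nat \<Rightarrow> int ^ 3 \<Rightarrow> ennreal" where
  "weight n k = (SUP t\<in>{0..R}. ennreal (t ^ n * exp ((a - b * t) * norm (int_vec k))))"

text \<open>The application takes \<open>j = 0\<close> for right-hand sides and \<open>j = 1\<close>
  for unknowns.\<close>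

definition jweight :: "nat \<Rightarrow> nat \<Rightarrow> int ^ 3 \<Rightarrow> ennreal" where
  "jweight j n k = ennreal ((1 + norm (int_vec k)) ^ j) * weight n k"

text \<open>Operator bound of time integration from index 0 to index 1: \<open>R\<close> pays for
  the summand 1 of \<open>1 + |k|\<close>, and \<open>1 / b\<close> for the summand
  \<open>|k|\<close>.\<close>

definition gain :: real where "gain = R + 1 / b"

lemma gain_pos: "gain > 0" using R_pos b_pos by (simp add: gain_def add_pos_pos)

lemma bt_le: "t \<in> {0..R} \<Longrightarrow> b * t < a"
proof -
  assume "t \<in> {0..R}"
  then have "b * t \<le> b * R" using b_pos by (intro mult_left_mono) auto
  then show "b * t < a" using bR by linarith
qed

lemma weight_upper: "t \<in> {0..R} \<Longrightarrow> ennreal (t ^ n * exp ((a - b * t) * norm (int_vec k))) \<le> weight n k"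
  unfolding weight_def by (rule SUP_upper)

lemma weight_lower: "ennreal (R ^ n * exp ((a - b * R) * norm (int_vec k))) \<le> weight n k"
  using weight_upper[of R n k] R_pos by simp

lemma weight_0: "weight 0 k \<le> ennreal (exp (a * norm (int_vec k)))"
  unfolding weight_def
  by (rule SUP_least) (use b_pos in \<open>auto intro!: ennreal_leI mult_right_mono\<close>)

text \<open>At one and the same \<open>t\<close> the factors multiply, and the supremum of a product
  is at most the product of the suprema; positivity of \<open>a - b * t\<close> makes the triangle
  inequality usable in the exponent.\<close>

lemma weight_submult: "weight (n + m) (k + l) \<le> weight n k * weight m l"
  unfolding weight_def[of "n + m"]
proof (rule SUP_least)
  fix t assume t: "t \<in> {0..R}"
  have "exp ((a - b * t) * norm (int_vec (k + l))) \<le>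
      exp ((a - b * t) * norm (int_vec k)) * exp ((a - b * t) * norm (int_vec l))"
    using bt_le[OF t] norm_triangle_ineq[of "int_vec k" "int_vec l"]
    by (simp add: mult_left_mono flip: exp_add distrib_left)
  then have "t ^ (n + m) * exp ((a - b * t) * norm (int_vec (k + l))) \<le>
      t ^ (n + m) * (exp ((a - b * t) * norm (int_vec k)) * exp ((a - b * t) * norm (int_vec l)))"
    using t by (intro mult_left_mono) auto
  then have "ennreal (t ^ (n + m) * exp ((a - b * t) * norm (int_vec (k + l)))) \<le>
      ennreal ((t ^ n * exp ((a - b * t) * norm (int_vec k))) * (t ^ m * exp ((a - b * t) * norm (int_vec l))))"
    by (intro ennreal_leI) (simp add: power_add mult_ac)
  also have "\<dots> = ennreal (t ^ n * exp ((a - b * t) * norm (int_vec k))) * ennreal (t ^ m * exp ((a - b * t) * norm (int_vec l)))"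
    using t by (intro ennreal_mult) auto
  also have "\<dots> \<le> weight n k * weight m l"
    by (intro mult_mono weight_upper t) auto
  finally show "ennreal (t ^ (n + m) * exp ((a - b * t) * norm (int_vec (k + l)))) \<le> weight n k * weight m l" .
qed

lemma jweight_submult: "jweight j (n + m) (k + l) \<le> jweight j n k * jweight j m l"
proof -
  have "1 + norm (int_vec (k + l)) \<le> (1 + norm (int_vec k)) * (1 + norm (int_vec l))"
  proof -
    have "0 \<le> norm (int_vec k) * norm (int_vec l)" by simp
    moreover have "(1 + norm (int_vec k)) * (1 + norm (int_vec l)) =
        1 + norm (int_vec k) + norm (int_vec l) + norm (int_vec k) * norm (int_vec l)"
      by (simp add: algebra_simps)
    ultimately show ?thesis using norm_triangle_ineq[of "int_vec k" "int_vec l"] unfolding int_vec_simps by linarith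
  qed
  then have "(1 + norm (int_vec (k + l))) ^ j \<le> (1 + norm (int_vec k)) ^ j * (1 + norm (int_vec l)) ^ j"
    by (subst power_mult_distrib[symmetric]) (intro power_mono, auto)
  then have "ennreal ((1 + norm (int_vec (k + l))) ^ j) \<le> ennreal ((1 + norm (int_vec k)) ^ j) * ennreal ((1 + norm (int_vec l)) ^ j)"
    by (subst ennreal_mult[symmetric]) (auto intro!: ennreal_leI)
  then have "jweight j (n + m) (k + l) \<le> (ennreal ((1 + norm (int_vec k)) ^ j) * ennreal ((1 + norm (int_vec l)) ^ j)) * (weight n k * weight m l)"
    unfolding jweight_def by (intro mult_mono weight_submult) auto
  then show ?thesis by (simp add: jweight_def mult_ac)
qed

text \<open>
  Cauchy's mean value theorem for \<open>s \<mapsto> s ^ (n + 1)\<close> and \<open>s \<mapsto> exp (b \<kappa> s)\<close> trades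
  one derivative for a factor \<open>1 / b\<close>.
\<close>

lemma weight_Suc:
  "ennreal ((1 + norm (int_vec k)) / real (Suc n)) * weight (Suc n) k \<le> ennreal gain * weight n k"
  unfolding weight_def[of "Suc n"] SUP_mult_left_ennreal
proof (rule SUP_least)
  fix t assume t: "t \<in> {0..R}"
  define \<kappa> where "\<kappa> = norm (int_vec k)"
  have \<kappa>: "\<kappa> \<ge> 0" by (simp add: \<kappa>_def)
  define m where "m s n = s ^ n * exp ((a - b * s) * \<kappa>)" for s :: real and n :: nat
  \<comment> \<open>The weight of order \<open>n + 1\<close> at \<open>t\<close> is compared with
    the weight of order \<open>n\<close> at another time \<open>s\<close>, which the supremum in
    \<open>weight n k\<close> allows.\<close>
  obtain s where s: "s \<in> {0..R}" "\<kappa> / real (Suc n) * m t (Suc n) \<le> 1 / b * m s n"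
  proof (cases "t = 0")
    case True
    then show ?thesis using that[of 0] R_pos b_pos by (simp add: m_def)
  next
    case False
    then have "0 < t" using t by simp
    have "\<exists>s. 0 < s \<and> s < t \<and>
      (t ^ Suc n - 0 ^ Suc n) * (b * \<kappa> * exp (b * \<kappa> * s)) = (exp (b * \<kappa> * t) - exp (b * \<kappa> * 0)) * (real (Suc n) * s ^ n)"
      by (rule GMVT'[of 0 t "\<lambda>s. s ^ Suc n" "\<lambda>s. exp (b * \<kappa> * s)" "\<lambda>s. b * \<kappa> * exp (b * \<kappa> * s)" "\<lambda>s. real (Suc n) * s ^ n"])
         (use \<open>0 < t\<close> in \<open>auto intro!: derivative_eq_intros continuous_intros simp del: power_Suc\<close>)
    then obtain s where s: "0 < s" "s < t"
      "(t ^ Suc n - 0 ^ Suc n) * (b * \<kappa> * exp (b * \<kappa> * s)) = (exp (b * \<kappa> * t) - exp (b * \<kappa> * 0)) * (real (Suc n) * s ^ n)"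
      by blast
    have "\<kappa> * b * t ^ Suc n * exp (b * \<kappa> * s) \<le> exp (b * \<kappa> * t) * (real (Suc n) * s ^ n)"
    proof -
      have "\<kappa> * b * t ^ Suc n * exp (b * \<kappa> * s) = (exp (b * \<kappa> * t) - 1) * (real (Suc n) * s ^ n)"
        using s(3) by (simp add: mult_ac)
      also have "\<dots> \<le> exp (b * \<kappa> * t) * (real (Suc n) * s ^ n)"
        using s(1) by (intro mult_right_mono) auto
      finally show ?thesis .
    qed
    \<comment> \<open>The common factor turns the exponentials on the two sides into those of the
      weights at \<open>t\<close> and at \<open>s\<close>.\<close>
    then have "\<kappa> * b * t ^ Suc n * exp (b * \<kappa> * s) * (exp (a * \<kappa>) * exp (- (b * \<kappa> * t)) * exp (- (b * \<kappa> * s))) \<le>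
       exp (b * \<kappa> * t) * (real (Suc n) * s ^ n) * (exp (a * \<kappa>) * exp (- (b * \<kappa> * t)) * exp (- (b * \<kappa> * s)))"
      by (rule mult_right_mono) auto
    then have "\<kappa> * b * m t (Suc n) \<le> real (Suc n) * m s n"
      by (simp add: m_def left_diff_distrib exp_diff exp_minus field_simps del: power_Suc of_nat_Suc)
    then have "\<kappa> / real (Suc n) * m t (Suc n) \<le> 1 / b * m s n"
      using b_pos by (simp add: field_simps del: of_nat_Suc)
    then show ?thesis using that[of s] s t by auto
  qed
  have 1: "1 / real (Suc n) * m t (Suc n) \<le> R * m t n"
  proof -
    have "1 / real (Suc n) * m t (Suc n) \<le> 1 * m t (Suc n)"
      using t by (intro mult_right_mono) (auto simp: m_def)
    also have "\<dots> = t * m t n" by (simp add: m_def)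
    also have "\<dots> \<le> R * m t n" using t by (intro mult_right_mono) (auto simp: m_def)
    finally show ?thesis .
  qed
  have mw: "ennreal (m u n) \<le> weight n k" if "u \<in> {0..R}" for u
    unfolding m_def \<kappa>_def by (rule weight_upper[OF that])
  have "ennreal ((1 + \<kappa>) / real (Suc n)) * ennreal (m t (Suc n)) = ennreal ((1 + \<kappa>) / real (Suc n) * m t (Suc n))"
    using \<kappa> t by (intro ennreal_mult[symmetric]) (auto simp: m_def)
  also have "\<dots> \<le> ennreal (R * m t n + 1 / b * m s n)"
    using 1 s(2) by (intro ennreal_leI) (simp add: add_divide_distrib distrib_right del: of_nat_Suc)
  also have "\<dots> = ennreal R * ennreal (m t n) + ennreal (1 / b) * ennreal (m s n)"
    using R_pos b_pos t s(1) by (subst ennreal_plus) (auto simp: m_def ennreal_mult[symmetric])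
  also have "\<dots> \<le> ennreal R * weight n k + ennreal (1 / b) * weight n k"
    by (intro add_mono mult_left_mono mw t s(1)) auto
  also have "\<dots> = ennreal gain * weight n k"
    using R_pos b_pos by (simp add: gain_def distrib_right ennreal_plus del: ennreal_plus[symmetric])
  finally show "ennreal ((1 + norm (int_vec k)) / real (Suc n)) * ennreal (t ^ Suc n * exp ((a - b * t) * norm (int_vec k)))
      \<le> ennreal gain * weight n k"
    by (simp add: m_def \<kappa>_def)
qed

end

lemma deriv_symbol_bound: "cmod (deriv_symbol i k) \<le> 2 * pi * norm (int_vec k)"
  using component_le_norm_cart[of "int_vec k" i] by (simp add: deriv_symbol_def norm_mult)

text \<open>Raise \<open>1 + x \<le> m * (1 + c * x / n) \<le> m * exp (c * x / n)\<close> to the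
  power \<open>n\<close>; the maximum in \<open>m\<close> takes care of both summands of
  \<open>1 + x\<close>.\<close>

lemma exp_dominates_power:
  fixes c :: real
  assumes "c > 0"
  obtains K where "K > 0" "\<And>x. x \<ge> 0 \<Longrightarrow> (1 + x) ^ n \<le> K * exp (c * x)"
proof -
  have "(1 + x) ^ n \<le> (max 1 (real n / c)) ^ n * exp (c * x)" if "x \<ge> 0" for x
  proof (cases "n = 0")
    case False
    define m where "m = max 1 (real n / c)"
    have m: "m \<ge> 1" "real n / c \<le> m" by (auto simp: m_def)
    have "real n \<le> m * c" using m(2) assms by (simp add: field_simps)
    have "x * real n \<le> x * (m * c)" using \<open>real n \<le> m * c\<close> that by (rule mult_left_mono)
    then have "x \<le> m * (c * x / real n)" using False by (simp add: field_simps)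
    then have "1 + x \<le> m * (1 + c * x / real n)" using m(1) by (simp add: distrib_left)
    also have "\<dots> \<le> m * exp (c * x / real n)"
      using m(1) by (intro mult_left_mono exp_ge_add_one_self) auto
    finally have "(1 + x) ^ n \<le> (m * exp (c * x / real n)) ^ n"
      using that by (intro power_mono) auto
    also have "\<dots> = m ^ n * exp (c * x)"
      using False by (simp add: power_mult_distrib flip: exp_of_nat_mult)
    finally show ?thesis by (simp add: m_def)
  qed (use that assms in auto)
  then show ?thesis using that[of "(max 1 (real n / c)) ^ n"] by fastforce
qed

definition average :: "'a measure \<Rightarrow> ('a \<Rightarrow> real ^ 3 \<Rightarrow> real fps) \<Rightarrow> real ^ 3 \<Rightarrow> real fps" where
  "average M U x = Abs_fps (\<lambda>n. \<integral>\<theta>. coeff (U \<theta>) n x \<partial>M)"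

section \<open>The weighted algebra of time series\<close>

context time_weight
begin

definition tnorm :: "nat \<Rightarrow> (real ^ 3 \<Rightarrow> real fps) \<Rightarrow> ennreal" where
  "tnorm j U = (\<Sum>n. fsum (jweight j n) (coeff U n))"

text \<open>A real constant bounds the norm, so that estimates compose by ordinary arithmetic;
  \<open>c \<ge> 0\<close> keeps \<open>ennreal\<close> additive and multiplicative on the
  bounds.\<close>

definition bounded_series :: "nat \<Rightarrow> (real ^ 3 \<Rightarrow> real fps) \<Rightarrow> real \<Rightarrow> bool" where
  "bounded_series j U c \<longleftrightarrow> c \<ge> 0 \<and> (\<forall>n. periodic_continuous (coeff U n)) \<and> tnorm j U \<le> ennreal c"

lemma bounded_seriesD:
  assumes "bounded_series j U c"
  shows "c \<ge> 0" "periodic_continuous (coeff U n)" "continuous_on S (coeff U n)" "tnorm j U \<le> ennreal c"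
    "fsum (jweight j n) (coeff U n) \<le> ennreal c"
proof -
  show "c \<ge> 0" "periodic_continuous (coeff U n)" "tnorm j U \<le> ennreal c"
    using assms by (auto simp: bounded_series_def)
  then show "continuous_on S (coeff U n)" by (intro periodic_continuousD)
  have "fsum (jweight j n) (coeff U n) = (\<Sum>m\<in>{n}. fsum (jweight j m) (coeff U m))" by simp
  also have "\<dots> \<le> tnorm j U" unfolding tnorm_def by (intro sum_le_suminf) auto
  also have "\<dots> \<le> ennreal c" by fact
  finally show "fsum (jweight j n) (coeff U n) \<le> ennreal c" .
qed

lemma jweight_lower: "ennreal (R ^ n * exp ((a - b * R) * norm (int_vec k))) \<le> jweight j n k"
proof -
  have "1 * weight n k \<le> jweight j n k"
    unfolding jweight_def by (intro mult_right_mono) (auto simp: ennreal_1[symmetric] simp del: ennreal_1 intro!: ennreal_leI)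
  then show ?thesis using weight_lower[of n k] by (simp add: order_trans)
qed

lemma jweight_lower_1: "ennreal (R ^ n) \<le> jweight j n k"
proof -
  have "R ^ n * 1 \<le> R ^ n * exp ((a - b * R) * norm (int_vec k))"
    using R_pos bR by (intro mult_left_mono) auto
  then have "ennreal (R ^ n) \<le> ennreal (R ^ n * exp ((a - b * R) * norm (int_vec k)))" by (simp add: ennreal_leI)
  then show ?thesis using jweight_lower by (rule order_trans)
qed

text \<open>At \<open>t = R\<close> the weight contains the exponential with rate
  \<open>a - b * R > 0\<close>, which absorbs every power of \<open>1 + |k|\<close>; hence each time
  coefficient is smooth.\<close>

lemma bounded_series_summable:
  assumes "bounded_series j U c"
  shows "(\<lambda>k. cmod (fourier (coeff U n) k) * exp ((a - b * R) * norm (int_vec k))) summable_on UNIV"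
    "(\<lambda>k. cmod (fourier (coeff U n) k) * (1 + norm (int_vec k)) ^ m) summable_on UNIV"
    "(\<lambda>k. cmod (fourier (coeff U n) k)) summable_on UNIV"
proof -
  have "fsum (jweight j n) (coeff U n) < \<infinity>"
    by (simp add: le_less_trans[OF bounded_seriesD(5)[OF assms]])
  from fsum_summable[OF this jweight_lower]
  have "(\<lambda>k. cmod (fourier (coeff U n) k) * (R ^ n * exp ((a - b * R) * norm (int_vec k)))) summable_on UNIV"
    using R_pos by simp
  from summable_on_cmult_right[OF this, of "inverse (R ^ n)"]
  show s: "(\<lambda>k. cmod (fourier (coeff U n) k) * exp ((a - b * R) * norm (int_vec k))) summable_on UNIV"
    using R_pos by (simp add: mult_ac field_simps)
  show s': "(\<lambda>k. cmod (fourier (coeff U n) k) * (1 + norm (int_vec k)) ^ m) summable_on UNIV" for m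
  proof -
    obtain K where K: "\<And>x. x \<ge> 0 \<Longrightarrow> (1 + x) ^ m \<le> K * exp ((a - b * R) * x)"
      using exp_dominates_power[of "a - b * R" m] bR by (metis diff_gt_0_iff_gt)
    have "norm (cmod (fourier (coeff U n) k) * (1 + norm (int_vec k)) ^ m) \<le>
       K * (cmod (fourier (coeff U n) k) * exp ((a - b * R) * norm (int_vec k)))" for k
      using mult_left_mono[OF K[of "norm (int_vec k)"], of "cmod (fourier (coeff U n) k)"]
      by (simp add: abs_mult mult_ac)
    from Infinite_Sum.abs_summable_on_comparison_test'[OF summable_on_cmult_right[OF s] this]
    show ?thesis by (simp add: abs_mult)
  qed
  show "(\<lambda>k. cmod (fourier (coeff U n) k)) summable_on UNIV" using s'[of 0] by simp
qed

lemma bounded_series_mono: "bounded_series j U c \<Longrightarrow> c \<le> d \<Longrightarrow> bounded_series j U d"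
  unfolding bounded_series_def using ennreal_leI order_trans by fastforce

lemma bounded_series_1_0: "bounded_series 1 U c \<Longrightarrow> bounded_series 0 U c"
proof -
  assume *: "bounded_series 1 U c"
  have "jweight 0 n k \<le> jweight 1 n k" for n k
    unfolding jweight_def by (intro mult_right_mono ennreal_leI) auto
  then have "tnorm 0 U \<le> tnorm 1 U"
    unfolding tnorm_def by (intro suminf_le fsum_mono) auto
  with * show ?thesis by (auto simp: bounded_series_def intro: order_trans)
qed

lemma bounded_series_add:
  assumes "bounded_series j U c" "bounded_series j V d"
  shows "bounded_series j (\<lambda>x. U x + V x) (c + d)"
proof -
  note [simp] = bounded_seriesD[OF assms(1)] bounded_seriesD[OF assms(2)]
  have "tnorm j (\<lambda>x. U x + V x) \<le> (\<Sum>n. fsum (jweight j n) (coeff U n) + fsum (jweight j n) (coeff V n))"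
    unfolding tnorm_def coeff_simps by (intro suminf_le fsum_add) auto
  also have "\<dots> = tnorm j U + tnorm j V"
    unfolding tnorm_def by (rule suminf_add[symmetric]) auto
  also have "\<dots> \<le> ennreal c + ennreal d" by (intro add_mono) auto
  also have "\<dots> = ennreal (c + d)" by (simp add: ennreal_plus)
  finally show ?thesis by (simp add: bounded_series_def periodic_continuous_intros)
qed

text \<open>Covers every operator that acts on each mode separately: scalars, signs, derivatives and
  Fourier multipliers. Only the powers of \<open>1 + |k|\<close> have to be compared, since the
  remaining weight is common to both sides.\<close>

lemma bounded_series_multiplier:
  assumes U: "bounded_series j U c" and V: "\<And>n. periodic_continuous (coeff V n)" and "C \<ge> 0"
    and le: "\<And>n k. cmod (fourier (coeff V n) k) * (1 + norm (int_vec k)) ^ i \<le>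
                C * (cmod (fourier (coeff U n) k) * (1 + norm (int_vec k)) ^ j)"
  shows "bounded_series i V (C * c)"
proof -
  have "fsum (jweight i n) (coeff V n) \<le> ennreal C * fsum (jweight j n) (coeff U n)" for n
  proof (rule fsum_le_multiplier)
    fix k
    have "ennreal (cmod (fourier (coeff V n) k)) * jweight i n k =
       ennreal (cmod (fourier (coeff V n) k) * (1 + norm (int_vec k)) ^ i) * weight n k"
      by (simp add: jweight_def ennreal_mult mult_ac)
    also have "\<dots> \<le> ennreal (C * (cmod (fourier (coeff U n) k) * (1 + norm (int_vec k)) ^ j)) * weight n k"
      by (intro mult_right_mono ennreal_leI le) auto
    also have "\<dots> = ennreal C * (ennreal (cmod (fourier (coeff U n) k)) * jweight j n k)"
      using \<open>C \<ge> 0\<close> by (simp add: jweight_def ennreal_mult mult_ac)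
    finally show "ennreal (cmod (fourier (coeff V n) k)) * jweight i n k \<le>
       ennreal C * (ennreal (cmod (fourier (coeff U n) k)) * jweight j n k)" .
  qed
  then have "tnorm i V \<le> (\<Sum>n. ennreal C * fsum (jweight j n) (coeff U n))"
    unfolding tnorm_def by (intro suminf_le) auto
  also have "\<dots> = ennreal C * tnorm j U" by (simp add: tnorm_def)
  also have "\<dots> \<le> ennreal C * ennreal c" by (intro mult_left_mono bounded_seriesD[OF U]) auto
  also have "\<dots> = ennreal (C * c)" using \<open>C \<ge> 0\<close> bounded_seriesD(1)[OF U] by (simp add: ennreal_mult)
  finally show ?thesis using V \<open>C \<ge> 0\<close> bounded_seriesD(1)[OF U] by (simp add: bounded_series_def)
qed

lemma bounded_series_cmult:
  assumes "bounded_series j U c"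
  shows "bounded_series j (\<lambda>x. fps_const r * U x) (\<bar>r\<bar> * c)"
  by (rule bounded_series_multiplier[OF assms])
     (auto simp: fourier_cmult norm_mult mult.assoc intro!: periodic_continuous_intros bounded_seriesD[OF assms])

lemma bounded_series_uminus:
  assumes "bounded_series j U c"
  shows "bounded_series j (\<lambda>x. - U x) c"
  using bounded_series_multiplier[OF assms, of "\<lambda>x. - U x" 1 j]
  by (auto simp: fourier_uminus intro!: periodic_continuous_intros bounded_seriesD[OF assms])

lemma bounded_series_diff:
  assumes "bounded_series j U c" "bounded_series j V d"
  shows "bounded_series j (\<lambda>x. U x - V x) (c + d)"
  using bounded_series_add[OF assms(1) bounded_series_uminus[OF assms(2)]] by simp

lemma bounded_series_const:
  "bounded_series j (\<lambda>x. fps_const r) \<bar>r\<bar>"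
proof -
  have "fsum (jweight j n) (coeff (\<lambda>x. fps_const r) n) \<le> (if n = 0 then ennreal \<bar>r\<bar> else 0)" for n
  proof -
    have w: "jweight j 0 0 \<le> 1"
      using weight_0[of 0] by (simp add: jweight_def)
    have "fsum (jweight j n) (coeff (\<lambda>x. fps_const r) n) =
       (\<integral>\<^sup>+(k::int^3). (if n = 0 then ennreal \<bar>r\<bar> * jweight j 0 0 else 0) * indicator {0} k \<partial>count_space UNIV)"
      unfolding fsum_def coeff_const by (intro nn_integral_cong) (auto simp: fourier_const indicator_def)
    also have "\<dots> = (if n = 0 then ennreal \<bar>r\<bar> * jweight j 0 0 else 0)"
      by (subst nn_integral_cmult_indicator) auto
    also have "\<dots> \<le> (if n = 0 then ennreal \<bar>r\<bar> else 0)"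
      using mult_left_mono[OF w, of "ennreal \<bar>r\<bar>"] by auto
    finally show ?thesis .
  qed
  then have "tnorm j (\<lambda>x. fps_const r) \<le> (\<Sum>n. if n = 0 then ennreal \<bar>r\<bar> else 0)"
    unfolding tnorm_def by (intro suminf_le) auto
  also have "\<dots> = ennreal \<bar>r\<bar>" by (subst ennreal_suminf_split_head) simp
  finally show ?thesis
    by (simp add: bounded_series_def coeff_const periodic_continuous_intros)
qed

lemma bounded_series_sum:
  assumes "\<And>i. i \<in> I \<Longrightarrow> bounded_series j (U i) (c i)"
  shows "bounded_series j (\<lambda>x. \<Sum>i\<in>I. U i x) (\<Sum>i\<in>I. c i)"
  using assms
proof (induction I rule: infinite_finite_induct)
  case (insert i I)
  then show ?case using bounded_series_add[of j "U i" "c i" "\<lambda>x. \<Sum>i\<in>I. U i x"] by simp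
qed (use bounded_series_const[of j 0] in auto)

text \<open>Cauchy product in time and convolution in space, both compatible with the joint
  submultiplicativity of the weights in order and mode.\<close>

lemma bounded_series_mult:
  assumes "bounded_series j U c" "bounded_series j V d"
  shows "bounded_series j (\<lambda>x. U x * V x) (c * d)"
proof -
  note U = bounded_seriesD[OF assms(1)] and V = bounded_seriesD[OF assms(2)]
  let ?f = "\<lambda>n. fsum (jweight j n) (coeff U n)" and ?g = "\<lambda>n. fsum (jweight j n) (coeff V n)"
  have "fsum (jweight j n) (coeff (\<lambda>x. U x * V x) n) \<le> (\<Sum>i\<le>n. ?f i * ?g (n - i))" for n
  proof -
    have "fsum (jweight j n) (coeff (\<lambda>x. U x * V x) n) \<le> (\<Sum>i\<le>n. fsum (jweight j n) (\<lambda>x. coeff U i x * coeff V (n - i) x))"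
      unfolding coeff_mult by (rule fsum_sum) (intro continuous_intros U V)
    also have "\<dots> \<le> (\<Sum>i\<le>n. ?f i * ?g (n - i))"
    proof (rule sum_mono)
      fix i assume "i \<in> {..n}"
      then show "fsum (jweight j n) (\<lambda>x. coeff U i x * coeff V (n - i) x) \<le> ?f i * ?g (n - i)"
        using jweight_submult[of j i "n - i"]
        by (intro fsum_mult U V bounded_series_summable[OF assms(1)]) auto
    qed
    finally show ?thesis .
  qed
  then have "tnorm j (\<lambda>x. U x * V x) \<le> (\<Sum>n. \<Sum>i\<le>n. ?f i * ?g (n - i))"
    unfolding tnorm_def by (intro suminf_le) auto
  also have "\<dots> \<le> tnorm j U * tnorm j V"
    unfolding tnorm_def by (rule ennreal_Cauchy_product_le)
  also have "\<dots> \<le> ennreal c * ennreal d" by (intro mult_mono U V) auto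
  also have "\<dots> = ennreal (c * d)" using U(1) V(1) by (simp add: ennreal_mult)
  finally show ?thesis
    using U(1,2) V(1,2) by (auto simp: bounded_series_def coeff_mult intro!: periodic_continuous_intros periodic_continuous_sum)
qed

lemma bounded_series_deriv:
  assumes U: "bounded_series j U c"
  shows "periodic_continuous (pderiv_x i (coeff U n))" "coeff U n differentiable (at x)"
    "fourier (pderiv_x i (coeff U n)) k = deriv_symbol i k * fourier (coeff U n) k"
  using pderiv_fourier[OF bounded_seriesD(2)[OF U] bounded_series_summable(2)[OF U]] by auto

lemma bounded_series_pderiv:
  assumes "bounded_series 1 U c"
  shows "bounded_series 0 (lift_op (pderiv_x i) U) (2 * pi * c)"
proof (rule bounded_series_multiplier[OF assms])
  fix n k
  have "cmod (deriv_symbol i k) \<le> 2 * pi * (1 + norm (int_vec k))"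
    using deriv_symbol_bound[of i k] by (simp add: distrib_left add_increasing)
  then show "cmod (fourier (coeff (lift_op (pderiv_x i) U) n) k) * (1 + norm (int_vec k)) ^ 0
     \<le> 2 * pi * (cmod (fourier (coeff U n) k) * (1 + norm (int_vec k)) ^ 1)"
    using mult_right_mono[of "cmod (deriv_symbol i k)" "2 * pi * (1 + norm (int_vec k))" "cmod (fourier (coeff U n) k)"]
    by (simp add: bounded_series_deriv[OF assms] norm_mult algebra_simps)
qed (auto simp: bounded_series_deriv[OF assms])

text \<open>Order \<open>n + 1\<close> of the integral is order \<open>n\<close> of \<open>F\<close>
  divided by \<open>n + 1\<close>, so \<open>weight_Suc\<close> applies term by term; order zero is
  the initial value and is counted by \<open>d\<close>.\<close>

lemma bounded_series_integral:
  assumes F: "bounded_series 0 F c" and u: "periodic_continuous u" "fsum (jweight 1 0) u \<le> ennreal d" "d \<ge> 0"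
  shows "bounded_series 1 (\<lambda>x. fps_integral (F x) (u x)) (d + gain * c)"
proof -
  let ?V = "\<lambda>x. fps_integral (F x) (u x)"
  have "fsum (jweight 1 (Suc n)) (coeff ?V (Suc n)) \<le> ennreal gain * fsum (jweight 0 n) (coeff F n)" for n
    unfolding coeff_integral_Suc
  proof (rule fsum_le_multiplier)
    fix k
    have "ennreal (cmod (fourier (\<lambda>x. inverse (real (Suc n)) * coeff F n x) k)) * jweight 1 (Suc n) k =
        ennreal (cmod (fourier (coeff F n) k)) * (ennreal ((1 + norm (int_vec k)) / real (Suc n)) * weight (Suc n) k)"
    proof -
      have "ennreal (cmod (fourier (\<lambda>x. inverse (real (Suc n)) * coeff F n x) k)) =
          ennreal (inverse (real (Suc n))) * ennreal (cmod (fourier (coeff F n) k))"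
        unfolding fourier_cmult norm_mult by (simp add: ennreal_mult norm_inverse del: of_nat_Suc)
      moreover have "ennreal ((1 + norm (int_vec k)) / real (Suc n)) =
          ennreal (inverse (real (Suc n))) * ennreal (1 + norm (int_vec k))"
        by (simp add: divide_inverse mult.commute del: of_nat_Suc ennreal_plus flip: ennreal_mult)
      ultimately show ?thesis
        by (simp add: jweight_def mult_ac del: of_nat_Suc ennreal_plus)
    qed
    also have "\<dots> \<le> ennreal (cmod (fourier (coeff F n) k)) * (ennreal gain * weight n k)"
      by (intro mult_left_mono weight_Suc) auto
    finally show "ennreal (cmod (fourier (\<lambda>x. inverse (real (Suc n)) * coeff F n x) k)) * jweight 1 (Suc n) k
       \<le> ennreal gain * (ennreal (cmod (fourier (coeff F n) k)) * jweight 0 n k)"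
      by (simp add: jweight_def mult_ac)
  qed
  then have "(\<Sum>n. fsum (jweight 1 (Suc n)) (coeff ?V (Suc n))) \<le> (\<Sum>n. ennreal gain * fsum (jweight 0 n) (coeff F n))"
    by (intro suminf_le) auto
  also have "\<dots> = ennreal gain * tnorm 0 F" by (simp add: tnorm_def)
  also have "\<dots> \<le> ennreal gain * ennreal c" by (intro mult_left_mono bounded_seriesD[OF F]) auto
  finally have "tnorm 1 ?V \<le> ennreal d + ennreal gain * ennreal c"
    unfolding tnorm_def using u(2) by (subst ennreal_suminf_split_head) (auto intro!: add_mono)
  also have "\<dots> = ennreal (d + gain * c)"
    using gain_pos bounded_seriesD(1)[OF F] u(3) by (simp add: ennreal_plus ennreal_mult)
  finally have "tnorm 1 ?V \<le> ennreal (d + gain * c)" .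
  moreover have "periodic_continuous (coeff ?V n)" for n
    by (cases n) (auto simp: u coeff_integral_Suc intro!: periodic_continuous_intros bounded_seriesD[OF F] simp del: of_nat_Suc)
  ultimately show ?thesis
    using gain_pos bounded_seriesD(1)[OF F] u(3) by (simp add: bounded_series_def)
qed

lemma bounded_series_fsum_1:
  assumes "bounded_series j U c"
  shows "fsum (\<lambda>_. 1) (coeff U n) * ennreal (R ^ n) \<le> fsum (jweight j n) (coeff U n)"
    "fsum (\<lambda>_. 1) (coeff U n) \<le> ennreal (c / R ^ n)"
proof -
  show 1: "fsum (\<lambda>_. 1) (coeff U n) * ennreal (R ^ n) \<le> fsum (jweight j n) (coeff U n)"
    using fsum_mono[of "\<lambda>_. ennreal (R ^ n) * 1" "jweight j n" "coeff U n"] jweight_lower_1[of n j]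
    unfolding fsum_cmult by (simp add: mult.commute)
  have "fsum (\<lambda>_. 1) (coeff U n) = fsum (\<lambda>_. 1) (coeff U n) * ennreal (R ^ n) * ennreal (inverse (R ^ n))"
    using R_pos by (simp add: mult.assoc flip: ennreal_mult)
  also have "\<dots> \<le> ennreal c * ennreal (inverse (R ^ n))"
    using 1 bounded_seriesD(5)[OF assms, of n] by (intro mult_right_mono) auto
  also have "\<dots> = ennreal (c / R ^ n)"
    using R_pos bounded_seriesD(1)[OF assms] by (simp add: divide_inverse flip: ennreal_mult)
  finally show "fsum (\<lambda>_. 1) (coeff U n) \<le> ennreal (c / R ^ n)" .
qed

lemma bounded_series_average:
  assumes M: "prob_space M" and meas: "\<And>n x. (\<lambda>\<theta>. coeff (U \<theta>) n x) \<in> borel_measurable M"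
    and U: "\<And>\<theta>. \<theta> \<in> space M \<Longrightarrow> bounded_series j (U \<theta>) c" and c: "c \<ge> 0"
  shows "bounded_series j (average M U) c"
    "fourier (coeff (average M U) n) k = (\<integral>\<theta>. fourier (coeff (U \<theta>) n) k \<partial>M)"
proof -
  interpret prob_space M by fact
  have pos: "c / R ^ n \<ge> 0" for n using R_pos c by simp
  note fa = fourier_average[OF M meas bounded_seriesD(2)[OF U] bounded_series_fsum_1(2)[OF U] pos]
  have coe: "coeff (average M U) n = (\<lambda>x. \<integral>\<theta>. coeff (U \<theta>) n x \<partial>M)" for n
    by (auto simp: average_def coeff_def)
  show "fourier (coeff (average M U) n) k = (\<integral>\<theta>. fourier (coeff (U \<theta>) n) k \<partial>M)"
    unfolding coe by (rule fa(2))
  have "tnorm j (average M U) \<le> (\<Sum>n. \<integral>\<^sup>+\<theta>. fsum (jweight j n) (coeff (U \<theta>) n) \<partial>M)"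
    unfolding tnorm_def coe by (intro suminf_le fa(3)) auto
  also have "\<dots> = (\<integral>\<^sup>+\<theta>. tnorm j (U \<theta>) \<partial>M)"
    unfolding tnorm_def
    by (rule nn_integral_suminf[symmetric]) (intro measurable_fsum meas bounded_seriesD(3)[OF U])
  also have "\<dots> \<le> (\<integral>\<^sup>+\<theta>. ennreal c \<partial>M)"
    by (intro nn_integral_mono bounded_seriesD(4)[OF U])
  also have "\<dots> = ennreal c" by (simp add: emeasure_space_1)
  finally show "bounded_series j (average M U) c"
    using c fa(1) by (simp add: bounded_series_def coe)
qed

end

subsection \<open>Formal solutions\<close>

text \<open>Order \<open>n\<close> of the right-hand side sees only orders up to \<open>n\<close> of
  the unknowns. Integration shifts orders by one, so the integral equation becomes an explicit
  recursion for the time coefficients.\<close>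

definition causal :: "(('s \<Rightarrow> real ^ 3 \<Rightarrow> real fps) \<Rightarrow> 's \<Rightarrow> real ^ 3 \<Rightarrow> real fps) \<Rightarrow> bool" where
  "causal F \<longleftrightarrow> (\<forall>U V n. (\<forall>m\<le>n. \<forall>s. coeff (U s) m = coeff (V s) m) \<longrightarrow> (\<forall>s. coeff (F U s) n = coeff (F V s) n))"

primrec picard :: "(('s \<Rightarrow> real ^ 3 \<Rightarrow> real fps) \<Rightarrow> 's \<Rightarrow> real ^ 3 \<Rightarrow> real fps) \<Rightarrow> ('s \<Rightarrow> real ^ 3 \<Rightarrow> real) \<Rightarrow>
    nat \<Rightarrow> 's \<Rightarrow> real ^ 3 \<Rightarrow> real fps" where
  "picard F u 0 = (\<lambda>s x. fps_integral 0 (u s x))"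
| "picard F u (Suc m) = (\<lambda>s x. fps_integral (F (picard F u m) s x) (u s x))"

text \<open>Diagonal sequence: iterate number \<open>n\<close> already has its final coefficient of
  order \<open>n\<close>.\<close>

definition formal_solution where
  "formal_solution F u s x = Abs_fps (\<lambda>n. coeff (picard F u n s) n x)"

lemma picard_stable_Suc:
  assumes F: "causal F"
  shows "n \<le> m \<Longrightarrow> coeff (picard F u (Suc m) s) n = coeff (picard F u m s) n"
proof (induction m arbitrary: n s)
  case 0
  then show ?case by simp
next
  case (Suc m)
  show ?case
  proof (cases n)
    case (Suc n')
    have "coeff (F (picard F u (Suc m)) s) n' = coeff (F (picard F u m) s) n'"
      using F Suc.IH Suc.prems Suc unfolding causal_def by (meson Suc_le_mono order_trans)
    then show ?thesis unfolding Suc by (simp only: picard.simps coeff_integral_Suc)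
  qed simp
qed

lemma picard_stable:
  assumes F: "causal F" and "n \<le> m"
  shows "coeff (picard F u m s) n = coeff (formal_solution F u s) n"
proof -
  have "coeff (picard F u m s) n = coeff (picard F u n s) n"
    using \<open>n \<le> m\<close> by (induction m rule: dec_induct) (simp_all add: picard_stable_Suc[OF F] del: picard.simps)
  then show ?thesis by (auto simp: formal_solution_def coeff_def)
qed

lemma coeff_eqI: "(\<And>n. coeff U n = coeff V n) \<Longrightarrow> U = V"
  by (auto simp: coeff_def fun_eq_iff fps_eq_iff)

theorem formal_solution:
  assumes F: "causal F"
  shows "formal_solution F u s = (\<lambda>x. fps_integral (F (formal_solution F u) s x) (u s x))"
proof (rule coeff_eqI)
  fix n
  show "coeff (formal_solution F u s) n = coeff (\<lambda>x. fps_integral (F (formal_solution F u) s x) (u s x)) n"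
  proof (cases n)
    case 0
    then show ?thesis by (simp add: formal_solution_def coeff_def)
  next
    case (Suc n')
    have "coeff (F (picard F u n') s) n' = coeff (F (formal_solution F u) s) n'"
      using F picard_stable[OF F] unfolding causal_def by blast
    then show ?thesis
      unfolding Suc coeff_integral_Suc picard_stable[OF F order_refl, symmetric] by (simp add: coeff_integral_Suc)
  qed
qed

text \<open>Any finite part of the norm agrees with the same part of the norm of a sufficiently late
  iterate, so a common bound for the iterates passes to the limit.\<close>

lemma (in time_weight) bounded_series_formal_solution:
  assumes F: "causal F" and b: "\<And>m. bounded_series j (picard F u m s) c"
  shows "bounded_series j (formal_solution F u s) c"
proof -
  have "tnorm j (formal_solution F u s) \<le> ennreal c"
    unfolding tnorm_def
  proof (rule suminf_le_const)
    fix N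
    have "(\<Sum>n<N. fsum (jweight j n) (coeff (formal_solution F u s) n)) = (\<Sum>n<N. fsum (jweight j n) (coeff (picard F u N s) n))"
      by (intro sum.cong refl) (simp add: picard_stable[OF F])
    also have "\<dots> \<le> tnorm j (picard F u N s)" unfolding tnorm_def by (intro sum_le_suminf) auto
    also have "\<dots> \<le> ennreal c" by (rule bounded_seriesD[OF b])
    finally show "(\<Sum>n<N. fsum (jweight j n) (coeff (formal_solution F u s) n)) \<le> ennreal c" .
  qed auto
  moreover have "periodic_continuous (coeff (formal_solution F u s) n)" for n
    using bounded_seriesD(2)[OF b[of n], of n] by (simp add: picard_stable[OF F])
  ultimately show ?thesis using bounded_seriesD(1)[OF b[of 0]] by (simp add: bounded_series_def)
qed

subsection \<open>Evaluation of time series\<close>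

definition exp_weight :: "real \<Rightarrow> int ^ 3 \<Rightarrow> ennreal" where
  "exp_weight s k = ennreal (exp (s * norm (int_vec k)))"

text \<open>Decay rate \<open>s\<close> in \<open>|k|\<close> and radius \<open>r\<close> in time as
  separate parameters. In contrast to the weights above, each can be lowered on its own, which pays
  for derivatives in space or in time of any order.\<close>

definition decay :: "real \<Rightarrow> real \<Rightarrow> (real ^ 3 \<Rightarrow> real fps) \<Rightarrow> bool" where
  "decay s r U \<longleftrightarrow> s > 0 \<and> r > 0 \<and> (\<forall>n. periodic_continuous (coeff U n)) \<and>
     (\<exists>\<alpha>. (\<forall>n. \<alpha> n \<ge> 0 \<and> fsum (exp_weight s) (coeff U n) \<le> ennreal (\<alpha> n)) \<and> summable (\<lambda>n. \<alpha> n * r ^ n))"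

lemma (in time_weight) bounded_series_imp_decay:
  assumes "bounded_series j U c"
  shows "decay (a - b * R) R U"
proof -
  let ?v = "\<lambda>n. fsum (jweight j n) (coeff U n)"
  define \<alpha> where "\<alpha> n = enn2real (?v n) / R ^ n" for n
  have fin: "ennreal (enn2real (?v n)) = ?v n" for n
    using bounded_seriesD(5)[OF assms, of n] by (intro ennreal_enn2real) (simp add: le_less_trans)
  have "(\<Sum>n. ennreal (enn2real (?v n))) \<noteq> top"
    using bounded_seriesD(4)[OF assms] by (auto simp: fin tnorm_def[symmetric] top_unique)
  then have "summable (\<lambda>n. enn2real (?v n))" by (rule summable_suminf_not_top[rotated]) simp
  then have s: "summable (\<lambda>n. \<alpha> n * R ^ n)" using R_pos by (simp add: \<alpha>_def)
  have le: "fsum (exp_weight (a - b * R)) (coeff U n) \<le> ennreal (\<alpha> n)" for n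
  proof -
    have "fsum (exp_weight (a - b * R)) (coeff U n) = ennreal (inverse (R ^ n)) * fsum (\<lambda>k. ennreal (R ^ n) * exp_weight (a - b * R) k) (coeff U n)"
      using R_pos by (simp add: fsum_cmult mult.assoc[symmetric] flip: ennreal_mult)
    also have "\<dots> \<le> ennreal (inverse (R ^ n)) * ?v n"
      using R_pos jweight_lower by (intro mult_left_mono fsum_mono) (auto simp: exp_weight_def ennreal_mult[symmetric])
    also have "\<dots> = ennreal (\<alpha> n)"
      using R_pos by (subst fin[symmetric]) (simp add: \<alpha>_def divide_inverse mult.commute flip: ennreal_mult)
    finally show ?thesis .
  qed
  have "\<alpha> n \<ge> 0" for n using R_pos by (simp add: \<alpha>_def)
  then show ?thesis
    using R_pos bR bounded_seriesD(2)[OF assms] s le unfolding decay_def by auto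
qed

lemma decayE:
  assumes "decay s r U"
  obtains \<alpha> where "\<And>n. \<alpha> n \<ge> 0" "\<And>n. fsum (exp_weight s) (coeff U n) \<le> ennreal (\<alpha> n)"
    "summable (\<lambda>n. \<alpha> n * r ^ n)" "\<And>n x. \<bar>coeff U n x\<bar> \<le> \<alpha> n"
    "\<And>n. (\<lambda>k. cmod (fourier (coeff U n) k)) summable_on UNIV"
proof -
  obtain \<alpha> where \<alpha>: "\<And>n. \<alpha> n \<ge> 0" "\<And>n. fsum (exp_weight s) (coeff U n) \<le> ennreal (\<alpha> n)"
    "summable (\<lambda>n. \<alpha> n * r ^ n)" and pc: "\<And>n. periodic_continuous (coeff U n)" and "s > 0"
    using assms unfolding decay_def by blast
  have one: "1 \<le> exp_weight s k" for k
    using \<open>s > 0\<close> ennreal_leI[of 1 "exp (s * norm (int_vec k))"] by (simp add: exp_weight_def)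
  have sm: "(\<lambda>k. cmod (fourier (coeff U n) k)) summable_on UNIV" for n
    using fsum_summable[of "exp_weight s" "coeff U n" "\<lambda>_. 1"] one by (simp add: le_less_trans[OF \<alpha>(2)])
  have "ennreal \<bar>coeff U n x\<bar> \<le> ennreal (\<alpha> n)" for n x
    using abs_le_fsum[OF pc sm, of n x] fsum_mono[of "\<lambda>_. 1" "exp_weight s" "coeff U n"] one \<alpha>(2)[of n]
    by (meson order_trans)
  then have "\<bar>coeff U n x\<bar> \<le> \<alpha> n" for n x using \<alpha>(1) by (simp add: ennreal_le_iff)
  then show ?thesis using that \<alpha> sm by blast
qed

lemma decayD: "decay s r U \<Longrightarrow> periodic_continuous (coeff U n)" "decay s r U \<Longrightarrow> s > 0" "decay s r U \<Longrightarrow> r > 0"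
  by (auto simp: decay_def)

text \<open>The general sequence \<beta> unites evaluation at a time, differences of evaluations at
  two times, and the plain sum used for the binomial series.\<close>

definition series_comb :: "(real ^ 3 \<Rightarrow> real fps) \<Rightarrow> (nat \<Rightarrow> real) \<Rightarrow> real ^ 3 \<Rightarrow> real" where
  "series_comb U \<beta> x = (\<Sum>n. coeff U n x * \<beta> n)"

lemma continuous_on_suminf_M_test:
  fixes f :: "nat \<Rightarrow> 'a::topological_space \<Rightarrow> 'b::banach"
  assumes "\<And>n. continuous_on S (f n)" "\<And>n x. x \<in> S \<Longrightarrow> norm (f n x) \<le> m n" "summable m"
  shows "continuous_on S (\<lambda>x. \<Sum>n. f n x)"
proof (rule uniform_limit_theorem)
  show "uniform_limit S (\<lambda>n x. \<Sum>i<n. f i x) (\<lambda>x. \<Sum>n. f n x) sequentially"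
    by (rule Weierstrass_m_test[OF assms(2,3)])
qed (auto intro!: always_eventually continuous_on_sum assms(1))

text \<open>The majorant \<open>C * \<alpha> n * r ^ n\<close> is uniform in \<open>x\<close>; it
  gives continuity by the M-test as well as the exchange of the sum with the Fourier
  integral.\<close>

lemma series_comb:
  assumes U: "decay s r U" and \<beta>: "\<And>n. \<bar>\<beta> n\<bar> \<le> C * r ^ n" and "C \<ge> 0"
  shows "summable (\<lambda>n. coeff U n x * \<beta> n)"
    "periodic_continuous (series_comb U \<beta>)"
    "summable (\<lambda>n. norm (fourier (coeff U n) k * of_real (\<beta> n)))"
    "fourier (series_comb U \<beta>) k = (\<Sum>n. fourier (coeff U n) k * of_real (\<beta> n))"
    "fsum \<omega> (series_comb U \<beta>) \<le> (\<Sum>n. fsum \<omega> (coeff U n) * ennreal \<bar>\<beta> n\<bar>)"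
proof -
  obtain \<alpha> where \<alpha>: "\<And>n. \<alpha> n \<ge> 0" "summable (\<lambda>n. \<alpha> n * r ^ n)" "\<And>n x. \<bar>coeff U n x\<bar> \<le> \<alpha> n"
    using decayE[OF U] by metis
  have s: "summable (\<lambda>n. C * (\<alpha> n * r ^ n))" by (intro summable_mult \<alpha>)
  have le: "norm (coeff U n x * \<beta> n) \<le> C * (\<alpha> n * r ^ n)" for n x
    using mult_mono[OF \<alpha>(3)[of n x] \<beta>[of n]] \<alpha>(1)[of n] by (simp add: abs_mult mult_ac)
  show sm: "summable (\<lambda>n. coeff U n x * \<beta> n)" for x
    by (rule summable_comparison_test'[OF s, of 0]) (use le in auto)
  have cont: "continuous_on UNIV (series_comb U \<beta>)"
    unfolding series_comb_def[abs_def]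
    by (rule continuous_on_suminf_M_test[OF _ le s]) (intro continuous_intros periodic_continuousD decayD(1)[OF U])
  show "periodic_continuous (series_comb U \<beta>)"
    using cont by (simp add: periodic_continuous_def periodic_def series_comb_def periodic_continuousD(2)[OF decayD(1)[OF U]])
  have fle: "norm (of_real (coeff U n x * \<beta> n) * char_fun (- k) x) \<le> C * (\<alpha> n * r ^ n)" for n x k
    using le[of n x] by (simp add: norm_mult)
  have fo: "torus_mean (\<lambda>x. of_real (coeff U n x * \<beta> n) * char_fun (- k) x) = fourier (coeff U n) k * of_real (\<beta> n)" for n k
    unfolding fourier_eq torus_mean_eq by (simp add: mult_ac flip: Bochner_Integration.integral_mult_right_zero)
  have pcn: "continuous_on UNIV (coeff U n)" for n by (intro periodic_continuousD decayD(1)[OF U])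
  have fb: "norm (fourier (coeff U n) k * of_real (\<beta> n)) \<le> C * (\<alpha> n * r ^ n)" for n k
    unfolding fo[symmetric] by (rule norm_torus_mean_le) (use fle in \<open>auto intro!: continuous_intros pcn\<close>)
  show sf: "summable (\<lambda>n. norm (fourier (coeff U n) k * of_real (\<beta> n)))" for k
    by (rule summable_comparison_test'[OF s, of 0]) (simp only: real_norm_def abs_norm_cancel fb)
  show F: "fourier (series_comb U \<beta>) k = (\<Sum>n. fourier (coeff U n) k * of_real (\<beta> n))" for k
  proof -
    interpret prob_space cube_measure by (rule prob_space_cube)
    have nn: "0 \<le> C * (\<alpha> n * r ^ n)" for n using le[of n 0] norm_ge_zero order_trans by blast
    have "((\<lambda>n. torus_mean (\<lambda>x. of_real (coeff U n x * \<beta> n) * char_fun (- k) x)) has_sum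
       torus_mean (\<lambda>x. \<Sum>\<^sub>\<infinity>n. of_real (coeff U n x * \<beta> n) * char_fun (- k) x)) UNIV"
      unfolding torus_mean_eq
    proof (rule integral_infsum[OF _ _ fle])
      show "finite_measure cube_measure" by unfold_locales
      show "(\<lambda>x. of_real (coeff U n x * \<beta> n) * char_fun (- k) x) \<in> borel_measurable cube_measure" for n
        by (intro measurable_cube continuous_intros pcn)
      show "(\<lambda>n. C * (\<alpha> n * r ^ n)) summable_on UNIV"
        using s nn by (simp add: summable_on_UNIV_nonneg_real_iff)
    qed
    moreover have "(\<Sum>\<^sub>\<infinity>n. of_real (coeff U n x * \<beta> n) * char_fun (- k) x) = of_real (series_comb U \<beta> x) * char_fun (- k) x" for x
    proof -
      have "summable (\<lambda>n. norm (coeff U n x * \<beta> n))"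
        by (rule summable_comparison_test'[OF s, of 0]) (use le in auto)
      then have "(\<lambda>n. coeff U n x * \<beta> n) summable_on UNIV" by (rule norm_summable_imp_summable_on)
      then have "((\<lambda>n. coeff U n x * \<beta> n) has_sum (\<Sum>\<^sub>\<infinity>n. coeff U n x * \<beta> n)) UNIV" by (rule has_sum_infsum)
      moreover from this have "(\<Sum>\<^sub>\<infinity>n. coeff U n x * \<beta> n) = series_comb U \<beta> x"
        unfolding series_comb_def by (intro sums_unique has_sum_imp_sums)
      ultimately have "((\<lambda>n. of_real (coeff U n x * \<beta> n) * char_fun (- k) x) has_sum of_real (series_comb U \<beta> x) * char_fun (- k) x) UNIV"
        by (intro has_sum_cmult_left has_sum_of_real) simp
      then show ?thesis by (rule infsumI)
    qed
    ultimately have "((\<lambda>n. fourier (coeff U n) k * of_real (\<beta> n)) has_sum fourier (series_comb U \<beta>) k) UNIV"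
      unfolding fo by (simp add: fourier_eq torus_mean_eq mult_ac)
    then show ?thesis by (intro sums_unique has_sum_imp_sums)
  qed
  have "fsum \<omega> (series_comb U \<beta>) \<le> (\<integral>\<^sup>+k. (\<Sum>n. (ennreal (cmod (fourier (coeff U n) k)) * \<omega> k) * ennreal \<bar>\<beta> n\<bar>) \<partial>count_space UNIV)"
    unfolding fsum_def
  proof (rule nn_integral_mono)
    fix k
    have "ennreal (cmod (fourier (series_comb U \<beta>) k)) \<le> ennreal (\<Sum>n. norm (fourier (coeff U n) k * of_real (\<beta> n)))"
      unfolding F by (intro ennreal_leI summable_norm sf)
    also have "\<dots> = (\<Sum>n. ennreal (norm (fourier (coeff U n) k * of_real (\<beta> n))))"
      by (rule suminf_ennreal2[symmetric]) (auto intro: sf)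
    finally have "ennreal (cmod (fourier (series_comb U \<beta>) k)) * \<omega> k \<le> (\<Sum>n. ennreal (norm (fourier (coeff U n) k * of_real (\<beta> n)))) * \<omega> k"
      by (rule mult_right_mono) simp
    then show "ennreal (cmod (fourier (series_comb U \<beta>) k)) * \<omega> k \<le> (\<Sum>n. (ennreal (cmod (fourier (coeff U n) k)) * \<omega> k) * ennreal \<bar>\<beta> n\<bar>)"
      by (simp add: norm_mult ennreal_mult mult_ac)
  qed
  also have "\<dots> = (\<Sum>n. fsum \<omega> (coeff U n) * ennreal \<bar>\<beta> n\<bar>)"
    unfolding fsum_def by (subst nn_integral_suminf) (simp_all add: nn_integral_multc)
  finally show "fsum \<omega> (series_comb U \<beta>) \<le> (\<Sum>n. fsum \<omega> (coeff U n) * ennreal \<bar>\<beta> n\<bar>)" .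
qed

definition ev :: "(real ^ 3 \<Rightarrow> real fps) \<Rightarrow> real \<Rightarrow> real ^ 3 \<Rightarrow> real" where
  "ev U t x = eval_fps (U x) t"

lemma ev_conv_series_comb: "ev U t = series_comb U (\<lambda>n. t ^ n)"
  by (auto simp: ev_def eval_fps_def series_comb_def coeff_def)

lemma power_bound: "t \<in> {0..T} \<Longrightarrow> T \<le> r \<Longrightarrow> \<bar>t ^ n\<bar> \<le> 1 * r ^ n" for t r :: real
  by (auto simp: power_mono)

lemma ev_facts:
  assumes U: "decay s r U" and "t \<in> {0..T}" "T \<le> r"
  shows "periodic_continuous (ev U t)"
    "summable (\<lambda>n. norm (fourier (coeff U n) k * of_real t ^ n))"
    "fourier (ev U t) k = (\<Sum>n. fourier (coeff U n) k * of_real t ^ n)"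
    "fsum \<omega> (ev U t) \<le> (\<Sum>n. fsum \<omega> (coeff U n) * ennreal (t ^ n))"
  using series_comb(2-5)[OF U power_bound[OF assms(2,3)]] assms(2)
  unfolding ev_conv_series_comb by auto

lemma fsum_exp_weight_summable:
  assumes "s > 0" "fsum (exp_weight s) f < \<infinity>"
  shows "(\<lambda>k. cmod (fourier f k) * (1 + norm (int_vec k)) ^ m) summable_on UNIV"
    "(\<lambda>k. cmod (fourier f k)) summable_on UNIV"
proof -
  show *: "(\<lambda>k. cmod (fourier f k) * (1 + norm (int_vec k)) ^ m) summable_on UNIV" for m
  proof -
    obtain K where K: "K > 0" "\<And>x. x \<ge> 0 \<Longrightarrow> (1 + x) ^ m \<le> K * exp (s * x)"
      using exp_dominates_power[OF \<open>s > 0\<close>, of m] by metis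
    have "fsum (\<lambda>k. ennreal K * exp_weight s k) f < \<infinity>"
      using assms(2) by (simp add: fsum_cmult ennreal_mult_less_top)
    then show ?thesis
      by (rule fsum_summable) (use K in \<open>auto simp: exp_weight_def ennreal_mult[symmetric] intro!: ennreal_leI\<close>)
  qed
  show "(\<lambda>k. cmod (fourier f k)) summable_on UNIV" using *[of 0] by simp
qed

lemma decay_deriv:
  assumes U: "decay s r U"
  shows "coeff U n differentiable (at x)" "periodic_continuous (pderiv_x i (coeff U n))"
    "fourier (pderiv_x i (coeff U n)) k = deriv_symbol i k * fourier (coeff U n) k"
proof -
  obtain \<alpha> where \<alpha>: "fsum (exp_weight s) (coeff U n) \<le> ennreal (\<alpha> n)"
    using decayE[OF U] by metis
  have "fsum (exp_weight s) (coeff U n) < \<infinity>" by (simp add: le_less_trans[OF \<alpha>])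
  note pderiv_fourier[OF decayD(1)[OF U] fsum_exp_weight_summable(1)[OF decayD(2)[OF U] this]]
  then show "coeff U n differentiable (at x)" "periodic_continuous (pderiv_x i (coeff U n))"
    "fourier (pderiv_x i (coeff U n)) k = deriv_symbol i k * fourier (coeff U n) k" by auto
qed

lemma decay_multiplier:
  assumes U: "decay s r U" and V: "\<And>n. periodic_continuous (coeff V n)" and s': "0 < s'" and "K \<ge> 0"
    and le: "\<And>n k. cmod (fourier (coeff V n) k) * exp (s' * norm (int_vec k)) \<le> K * (cmod (fourier (coeff U n) k) * exp (s * norm (int_vec k)))"
  shows "decay s' r V"
proof -
  obtain \<alpha> where \<alpha>: "\<And>n. \<alpha> n \<ge> 0" "\<And>n. fsum (exp_weight s) (coeff U n) \<le> ennreal (\<alpha> n)" "summable (\<lambda>n. \<alpha> n * r ^ n)"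
    using decayE[OF U] by metis
  have "fsum (exp_weight s') (coeff V n) \<le> ennreal K * fsum (exp_weight s) (coeff U n)" for n
    using le \<open>K \<ge> 0\<close>
    by (intro fsum_le_multiplier) (simp add: exp_weight_def ennreal_mult[symmetric] ennreal_leI)
  also have "ennreal K * fsum (exp_weight s) (coeff U n) \<le> ennreal K * ennreal (\<alpha> n)" for n
    by (intro mult_left_mono \<alpha>) auto
  also have "ennreal K * ennreal (\<alpha> n) = ennreal (K * \<alpha> n)" for n
    using \<open>K \<ge> 0\<close> \<alpha>(1) by (simp add: ennreal_mult)
  finally have "fsum (exp_weight s') (coeff V n) \<le> ennreal (K * \<alpha> n)" for n .
  moreover have "summable (\<lambda>n. K * \<alpha> n * r ^ n)"
    using summable_mult[OF \<alpha>(3), of K] by (simp add: mult.assoc)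
  ultimately show ?thesis
    using V s' \<open>K \<ge> 0\<close> \<alpha>(1) decayD(3)[OF U] unfolding decay_def by (auto intro!: exI[of _ "\<lambda>n. K * \<alpha> n"])
qed

text \<open>The factor \<open>|k|\<close> is absorbed by the quotient of the exponentials with rates
  \<open>s\<close> and \<open>s'\<close>.\<close>

lemma decay_pderiv:
  assumes U: "decay s r U" and s': "0 < s'" "s' < s"
  shows "decay s' r (lift_op (pderiv_x i) U)"
proof -
  obtain K where K: "K > 0" "\<And>x. x \<ge> 0 \<Longrightarrow> (1 + x) ^ 1 \<le> K * exp ((s - s') * x)"
    using exp_dominates_power[of "s - s'" 1] s' by (metis diff_gt_0_iff_gt)
  show ?thesis
  proof (rule decay_multiplier[OF U _ s'(1), of _ "2 * pi * K"])
    fix n k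
    have "cmod (deriv_symbol i k) \<le> 2 * pi * (1 + norm (int_vec k))"
      using deriv_symbol_bound[of i k] by (simp add: distrib_left add_increasing)
    also have "\<dots> \<le> 2 * pi * (K * exp ((s - s') * norm (int_vec k)))"
      using K(2)[of "norm (int_vec k)"] by (intro mult_left_mono) auto
    finally have "cmod (deriv_symbol i k) * exp (s' * norm (int_vec k)) \<le>
       2 * pi * (K * exp ((s - s') * norm (int_vec k))) * exp (s' * norm (int_vec k))"
      by (rule mult_right_mono) simp
    also have "\<dots> = 2 * pi * K * exp (s * norm (int_vec k))"
      by (simp add: left_diff_distrib exp_diff)
    finally have "cmod (fourier (coeff U n) k) * (cmod (deriv_symbol i k) * exp (s' * norm (int_vec k))) \<le>
        cmod (fourier (coeff U n) k) * (2 * pi * K * exp (s * norm (int_vec k)))"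
      by (rule mult_left_mono) simp
    then show "cmod (fourier (coeff (lift_op (pderiv_x i) U) n) k) * exp (s' * norm (int_vec k))
       \<le> 2 * pi * K * (cmod (fourier (coeff U n) k) * exp (s * norm (int_vec k)))"
      by (simp add: decay_deriv[OF U] norm_mult mult_ac)
  qed (use K in \<open>auto simp: decay_deriv[OF U]\<close>)
qed

text \<open>The majorants are differentiated as a power series, which still converges at the smaller
  radius \<open>r'\<close>.\<close>

lemma decay_fps_deriv:
  assumes U: "decay s r U" and r': "0 < r'" "r' < r"
  shows "decay s r' (\<lambda>x. fps_deriv (U x))"
proof -
  obtain \<alpha> where \<alpha>: "\<And>n. \<alpha> n \<ge> 0" "\<And>n. fsum (exp_weight s) (coeff U n) \<le> ennreal (\<alpha> n)" "summable (\<lambda>n. \<alpha> n * r ^ n)"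
    using decayE[OF U] by metis
  have "summable (\<lambda>n. diffs \<alpha> n * r' ^ n)"
  proof (rule termdiff_converges)
    show "norm r' < r" using r' by simp
    show "summable (\<lambda>n. \<alpha> n * x ^ n)" if "norm x < r" for x
      using powser_inside[OF \<alpha>(3), of x] that r' by simp
  qed
  moreover have "fsum (exp_weight s) (coeff (\<lambda>x. fps_deriv (U x)) n) \<le> ennreal (diffs \<alpha> n)" for n
  proof -
    have "fsum (exp_weight s) (coeff (\<lambda>x. fps_deriv (U x)) n) \<le> ennreal (real (Suc n)) * fsum (exp_weight s) (coeff U (Suc n))"
      by (rule fsum_le_multiplier) (simp add: fourier_cmult norm_mult ennreal_mult mult_ac del: of_nat_Suc)
    also have "\<dots> \<le> ennreal (real (Suc n)) * ennreal (\<alpha> (Suc n))" by (intro mult_left_mono \<alpha>) auto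
    also have "\<dots> = ennreal (diffs \<alpha> n)" using \<alpha>(1) by (simp add: diffs_def ennreal_mult del: of_nat_Suc)
    finally show ?thesis .
  qed
  moreover have "diffs \<alpha> n \<ge> 0" for n using \<alpha>(1) by (simp add: diffs_def)
  ultimately show ?thesis
    using decayD[OF U] r' unfolding decay_def by (auto intro!: periodic_continuous_intros)
qed

lemma conv_radius_decay:
  assumes U: "decay s r U"
  shows "fps_conv_radius (U x) \<ge> ereal r"
proof -
  have "summable (\<lambda>n. fps_nth (U x) n * r ^ n)"
    using series_comb(1)[OF U, of "\<lambda>n. r ^ n" 1 x] decayD(3)[OF U] by (simp add: coeff_def)
  then have "conv_radius (fps_nth (U x)) \<ge> ereal (norm r)" by (rule conv_radius_geI)
  then show ?thesis using decayD(3)[OF U] by (simp add: fps_conv_radius_def)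
qed

text \<open>Hiding \<open>s\<close> and \<open>r\<close> behind a strict inequality makes the
  predicate stable under all derivatives, as each of them consumes a part of the rate or of the
  radius.\<close>

definition analytic_upto :: "real \<Rightarrow> (real ^ 3 \<Rightarrow> real fps) \<Rightarrow> bool" where
  "analytic_upto T U \<longleftrightarrow> (\<exists>s r. T < r \<and> decay s r U)"

lemma analytic_upto_conv_radius:
  assumes "analytic_upto T U" "t \<in> {0..T}"
  shows "ereal (norm t) < fps_conv_radius (U x)"
proof -
  obtain s r where "T < r" "decay s r U" using assms by (auto simp: analytic_upto_def)
  then have "ereal (norm t) < ereal r" "ereal r \<le> fps_conv_radius (U x)"
    using assms(2) by (auto intro: conv_radius_decay)
  then show ?thesis by (rule less_le_trans)
qed

lemma analytic_upto_pderiv: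
  assumes "analytic_upto T U"
  shows "analytic_upto T (lift_op (pderiv_x i) U)"
proof -
  obtain s r where r: "T < r" "decay s r U" using assms by (auto simp: analytic_upto_def)
  then have "decay (s / 2) r (lift_op (pderiv_x i) U)"
    using decayD(2)[OF r(2)] by (intro decay_pderiv[OF r(2)]) auto
  then show ?thesis using r(1) by (auto simp: analytic_upto_def)
qed

lemma analytic_upto_fps_deriv:
  assumes "T \<ge> 0" "analytic_upto T U"
  shows "analytic_upto T (\<lambda>x. fps_deriv (U x))"
proof -
  obtain s r where r: "T < r" "decay s r U" using assms by (auto simp: analytic_upto_def)
  then have "decay s ((T + r) / 2) (\<lambda>x. fps_deriv (U x))"
    using assms(1) by (intro decay_fps_deriv[OF r(2)]) auto
  moreover have "T < (T + r) / 2" using r(1) by simp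
  ultimately show ?thesis unfolding analytic_upto_def by blast
qed

text \<open>In each mode both sides are the symbol of the derivative times the sum over the orders
  in time.\<close>

lemma ev_pderiv:
  assumes U: "analytic_upto T U" and t: "t \<in> {0..T}"
  shows "ev U t differentiable (at x)" "pderiv_x i (ev U t) = ev (lift_op (pderiv_x i) U) t"
proof -
  obtain s r where r: "T < r" and dU: "decay s r U" using U by (auto simp: analytic_upto_def)
  obtain s' r' where r': "T < r'" and dV: "decay s' r' (lift_op (pderiv_x i) U)" using analytic_upto_pderiv[OF U, of i] unfolding analytic_upto_def by blast
  note U = ev_facts[OF dU t less_imp_le[OF r]] and V = ev_facts[OF dV t less_imp_le[OF r']]
  obtain \<alpha> where \<alpha>: "\<And>n. \<alpha> n \<ge> 0" "\<And>n. fsum (exp_weight s) (coeff U n) \<le> ennreal (\<alpha> n)" "summable (\<lambda>n. \<alpha> n * r ^ n)"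
    using decayE[OF dU] by metis
  have "fsum (exp_weight s) (ev U t) \<le> (\<Sum>n. fsum (exp_weight s) (coeff U n) * ennreal (t ^ n))" by (rule U)
  also have "\<dots> \<le> (\<Sum>n. ennreal (\<alpha> n * r ^ n))"
    using t r \<alpha> by (intro suminf_le) (auto simp: ennreal_mult intro!: mult_mono ennreal_leI power_mono)
  also have "\<dots> = ennreal (\<Sum>n. \<alpha> n * r ^ n)" using \<alpha> decayD(3)[OF dU] by (intro suminf_ennreal2) auto
  finally have "fsum (exp_weight s) (ev U t) < \<infinity>" by (simp add: le_less_trans)
  note P = pderiv_fourier[OF U(1) fsum_exp_weight_summable(1)[OF decayD(2)[OF dU] this]]
  show "ev U t differentiable (at x)" by (rule P)
  show "pderiv_x i (ev U t) = ev (lift_op (pderiv_x i) U) t"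
  proof (rule fourier_inject[OF P(2) V(1)])
    fix k
    show "fourier (pderiv_x i (ev U t)) k = fourier (ev (lift_op (pderiv_x i) U) t) k"
      unfolding P(3) U(3) V(3) coeff_simps decay_deriv(3)[OF dU]
      by (subst suminf_mult[symmetric]) (auto simp: mult.assoc intro!: summable_norm_cancel U(2))
  qed
qed

lemma ev_jointly_continuous:
  assumes "analytic_upto T U"
  shows "jointly_continuous T (ev U)"
proof -
  obtain s r where r: "T < r" and dU: "decay s r U" using assms by (auto simp: analytic_upto_def)
  obtain \<alpha> where \<alpha>: "\<And>n. \<alpha> n \<ge> 0" "summable (\<lambda>n. \<alpha> n * r ^ n)" "\<And>n x. \<bar>coeff U n x\<bar> \<le> \<alpha> n"
    using decayE[OF dU] by metis
  have "continuous_on ({0..T} \<times> UNIV) (\<lambda>p. \<Sum>n. coeff U n (snd p) * fst p ^ n)"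
  proof (rule continuous_on_suminf_M_test[OF _ _ \<alpha>(2)])
    show "continuous_on ({0..T} \<times> UNIV) (\<lambda>p. coeff U n (snd p) * fst p ^ n)" for n
      by (intro continuous_intros continuous_on_compose2[OF periodic_continuousD(1)[OF decayD(1)[OF dU], of UNIV]]) auto
    show "norm (coeff U n (snd p) * fst p ^ n) \<le> \<alpha> n * r ^ n" if "p \<in> {0..T} \<times> UNIV" for n p
      using that r \<alpha> by (auto simp: abs_mult intro!: mult_mono power_mono)
  qed
  then show ?thesis
    by (simp add: jointly_continuous_def ev_def eval_fps_def coeff_def case_prod_unfold)
qed

lemma ev_has_time_derivative:
  assumes "analytic_upto T U" "t \<in> {0..T}"
  shows "((\<lambda>s. ev U s x) has_vector_derivative ev (\<lambda>x. fps_deriv (U x)) t x) (at t within {0..T})"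
  unfolding ev_def has_real_derivative_iff_has_vector_derivative[symmetric]
  using analytic_upto_conv_radius[OF assms, of x] by (intro has_field_derivative_eval_fps) auto

lemma ev_pderiv_t:
  assumes "analytic_upto T U" "t \<in> {0..T}" "T > 0"
  shows "pderiv_t T (ev U) t x = ev (\<lambda>x. fps_deriv (U x)) t x"
  unfolding pderiv_t_def
  by (rule vector_derivative_within_cbox[of 0 T t, unfolded box_real, OF _ _ ev_has_time_derivative[OF assms(1,2)]])
     (use assms in auto)

lemma ev_C1_x: "analytic_upto T U \<Longrightarrow> C1_x T (ev U)"
  unfolding C1_x_def
proof (intro conjI ballI allI)
  assume U: "analytic_upto T U"
  then obtain s r where r: "T < r" and dU: "decay s r U" by (auto simp: analytic_upto_def)
  show "periodic (ev U t)" if "t \<in> {0..T}" for t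
    using ev_facts(1)[OF dU that] r by (simp add: periodic_continuous_def)
  show "ev U t differentiable_on UNIV" if "t \<in> {0..T}" for t
    using ev_pderiv(1)[OF U that] by (simp add: differentiable_on_def)
  show "jointly_continuous T (ev U)" by (rule ev_jointly_continuous[OF U])
  fix i
  have "jointly_continuous T (ev (lift_op (pderiv_x i) U))"
    by (intro ev_jointly_continuous analytic_upto_pderiv U)
  then show "jointly_continuous T (\<lambda>t. pderiv_x i (ev U t))"
    unfolding jointly_continuous_def
    by (rule continuous_on_eq) (use ev_pderiv(2)[OF U] in auto)
qed

text \<open>Derivatives of an evaluated series are identified with evaluations only for times in
  \<open>{0..T}\<close>; the regularity predicates do not look outside this interval.\<close>

lemma C1_x_cong:
  assumes "\<And>t. t \<in> {0..T} \<Longrightarrow> u t = v t"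
  shows "C1_x T u = C1_x T v"
proof -
  have "jointly_continuous T f = jointly_continuous T g" if "\<And>t. t \<in> {0..T} \<Longrightarrow> f t = g t" for f g :: "real \<Rightarrow> real^3 \<Rightarrow> 'a"
    unfolding jointly_continuous_def by (rule continuous_on_cong) (use that in auto)
  from this[of u v] this[of "\<lambda>t. pderiv_x i (u t)" "\<lambda>t. pderiv_x i (v t)" for i] show ?thesis
    unfolding C1_x_def using assms by auto
qed

lemma C1_tx_cong:
  assumes "\<And>t. t \<in> {0..T} \<Longrightarrow> u t = v t"
  shows "C1_tx T u = C1_tx T v"
proof -
  have 0: "((\<lambda>s. u s x) has_derivative d) (at t within {0..T}) \<longleftrightarrow> ((\<lambda>s. v s x) has_derivative d) (at t within {0..T})"
    if "t \<in> {0..T}" for t x d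
    using has_derivative_transform[OF that, of "\<lambda>s. u s x" "\<lambda>s. v s x" d]
      has_derivative_transform[OF that, of "\<lambda>s. v s x" "\<lambda>s. u s x" d] assms by auto
  then have 1: "(\<lambda>s. u s x) differentiable (at t within {0..T}) \<longleftrightarrow> (\<lambda>s. v s x) differentiable (at t within {0..T})" if "t \<in> {0..T}" for t x
    unfolding differentiable_def using that by blast
  have "((\<lambda>s. u s x) has_vector_derivative d) (at t within {0..T}) \<longleftrightarrow> ((\<lambda>s. v s x) has_vector_derivative d) (at t within {0..T})"
    if "t \<in> {0..T}" for t x d
    unfolding has_vector_derivative_def by (rule 0[OF that])
  then have "pderiv_t T u t x = pderiv_t T v t x" if "t \<in> {0..T}" for t x
    using that by (simp add: pderiv_t_def vector_derivative_def)
  then have "jointly_continuous T (pderiv_t T u) = jointly_continuous T (pderiv_t T v)"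
    unfolding jointly_continuous_def by (intro continuous_on_cong) auto
  with 1 C1_x_cong[OF assms] show ?thesis unfolding C1_tx_def by auto
qed

lemma ev_C1_tx: "T > 0 \<Longrightarrow> analytic_upto T U \<Longrightarrow> C1_tx T (ev U)"
  unfolding C1_tx_def
proof (intro conjI ballI allI)
  assume T: "T > 0" and U: "analytic_upto T U"
  show "C1_x T (ev U)" by (rule ev_C1_x[OF U])
  show "(\<lambda>s. ev U s x) differentiable at t within {0..T}" if "t \<in> {0..T}" for t x
    using ev_has_time_derivative[OF U that] by (rule differentiableI_vector)
  have "jointly_continuous T (ev (\<lambda>x. fps_deriv (U x)))"
    using T U by (intro ev_jointly_continuous analytic_upto_fps_deriv) auto
  then show "jointly_continuous T (pderiv_t T (ev U))"
    unfolding jointly_continuous_def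
    by (rule continuous_on_eq) (use ev_pderiv_t[OF U _ T] in auto)
qed

lemma ev_C2_x: "analytic_upto T U \<Longrightarrow> C2_x T (ev U)"
  unfolding C2_x_def
  using C1_x_cong[of T "\<lambda>t. pderiv_x i (ev U t)" "ev (lift_op (pderiv_x i) U)" for i]
  by (auto intro: ev_C1_x analytic_upto_pderiv simp: ev_pderiv(2))

subsection \<open>Vector fields\<close>

lemma vec_eq_sum_axis: "(\<chi> j. f j) = (\<Sum>j\<in>UNIV. f j *\<^sub>R axis j (1::real))" for f :: "3 \<Rightarrow> real"
  by (simp add: vec_eq_iff axis_def if_distrib sum.delta cong: if_cong)

lemma pderiv_x_vec:
  fixes f :: "3 \<Rightarrow> real ^ 3 \<Rightarrow> real"
  assumes "\<And>j. f j differentiable (at x)"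
  shows "(\<lambda>y. \<chi> j. f j y) differentiable (at x)" "pderiv_x i (\<lambda>y. \<chi> j. f j y) x = (\<chi> j. pderiv_x i (f j) x)"
proof -
  have "(f j has_derivative frechet_derivative (f j) (at x)) (at x)" for j
    using assms frechet_derivative_works by blast
  then have D: "((\<lambda>y. \<chi> j. f j y) has_derivative (\<lambda>h. \<chi> j. frechet_derivative (f j) (at x) h)) (at x)"
    unfolding vec_eq_sum_axis by (intro has_derivative_sum has_derivative_scaleR_left)
  then show "(\<lambda>y. \<chi> j. f j y) differentiable (at x)" by (auto simp: differentiable_def)
  show "pderiv_x i (\<lambda>y. \<chi> j. f j y) x = (\<chi> j. pderiv_x i (f j) x)"
    unfolding pderiv_x_def frechet_derivative_at[OF D, symmetric] ..
qed

lemma jointly_continuous_vec: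
  fixes u :: "3 \<Rightarrow> real \<Rightarrow> real ^ 3 \<Rightarrow> real"
  assumes "\<And>j. jointly_continuous T (u j)"
  shows "jointly_continuous T (\<lambda>t x. \<chi> j. u j t x)"
  using assms unfolding jointly_continuous_def case_prod_unfold by (intro continuous_on_vec_lambda) auto

lemma C1_x_vec:
  fixes u :: "3 \<Rightarrow> real \<Rightarrow> real ^ 3 \<Rightarrow> real"
  assumes "\<And>j. C1_x T (u j)"
  shows "C1_x T (\<lambda>t x. \<chi> j. u j t x)"
proof -
  have d: "u j t differentiable (at x)" if "t \<in> {0..T}" for j t x
    using assms[of j] that unfolding C1_x_def differentiable_on_def by auto
  have "jointly_continuous T (\<lambda>t x. \<chi> j. pderiv_x i (u j t) x)" for i
    by (intro jointly_continuous_vec) (use assms in \<open>auto simp: C1_x_def\<close>)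
  then have "jointly_continuous T (\<lambda>t. pderiv_x i (\<lambda>x. \<chi> j. u j t x))" for i
    unfolding jointly_continuous_def by (rule continuous_on_eq) (use pderiv_x_vec(2)[OF d] in auto)
  moreover have "jointly_continuous T (\<lambda>t x. \<chi> j. u j t x)"
    by (intro jointly_continuous_vec) (use assms in \<open>auto simp: C1_x_def\<close>)
  ultimately show ?thesis
    using assms pderiv_x_vec(1)[OF d] by (auto simp: C1_x_def differentiable_on_def periodic_def)
qed

lemma has_vector_derivative_vec:
  fixes u :: "3 \<Rightarrow> real \<Rightarrow> real"
  assumes "\<And>j. (u j has_vector_derivative d j) (at t within S)"
  shows "((\<lambda>s. \<chi> j. u j s) has_vector_derivative (\<chi> j. d j)) (at t within S)"
  unfolding vec_eq_sum_axis
  by (intro has_vector_derivative_sum has_vector_derivative_scaleR[where g = "\<lambda>_. axis j 1" for j, THEN has_vector_derivative_eq_rhs])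
    (use assms in \<open>auto simp: has_real_derivative_iff_has_vector_derivative intro: has_vector_derivative_const\<close>)

lemma ev_vec_pderiv_t:
  fixes U :: "3 \<Rightarrow> real ^ 3 \<Rightarrow> real fps"
  assumes "\<And>j. analytic_upto T (U j)" "t \<in> {0..T}" "T > 0"
  shows "pderiv_t T (\<lambda>t x. \<chi> j. ev (U j) t x) t x = (\<chi> j. ev (\<lambda>x. fps_deriv (U j x)) t x)"
  unfolding pderiv_t_def
  by (rule vector_derivative_within_cbox[of 0 T t, unfolded box_real, OF _ _ has_vector_derivative_vec])
     (use ev_has_time_derivative assms in auto)

lemma C1_tx_vec:
  fixes U :: "3 \<Rightarrow> real ^ 3 \<Rightarrow> real fps"
  assumes U: "\<And>j. analytic_upto T (U j)" and T: "T > 0"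
  shows "C1_tx T (\<lambda>t x. \<chi> j. ev (U j) t x)"
  unfolding C1_tx_def
proof (intro conjI ballI allI)
  show "C1_x T (\<lambda>t x. \<chi> j. ev (U j) t x)" by (intro C1_x_vec ev_C1_x U)
  show "(\<lambda>s. \<chi> j. ev (U j) s x) differentiable at t within {0..T}" if "t \<in> {0..T}" for t x
    using has_vector_derivative_vec[OF ev_has_time_derivative[OF U that]] by (rule differentiableI_vector)
  have "jointly_continuous T (\<lambda>t x. \<chi> j. ev (\<lambda>x. fps_deriv (U j x)) t x)"
    using T by (intro jointly_continuous_vec ev_jointly_continuous analytic_upto_fps_deriv U) auto
  then show "jointly_continuous T (pderiv_t T (\<lambda>t x. \<chi> j. ev (U j) t x))"
    unfolding jointly_continuous_def
    by (rule continuous_on_eq) (use ev_vec_pderiv_t[OF U _ T] in auto)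
qed

lemma C2_tx_vec:
  fixes U :: "3 \<Rightarrow> real ^ 3 \<Rightarrow> real fps"
  assumes U: "\<And>j. analytic_upto T (U j)" and T: "T > 0"
  shows "C2_tx T (\<lambda>t x. \<chi> j. ev (U j) t x)"
  unfolding C2_tx_def
proof (intro conjI allI)
  show "C1_tx T (\<lambda>t x. \<chi> j. ev (U j) t x)" by (rule C1_tx_vec[OF assms])
  have "C1_tx T (pderiv_t T (\<lambda>t x. \<chi> j. ev (U j) t x)) = C1_tx T (\<lambda>t x. \<chi> j. ev (\<lambda>x. fps_deriv (U j x)) t x)"
    by (rule C1_tx_cong) (simp add: fun_eq_iff ev_vec_pderiv_t[OF U _ T])
  then show "C1_tx T (pderiv_t T (\<lambda>t x. \<chi> j. ev (U j) t x))"
    using T by (simp add: C1_tx_vec analytic_upto_fps_deriv U)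
  fix i
  have "C1_tx T (\<lambda>t. pderiv_x i (\<lambda>x. \<chi> j. ev (U j) t x)) = C1_tx T (\<lambda>t x. \<chi> j. ev (lift_op (pderiv_x i) (U j)) t x)"
    by (rule C1_tx_cong) (use pderiv_x_vec(2)[OF ev_pderiv(1)[OF U]] ev_pderiv(2)[OF U] in auto)
  then show "C1_tx T (\<lambda>t. pderiv_x i (\<lambda>x. \<chi> j. ev (U j) t x))"
    using T by (simp add: C1_tx_vec analytic_upto_pderiv U)
qed

subsection \<open>Curves in the weighted spaces\<close>

lemma norm_vec3_le: "norm v \<le> (\<Sum>j\<in>UNIV. norm (v $ j))" for v :: "complex ^ 3"
  unfolding norm_vec_def by (rule L2_set_le_sum) auto

lemma B_norm_vec_le: "B_norm_vec \<delta> F \<le> (\<Sum>j\<in>UNIV. B_norm \<delta> (\<lambda>x. F x $ j))"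
proof -
  have "B_norm_vec \<delta> F = (\<integral>\<^sup>+k. ennreal (norm (fourier_vec F k) * \<delta> powr norm (int_vec k)) \<partial>count_space UNIV)"
    by (simp add: B_norm_vec_def weighted_sum_def infsum_ennreal_eq_nn_integral)
  also have "\<dots> \<le> (\<integral>\<^sup>+k. (\<Sum>j\<in>UNIV. ennreal (cmod (fourier (\<lambda>x. F x $ j) k) * \<delta> powr norm (int_vec k))) \<partial>count_space UNIV)"
  proof (rule nn_integral_mono)
    fix k
    have "norm (fourier_vec F k) * \<delta> powr norm (int_vec k) \<le> (\<Sum>j\<in>UNIV. norm (fourier_vec F k $ j)) * \<delta> powr norm (int_vec k)"
      by (intro mult_right_mono norm_vec3_le) auto
    then have "ennreal (norm (fourier_vec F k) * \<delta> powr norm (int_vec k)) \<le>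
       ennreal (\<Sum>j\<in>UNIV. cmod (fourier (\<lambda>x. F x $ j) k) * \<delta> powr norm (int_vec k))"
      by (intro ennreal_leI) (simp add: fourier_vec_def sum_distrib_right)
    also have "\<dots> = (\<Sum>j\<in>UNIV. ennreal (cmod (fourier (\<lambda>x. F x $ j) k) * \<delta> powr norm (int_vec k)))"
      by (rule sum_ennreal[symmetric]) auto
    finally show "ennreal (norm (fourier_vec F k) * \<delta> powr norm (int_vec k)) \<le>
       (\<Sum>j\<in>UNIV. ennreal (cmod (fourier (\<lambda>x. F x $ j) k) * \<delta> powr norm (int_vec k)))" .
  qed
  also have "\<dots> = (\<Sum>j\<in>UNIV. B_norm \<delta> (\<lambda>x. F x $ j))"
    by (subst nn_integral_sum) (auto simp: B_norm_def weighted_sum_def infsum_ennreal_eq_nn_integral)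
  finally show ?thesis .
qed

lemma B_norm_le_vec: "B_norm \<delta> (\<lambda>x. F x $ j) \<le> B_norm_vec \<delta> F"
  unfolding B_norm_def B_norm_vec_def weighted_sum_def infsum_ennreal_eq_nn_integral
proof (intro nn_integral_mono ennreal_leI mult_right_mono)
  show "norm (fourier (\<lambda>x. F x $ j) k) \<le> norm (fourier_vec F k)" for k
    using Finite_Cartesian_Product.norm_nth_le[of "fourier_vec F k" j] by (simp add: fourier_vec_def)
qed auto

lemma powr_le_exp_weight:
  assumes "\<delta> > 0" "ln \<delta> \<le> s"
  shows "ennreal (\<delta> powr norm (int_vec k)) \<le> exp_weight s k"
  using assms by (auto simp: exp_weight_def powr_def mult.commute[of "norm _"] intro!: ennreal_leI mult_right_mono)

lemma B_norm_le_exp_weight: "\<delta> > 0 \<Longrightarrow> ln \<delta> \<le> s \<Longrightarrow> B_norm \<delta> f \<le> fsum (exp_weight s) f"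
  unfolding B_norm_eq_fsum[OF less_imp_le] by (intro fsum_mono powr_le_exp_weight)

lemma B_norm_ev_le:
  assumes "decay s r U" "t \<in> {0..T}" "T \<le> r" "\<delta> > 0" "ln \<delta> \<le> s"
  shows "B_norm \<delta> (ev U t) \<le> (\<Sum>n. fsum (exp_weight s) (coeff U n) * ennreal (r ^ n))"
proof -
  have "B_norm \<delta> (ev U t) \<le> fsum (exp_weight s) (ev U t)" by (rule B_norm_le_exp_weight[OF assms(4,5)])
  also have "\<dots> \<le> (\<Sum>n. fsum (exp_weight s) (coeff U n) * ennreal (t ^ n))" by (rule ev_facts(4)[OF assms(1-3)])
  also have "\<dots> \<le> (\<Sum>n. fsum (exp_weight s) (coeff U n) * ennreal (r ^ n))"
    using assms(2,3) by (intro suminf_le mult_left_mono ennreal_leI power_mono) auto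
  finally show ?thesis .
qed

lemma B_space_ev:
  assumes "decay s r U" "t \<in> {0..T}" "T \<le> r" "\<delta> > 0" "ln \<delta> \<le> s"
  shows "ev U t \<in> B_space \<delta>"
proof -
  obtain \<alpha> where \<alpha>: "\<And>n. \<alpha> n \<ge> 0" "\<And>n. fsum (exp_weight s) (coeff U n) \<le> ennreal (\<alpha> n)" "summable (\<lambda>n. \<alpha> n * r ^ n)"
    using decayE[OF assms(1)] by metis
  have "B_norm \<delta> (ev U t) \<le> (\<Sum>n. fsum (exp_weight s) (coeff U n) * ennreal (r ^ n))" by (rule B_norm_ev_le[OF assms])
  also have "\<dots> \<le> (\<Sum>n. ennreal (\<alpha> n * r ^ n))"
    using \<alpha> decayD(3)[OF assms(1)] by (intro suminf_le) (auto simp: ennreal_mult intro!: mult_right_mono)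
  also have "\<dots> = ennreal (\<Sum>n. \<alpha> n * r ^ n)" using \<alpha> decayD(3)[OF assms(1)] by (intro suminf_ennreal2) auto
  finally have "B_norm \<delta> (ev U t) < \<infinity>" by (simp add: le_less_trans)
  then show ?thesis
    using ev_facts(1)[OF assms(1-3)] by (simp add: B_space_def periodic_continuous_def)
qed

text \<open>The norm of the difference is dominated by the scalar series \<open>h\<close>, which is
  continuous in \<tau> by the M-test and vanishes at \<open>t\<close>.\<close>

lemma B_norm_ev_tendsto:
  assumes U: "decay s r U" and "t \<in> {0..T}" "T \<le> r" "\<delta> > 0" "ln \<delta> \<le> s"
  shows "((\<lambda>\<tau>. B_norm \<delta> (\<lambda>x. ev U \<tau> x - ev U t x)) \<longlongrightarrow> 0) (at t within {0..T})"
proof -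
  obtain \<alpha> where \<alpha>: "\<And>n. \<alpha> n \<ge> 0" "\<And>n. fsum (exp_weight s) (coeff U n) \<le> ennreal (\<alpha> n)" "summable (\<lambda>n. \<alpha> n * r ^ n)"
    using decayE[OF U] by metis
  have pb: "\<bar>\<tau> ^ n\<bar> \<le> r ^ n" if "\<tau> \<in> {0..T}" for \<tau> n
    using power_bound[OF that \<open>T \<le> r\<close>, of n] by simp
  define h where "h \<tau> = (\<Sum>n. \<alpha> n * \<bar>\<tau> ^ n - t ^ n\<bar>)" for \<tau>
  have hb: "norm (\<alpha> n * \<bar>\<tau> ^ n - t ^ n\<bar>) \<le> 2 * (\<alpha> n * r ^ n)" if "\<tau> \<in> {0..T}" for \<tau> n
  proof -
    have "\<bar>\<tau> ^ n - t ^ n\<bar> \<le> 2 * r ^ n" using pb[OF that, of n] pb[OF assms(2), of n] by linarith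
    then show ?thesis using mult_left_mono[of "\<bar>\<tau> ^ n - t ^ n\<bar>" "2 * r ^ n" "\<alpha> n"] \<alpha>(1)[of n] by (simp add: abs_mult mult_ac)
  qed
  have "continuous_on {0..T} h"
    unfolding h_def[abs_def]
    by (rule continuous_on_suminf_M_test[OF _ hb]) (auto intro!: continuous_intros summable_mult \<alpha>)
  then have "(h \<longlongrightarrow> h t) (at t within {0..T})" using assms(2) by (simp add: continuous_on)
  then have "(h \<longlongrightarrow> 0) (at t within {0..T})" by (simp add: h_def)
  then have lim: "((\<lambda>\<tau>. ennreal (h \<tau>)) \<longlongrightarrow> ennreal 0) (at t within {0..T})" by (rule tendsto_ennrealI)
  have le: "B_norm \<delta> (\<lambda>x. ev U \<tau> x - ev U t x) \<le> ennreal (h \<tau>)" if \<tau>: "\<tau> \<in> {0..T}" for \<tau>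
  proof -
    have \<beta>: "\<bar>\<tau> ^ n - t ^ n\<bar> \<le> 2 * r ^ n" for n
      using pb[OF \<tau>, of n] pb[OF assms(2), of n] by linarith
    have eq: "(\<lambda>x. ev U \<tau> x - ev U t x) = series_comb U (\<lambda>n. \<tau> ^ n - t ^ n)"
    proof
      fix x
      show "ev U \<tau> x - ev U t x = series_comb U (\<lambda>n. \<tau> ^ n - t ^ n) x"
        unfolding ev_conv_series_comb series_comb_def right_diff_distrib
        by (rule suminf_diff) (use series_comb(1)[OF U power_bound] \<tau> assms in auto)
    qed
    have "B_norm \<delta> (\<lambda>x. ev U \<tau> x - ev U t x) \<le> fsum (exp_weight s) (series_comb U (\<lambda>n. \<tau> ^ n - t ^ n))"
      unfolding eq by (rule B_norm_le_exp_weight[OF assms(4,5)])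
    also have "\<dots> \<le> (\<Sum>n. fsum (exp_weight s) (coeff U n) * ennreal \<bar>\<tau> ^ n - t ^ n\<bar>)"
      by (rule series_comb(5)[OF U \<beta>]) simp
    also have "\<dots> \<le> (\<Sum>n. ennreal (\<alpha> n * \<bar>\<tau> ^ n - t ^ n\<bar>))"
      using \<alpha> by (intro suminf_le) (auto simp: ennreal_mult intro!: mult_right_mono)
    also have "\<dots> = ennreal (h \<tau>)"
      unfolding h_def using \<alpha>(1)
      by (intro suminf_ennreal2 summable_comparison_test'[OF summable_mult[OF \<alpha>(3), of 2], of 0] hb[OF \<tau>]) auto
    finally show ?thesis .
  qed
  show ?thesis
  proof (rule tendsto_sandwich)
    show "\<forall>\<^sub>F \<tau> in at t within {0..T}. 0 \<le> B_norm \<delta> (\<lambda>x. ev U \<tau> x - ev U t x)" by simp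
    show "\<forall>\<^sub>F \<tau> in at t within {0..T}. B_norm \<delta> (\<lambda>x. ev U \<tau> x - ev U t x) \<le> ennreal (h \<tau>)"
      unfolding eventually_at_filter using le by (intro always_eventually) blast
    show "((\<lambda>\<tau>. ennreal (h \<tau>)) \<longlongrightarrow> 0) (at t within {0..T})" using lim by simp
  qed simp
qed

lemma continuous_curve_ev:
  assumes U: "decay s r U" and "T \<le> r" "\<delta> > 0" "ln \<delta> \<le> s"
  shows "continuous_curve (B_norm \<delta>) (B_space \<delta>) T (ev U)"
  unfolding continuous_curve_def
  using B_space_ev[OF U _ assms(2-4)] B_norm_ev_tendsto[OF U _ assms(2-4)] by blast

lemma continuous_curve_ev_vec:
  assumes U: "\<And>j. decay s r (U j)" and "T \<le> r" "\<delta> > 0" "ln \<delta> \<le> s"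
  shows "continuous_curve (B_norm_vec \<delta>) (B_space_vec \<delta>) T (\<lambda>t x. \<chi> j. ev (U j) t x)"
  unfolding continuous_curve_def
proof (intro conjI ballI)
  fix t assume t: "t \<in> {0..T}"
  have *: "ev (U j) t \<in> B_space \<delta>" for j by (rule B_space_ev[OF U t assms(2-4)])
  have "B_norm_vec \<delta> (\<lambda>x. \<chi> j. ev (U j) t x) \<le> (\<Sum>j\<in>UNIV. B_norm \<delta> (ev (U j) t))"
    using B_norm_vec_le[of \<delta> "\<lambda>x. \<chi> j. ev (U j) t x"] by simp
  also have "\<dots> < \<infinity>" using * by (simp add: B_space_def)
  finally show "(\<lambda>x. \<chi> j. ev (U j) t x) \<in> B_space_vec \<delta>"
    using * by (auto simp: B_space_vec_def B_space_def periodic_def intro!: continuous_on_vec_lambda)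
  have lim: "((\<lambda>\<tau>. \<Sum>j\<in>UNIV. B_norm \<delta> (\<lambda>x. ev (U j) \<tau> x - ev (U j) t x)) \<longlongrightarrow> (\<Sum>j\<in>(UNIV::3 set). 0)) (at t within {0..T})"
    by (intro tendsto_sum B_norm_ev_tendsto[OF U t assms(2-4)])
  have le: "B_norm_vec \<delta> (\<lambda>x. (\<chi> j. ev (U j) \<tau> x) - (\<chi> j. ev (U j) t x)) \<le> (\<Sum>j\<in>UNIV. B_norm \<delta> (\<lambda>x. ev (U j) \<tau> x - ev (U j) t x))" for \<tau>
    using B_norm_vec_le[of \<delta> "\<lambda>x. (\<chi> j. ev (U j) \<tau> x) - (\<chi> j. ev (U j) t x)"] by simp
  show "((\<lambda>\<tau>. B_norm_vec \<delta> (\<lambda>x. (\<chi> j. ev (U j) \<tau> x) - (\<chi> j. ev (U j) t x))) \<longlongrightarrow> 0) (at t within {0..T})"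
    by (rule tendsto_sandwich[OF _ _ tendsto_const]) (use lim le in simp_all)
qed

text \<open>Continuity of the single modes makes the norm a measurable function of time; without
  that the essential supremum would be infinite by convention.\<close>

lemma continuous_on_fourier_ev:
  assumes U: "decay s r U" and "T \<le> r"
  shows "continuous_on {0..T} (\<lambda>t. fourier (ev U t) k)"
proof -
  have 1: "\<bar>r ^ n\<bar> \<le> 1 * r ^ n" for n using decayD(3)[OF U] by simp
  have "continuous_on {0..T} (\<lambda>t. \<Sum>n. fourier (coeff U n) k * of_real t ^ n)"
  proof (rule continuous_on_suminf_M_test)
    show "summable (\<lambda>n. norm (fourier (coeff U n) k * of_real (r ^ n)))"
      by (rule series_comb(3)[OF U 1]) simp
    show "norm (fourier (coeff U n) k * of_real t ^ n) \<le> norm (fourier (coeff U n) k * of_real (r ^ n))" if "t \<in> {0..T}" for n t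
      using that \<open>T \<le> r\<close> by (auto simp: norm_mult norm_power intro!: mult_left_mono power_mono)
  qed (intro continuous_intros)
  then show ?thesis
    by (rule continuous_on_eq) (use ev_facts(3)[OF U _ assms(2)] in auto)
qed

lemma measurable_lborel_interval:
  fixes f :: "real \<Rightarrow> 'b::topological_space"
  assumes "continuous_on {0..T} f"
  shows "f \<in> borel_measurable (restrict_space lborel {0<..<T})"
proof -
  have "continuous_on {0<..<T} f" by (rule continuous_on_subset[OF assms]) auto
  then have "f \<in> borel_measurable (restrict_space borel {0<..<T})" by (rule borel_measurable_continuous_on_restrict)
  moreover have "sets (restrict_space lborel {0<..<T}) = sets (restrict_space borel {0<..<T})"
    by (simp add: sets_restrict_space)
  ultimately show ?thesis using measurable_cong_sets by blast
qed

lemma measurable_B_norm: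
  fixes T :: real
  assumes "\<And>k. continuous_on {0..T} (\<lambda>t. fourier (u t) k)"
  shows "(\<lambda>t. B_norm \<delta> (u t)) \<in> borel_measurable (restrict_space lborel {0<..<T})"
proof -
  have [measurable]: "(\<lambda>t. fourier (u t) k) \<in> borel_measurable (restrict_space lborel {0<..<T})" for k
    by (rule measurable_lborel_interval[OF assms])
  show ?thesis
    unfolding B_norm_def weighted_sum_def infsum_ennreal_eq_nn_integral
    by (rule measurable_nn_integral_count_space) measurable
qed

lemma measurable_B_norm_vec:
  fixes T :: real
  assumes "\<And>j k. continuous_on {0..T} (\<lambda>t. fourier (\<lambda>x. u t x $ j) k)"
  shows "(\<lambda>t. B_norm_vec \<delta> (u t)) \<in> borel_measurable (restrict_space lborel {0<..<T})"
proof -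
  have [measurable]: "(\<lambda>t. norm (fourier_vec (u t) k)) \<in> borel_measurable (restrict_space lborel {0<..<T})" for k
    unfolding fourier_vec_def
    by (intro measurable_lborel_interval continuous_on_norm continuous_on_vec_lambda assms)
  show ?thesis
    unfolding B_norm_vec_def weighted_sum_def infsum_ennreal_eq_nn_integral
    by (rule measurable_nn_integral_count_space) measurable
qed

lemma Linf_norm_le:
  assumes "(\<lambda>t. N (u t)) \<in> borel_measurable (restrict_space lborel {0<..<T})" "\<And>t. t \<in> {0..T} \<Longrightarrow> N (u t) \<le> C"
  shows "Linf_norm N T u \<le> C"
  unfolding Linf_norm_def
  by (rule esssup_I[OF assms(1)]) (auto intro!: AE_I2 assms(2) simp: space_restrict_space)

lemma Linf_norm_ev_le:
  assumes "decay s r U" "T \<le> r" "\<And>t. t \<in> {0..T} \<Longrightarrow> B_norm \<delta> (ev U t) \<le> C"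
  shows "Linf_norm (B_norm \<delta>) T (ev U) \<le> C"
  by (intro Linf_norm_le measurable_B_norm continuous_on_fourier_ev[OF assms(1,2)] assms(3))

lemma Linf_norm_ev_vec_le:
  assumes "\<And>j. decay s r (U j)" "T \<le> r" "\<And>t j. t \<in> {0..T} \<Longrightarrow> B_norm \<delta> (ev (U j) t) \<le> C j"
    and eq: "\<And>t. t \<in> {0..T} \<Longrightarrow> u t = (\<lambda>x. \<chi> j. ev (U j) t x)"
  shows "Linf_norm (B_norm_vec \<delta>) T u \<le> (\<Sum>j\<in>UNIV. C j)"
proof (rule Linf_norm_le)
  show "B_norm_vec \<delta> (u t) \<le> (\<Sum>j\<in>UNIV. C j)" if "t \<in> {0..T}" for t
  proof -
    have "B_norm_vec \<delta> (u t) \<le> (\<Sum>j\<in>UNIV. B_norm \<delta> (ev (U j) t))"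
      using B_norm_vec_le[of \<delta> "u t"] by (simp add: eq[OF that])
    also have "\<dots> \<le> (\<Sum>j\<in>UNIV. C j)" by (intro sum_mono assms(3)[OF that])
    finally show ?thesis .
  qed
  have "continuous_on {0..T} (\<lambda>t. fourier (\<lambda>x. u t x $ j) k)" for j k
    by (rule continuous_on_eq[OF continuous_on_fourier_ev[OF assms(1,2)]]) (simp add: eq)
  then show "(\<lambda>t. B_norm_vec \<delta> (u t)) \<in> borel_measurable (restrict_space lborel {0<..<T})"
    by (rule measurable_B_norm_vec)
qed

context time_weight
begin

text \<open>The supremum in the weight includes the end point \<open>R\<close>, where it gives the
  factor \<open>R ^ n\<close> and the rate \<open>a - b * R\<close>. Hence the norm of the series
  bounds the norm at every time, with constant 1.\<close>

lemma B_norm_ev_bounded_series: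
  assumes U: "bounded_series j U c" and "t \<in> {0..T}" "T \<le> R" "\<delta> > 0" "ln \<delta> \<le> a - b * R"
  shows "B_norm \<delta> (ev U t) \<le> ennreal c"
proof -
  have "B_norm \<delta> (ev U t) \<le> (\<Sum>n. fsum (exp_weight (a - b * R)) (coeff U n) * ennreal (R ^ n))"
    by (rule B_norm_ev_le[OF bounded_series_imp_decay[OF U] assms(2-5)])
  also have "\<dots> \<le> tnorm j U"
    unfolding tnorm_def
  proof (rule suminf_le)
    fix n
    have "fsum (exp_weight (a - b * R)) (coeff U n) * ennreal (R ^ n) = fsum (\<lambda>k. ennreal (R ^ n) * exp_weight (a - b * R) k) (coeff U n)"
      by (simp add: fsum_cmult mult.commute)
    also have "\<dots> \<le> fsum (jweight j n) (coeff U n)"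
      using jweight_lower R_pos by (intro fsum_mono) (auto simp: exp_weight_def ennreal_mult[symmetric])
    finally show "fsum (exp_weight (a - b * R)) (coeff U n) * ennreal (R ^ n) \<le> fsum (jweight j n) (coeff U n)" .
  qed auto
  also have "\<dots> \<le> ennreal c" by (rule bounded_seriesD[OF U])
  finally show ?thesis .
qed

lemma bounded_series_imp_analytic_upto: "bounded_series j U c \<Longrightarrow> T < R \<Longrightarrow> analytic_upto T U"
  using bounded_series_imp_decay unfolding analytic_upto_def by blast

end

subsection \<open>Fourier multipliers\<close>

definition mult_op :: "(int ^ 3 \<Rightarrow> real) \<Rightarrow> (real ^ 3 \<Rightarrow> real) \<Rightarrow> real ^ 3 \<Rightarrow> real" where
  "mult_op m f x = Re (synth (\<lambda>k. of_real (m k) * fourier f k) x)"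

text \<open>Evenness of a real symbol preserves the symmetry of the coefficients under
  \<open>k \<mapsto> - k\<close> and thereby real values.\<close>

definition even_bounded :: "(int ^ 3 \<Rightarrow> real) \<Rightarrow> real \<Rightarrow> bool" where
  "even_bounded m K \<longleftrightarrow> (\<forall>k. m (- k) = m k \<and> \<bar>m k\<bar> \<le> K)"

lemma mult_op:
  assumes m: "even_bounded m K" and f: "(\<lambda>k. cmod (fourier f k)) summable_on UNIV"
  shows "periodic_continuous (mult_op m f)" "fourier (mult_op m f) k = of_real (m k) * fourier f k"
proof -
  have s: "(\<lambda>k. norm (of_real (m k) * fourier f k)) summable_on UNIV"
    by (rule Infinite_Sum.abs_summable_on_comparison_test'[OF summable_on_cmult_right[OF f, of K]])
       (use m in \<open>auto simp: even_bounded_def norm_mult intro!: mult_right_mono\<close>)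
  show "periodic_continuous (mult_op m f)"
    unfolding mult_op_def[abs_def] by (rule periodic_continuous_synth[OF s])
  show "fourier (mult_op m f) k = of_real (m k) * fourier f k"
    unfolding mult_op_def[abs_def] by (rule fourier_synth[OF s]) (use m in \<open>simp add: even_bounded_def fourier_minus\<close>)
qed

text \<open>At \<open>k = 0\<close> division by zero makes the inverse Laplacian drop the mean.\<close>

definition inv_laplace_symbol :: "int ^ 3 \<Rightarrow> real" where
  "inv_laplace_symbol k = 1 / (4 * pi\<^sup>2 * (norm (int_vec k))\<^sup>2)"

text \<open>Matrix entry of the projection orthogonal to \<open>k\<close>; at \<open>k = 0\<close>
  the quotient is \<open>x / 0 = 0\<close>, which leaves the identity, in agreement with
  \<open>leray_symbol\<close>.\<close>

definition leray_entry :: "3 \<Rightarrow> 3 \<Rightarrow> int ^ 3 \<Rightarrow> real" where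
  "leray_entry i j k = (if i = j then 1 else 0) - of_int (k $ i) * of_int (k $ j) / (norm (int_vec k))\<^sup>2"

lemma norm_int_vec_ge_1:
  assumes "k \<noteq> 0"
  shows "1 \<le> norm (int_vec k)"
proof -
  obtain i where "k $ i \<noteq> 0" using assms by (auto simp: vec_eq_iff)
  then have "1 \<le> \<bar>int_vec k $ i\<bar>" by (simp flip: of_int_abs)
  then show ?thesis using component_le_norm_cart[of "int_vec k" i] by linarith
qed

text \<open>Nonzero modes have \<open>|k| \<ge> 1\<close>, so one power of \<open>1 + |k|\<close> is
  gained with constant 1. This puts the electric potential and the initial vector potential into
  index 1 when their sources are measured in index 0.\<close>

lemma inv_laplace_bound: "inv_laplace_symbol k * (1 + norm (int_vec k)) \<le> 1" "inv_laplace_symbol k \<ge> 0"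
proof -
  show "inv_laplace_symbol k \<ge> 0" by (simp add: inv_laplace_symbol_def)
  show "inv_laplace_symbol k * (1 + norm (int_vec k)) \<le> 1"
  proof (cases "k = 0")
    case False
    let ?n = "norm (int_vec k)"
    have n: "1 \<le> ?n" by (rule norm_int_vec_ge_1[OF False])
    have "1 \<le> pi\<^sup>2" using pi_ge_two by (simp add: one_le_power)
    have "1 + ?n \<le> 4 * ?n\<^sup>2" using n self_le_power[OF n, of 2] by simp
    also have "\<dots> \<le> 4 * pi\<^sup>2 * ?n\<^sup>2" using \<open>1 \<le> pi\<^sup>2\<close> by (intro mult_right_mono) auto
    finally show ?thesis using n by (simp add: inv_laplace_symbol_def divide_le_eq)
  qed (simp add: inv_laplace_symbol_def)
qed

lemma even_bounded_inv_laplace: "even_bounded inv_laplace_symbol 1"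
  unfolding even_bounded_def
proof (intro allI conjI)
  fix k
  show "inv_laplace_symbol (- k) = inv_laplace_symbol k" by (simp add: inv_laplace_symbol_def)
  have "inv_laplace_symbol k * 1 \<le> inv_laplace_symbol k * (1 + norm (int_vec k))"
    using inv_laplace_bound(2)[of k] by (intro mult_left_mono) auto
  then show "\<bar>inv_laplace_symbol k\<bar> \<le> 1" using inv_laplace_bound[of k] by simp
qed

lemma even_bounded_leray: "even_bounded (leray_entry i j) 2"
  unfolding even_bounded_def
proof (intro allI conjI)
  fix k
  show "leray_entry i j (- k) = leray_entry i j k" by (simp add: leray_entry_def)
  have "\<bar>of_int (k $ i)\<bar> * \<bar>of_int (k $ j)\<bar> \<le> norm (int_vec k) * norm (int_vec k)"
    using component_le_norm_cart[of "int_vec k" i] component_le_norm_cart[of "int_vec k" j]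
    by (intro mult_mono) auto
  then have q: "\<bar>of_int (k $ i) * of_int (k $ j) / (norm (int_vec k))\<^sup>2\<bar> \<le> (1::real)"
    by (cases "k = 0") (simp_all add: abs_mult power2_eq_square divide_le_eq_1)
  have "\<bar>(if i = j then 1 else 0) - q\<bar> \<le> 2" if "\<bar>q\<bar> \<le> 1" for q :: real
    using that by (auto split: if_splits)
  from this[OF q] show "\<bar>leray_entry i j k\<bar> \<le> 2" by (simp only: leray_entry_def)
qed

lemma infsum_sum:
  fixes f :: "'i \<Rightarrow> 'k \<Rightarrow> 'b::real_normed_vector"
  assumes "\<And>i. i \<in> I \<Longrightarrow> f i summable_on A"
  shows "(\<Sum>\<^sub>\<infinity>k\<in>A. \<Sum>i\<in>I. f i k) = (\<Sum>i\<in>I. \<Sum>\<^sub>\<infinity>k\<in>A. f i k)"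
proof (rule infsumI)
  show "((\<lambda>k. \<Sum>i\<in>I. f i k) has_sum (\<Sum>i\<in>I. \<Sum>\<^sub>\<infinity>k\<in>A. f i k)) A"
    using assms
  proof (induction I rule: infinite_finite_induct)
    case (insert i I)
    then show ?case by (simp add: has_sum_add)
  qed auto
qed

text \<open>Rewrites the complex vector-valued projection as real scalar multipliers, one for each
  matrix entry.\<close>

lemma leray_component:
  assumes F: "\<And>j. (\<lambda>k. cmod (fourier (\<lambda>y. F y $ j) k)) summable_on UNIV"
  shows "leray F x $ i = (\<Sum>j\<in>UNIV. mult_op (leray_entry i j) (\<lambda>y. F y $ j) x)"
proof -
  have s: "(\<lambda>k. of_real (leray_entry i j k) * fourier (\<lambda>y. F y $ j) k * char_fun k x) summable_on UNIV" for j
  proof (rule abs_summable_summable, rule Infinite_Sum.abs_summable_on_comparison_test'[OF summable_on_cmult_right[OF F[of j], of 2]])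
    show "norm (of_real (leray_entry i j k) * fourier (\<lambda>y. F y $ j) k * char_fun k x) \<le> 2 * cmod (fourier (\<lambda>y. F y $ j) k)" for k
      using even_bounded_leray[of i j] by (auto simp: even_bounded_def norm_mult intro!: mult_right_mono)
  qed
  have "leray_symbol k (fourier_vec F k) $ i = (\<Sum>j\<in>UNIV. of_real (leray_entry i j k) * fourier (\<lambda>y. F y $ j) k)" for k
    by (simp add: leray_symbol_def leray_entry_def fourier_vec_def left_diff_distrib sum_subtractf sum_distrib_left
        sum_divide_distrib if_distrib[of of_real] if_distrib[of "\<lambda>z. z * _"] mult.assoc cong: if_cong)
  then have "leray F x $ i = Re (\<Sum>\<^sub>\<infinity>k. \<Sum>j\<in>UNIV. of_real (leray_entry i j k) * fourier (\<lambda>y. F y $ j) k * char_fun k x)"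
    by (simp add: leray_def char_fun_def sum_distrib_right)
  also have "(\<Sum>\<^sub>\<infinity>k. \<Sum>j\<in>UNIV. of_real (leray_entry i j k) * fourier (\<lambda>y. F y $ j) k * char_fun k x) =
      (\<Sum>j\<in>UNIV. \<Sum>\<^sub>\<infinity>k. of_real (leray_entry i j k) * fourier (\<lambda>y. F y $ j) k * char_fun k x)"
    by (rule infsum_sum) (rule s)
  finally show ?thesis by (simp add: mult_op_def synth_def)
qed

lemma ev_mult_op:
  assumes U: "decay s r U" and V: "decay s' r (lift_op (mult_op m) U)" and m: "even_bounded m K" and t: "t \<in> {0..T}" "T \<le> r"
  shows "ev (lift_op (mult_op m) U) t = mult_op m (ev U t)"
proof -
  note fU = ev_facts[OF U t] and fV = ev_facts[OF V t]
  obtain \<alpha> where \<alpha>: "\<And>n. \<alpha> n \<ge> 0" "\<And>n. fsum (exp_weight s) (coeff U n) \<le> ennreal (\<alpha> n)" "summable (\<lambda>n. \<alpha> n * r ^ n)"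
      "\<And>n. (\<lambda>k. cmod (fourier (coeff U n) k)) summable_on UNIV"
    using decayE[OF U] by metis
  have "ev U t \<in> B_space (exp s)" by (rule B_space_ev[OF U t]) auto
  then have "fsum (exp_weight s) (ev U t) < \<infinity>"
    by (simp add: B_space_def B_norm_eq_fsum exp_weight_def[abs_def] powr_def mult.commute)
  from mult_op[OF m fsum_exp_weight_summable(2)[OF decayD(2)[OF U] this]]
  show ?thesis
  proof (intro fourier_inject[OF fV(1)])
    fix k
    assume *: "\<And>k. fourier (mult_op m (ev U t)) k = of_real (m k) * fourier (ev U t) k"
    show "fourier (ev (lift_op (mult_op m) U) t) k = fourier (mult_op m (ev U t)) k"
      unfolding * fU(3) fV(3) coeff_simps mult_op(2)[OF m \<alpha>(4)]
      by (subst suminf_mult[symmetric]) (auto simp: mult.assoc intro!: summable_norm_cancel fU(2))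
  qed
qed

lemma (in time_weight) bounded_series_mult_op:
  assumes U: "bounded_series j U c" and m: "even_bounded m K" and K: "\<And>k. \<bar>m k\<bar> * (1 + norm (int_vec k)) ^ i \<le> C * (1 + norm (int_vec k)) ^ j" "C \<ge> 0"
  shows "bounded_series i (lift_op (mult_op m) U) (C * c)"
proof (rule bounded_series_multiplier[OF U _ K(2)])
  note mo = mult_op[OF m bounded_series_summable(3)[OF U]]
  show "periodic_continuous (coeff (lift_op (mult_op m) U) n)" for n by (simp add: mo)
  show "cmod (fourier (coeff (lift_op (mult_op m) U) n) k) * (1 + norm (int_vec k)) ^ i \<le>
     C * (cmod (fourier (coeff U n) k) * (1 + norm (int_vec k)) ^ j)" for n k
    using mult_left_mono[OF K(1)[of k], of "cmod (fourier (coeff U n) k)"] by (simp add: mo norm_mult mult_ac)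
qed

subsection \<open>The Lorentz factor\<close>

text \<open>The quotient of consecutive coefficients is \<open>(- 1/2 - n) / (n + 1)\<close>, of
  modulus at most one.\<close>

lemma abs_gbinomial_half_le: "\<bar>(-1/2::real) gchoose n\<bar> \<le> 1"
proof (induction n)
  case (Suc n)
  have "((-1/2::real) gchoose Suc n) = ((-1/2) gchoose n) * ((-1/2 - real n) / real (Suc n))"
    using gbinomial_absorption'[of "Suc n" "-1/2::real"] gbinomial_absorb_comp[of "-1/2::real" n]
    by (simp add: field_simps)
  moreover have "\<bar>(-1/2 - real n) / real (Suc n)\<bar> \<le> 1" by (simp add: abs_divide)
  ultimately show ?case using mult_mono[OF Suc.IH, of "\<bar>(-1/2 - real n) / real (Suc n)\<bar>" 1] by (simp add: abs_mult)
qed simp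

lemma fsum_power_le:
  assumes f: "periodic_continuous f" "(\<lambda>k. cmod (fourier f k)) summable_on UNIV"
    and \<omega>: "\<And>i j. \<omega> (i + j) \<le> \<omega> i * \<omega> j" "\<omega> 0 = 1" and q: "fsum \<omega> f \<le> ennreal q" "q \<ge> 0"
  shows "fsum \<omega> (\<lambda>x. f x ^ n) \<le> ennreal (q ^ n)"
proof (induction n)
  case 0
  have "fsum \<omega> (\<lambda>x. 1) = (\<integral>\<^sup>+(k::int^3). indicator {0} k \<partial>count_space UNIV)"
    unfolding fsum_def fourier_const by (intro nn_integral_cong) (auto simp: \<omega>)
  then show ?case by simp
next
  case (Suc n)
  have "fsum \<omega> (\<lambda>x. f x * f x ^ n) \<le> fsum \<omega> f * fsum \<omega> (\<lambda>x. f x ^ n)"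
    by (rule fsum_mult[where \<omega> = \<omega> and ?\<omega>1.0 = \<omega> and ?\<omega>2.0 = \<omega>, OF f _ \<omega>(1)]) (intro continuous_intros periodic_continuousD[OF f(1)])
  also have "\<dots> \<le> ennreal q * ennreal (q ^ n)" by (intro mult_mono q Suc) auto
  finally show ?case using q by (simp add: ennreal_mult)
qed

text \<open>Binomial series in the weighted algebra: coefficients of modulus at most one and
  \<open>z\<close> of norm at most 1/2 give the geometric bound 2.\<close>

lemma lorentz_factor:
  fixes z :: "real ^ 3 \<Rightarrow> real"
  assumes z: "periodic_continuous z" and s: "s > 0" "\<And>k. exp_weight s k \<le> \<omega> k"
    and \<omega>: "\<And>i j. \<omega> (i + j) \<le> \<omega> i * \<omega> j" "\<omega> 0 = 1" and q: "fsum \<omega> z \<le> ennreal (1/2)"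
  shows "periodic_continuous (\<lambda>x. (1 + z x) powr (-1/2))" "fsum \<omega> (\<lambda>x. (1 + z x) powr (-1/2)) \<le> ennreal 2"
proof -
  have "fsum (exp_weight s) z < \<infinity>"
    unfolding infinity_ennreal_def by (rule le_less_trans[OF order_trans[OF fsum_mono[OF s(2)] q] ennreal_less_top])
  note zs = fsum_exp_weight_summable(2)[OF s(1) this]
  have one: "1 \<le> \<omega> k" for k
  proof -
    have "1 \<le> exp_weight s k" using s(1) ennreal_leI[of 1 "exp (s * norm (int_vec k))"] by (simp add: exp_weight_def)
    then show ?thesis using s(2) by (rule order_trans)
  qed
  have zb: "\<bar>z x\<bar> \<le> 1/2" for x
  proof -
    have "ennreal \<bar>z x\<bar> \<le> fsum (\<lambda>_. 1) z" by (rule abs_le_fsum[OF z zs])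
    also have "\<dots> \<le> fsum \<omega> z" by (rule fsum_mono[OF one])
    also have "\<dots> \<le> ennreal (1/2)" by fact
    finally show ?thesis by (simp add: ennreal_le_iff del: ennreal_half)
  qed
  \<comment> \<open>The expansion parameter plays the part of time: \<open>P\<close> is a time
    series with radius 1, and \<open>series_comb\<close> sums it at 1.\<close>
  define P where "P x = Abs_fps (\<lambda>n. ((-1/2) gchoose n) * z x ^ n)" for x
  have cP: "coeff P n = (\<lambda>x. ((-1/2) gchoose n) * z x ^ n)" for n by (auto simp: coeff_def P_def)
  have bound: "fsum \<omega> (coeff P n) \<le> ennreal ((1/2) ^ n)" for n
  proof -
    have "fsum \<omega> (coeff P n) \<le> ennreal \<bar>(-1/2) gchoose n\<bar> * fsum \<omega> (\<lambda>x. z x ^ n)"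
      unfolding cP by (rule fsum_le_multiplier) (simp add: fourier_cmult norm_mult ennreal_mult mult.assoc)
    also have "\<dots> \<le> ennreal 1 * ennreal ((1/2) ^ n)"
      by (intro mult_mono fsum_power_le[OF z zs \<omega> q] ennreal_leI abs_gbinomial_half_le) auto
    finally show ?thesis by simp
  qed
  have dP: "decay s 1 P"
    unfolding decay_def
  proof (intro conjI allI exI[of _ "\<lambda>n. (1/2::real) ^ n"])
    show "periodic_continuous (coeff P n)" for n
      using z unfolding cP by (auto simp: periodic_continuous_def periodic_def intro!: continuous_intros)
    show "fsum (exp_weight s) (coeff P n) \<le> ennreal ((1/2) ^ n)" for n
      using fsum_mono[of "exp_weight s" \<omega> "coeff P n"] s(2) bound[of n] by (auto intro: order_trans)
    show "summable (\<lambda>n. (1/2::real) ^ n * 1 ^ n)" by simp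
  qed (use s in auto)
  have eq: "(\<lambda>x. (1 + z x) powr (-1/2)) = series_comb P (\<lambda>_. 1)"
  proof
    fix x
    have "(\<lambda>n. ((-1/2) gchoose n) * z x ^ n) sums (1 + z x) powr (-1/2)"
      by (rule gen_binomial_real) (use zb[of x] in auto)
    then show "(1 + z x) powr (-1/2) = series_comb P (\<lambda>_. 1) x"
      by (simp add: series_comb_def cP sums_iff)
  qed
  have \<beta>: "\<bar>1\<bar> \<le> 1 * (1::real) ^ n" for n by simp
  show "periodic_continuous (\<lambda>x. (1 + z x) powr (-1/2))"
    unfolding eq by (rule series_comb(2)[OF dP \<beta>]) simp
  have "fsum \<omega> (series_comb P (\<lambda>_. 1)) \<le> (\<Sum>n. fsum \<omega> (coeff P n) * ennreal \<bar>1\<bar>)"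
    by (rule series_comb(5)[OF dP \<beta>]) simp
  also have "\<dots> \<le> (\<Sum>n. ennreal ((1/2) ^ n))"
    using bound by (intro suminf_le) auto
  also have "\<dots> = ennreal (\<Sum>n. (1/2) ^ n)" by (rule suminf_ennreal2) auto
  also have "(\<Sum>n. (1/2) ^ n) = (2::real)" by (subst suminf_geometric) auto
  finally show "fsum \<omega> (\<lambda>x. (1 + z x) powr (-1/2)) \<le> ennreal 2" unfolding eq .
qed

subsection \<open>The multifluid system for time series\<close>

text \<open>
  The Lorentz factor \<open>(1 + \<epsilon>\<^sup>2 |\<xi>|\<^sup>2) powr (- 1 / 2)\<close> is an unknown of its own, which makes the
  system polynomial; the field equations are closed by the time derivative of the vector potential
  and by the full magnetic field instead of the vector potential itself, so that no second
  derivatives occur.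
\<close>

datatype 'a field_var =
  Density 'a | Momentum 'a 3 | Lorentz 'a | Potential_Rate 3 | Magnetic 3

type_synonym series = "real ^ 3 \<Rightarrow> real fps"

definition curl_series :: "(3 \<Rightarrow> series) \<Rightarrow> 3 \<Rightarrow> series" where
  "curl_series W i =
     (if i = 1 then (\<lambda>x. lift_op (pderiv_x 2) (W 3) x - lift_op (pderiv_x 3) (W 2) x)
      else if i = 2 then (\<lambda>x. lift_op (pderiv_x 3) (W 1) x - lift_op (pderiv_x 1) (W 3) x)
      else (\<lambda>x. lift_op (pderiv_x 1) (W 2) x - lift_op (pderiv_x 2) (W 1) x))"

definition cross_series :: "(3 \<Rightarrow> series) \<Rightarrow> (3 \<Rightarrow> series) \<Rightarrow> 3 \<Rightarrow> series" where
  "cross_series V W i =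
     (if i = 1 then (\<lambda>x. V 2 x * W 3 x - V 3 x * W 2 x)
      else if i = 2 then (\<lambda>x. V 3 x * W 1 x - V 1 x * W 3 x)
      else (\<lambda>x. V 1 x * W 2 x - V 2 x * W 1 x))"

definition velocity_series :: "('a field_var \<Rightarrow> series) \<Rightarrow> 'a \<Rightarrow> 3 \<Rightarrow> series" where
  "velocity_series U \<theta> i = (\<lambda>x. U (Lorentz \<theta>) x * U (Momentum \<theta> i) x)"

definition charge_series :: "'a measure \<Rightarrow> ('a field_var \<Rightarrow> series) \<Rightarrow> series" where
  "charge_series M U = average M (\<lambda>\<theta>. U (Density \<theta>))"

definition current_series :: "'a measure \<Rightarrow> ('a field_var \<Rightarrow> series) \<Rightarrow> 3 \<Rightarrow> series" where
  "current_series M U i = average M (\<lambda>\<theta> x. U (Density \<theta>) x * velocity_series U \<theta> i x)"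

text \<open>Normalises the free function of time in the potential to mean zero.\<close>

definition potential_series :: "'a measure \<Rightarrow> ('a field_var \<Rightarrow> series) \<Rightarrow> series" where
  "potential_series M U = lift_op (mult_op inv_laplace_symbol) (charge_series M U)"

text \<open>The full time derivative at a fixed point, convection included, so that the Lorentz
  factor can be differentiated by the chain rule without a transport term of its own.\<close>

definition accel_series :: "'a measure \<Rightarrow> real \<Rightarrow> ('a field_var \<Rightarrow> series) \<Rightarrow> 'a \<Rightarrow> 3 \<Rightarrow> series" where
  "accel_series M \<epsilon> U \<theta> i = (\<lambda>x.
     - lift_op (pderiv_x i) (potential_series M U) x - fps_const \<epsilon> * U (Potential_Rate i) x
     + fps_const \<epsilon> * cross_series (velocity_series U \<theta>) (\<lambda>j. U (Magnetic j)) i x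
     - (\<Sum>j\<in>UNIV. velocity_series U \<theta> j x * lift_op (pderiv_x j) (U (Momentum \<theta> i)) x))"

text \<open>The Lorentz equation is the chain rule for
  \<open>(1 + \<epsilon>^2 |\<xi>|^2) powr (- 1 / 2)\<close>, whose derivative brings in the cube of
  the factor. In the rate equation the curl of the magnetic field replaces minus the Laplacian of a
  divergence-free vector potential; the constant mean field drops out under the curl.\<close>

fun mf_rhs :: "'a measure \<Rightarrow> real \<Rightarrow> ('a field_var \<Rightarrow> series) \<Rightarrow> 'a field_var \<Rightarrow> series" where
  "mf_rhs M \<epsilon> U (Density \<theta>) =
     (\<lambda>x. - (\<Sum>i\<in>UNIV. lift_op (pderiv_x i) (\<lambda>x. U (Density \<theta>) x * velocity_series U \<theta> i x) x))"
| "mf_rhs M \<epsilon> U (Momentum \<theta> i) = accel_series M \<epsilon> U \<theta> i"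
| "mf_rhs M \<epsilon> U (Lorentz \<theta>) =
     (\<lambda>x. fps_const (- (\<epsilon>\<^sup>2)) * (U (Lorentz \<theta>) x * U (Lorentz \<theta>) x * U (Lorentz \<theta>) x *
        (\<Sum>i\<in>UNIV. U (Momentum \<theta> i) x * accel_series M \<epsilon> U \<theta> i x)))"
| "mf_rhs M \<epsilon> U (Potential_Rate i) =
     (\<lambda>x. fps_const (1 / \<epsilon>\<^sup>2) *
        (fps_const \<epsilon> * (\<Sum>j\<in>UNIV. lift_op (mult_op (leray_entry i j)) (current_series M U j) x)
         - curl_series (\<lambda>j. U (Magnetic j)) i x))"
| "mf_rhs M \<epsilon> U (Magnetic i) = curl_series (\<lambda>j. U (Potential_Rate j)) i"

text \<open>Causality as a relation that every operation preserves, so that it is proved by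
  following the syntax of the right-hand side.\<close>

definition agree_upto :: "nat \<Rightarrow> series \<Rightarrow> series \<Rightarrow> bool" where
  "agree_upto n U V \<longleftrightarrow> (\<forall>m\<le>n. coeff U m = coeff V m)"

lemma agree_upto_mult:
  assumes "agree_upto n U U'" "agree_upto n V V'"
  shows "agree_upto n (\<lambda>x. U x * V x) (\<lambda>x. U' x * V' x)"
  unfolding agree_upto_def coeff_mult
proof (intro allI impI ext sum.cong refl)
  fix m x i assume "m \<le> n" "i \<in> {..m}"
  then have "coeff U i = coeff U' i" "coeff V (m - i) = coeff V' (m - i)"
    using assms by (auto simp: agree_upto_def)
  then show "coeff U i x * coeff V (m - i) x = coeff U' i x * coeff V' (m - i) x" by simp
qed

lemma coeff_average: "coeff (average M U) n = (\<lambda>x. \<integral>\<theta>. coeff (U \<theta>) n x \<partial>M)"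
  by (auto simp: average_def coeff_def)

lemma agree_upto_intros:
  "agree_upto n U U"
  "agree_upto n U U' \<Longrightarrow> agree_upto n V V' \<Longrightarrow> agree_upto n (\<lambda>x. U x + V x) (\<lambda>x. U' x + V' x)"
  "agree_upto n U U' \<Longrightarrow> agree_upto n V V' \<Longrightarrow> agree_upto n (\<lambda>x. U x - V x) (\<lambda>x. U' x - V' x)"
  "agree_upto n U U' \<Longrightarrow> agree_upto n (\<lambda>x. - U x) (\<lambda>x. - U' x)"
  "(\<And>i. agree_upto n (W i) (W' i)) \<Longrightarrow> agree_upto n (\<lambda>x. \<Sum>i\<in>I. W i x) (\<lambda>x. \<Sum>i\<in>I. W' i x)"
  "agree_upto n U U' \<Longrightarrow> agree_upto n (lift_op L U) (lift_op L U')"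
  "(\<And>\<theta>. agree_upto n (Z \<theta>) (Z' \<theta>)) \<Longrightarrow> agree_upto n (average M Z) (average M Z')"
  by (auto simp: agree_upto_def coeff_average)

lemma causal_mf_rhs: "causal (mf_rhs M \<epsilon>)"
  unfolding causal_def
proof (intro allI impI)
  fix U V :: "'a field_var \<Rightarrow> series" and n s
  assume "\<forall>m\<le>n. \<forall>s. coeff (U s) m = coeff (V s) m"
  then have A: "agree_upto n (U s) (V s)" for s by (simp add: agree_upto_def)
  note I = agree_upto_intros agree_upto_mult A
  have vel: "agree_upto n (velocity_series U \<theta> i) (velocity_series V \<theta> i)" for \<theta> i
    unfolding velocity_series_def by (intro I)
  have cross: "agree_upto n (cross_series W (\<lambda>j. U (Magnetic j)) i) (cross_series W' (\<lambda>j. V (Magnetic j)) i)"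
    if "\<And>i. agree_upto n (W i) (W' i)" for W W' i
    unfolding cross_series_def using that by (auto intro!: I)
  have curl: "agree_upto n (curl_series W i) (curl_series W' i)"
    if "\<And>i. agree_upto n (W i) (W' i)" for W W' i
    unfolding curl_series_def using that by (auto intro!: I)
  have acc: "agree_upto n (accel_series M \<epsilon> U \<theta> i) (accel_series M \<epsilon> V \<theta> i)" for \<theta> i
    unfolding accel_series_def potential_series_def charge_series_def by (intro I cross vel)
  have "agree_upto n (mf_rhs M \<epsilon> U s) (mf_rhs M \<epsilon> V s)"
    by (cases s) (auto simp: current_series_def intro!: I vel acc curl)
  then show "coeff (mf_rhs M \<epsilon> U s) n = coeff (mf_rhs M \<epsilon> V s) n" by (simp add: agree_upto_def)
qed

section \<open>Measurability in the label \<theta>\<close>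

definition measurable_series :: "'a measure \<Rightarrow> ('a \<Rightarrow> series) \<Rightarrow> bool" where
  "measurable_series M W \<longleftrightarrow> (\<forall>n x. (\<lambda>\<theta>. coeff (W \<theta>) n x) \<in> borel_measurable M)"

lemma measurable_series_intros:
  "measurable_series M (\<lambda>\<theta>. U)"
  "measurable_series M W \<Longrightarrow> measurable_series M W' \<Longrightarrow> measurable_series M (\<lambda>\<theta> x. W \<theta> x + W' \<theta> x)"
  "measurable_series M W \<Longrightarrow> measurable_series M W' \<Longrightarrow> measurable_series M (\<lambda>\<theta> x. W \<theta> x - W' \<theta> x)"
  "measurable_series M W \<Longrightarrow> measurable_series M W' \<Longrightarrow> measurable_series M (\<lambda>\<theta> x. W \<theta> x * W' \<theta> x)"
  "measurable_series M W \<Longrightarrow> measurable_series M (\<lambda>\<theta> x. - W \<theta> x)"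
  "(\<And>i. measurable_series M (Z i)) \<Longrightarrow> measurable_series M (\<lambda>\<theta> x. \<Sum>i\<in>I. Z i \<theta> x)"
  by (auto simp: measurable_series_def coeff_mult intro!: borel_measurable_add borel_measurable_diff
      borel_measurable_times borel_measurable_sum)

text \<open>The derivative is a pointwise limit of difference quotients along the steps
  \<open>1 / (m + 1)\<close>.\<close>

lemma measurable_pderiv_x:
  fixes f :: "'a \<Rightarrow> real ^ 3 \<Rightarrow> real"
  assumes meas: "\<And>x. (\<lambda>\<theta>. f \<theta> x) \<in> borel_measurable M" and d: "\<And>\<theta>. \<theta> \<in> space M \<Longrightarrow> f \<theta> differentiable (at x)"
  shows "(\<lambda>\<theta>. pderiv_x i (f \<theta>) x) \<in> borel_measurable M"
proof (rule borel_measurable_LIMSEQ_real)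
  let ?q = "\<lambda>m \<theta>. (f \<theta> (x + inverse (real (Suc m)) *\<^sub>R axis i 1) - f \<theta> x) / inverse (real (Suc m))"
  show "?q m \<in> borel_measurable M" for m using meas by (intro borel_measurable_divide borel_measurable_diff) auto
  fix \<theta> assume "\<theta> \<in> space M"
  then have D: "(f \<theta> has_derivative frechet_derivative (f \<theta>) (at x)) (at x)"
    using d frechet_derivative_works by blast
  have "((\<lambda>h. f \<theta> (x + h *\<^sub>R axis i 1)) has_derivative (\<lambda>h. frechet_derivative (f \<theta>) (at x) (h *\<^sub>R axis i 1))) (at 0)"
    by (rule has_derivative_compose[where f = "\<lambda>h. x + h *\<^sub>R axis i 1" and g = "f \<theta>"])
       (use D in \<open>auto intro!: derivative_eq_intros\<close>)
  moreover have "frechet_derivative (f \<theta>) (at x) (h *\<^sub>R axis i 1) = pderiv_x i (f \<theta>) x * h" for h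
    unfolding pderiv_x_def
    using linear_cmul[OF has_derivative_linear[OF D], of h "axis i 1"] by (simp add: mult.commute)
  ultimately have "((\<lambda>h. f \<theta> (x + h *\<^sub>R axis i 1)) has_field_derivative pderiv_x i (f \<theta>) x) (at 0)"
    by (simp add: has_field_derivative_def)
  then have "((\<lambda>h. (f \<theta> (x + h *\<^sub>R axis i 1) - f \<theta> x) / h) \<longlongrightarrow> pderiv_x i (f \<theta>) x) (at 0)"
    by (simp add: has_field_derivative_iff)
  moreover have "filterlim (\<lambda>m. inverse (real (Suc m))) (at 0) sequentially"
    unfolding filterlim_at using LIMSEQ_inverse_real_of_nat by (auto intro!: always_eventually)
  ultimately show "(\<lambda>m. ?q m \<theta>) \<longlonglongrightarrow> pderiv_x i (f \<theta>) x"
    by (rule filterlim_compose)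
qed

text \<open>The hypotheses on the data concern only labels in \<open>space M\<close>, whereas the
  recursion is set up for all labels.\<close>

definition valid_var :: "'a measure \<Rightarrow> 'a field_var \<Rightarrow> bool" where
  "valid_var M s \<longleftrightarrow> (case s of Density \<theta> \<Rightarrow> \<theta> \<in> space M | Momentum \<theta> i \<Rightarrow> \<theta> \<in> space M
     | Lorentz \<theta> \<Rightarrow> \<theta> \<in> space M | _ \<Rightarrow> True)"

lemma valid_var_simps [simp]:
  "valid_var M (Density \<theta>) \<longleftrightarrow> \<theta> \<in> space M" "valid_var M (Momentum \<theta> i) \<longleftrightarrow> \<theta> \<in> space M"
  "valid_var M (Lorentz \<theta>) \<longleftrightarrow> \<theta> \<in> space M" "valid_var M (Potential_Rate i)" "valid_var M (Magnetic i)"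
  by (simp_all add: valid_var_def)

definition measurable_state :: "'a measure \<Rightarrow> ('a field_var \<Rightarrow> series) \<Rightarrow> bool" where
  "measurable_state M U \<longleftrightarrow> measurable_series M (\<lambda>\<theta>. U (Density \<theta>)) \<and>
     measurable_series M (\<lambda>\<theta>. U (Lorentz \<theta>)) \<and> (\<forall>i. measurable_series M (\<lambda>\<theta>. U (Momentum \<theta> i)))"

text \<open>The bounds on the right-hand side are proved for an arbitrary bounded measurable state,
  since they are applied to every Picard iterate and later to the solution.\<close>

locale mf_state = time_weight a b R + prob_space M
  for a b R :: real and M :: "'a measure" +
  fixes \<epsilon> K :: real and U :: "'a field_var \<Rightarrow> series"
  assumes \<epsilon>: "0 < \<epsilon>" "\<epsilon> \<le> 1" and K: "1 \<le> K"
    and state: "\<And>s. valid_var M s \<Longrightarrow> bounded_series 1 (U s) K"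
    and meas: "measurable_state M U"
begin

lemmas state0 = bounded_series_1_0[OF state]

lemma K_powers: "K \<le> K ^ 3" "K ^ 3 \<le> K ^ 7" "K ^ 2 \<le> K ^ 3"
  using K by (auto intro: power_increasing self_le_power)

lemma velocity_bound:
  "\<theta> \<in> space M \<Longrightarrow> bounded_series 1 (velocity_series U \<theta> i) (K ^ 2)"
  unfolding velocity_series_def power2_eq_square by (intro bounded_series_mult state) auto

lemma flux_bound:
  assumes "\<theta> \<in> space M"
  shows "bounded_series 1 (\<lambda>x. U (Density \<theta>) x * velocity_series U \<theta> i x) (K ^ 3)"
  using bounded_series_mult[OF state[of "Density \<theta>"] velocity_bound[OF assms]] assms
  by (simp add: power2_eq_square power3_eq_cube mult.assoc)

lemma measurable_velocity: "measurable_series M (\<lambda>\<theta>. velocity_series U \<theta> i)"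
  using meas unfolding velocity_series_def measurable_state_def by (intro measurable_series_intros) auto

lemma charge_bound: "bounded_series 1 (charge_series M U) K"
  and fourier_charge: "fourier (coeff (charge_series M U) n) k = (\<integral>\<theta>. fourier (coeff (U (Density \<theta>)) n) k \<partial>M)"
  unfolding charge_series_def
  using bounded_series_average[OF prob_space_axioms, of "\<lambda>\<theta>. U (Density \<theta>)" 1 K] meas state K
  by (auto simp: measurable_state_def measurable_series_def)

lemma current_bound: "bounded_series 1 (current_series M U i) (K ^ 3)"
proof -
  have "measurable_series M (\<lambda>\<theta> x. U (Density \<theta>) x * velocity_series U \<theta> i x)"
    using meas by (intro measurable_series_intros measurable_velocity) (auto simp: measurable_state_def)
  then show ?thesis
    unfolding current_series_def using K flux_bound
    by (intro bounded_series_average(1)[OF prob_space_axioms]) (auto simp: measurable_series_def)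
qed

text \<open>Stated for a bound \<open>d\<close> other than \<open>K\<close>: the constant
  \<open>K\<close> will depend on \<epsilon>, whereas the final estimate of the electric field uses
  the bound of the densities.\<close>

lemma potential_bound':
  assumes "\<And>\<theta>. \<theta> \<in> space M \<Longrightarrow> bounded_series 1 (U (Density \<theta>)) d" "d \<ge> 0"
  shows "bounded_series 1 (potential_series M U) d"
proof -
  have "bounded_series 1 (charge_series M U) d"
    unfolding charge_series_def using assms meas
    by (intro bounded_series_average(1)[OF prob_space_axioms]) (auto simp: measurable_state_def measurable_series_def)
  moreover have "\<bar>inv_laplace_symbol k\<bar> * (1 + norm (int_vec k)) ^ 1 \<le> 1 * (1 + norm (int_vec k)) ^ 0" for k
    using inv_laplace_bound[of k] by simp
  ultimately have "bounded_series 1 (lift_op (mult_op inv_laplace_symbol) (charge_series M U)) (1 * d)"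
    by (intro bounded_series_mult_op[OF bounded_series_1_0 even_bounded_inv_laplace]) auto
  then show ?thesis by (simp add: potential_series_def)
qed

lemma potential_bound: "bounded_series 1 (potential_series M U) K"
  using K by (intro potential_bound' state) auto

lemma curl_bound:
  assumes "\<And>i. bounded_series 1 (W i) K"
  shows "bounded_series 0 (curl_series W i) (16 * K)"
proof -
  have "bounded_series 0 (curl_series W i) (2 * pi * K + 2 * pi * K)"
    by (simp only: curl_series_def split: if_split) (intro conjI impI bounded_series_diff bounded_series_pderiv assms)
  then show ?thesis
    by (rule bounded_series_mono) (use pi_less_4 K mult_right_mono[of pi 4 K] in auto)
qed

text \<open>The constant is 8 + 1 + 2 + 24 for the potential, the rate of the vector potential, the
  magnetic force and the convection term, with \<open>pi < 4\<close> and lower powers of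
  \<open>K\<close> raised to the third.\<close>

lemma accel_bound:
  assumes \<theta>: "\<theta> \<in> space M"
  shows "bounded_series 0 (accel_series M \<epsilon> U \<theta> i) (35 * K ^ 3)"
proof -
  have cr: "bounded_series 0 (cross_series (velocity_series U \<theta>) (\<lambda>j. U (Magnetic j)) i) (K ^ 2 * K + K ^ 2 * K)"
    by (simp only: cross_series_def split: if_split)
       (intro conjI impI bounded_series_diff bounded_series_mult bounded_series_1_0[OF velocity_bound[OF \<theta>]] state0 valid_var_simps)
  have cv: "bounded_series 0 (\<lambda>x. \<Sum>j\<in>UNIV. velocity_series U \<theta> j x * lift_op (pderiv_x j) (U (Momentum \<theta> i)) x)
      (\<Sum>j\<in>(UNIV :: 3 set). K ^ 2 * (2 * pi * K))"
    using \<theta> by (intro bounded_series_sum bounded_series_mult bounded_series_1_0[OF velocity_bound[OF \<theta>]] bounded_series_pderiv state) auto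
  have "bounded_series 0 (accel_series M \<epsilon> U \<theta> i)
     ((((2 * pi * K) + \<bar>\<epsilon>\<bar> * K) + \<bar>\<epsilon>\<bar> * (K ^ 2 * K + K ^ 2 * K)) + (\<Sum>j\<in>(UNIV :: 3 set). K ^ 2 * (2 * pi * K)))"
    unfolding accel_series_def
    by (intro bounded_series_diff bounded_series_add bounded_series_cmult bounded_series_uminus cr cv
        bounded_series_pderiv potential_bound state0) auto
  then show ?thesis
  proof (rule bounded_series_mono)
    have 1: "2 * pi * K \<le> 8 * K ^ 3" using pi_less_4 K K_powers(1) mult_mono[of "2 * pi" 8 K "K ^ 3"] by auto
    have 2: "\<bar>\<epsilon>\<bar> * K \<le> K ^ 3" using \<epsilon> K K_powers(1) mult_mono[of "\<bar>\<epsilon>\<bar>" 1 K "K ^ 3"] by auto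
    have 3: "\<bar>\<epsilon>\<bar> * (K ^ 2 * K + K ^ 2 * K) \<le> 2 * K ^ 3"
      using \<epsilon> K mult_right_mono[of "\<bar>\<epsilon>\<bar>" 1 "2 * K ^ 3"] by (simp add: power2_eq_square power3_eq_cube)
    have 4: "(\<Sum>j\<in>(UNIV :: 3 set). K ^ 2 * (2 * pi * K)) \<le> 24 * K ^ 3"
      using pi_less_4 K mult_right_mono[of pi 4 "K ^ 3"] by (simp add: power2_eq_square power3_eq_cube)
    show "(((2 * pi * K) + \<bar>\<epsilon>\<bar> * K) + \<bar>\<epsilon>\<bar> * (K ^ 2 * K + K ^ 2 * K)) + (\<Sum>j\<in>(UNIV :: 3 set). K ^ 2 * (2 * pi * K)) \<le> 35 * K ^ 3"
      using 1 2 3 4 by linarith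
  qed
qed

text \<open>The Lorentz equation dictates \<open>105 * K ^ 7\<close>: three factors \<open>K\<close>
  from the cube, and for each of the three components \<open>K\<close> times the acceleration bound
  \<open>35 * K ^ 3\<close>. The division by \<open>\<epsilon>\<^sup>2\<close> comes from the wave
  equation.\<close>

lemma rhs_bound:
  assumes s: "valid_var M s"
  shows "bounded_series 0 (mf_rhs M \<epsilon> U s) (105 * K ^ 7 / \<epsilon>\<^sup>2)"
proof -
  have e: "0 < \<epsilon>\<^sup>2" "\<epsilon>\<^sup>2 \<le> 1" using \<epsilon> by (auto simp: power_le_one)
  have K7: "0 < K ^ 7" "105 * K ^ 7 \<le> 105 * K ^ 7 / \<epsilon>\<^sup>2" using K e by (auto simp: field_simps mult_left_le)
  show ?thesis
  proof (cases s)
    case (Density \<theta>)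
    then have \<theta>: "\<theta> \<in> space M" using s by simp
    have "bounded_series 0 (mf_rhs M \<epsilon> U s) (\<Sum>i\<in>(UNIV::3 set). 2 * pi * K ^ 3)"
      unfolding Density mf_rhs.simps
      by (intro bounded_series_uminus bounded_series_sum bounded_series_pderiv flux_bound \<theta>)
    moreover have "(\<Sum>i\<in>(UNIV::3 set). 2 * pi * K ^ 3) \<le> 105 * K ^ 7 / \<epsilon>\<^sup>2"
    proof -
      have "pi * K ^ 3 \<le> 4 * K ^ 3" using pi_less_4 K by (intro mult_right_mono) auto
      moreover have "(\<Sum>i\<in>(UNIV::3 set). 2 * pi * K ^ 3) = 6 * (pi * K ^ 3)" by simp
      ultimately show ?thesis using K7 K_powers K by linarith
    qed
    ultimately show ?thesis by (rule bounded_series_mono)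
  next
    case (Momentum \<theta> i)
    then have "bounded_series 0 (mf_rhs M \<epsilon> U s) (35 * K ^ 3)" using s accel_bound by simp
    then show ?thesis by (rule bounded_series_mono) (use K7 K_powers in linarith)
  next
    case (Lorentz \<theta>)
    then have \<theta>: "\<theta> \<in> space M" using s by simp
    have "bounded_series 0 (mf_rhs M \<epsilon> U s) (\<bar>- (\<epsilon>\<^sup>2)\<bar> * (K * K * K * (\<Sum>i\<in>(UNIV::3 set). K * (35 * K ^ 3))))"
      unfolding Lorentz mf_rhs.simps
      by (intro bounded_series_cmult bounded_series_mult bounded_series_sum accel_bound \<theta> state0) (use \<theta> in auto)
    moreover have "\<bar>- (\<epsilon>\<^sup>2)\<bar> * (K * K * K * (\<Sum>i\<in>(UNIV::3 set). K * (35 * K ^ 3))) \<le> 105 * K ^ 7 / \<epsilon>\<^sup>2"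
    proof -
      have "\<bar>- (\<epsilon>\<^sup>2)\<bar> * (K * K * K * (\<Sum>i\<in>(UNIV::3 set). K * (35 * K ^ 3))) = \<epsilon>\<^sup>2 * (105 * K ^ 7)"
        by (simp add: eval_nat_numeral)
      also have "\<dots> \<le> 105 * K ^ 7" using e K7 by (intro mult_left_le_one_le) auto
      finally show ?thesis using K7 by linarith
    qed
    ultimately show ?thesis by (rule bounded_series_mono)
  next
    case (Potential_Rate i)
    have "bounded_series 0 (lift_op (mult_op (leray_entry i j)) (current_series M U j)) (2 * K ^ 3)" for j
    proof -
      have "\<bar>leray_entry i j k\<bar> * (1 + norm (int_vec k)) ^ 0 \<le> 2 * (1 + norm (int_vec k)) ^ 0" for k
        using even_bounded_leray[of i j] by (simp add: even_bounded_def)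
      from bounded_series_mult_op[OF bounded_series_1_0[OF current_bound] even_bounded_leray this]
      show ?thesis by simp
    qed
    then have "bounded_series 0 (mf_rhs M \<epsilon> U s) (\<bar>1 / \<epsilon>\<^sup>2\<bar> * (\<bar>\<epsilon>\<bar> * (\<Sum>j\<in>(UNIV::3 set). 2 * K ^ 3) + 16 * K))"
      unfolding Potential_Rate mf_rhs.simps
      by (intro bounded_series_cmult bounded_series_diff bounded_series_sum curl_bound state) auto
    moreover have "\<bar>1 / \<epsilon>\<^sup>2\<bar> * (\<bar>\<epsilon>\<bar> * (\<Sum>j\<in>(UNIV::3 set). 2 * K ^ 3) + 16 * K) \<le> 105 * K ^ 7 / \<epsilon>\<^sup>2"
    proof -
      have "\<bar>\<epsilon>\<bar> * (\<Sum>j\<in>(UNIV::3 set). 2 * K ^ 3) \<le> 1 * (6 * K ^ 3)" using \<epsilon> K by (intro mult_mono) auto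
      then have "\<bar>\<epsilon>\<bar> * (\<Sum>j\<in>(UNIV::3 set). 2 * K ^ 3) + 16 * K \<le> 105 * K ^ 7" using K_powers K by linarith
      then show ?thesis using e by (simp add: divide_right_mono)
    qed
    ultimately show ?thesis by (rule bounded_series_mono)
  next
    case (Magnetic i)
    have "bounded_series 0 (mf_rhs M \<epsilon> U s) (16 * K)" unfolding Magnetic mf_rhs.simps by (intro curl_bound state) auto
    then show ?thesis by (rule bounded_series_mono) (use K7 K K_powers in linarith)
  qed
qed

lemma measurable_pderiv_series:
  assumes "measurable_series M W" "\<And>\<theta>. \<theta> \<in> space M \<Longrightarrow> bounded_series 1 (W \<theta>) c"
  shows "measurable_series M (\<lambda>\<theta>. lift_op (pderiv_x i) (W \<theta>))"
  using assms unfolding measurable_series_def coeff_simps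
  by (auto intro!: measurable_pderiv_x bounded_series_deriv(2))

lemma measurable_accel: "measurable_series M (\<lambda>\<theta>. accel_series M \<epsilon> U \<theta> i)"
proof -
  have "measurable_series M (\<lambda>\<theta>. cross_series (velocity_series U \<theta>) (\<lambda>j. U (Magnetic j)) i)"
    unfolding cross_series_def
    by (cases "i = 1"; cases "i = 2") (auto intro!: measurable_series_intros measurable_velocity)
  moreover have "measurable_series M (\<lambda>\<theta>. lift_op (pderiv_x j) (U (Momentum \<theta> i)))" for j
    by (rule measurable_pderiv_series[where c = K]) (use meas state in \<open>auto simp: measurable_state_def\<close>)
  ultimately show ?thesis
    unfolding accel_series_def by (intro measurable_series_intros measurable_velocity)
qed

lemma measurable_rhs: "measurable_state M (mf_rhs M \<epsilon> U)"
  unfolding measurable_state_def mf_rhs.simps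
proof (intro conjI allI measurable_accel)
  have md: "measurable_series M (\<lambda>\<theta>. U (Density \<theta>))" and ml: "measurable_series M (\<lambda>\<theta>. U (Lorentz \<theta>))"
    and mm: "measurable_series M (\<lambda>\<theta>. U (Momentum \<theta> i))" for i
    using meas by (auto simp: measurable_state_def)
  show "measurable_series M (\<lambda>\<theta> x. - (\<Sum>i\<in>UNIV. lift_op (pderiv_x i) (\<lambda>x. U (Density \<theta>) x * velocity_series U \<theta> i x) x))"
    by (intro measurable_series_intros measurable_pderiv_series[OF _ flux_bound] md measurable_velocity)
  show "measurable_series M (\<lambda>\<theta> x. fps_const (- \<epsilon>\<^sup>2) * (U (Lorentz \<theta>) x * U (Lorentz \<theta>) x * U (Lorentz \<theta>) x *
      (\<Sum>i\<in>UNIV. U (Momentum \<theta> i) x * accel_series M \<epsilon> U \<theta> i x)))"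
    by (intro measurable_series_intros measurable_accel ml mm)
qed

end

text \<open>\<open>c\<close> bounds each initial value separately and \<open>K\<close> is a common
  ceiling. By \<open>small\<close> an integration adds at most 1, so \<open>c s + 1 \<le> K\<close>
  reproduces the assumption under which the right-hand side was estimated.\<close>

locale mf_initial = time_weight a b R + prob_space M
  for a b R :: real and M :: "'a measure" +
  fixes \<epsilon> K :: real and u :: "'a field_var \<Rightarrow> real ^ 3 \<Rightarrow> real" and c :: "'a field_var \<Rightarrow> real"
  assumes \<epsilon>: "0 < \<epsilon>" "\<epsilon> \<le> 1" and K: "1 \<le> K"
    and init: "\<And>s. valid_var M s \<Longrightarrow> periodic_continuous (u s) \<and> fsum (jweight 1 0) (u s) \<le> ennreal (c s) \<and> 0 \<le> c s \<and> c s + 1 \<le> K"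
    and init_meas: "\<And>x. (\<lambda>\<theta>. u (Density \<theta>) x) \<in> borel_measurable M" "\<And>x. (\<lambda>\<theta>. u (Lorentz \<theta>) x) \<in> borel_measurable M"
      "\<And>i x. (\<lambda>\<theta>. u (Momentum \<theta> i) x) \<in> borel_measurable M"
    and small: "gain * (105 * K ^ 7 / \<epsilon>\<^sup>2) \<le> 1"
begin

lemma measurable_series_integral:
  assumes "measurable_series M W" "\<And>x. (\<lambda>\<theta>. v \<theta> x) \<in> borel_measurable M"
  shows "measurable_series M (\<lambda>\<theta> x. fps_integral (W \<theta> x) (v \<theta> x))"
  unfolding measurable_series_def
proof (intro allI)
  fix n x
  show "(\<lambda>\<theta>. coeff (\<lambda>x. fps_integral (W \<theta> x) (v \<theta> x)) n x) \<in> borel_measurable M"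
    using assms by (cases n) (auto simp: coeff_integral_Suc measurable_series_def simp del: of_nat_Suc intro!: borel_measurable_times)
qed

lemma picard_step:
  assumes "\<And>s. valid_var M s \<Longrightarrow> bounded_series 0 (F s) (105 * K ^ 7 / \<epsilon>\<^sup>2)" "measurable_state M F"
  shows "valid_var M s \<Longrightarrow> bounded_series 1 (\<lambda>x. fps_integral (F s x) (u s x)) (c s + 1)"
    "measurable_state M (\<lambda>s x. fps_integral (F s x) (u s x))"
proof -
  assume s: "valid_var M s"
  have "bounded_series 1 (\<lambda>x. fps_integral (F s x) (u s x)) (c s + gain * (105 * K ^ 7 / \<epsilon>\<^sup>2))"
    using init[OF s] by (intro bounded_series_integral assms(1) s) auto
  then show "bounded_series 1 (\<lambda>x. fps_integral (F s x) (u s x)) (c s + 1)"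
    by (rule bounded_series_mono) (use small in simp)
next
  show "measurable_state M (\<lambda>s x. fps_integral (F s x) (u s x))"
    using assms(2) init_meas unfolding measurable_state_def by (auto intro!: measurable_series_integral)
qed

text \<open>Measurability in \<theta> belongs to the induction hypothesis because the next iterate
  contains averages over the labels.\<close>

lemma picard_bound:
  "(\<forall>s. valid_var M s \<longrightarrow> bounded_series 1 (picard (mf_rhs M \<epsilon>) u m s) (c s + 1)) \<and>
   measurable_state M (picard (mf_rhs M \<epsilon>) u m)"
proof (induction m)
  case 0
  have "bounded_series 0 (\<lambda>x. 0) (105 * K ^ 7 / \<epsilon>\<^sup>2)"
    using bounded_series_mono[OF bounded_series_const[of 0 0]] K \<epsilon> by simp
  moreover have "measurable_state M (\<lambda>s x. 0)"
    by (simp add: measurable_state_def measurable_series_intros)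
  ultimately show ?case using picard_step[of "\<lambda>s x. 0"] by simp
next
  case (Suc m)
  have "mf_state a b R M \<epsilon> K (picard (mf_rhs M \<epsilon>) u m)"
    using Suc \<epsilon> K init by unfold_locales (auto intro: bounded_series_mono)
  then interpret mf_state a b R M \<epsilon> K "picard (mf_rhs M \<epsilon>) u m" .
  show ?case using picard_step[OF rhs_bound measurable_rhs] by simp
qed

definition sol :: "'a field_var \<Rightarrow> series" where
  "sol = formal_solution (mf_rhs M \<epsilon>) u"

lemma sol_bound: "valid_var M s \<Longrightarrow> bounded_series 1 (sol s) (c s + 1)"
  unfolding sol_def using picard_bound by (intro bounded_series_formal_solution causal_mf_rhs) blast

lemma measurable_sol: "measurable_state M sol"
proof -
  have "coeff (sol s) n = coeff (picard (mf_rhs M \<epsilon>) u n s) n" for n s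
    unfolding sol_def by (rule picard_stable[OF causal_mf_rhs order_refl, symmetric])
  then show ?thesis using picard_bound by (simp add: measurable_state_def measurable_series_def)
qed

lemma sol_eq: "sol s = (\<lambda>x. fps_integral (mf_rhs M \<epsilon> sol s x) (u s x))"
  unfolding sol_def by (rule formal_solution[OF causal_mf_rhs])

lemma sol_deriv: "fps_deriv (sol s x) = mf_rhs M \<epsilon> sol s x"
  by (subst sol_eq) (rule fps_deriv_fps_integral)

lemma coeff_sol_0: "coeff (sol s) 0 = u s"
  by (subst sol_eq) simp

lemma coeff_sol_Suc: "coeff (sol s) (Suc n) = (\<lambda>x. inverse (real (Suc n)) * coeff (mf_rhs M \<epsilon> sol s) n x)"
  by (subst sol_eq) (rule coeff_integral_Suc)

text \<open>All estimates for states become available for the solution itself.\<close>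

sublocale mf_state a b R M \<epsilon> K sol
  using \<epsilon> K sol_bound init measurable_sol by unfold_locales (auto intro: bounded_series_mono)

end

subsection \<open>Differential identities\<close>

text \<open>The rate is read off from the prescribed electric field: \<epsilon> times it equals
  \<open>- (E0 + grad \<phi>)\<close> at time zero, with \<phi> the mean-free potential of the
  initial charge.\<close>

fun mf_init :: "'a measure \<Rightarrow> real \<Rightarrow> ('a \<Rightarrow> real ^ 3 \<Rightarrow> real) \<Rightarrow> ('a \<Rightarrow> real ^ 3 \<Rightarrow> real ^ 3) \<Rightarrow>
    (real ^ 3 \<Rightarrow> real ^ 3) \<Rightarrow> (real ^ 3 \<Rightarrow> real ^ 3) \<Rightarrow> 'a field_var \<Rightarrow> real ^ 3 \<Rightarrow> real" where
  "mf_init M \<epsilon> \<rho>0 \<xi>0 E0 B0 (Density \<theta>) = \<rho>0 \<theta>"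
| "mf_init M \<epsilon> \<rho>0 \<xi>0 E0 B0 (Momentum \<theta> i) = (\<lambda>x. \<xi>0 \<theta> x $ i)"
| "mf_init M \<epsilon> \<rho>0 \<xi>0 E0 B0 (Lorentz \<theta>) = (\<lambda>x. (1 + \<epsilon>\<^sup>2 * (norm (\<xi>0 \<theta> x))\<^sup>2) powr (- 1 / 2))"
| "mf_init M \<epsilon> \<rho>0 \<xi>0 E0 B0 (Potential_Rate i) =
     (\<lambda>x. - (1 / \<epsilon>) * (E0 x $ i + pderiv_x i (mult_op inv_laplace_symbol (charge_density M \<rho>0)) x))"
| "mf_init M \<epsilon> \<rho>0 \<xi>0 E0 B0 (Magnetic i) = (\<lambda>x. B0 x $ i)"

definition curl_symbol :: "int ^ 3 \<Rightarrow> (3 \<Rightarrow> complex) \<Rightarrow> 3 \<Rightarrow> complex" where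
  "curl_symbol k w i =
     (if i = 1 then deriv_symbol 2 k * w 3 - deriv_symbol 3 k * w 2
      else if i = 2 then deriv_symbol 3 k * w 1 - deriv_symbol 1 k * w 3
      else deriv_symbol 1 k * w 2 - deriv_symbol 2 k * w 1)"

lemma one_two_three_distinct [simp]: "(1::3) \<noteq> 2" "(2::3) \<noteq> 1" "(1::3) \<noteq> 3" "(3::3) \<noteq> 1" "(2::3) \<noteq> 3" "(3::3) \<noteq> 2"
  by simp_all

lemma div_curl_symbol: "(\<Sum>i\<in>UNIV. deriv_symbol i k * curl_symbol k w i) = 0"
  by (simp add: sum_3 curl_symbol_def algebra_simps)

lemma curl_symbol_cmult: "curl_symbol k (\<lambda>j. c * w j) i = c * curl_symbol k w i"
  by (simp add: curl_symbol_def algebra_simps)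

lemma curl_symbol_0: "curl_symbol 0 w i = 0"
  by (simp add: curl_symbol_def deriv_symbol_def)

lemma sum_deriv_symbol_sq: "(\<Sum>i\<in>UNIV. deriv_symbol i k * deriv_symbol i k) = - of_real (4 * pi\<^sup>2 * (norm (int_vec k))\<^sup>2)"
proof -
  have "(norm (int_vec k))\<^sup>2 = (\<Sum>i\<in>UNIV. (of_int (k $ i))\<^sup>2)"
    unfolding power2_norm_eq_inner inner_vec_def by (simp add: power2_eq_square)
  then show ?thesis
    by (simp add: sum_3 deriv_symbol_def power2_eq_square algebra_simps)
qed

text \<open>The identity \<open>curl curl = grad div - \<Delta>\<close> on the side of the symbols,
  for a field without divergence.\<close>

lemma curl_curl_symbol:
  assumes "(\<Sum>i\<in>UNIV. deriv_symbol i k * w i) = 0"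
  shows "curl_symbol k (curl_symbol k w) i = of_real (4 * pi\<^sup>2 * (norm (int_vec k))\<^sup>2) * w i"
proof -
  have d: "deriv_symbol 1 k * w 1 = - (deriv_symbol 2 k * w 2) - deriv_symbol 3 k * w 3"
    using assms by (simp add: sum_3 algebra_simps eq_neg_iff_add_eq_0)
  have "of_real (4 * pi\<^sup>2 * (norm (int_vec k))\<^sup>2) = - (\<Sum>i\<in>UNIV. deriv_symbol i k * deriv_symbol i k)"
    by (simp add: sum_deriv_symbol_sq)
  then have *: "of_real (4 * pi\<^sup>2 * (norm (int_vec k))\<^sup>2) =
      - (deriv_symbol 1 k * deriv_symbol 1 k + deriv_symbol 2 k * deriv_symbol 2 k + deriv_symbol 3 k * deriv_symbol 3 k)"
    by (simp add: sum_3)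
  have "curl_symbol k (curl_symbol k w) i =
      deriv_symbol i k * (\<Sum>i\<in>UNIV. deriv_symbol i k * w i)
      - (deriv_symbol 1 k * deriv_symbol 1 k + deriv_symbol 2 k * deriv_symbol 2 k + deriv_symbol 3 k * deriv_symbol 3 k) * w i"
    using exhaust_3[of i] by (auto simp: curl_symbol_def sum_3 algebra_simps)
  then show ?thesis unfolding * assms by (simp only: mult_zero_right diff_0 mult_minus_left)
qed

lemma inv_laplace_mult: "of_real (inv_laplace_symbol k) * of_real (4 * pi\<^sup>2 * (norm (int_vec k))\<^sup>2) = (if k = 0 then 0 else 1 :: complex)"
  by (simp add: inv_laplace_symbol_def flip: of_real_mult)

lemma deriv_symbol_0 [simp]: "deriv_symbol i 0 = 0"
  by (simp add: deriv_symbol_def)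

lemma div_leray_entry: "(\<Sum>i\<in>UNIV. deriv_symbol i k * of_real (leray_entry i j k)) = 0"
proof (cases "k = 0")
  case False
  have n: "(norm (int_vec k))\<^sup>2 = (\<Sum>i\<in>UNIV. of_int (k $ i) * of_int (k $ i))"
    by (simp add: power2_norm_eq_inner inner_vec_def)
  have "(\<Sum>i\<in>UNIV. of_int (k $ i) * leray_entry i j k) =
      (\<Sum>i\<in>UNIV. if i = j then of_int (k $ i) else 0) - (\<Sum>i\<in>UNIV. of_int (k $ i) * of_int (k $ i)) * (of_int (k $ j) / (norm (int_vec k))\<^sup>2)"
    unfolding leray_entry_def sum_distrib_right sum_subtractf[symmetric] by (intro sum.cong) (auto simp: algebra_simps)
  also have "\<dots> = 0" unfolding n[symmetric] using False by simp
  finally have "of_real (\<Sum>i\<in>UNIV. of_int (k $ i) * leray_entry i j k) = (0 :: complex)" by simp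
  then have "2 * pi * \<i> * (\<Sum>i\<in>UNIV. of_int (k $ i) * of_real (leray_entry i j k)) = 0" by simp
  then show ?thesis by (simp add: deriv_symbol_def sum_distrib_left mult.assoc)
qed (simp)

lemma fourier_zero_mode: "fourier f 0 = of_real (torus_mean f)"
  unfolding fourier_eq torus_mean_eq by simp

lemma coeff_one: "coeff (\<lambda>x. 1) n = (\<lambda>x. if n = 0 then 1 else 0)"
  and coeff_zero: "coeff (\<lambda>x. 0) n = (\<lambda>x. 0)"
  by (auto simp: coeff_def)

text \<open>Reduces identities between time series to algebra with symbols, order by order and mode
  by mode.\<close>

lemma series_eqI:
  assumes "\<And>n. periodic_continuous (coeff U n)" "\<And>n. periodic_continuous (coeff V n)"
    "\<And>n k. fourier (coeff U n) k = fourier (coeff V n) k"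
  shows "U = V"
  by (rule coeff_eqI, rule fourier_inject) (use assms in auto)

context time_weight
begin

lemma fourier_curl_series:
  assumes W: "\<And>j. bounded_series l (W j) (d j)"
  shows "fourier (coeff (curl_series W i) n) k = curl_symbol k (\<lambda>j. fourier (coeff (W j) n) k) i"
proof -
  note D = bounded_series_deriv[OF W]
  have c: "continuous_on UNIV (pderiv_x i (coeff (W j) n))" for i j by (intro periodic_continuousD D)
  show ?thesis
    unfolding curl_series_def curl_symbol_def by (auto simp: fourier_diff c D)
qed

lemma periodic_continuous_curl_series:
  assumes W: "\<And>j. bounded_series l (W j) (d j)"
  shows "periodic_continuous (coeff (curl_series W i) n)"
  unfolding curl_series_def by (auto intro!: periodic_continuous_intros bounded_series_deriv[OF W])

end

text \<open>The compatibility conditions on the electromagnetic data enter here. \<open>s0\<close>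
  is a decay rate for the electric field that permits computing its divergence mode by mode.\<close>

locale mf_data = mf_initial a b R M \<epsilon> K "mf_init M \<epsilon> \<rho>0 \<xi>0 E0 B0" c
  for a b R :: real and M :: "'a measure" and \<epsilon> K :: real and \<rho>0 \<xi>0 E0 B0 c +
  fixes s0 :: real
  assumes s0: "s0 > 0"
    and E0: "\<And>i. periodic_continuous (\<lambda>x. E0 x $ i)" "\<And>i. fsum (exp_weight s0) (\<lambda>x. E0 x $ i) < \<infinity>"
    and div_E0: "\<And>x. divergence E0 x = charge_density M \<rho>0 x - 1"
    and div_B0: "\<And>x. divergence B0 x = 0"
begin

abbreviation "rate \<equiv> \<lambda>i. sol (Potential_Rate i)"
abbreviation "mag \<equiv> \<lambda>i. sol (Magnetic i)"

lemma rate_bound: "bounded_series 1 (rate i) K" and mag_bound: "bounded_series 1 (mag i) K"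
  by (intro state; simp)+

lemma charge_0: "coeff (charge_series M sol) 0 = charge_density M \<rho>0"
  by (simp add: charge_series_def coeff_average coeff_sol_0 charge_density_def[abs_def])

lemma fourier_divergence:
  assumes "\<And>i. periodic_continuous (\<lambda>x. F x $ i)" "\<And>i. fsum (exp_weight s0) (\<lambda>x. F x $ i) < \<infinity>"
  shows "fourier (divergence F) k = (\<Sum>i\<in>UNIV. deriv_symbol i k * fourier (\<lambda>x. F x $ i) k)"
proof -
  note P = pderiv_fourier[OF assms(1) fsum_exp_weight_summable(1)[OF s0 assms(2)]]
  show ?thesis
    unfolding divergence_def[abs_def] by (subst fourier_sum) (simp_all add: P periodic_continuousD(1)[OF P(2)])
qed

lemma div_E0_fourier:
  "(\<Sum>i\<in>UNIV. deriv_symbol i k * fourier (\<lambda>x. E0 x $ i) k) =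
   fourier (coeff (charge_series M sol) 0) k - (if k = 0 then 1 else 0)"
proof -
  have "divergence E0 = (\<lambda>x. coeff (charge_series M sol) 0 x - 1)"
    by (simp add: fun_eq_iff div_E0 charge_0)
  then show ?thesis
    unfolding fourier_divergence[OF E0, symmetric]
    by (simp add: fourier_diff fourier_const bounded_seriesD(3)[OF charge_bound])
qed

text \<open>Conservation of the total charge. At order zero it equals 1 because the divergence of
  \<open>E0\<close> has mean zero; at higher orders the coefficients are averages of
  divergences.\<close>

lemma charge_zero_mode: "fourier (coeff (charge_series M sol) n) 0 = (if n = 0 then 1 else 0)"
proof (cases n)
  case 0
  then show ?thesis using div_E0_fourier[of 0] by simp
next
  case (Suc m)
  have "fourier (coeff (sol (Density \<theta>)) (Suc m)) 0 = 0" if \<theta>: "\<theta> \<in> space M" for \<theta>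
  proof -
    note D = bounded_series_deriv[OF flux_bound[OF \<theta>]]
    show ?thesis
      unfolding coeff_sol_Suc mf_rhs.simps coeff_simps fourier_cmult fourier_uminus
      by (subst fourier_sum) (simp_all add: D periodic_continuousD(1)[OF D(1)])
  qed
  then show ?thesis
    unfolding fourier_charge Suc by (simp cong: Bochner_Integration.integral_cong)
qed

lemma fourier_potential:
  "fourier (coeff (potential_series M sol) n) k = of_real (inv_laplace_symbol k) * fourier (coeff (charge_series M sol) n) k"
  unfolding potential_series_def coeff_simps
  by (rule mult_op(2)[OF even_bounded_inv_laplace bounded_series_summable(3)[OF charge_bound]])

text \<open>Composing the Laplacian with its inverse removes the mean, and by
  \<open>charge_zero_mode\<close> this mean is the neutralising background 1.\<close>

lemma poisson_series:
  "(\<lambda>x. - (\<Sum>i\<in>UNIV. lift_op (pderiv_x i) (lift_op (pderiv_x i) (potential_series M sol)) x)) =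
   (\<lambda>x. charge_series M sol x - fps_const 1)"
proof (rule series_eqI)
  note D1 = bounded_series_deriv[OF potential_bound]
  note D2 = bounded_series_deriv[OF bounded_series_pderiv[OF potential_bound], unfolded coeff_simps]
  show "periodic_continuous (coeff (\<lambda>x. - (\<Sum>i\<in>UNIV. lift_op (pderiv_x i) (lift_op (pderiv_x i) (potential_series M sol)) x)) n)" for n
    by (auto intro!: periodic_continuous_intros periodic_continuous_sum D2)
  show "periodic_continuous (coeff (\<lambda>x. charge_series M sol x - fps_const 1) n)" for n
    by (auto simp: coeff_const coeff_one intro!: periodic_continuous_intros bounded_seriesD(2)[OF charge_bound])
  fix n k
  have "fourier (coeff (\<lambda>x. - (\<Sum>i\<in>UNIV. lift_op (pderiv_x i) (lift_op (pderiv_x i) (potential_series M sol)) x)) n) k =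
      - (\<Sum>i\<in>UNIV. deriv_symbol i k * deriv_symbol i k) * fourier (coeff (potential_series M sol) n) k"
    unfolding coeff_simps fourier_uminus
    by (subst fourier_sum) (simp_all add: D1 D2 periodic_continuousD(1)[OF D2(1)] sum_distrib_right mult.assoc)
  also have "\<dots> = (of_real (inv_laplace_symbol k) * of_real (4 * pi\<^sup>2 * (norm (int_vec k))\<^sup>2)) * fourier (coeff (charge_series M sol) n) k"
    by (simp add: fourier_potential sum_deriv_symbol_sq)
  also have "\<dots> = fourier (coeff (charge_series M sol) n) k - (if n = 0 \<and> k = 0 then 1 else 0)"
    unfolding inv_laplace_mult using charge_zero_mode[of n] by auto
  also have "\<dots> = fourier (coeff (\<lambda>x. charge_series M sol x - fps_const 1) n) k"
    by (cases "n = 0") (simp_all add: coeff_one fourier_diff bounded_seriesD(3)[OF charge_bound] fourier_const)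
  finally show "fourier (coeff (\<lambda>x. - (\<Sum>i\<in>UNIV. lift_op (pderiv_x i) (lift_op (pderiv_x i) (potential_series M sol)) x)) n) k
    = fourier (coeff (\<lambda>x. charge_series M sol x - fps_const 1) n) k" .
qed

text \<open>Propagation of the Coulomb gauge. At order zero the Gauss law for \<open>E0\<close>
  cancels against the Poisson equation; later coefficients consist of Leray projections and
  curls.\<close>

lemma div_rate: "(\<Sum>i\<in>UNIV. deriv_symbol i k * fourier (coeff (rate i) n) k) = 0"
proof (cases n)
  case 0
  note D = bounded_series_deriv[OF potential_bound, where n = 0]
  have p0: "mult_op inv_laplace_symbol (charge_density M \<rho>0) = coeff (potential_series M sol) 0"
    by (simp add: potential_series_def charge_0)
  have F0: "fourier (coeff (rate i) 0) k = - of_real (1 / \<epsilon>) * (fourier (\<lambda>x. E0 x $ i) k + deriv_symbol i k * fourier (coeff (potential_series M sol) 0) k)" for i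
    unfolding coeff_sol_0 mf_init.simps p0 fourier_cmult
    by (subst fourier_add) (simp_all add: D periodic_continuousD(1)[OF D(1)] periodic_continuousD(1)[OF E0(1)])
  have "(\<Sum>i\<in>UNIV. deriv_symbol i k * fourier (coeff (rate i) 0) k) =
     - of_real (1 / \<epsilon>) * ((\<Sum>i\<in>UNIV. deriv_symbol i k * fourier (\<lambda>x. E0 x $ i) k)
        + (\<Sum>i\<in>UNIV. deriv_symbol i k * deriv_symbol i k) * fourier (coeff (potential_series M sol) 0) k)"
    unfolding F0 sum_3 by (simp only: algebra_simps)
  also have "\<dots> = - of_real (1 / \<epsilon>) * (fourier (coeff (charge_series M sol) 0) k - (if k = 0 then 1 else 0)
        - (of_real (inv_laplace_symbol k) * of_real (4 * pi\<^sup>2 * (norm (int_vec k))\<^sup>2)) * fourier (coeff (charge_series M sol) 0) k)"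
    unfolding div_E0_fourier sum_deriv_symbol_sq fourier_potential by (simp add: mult_ac)
  also have "\<dots> = 0" unfolding inv_laplace_mult using charge_zero_mode[of 0] by auto
  finally show ?thesis by (simp add: 0)
next
  case (Suc m)
  let ?J = "\<lambda>j. fourier (coeff (current_series M sol j) m) k"
  let ?B = "curl_symbol k (\<lambda>j. fourier (coeff (mag j) m) k)"
  note L = mult_op[OF even_bounded_leray bounded_series_summable(3)[OF current_bound]]
  have F1: "fourier (coeff (rate i) (Suc m)) k = of_real (inverse (real (Suc m)) * (1 / \<epsilon>\<^sup>2)) *
      (of_real \<epsilon> * (\<Sum>j\<in>UNIV. of_real (leray_entry i j k) * ?J j) - ?B i)" for i
    unfolding coeff_sol_Suc mf_rhs.simps coeff_simps fourier_cmult
    apply (subst fourier_diff)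
      apply (intro continuous_intros periodic_continuousD(1)[OF L(1)])
     apply (intro periodic_continuousD(1)[OF periodic_continuous_curl_series[OF mag_bound]])
    unfolding fourier_cmult fourier_curl_series[OF mag_bound]
    by (subst fourier_sum) (simp_all add: L periodic_continuousD(1)[OF L(1)] del: of_nat_Suc)
  have "(\<Sum>i\<in>UNIV. deriv_symbol i k * fourier (coeff (rate i) (Suc m)) k) =
     of_real (inverse (real (Suc m)) * (1 / \<epsilon>\<^sup>2)) *
      (of_real \<epsilon> * (\<Sum>j\<in>UNIV. (\<Sum>i\<in>UNIV. deriv_symbol i k * of_real (leray_entry i j k)) * ?J j)
       - (\<Sum>i\<in>UNIV. deriv_symbol i k * ?B i))"
    unfolding F1 sum_3 by (simp only: algebra_simps)
  then show ?thesis by (simp add: div_leray_entry div_curl_symbol Suc del: of_nat_Suc)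
qed

lemma div_mag_0: "(\<Sum>i\<in>UNIV. deriv_symbol i k * fourier (coeff (mag i) 0) k) = 0"
proof -
  note D = bounded_series_deriv[OF mag_bound, where n = 0, unfolded coeff_sol_0 mf_init.simps]
  have "fourier (divergence B0) k = (\<Sum>i\<in>UNIV. deriv_symbol i k * fourier (\<lambda>x. B0 x $ i) k)"
    unfolding divergence_def[abs_def] by (subst fourier_sum) (simp_all add: D periodic_continuousD(1)[OF D(1)])
  moreover have "divergence B0 = (\<lambda>x. 0)" using div_B0 by auto
  ultimately show ?thesis by (simp add: coeff_sol_0 fourier_const split: if_splits)
qed

text \<open>Biot-Savart law: the divergence-free, mean-free field whose curl is the fluctuating part
  of the initial magnetic field.\<close>

definition pot0 :: "3 \<Rightarrow> real ^ 3 \<Rightarrow> real" where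
  "pot0 i = mult_op inv_laplace_symbol (coeff (curl_series mag i) 0)"

definition vpot :: "3 \<Rightarrow> series" where
  "vpot i = (\<lambda>x. fps_integral (rate i x) (pot0 i x))"

lemma vpot_bound: obtains d where "bounded_series 1 (vpot i) d"
proof -
  have "\<bar>inv_laplace_symbol k\<bar> * (1 + norm (int_vec k)) ^ 1 \<le> 1 * (1 + norm (int_vec k)) ^ 0" for k
    using inv_laplace_bound[of k] by simp
  from bounded_series_mult_op[OF curl_bound[OF mag_bound] even_bounded_inv_laplace this]
  have b: "bounded_series 1 (lift_op (mult_op inv_laplace_symbol) (curl_series mag i)) (16 * K)" by simp
  have "bounded_series 1 (vpot i) (16 * K + gain * K)"
    unfolding vpot_def
    using bounded_seriesD(2)[OF b, of 0] bounded_seriesD(5)[OF b, of 0] K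
    by (intro bounded_series_integral bounded_series_1_0[OF rate_bound]) (auto simp: pot0_def)
  then show ?thesis by (rule that)
qed

text \<open>Some finite bound suffices here, since the electric and magnetic fields are estimated
  through \<open>rate\<close> and \<open>mag\<close>.\<close>

definition vpot_norm :: "3 \<Rightarrow> real" where "vpot_norm i = (SOME d. bounded_series 1 (vpot i) d)"

lemma vpot_bounded: "bounded_series 1 (vpot i) (vpot_norm i)"
  unfolding vpot_norm_def by (rule someI_ex) (metis vpot_bound)

lemma fourier_pot0: "fourier (pot0 i) k = of_real (inv_laplace_symbol k) * curl_symbol k (\<lambda>j. fourier (coeff (mag j) 0) k) i"
  unfolding pot0_def mult_op(2)[OF even_bounded_inv_laplace bounded_series_summable(3)[OF curl_bound[OF mag_bound]]]
  by (simp add: fourier_curl_series[OF mag_bound])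

lemma coeff_vpot: "coeff (vpot i) 0 = pot0 i" "coeff (vpot i) (Suc n) = (\<lambda>x. inverse (real (Suc n)) * coeff (rate i) n x)"
  unfolding vpot_def by (simp, rule coeff_integral_Suc)

lemma vpot_deriv: "fps_deriv (vpot i x) = rate i x"
  unfolding vpot_def by (rule fps_deriv_fps_integral)

lemma div_vpot: "(\<Sum>i\<in>UNIV. deriv_symbol i k * fourier (coeff (vpot i) n) k) = 0"
proof (cases n)
  case 0
  have "(\<Sum>i\<in>UNIV. deriv_symbol i k * fourier (coeff (vpot i) 0) k) =
     of_real (inv_laplace_symbol k) * (\<Sum>i\<in>UNIV. deriv_symbol i k * curl_symbol k (\<lambda>j. fourier (coeff (mag j) 0) k) i)"
    by (simp add: coeff_vpot fourier_pot0 sum_distrib_left mult_ac)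
  then show ?thesis by (simp add: 0 div_curl_symbol)
next
  case (Suc m)
  have "(\<Sum>i\<in>UNIV. deriv_symbol i k * fourier (coeff (vpot i) (Suc m)) k) =
     of_real (inverse (real (Suc m))) * (\<Sum>i\<in>UNIV. deriv_symbol i k * fourier (coeff (rate i) m) k)"
    by (simp add: coeff_vpot fourier_cmult sum_distrib_left mult_ac del: of_nat_Suc)
  then show ?thesis by (simp add: Suc div_rate)
qed

lemma div_vpot_series: "(\<lambda>x. \<Sum>i\<in>UNIV. lift_op (pderiv_x i) (vpot i) x) = (\<lambda>x. 0)"
proof (rule series_eqI)
  note D = bounded_series_deriv[OF vpot_bounded]
  show "periodic_continuous (coeff (\<lambda>x. \<Sum>i\<in>UNIV. lift_op (pderiv_x i) (vpot i) x) n)" for n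
    by (auto intro!: periodic_continuous_sum D)
  show "periodic_continuous (coeff (\<lambda>x. 0) n)" for n by (simp add: coeff_zero periodic_continuous_intros)
  show "fourier (coeff (\<lambda>x. \<Sum>i\<in>UNIV. lift_op (pderiv_x i) (vpot i) x) n) k = fourier (coeff (\<lambda>x. 0) n) k" for n k
    unfolding coeff_simps
    by (subst fourier_sum) (simp_all add: D periodic_continuousD(1)[OF D(1)] div_vpot coeff_zero fourier_const)
qed

lemma fourier_mean:
  assumes "continuous_on UNIV B0"
  shows "fourier (\<lambda>x. B0 x $ i) 0 = of_real (torus_mean B0 $ i)"
proof -
  have "torus_mean (\<lambda>x. B0 x $ i) = torus_mean B0 $ i"
    unfolding torus_mean_eq by (rule integral_bounded_linear[OF bounded_linear_vec_nth integrable_cube[OF assms]])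
  then show ?thesis by (simp add: fourier_zero_mode)
qed

text \<open>At order zero this is the double curl identity for the divergence-free
  \<open>B0\<close>, with the mean lost to the inverse Laplacian; at higher orders both sides are
  the integrated curl of the rate.\<close>

lemma curl_vpot_fourier:
  "curl_symbol k (\<lambda>j. fourier (coeff (vpot j) n) k) i =
   fourier (coeff (mag i) n) k - (if n = 0 \<and> k = 0 then fourier (\<lambda>x. B0 x $ i) 0 else 0)"
proof (cases n)
  case 0
  let ?w = "\<lambda>j. fourier (coeff (mag j) 0) k"
  have "curl_symbol k (\<lambda>j. fourier (coeff (vpot j) 0) k) i = of_real (inv_laplace_symbol k) * curl_symbol k (curl_symbol k ?w) i"
    unfolding coeff_vpot fourier_pot0 by (rule curl_symbol_cmult)
  also have "\<dots> = (of_real (inv_laplace_symbol k) * of_real (4 * pi\<^sup>2 * (norm (int_vec k))\<^sup>2)) * ?w i"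
    unfolding curl_curl_symbol[OF div_mag_0] by (simp add: mult.assoc)
  also have "\<dots> = ?w i - (if k = 0 then fourier (\<lambda>x. B0 x $ i) 0 else 0)"
    unfolding inv_laplace_mult by (auto simp: coeff_sol_0)
  finally show ?thesis by (simp add: 0)
next
  case (Suc m)
  have "curl_symbol k (\<lambda>j. fourier (coeff (vpot j) (Suc m)) k) i =
      of_real (inverse (real (Suc m))) * curl_symbol k (\<lambda>j. fourier (coeff (rate j) m) k) i"
    unfolding coeff_vpot fourier_cmult by (rule curl_symbol_cmult)
  also have "\<dots> = fourier (coeff (mag i) (Suc m)) k"
    unfolding coeff_sol_Suc mf_rhs.simps fourier_cmult fourier_curl_series[OF rate_bound] ..
  finally show ?thesis by (simp add: Suc)
qed

lemma curl_vpot_series: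
  assumes "continuous_on UNIV B0"
  shows "curl_series vpot i = (\<lambda>x. mag i x - fps_const (torus_mean B0 $ i))"
proof (rule series_eqI)
  show "periodic_continuous (coeff (curl_series vpot i) n)" for n
    by (rule periodic_continuous_curl_series[OF vpot_bounded])
  show "periodic_continuous (coeff (\<lambda>x. mag i x - fps_const (torus_mean B0 $ i)) n)" for n
    by (auto simp: coeff_const intro!: periodic_continuous_intros bounded_seriesD(2)[OF mag_bound])
  fix n k
  have "fourier (coeff (\<lambda>x. mag i x - fps_const (torus_mean B0 $ i)) n) k =
      fourier (coeff (mag i) n) k - (if n = 0 \<and> k = 0 then of_real (torus_mean B0 $ i) else 0)"
    by (simp add: coeff_const fourier_diff bounded_seriesD(3)[OF mag_bound] fourier_const)
  then show "fourier (coeff (curl_series vpot i) n) k = fourier (coeff (\<lambda>x. mag i x - fps_const (torus_mean B0 $ i)) n) k"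
    unfolding fourier_curl_series[OF vpot_bounded] curl_vpot_fourier fourier_mean[OF assms] by simp
qed

text \<open>Turns the first-order field equations back into the wave equation: double curl identity
  combined with \<open>curl_vpot_fourier\<close>. The mean of \<open>B0\<close> only affects the
  zero mode, where the symbol of the curl vanishes.\<close>

lemma laplace_vpot_series:
  "(\<lambda>x. \<Sum>j\<in>UNIV. lift_op (pderiv_x j) (lift_op (pderiv_x j) (vpot i)) x) = (\<lambda>x. - curl_series mag i x)"
proof (rule series_eqI)
  note D1 = bounded_series_deriv[OF vpot_bounded]
  note D2 = bounded_series_deriv[OF bounded_series_pderiv[OF vpot_bounded], unfolded coeff_simps]
  show "periodic_continuous (coeff (\<lambda>x. \<Sum>j\<in>UNIV. lift_op (pderiv_x j) (lift_op (pderiv_x j) (vpot i)) x) n)" for n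
    by (auto intro!: periodic_continuous_sum D2)
  show "periodic_continuous (coeff (\<lambda>x. - curl_series mag i x) n)" for n
    by (auto intro!: periodic_continuous_intros periodic_continuous_curl_series[OF mag_bound])
  fix n k
  let ?v = "\<lambda>j. fourier (coeff (vpot j) n) k"
  have "fourier (coeff (\<lambda>x. \<Sum>j\<in>UNIV. lift_op (pderiv_x j) (lift_op (pderiv_x j) (vpot i)) x) n) k =
      (\<Sum>j\<in>UNIV. deriv_symbol j k * deriv_symbol j k) * ?v i"
    unfolding coeff_simps
    by (subst fourier_sum) (simp_all add: D1 D2 periodic_continuousD(1)[OF D2(1)] sum_distrib_right mult.assoc)
  also have "\<dots> = - curl_symbol k (curl_symbol k ?v) i"
    unfolding curl_curl_symbol[OF div_vpot] sum_deriv_symbol_sq by simp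
  also have "\<dots> = - curl_symbol k (\<lambda>j. fourier (coeff (mag j) n) k) i"
    unfolding curl_vpot_fourier by (cases "k = 0") (simp_all add: curl_symbol_0)
  also have "\<dots> = fourier (coeff (\<lambda>x. - curl_series mag i x) n) k"
    by (simp add: fourier_uminus fourier_curl_series[OF mag_bound])
  finally show "fourier (coeff (\<lambda>x. \<Sum>j\<in>UNIV. lift_op (pderiv_x j) (lift_op (pderiv_x j) (vpot i)) x) n) k =
     fourier (coeff (\<lambda>x. - curl_series mag i x) n) k" .
qed

subsection \<open>The Lorentz factor along the flow\<close>

lemma fps_linear_ode_zero:
  fixes q h :: "'b::field_char_0 fps"
  assumes "fps_deriv q = h * q" "fps_nth q 0 = 0"
  shows "q = 0"
proof -
  have "fps_nth q n = 0" for n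
  proof (induction n rule: less_induct)
    case (less n)
    show ?case
    proof (cases n)
      case (Suc m)
      have "of_nat (Suc m) * fps_nth q (Suc m) = fps_nth (h * q) m"
        using arg_cong[OF assms(1), of "\<lambda>f. fps_nth f m"] by simp
      also have "\<dots> = 0" using less Suc by (auto simp: fps_mult_nth intro!: sum.neutral)
      finally show ?thesis using Suc by (simp del: of_nat_Suc)
    qed (use assms in simp)
  qed
  then show ?thesis by (simp add: fps_eq_iff)
qed

lemma lorentz_identity:
  "sol (Lorentz \<theta>) x * sol (Lorentz \<theta>) x *
     (1 + fps_const (\<epsilon>\<^sup>2) * (\<Sum>i\<in>UNIV. sol (Momentum \<theta> i) x * sol (Momentum \<theta> i) x)) = 1"
proof -
  define g where "g = sol (Lorentz \<theta>) x"
  define \<xi> where "\<xi> i = sol (Momentum \<theta> i) x" for i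
  define h where "h i = accel_series M \<epsilon> sol \<theta> i x" for i
  define S where "S = (\<Sum>i\<in>UNIV. \<xi> i * \<xi> i)"
  define P where "P = (\<Sum>i\<in>UNIV. \<xi> i * h i)"
  define e where "e = fps_const (\<epsilon>\<^sup>2)"
  \<comment> \<open>\<open>q\<close> measures the failure of the identity. Its derivative is
    \<open>- 2 * e * g * g * P\<close> times \<open>q\<close> itself, and it vanishes at time zero
    by the choice of the initial Lorentz factor.\<close>
  define q where "q = g * g * (1 + e * S) - 1"
  have g': "fps_deriv g = - e * (g * g * g * P)"
    unfolding g_def sol_deriv by (simp add: \<xi>_def h_def P_def e_def flip: fps_const_neg)
  have \<xi>': "fps_deriv (\<xi> i) = h i" for i unfolding \<xi>_def sol_deriv by (simp add: h_def)
  have e': "fps_deriv e = 0" by (simp add: e_def)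
  have S': "fps_deriv S = 2 * P"
    by (simp add: S_def P_def fps_deriv_sum \<xi>' sum_distrib_left mult_ac)
  have "fps_deriv q = (- 2 * e * g * g * P) * q"
    unfolding q_def by (simp add: g' S' e') (simp add: algebra_simps)
  moreover have "fps_nth q 0 = 0"
  proof -
    have g0: "fps_nth g 0 = (1 + \<epsilon>\<^sup>2 * (norm (\<xi>0 \<theta> x))\<^sup>2) powr (- 1 / 2)"
      using fun_cong[OF coeff_sol_0[of "Lorentz \<theta>"], of x] by (simp add: g_def coeff_def)
    have x0: "fps_nth (\<xi> i) 0 = \<xi>0 \<theta> x $ i" for i
      using fun_cong[OF coeff_sol_0[of "Momentum \<theta> i"], of x] by (simp add: \<xi>_def coeff_def)
    have S0: "fps_nth S 0 = (norm (\<xi>0 \<theta> x))\<^sup>2"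
      by (simp add: S_def fps_sum_nth x0 power2_norm_eq_inner inner_vec_def)
    have powr_half: "z powr (- 1 / 2) * z powr (- 1 / 2) = inverse z" if "z > 0" for z :: real
      using powr_add[of z "- 1 / 2" "- 1 / 2"] that by (simp add: powr_minus)
    have pos: "1 + \<epsilon>\<^sup>2 * (norm (\<xi>0 \<theta> x))\<^sup>2 > 0" by (simp add: add_pos_nonneg)
    have "fps_nth q 0 = (1 + \<epsilon>\<^sup>2 * (norm (\<xi>0 \<theta> x))\<^sup>2) powr (- 1 / 2) * (1 + \<epsilon>\<^sup>2 * (norm (\<xi>0 \<theta> x))\<^sup>2) powr (- 1 / 2)
        * (1 + \<epsilon>\<^sup>2 * (norm (\<xi>0 \<theta> x))\<^sup>2) - 1"
      by (simp add: q_def g0 S0 e_def)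
    also have "\<dots> = 0" unfolding powr_half[OF pos] using pos by simp
    finally show ?thesis .
  qed
  ultimately have "q = 0" by (rule fps_linear_ode_zero)
  then show ?thesis by (simp add: q_def g_def S_def \<xi>_def e_def)
qed

end

subsection \<open>From series to solutions\<close>

text \<open>Packages the condition on the radius under which evaluation respects the ring
  operations.\<close>

definition converges_at :: "real \<Rightarrow> real fps \<Rightarrow> bool" where
  "converges_at t f \<longleftrightarrow> ereal (norm t) < fps_conv_radius f"

lemma converges_at_intros:
  "converges_at t f \<Longrightarrow> converges_at t g \<Longrightarrow> converges_at t (f + g)"
  "converges_at t f \<Longrightarrow> converges_at t g \<Longrightarrow> converges_at t (f - g)"
  "converges_at t f \<Longrightarrow> converges_at t g \<Longrightarrow> converges_at t (f * g)"
  "converges_at t f \<Longrightarrow> converges_at t (- f)"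
  "converges_at t (fps_const c)" "converges_at t 1"
  unfolding converges_at_def
  by (auto intro: less_le_trans[OF _ fps_conv_radius_add] less_le_trans[OF _ fps_conv_radius_diff]
      less_le_trans[OF _ fps_conv_radius_mult])

lemma converges_at_sum: "(\<And>i. converges_at t (f i)) \<Longrightarrow> converges_at t (\<Sum>i\<in>(UNIV::3 set). f i)"
  by (simp add: sum_3 converges_at_intros)

lemma eval_fps_ops:
  "converges_at t f \<Longrightarrow> converges_at t g \<Longrightarrow> eval_fps (f + g) t = eval_fps f t + eval_fps g t"
  "converges_at t f \<Longrightarrow> converges_at t g \<Longrightarrow> eval_fps (f - g) t = eval_fps f t - eval_fps g t"
  "converges_at t f \<Longrightarrow> converges_at t g \<Longrightarrow> eval_fps (f * g) t = eval_fps f t * eval_fps g t"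
  "converges_at t f \<Longrightarrow> eval_fps (- f) t = - eval_fps f t"
  by (auto simp: converges_at_def intro: eval_fps_add eval_fps_diff eval_fps_mult eval_fps_minus)

lemma eval_fps_sum3:
  "(\<And>i. converges_at t (f i)) \<Longrightarrow> eval_fps (\<Sum>i\<in>(UNIV::3 set). f i) t = (\<Sum>i\<in>UNIV. eval_fps (f i) t)"
  by (simp add: sum_3 eval_fps_ops converges_at_intros)

lemma analytic_upto_converges_at: "analytic_upto T U \<Longrightarrow> t \<in> {0..T} \<Longrightarrow> converges_at t (U x)"
  unfolding converges_at_def by (rule analytic_upto_conv_radius)

lemma integrable_vec3:
  fixes f :: "3 \<Rightarrow> 'a \<Rightarrow> real"
  assumes "\<And>i. integrable M (f i)"
  shows "integrable M (\<lambda>\<theta>. \<chi> i. f i \<theta>)" "(\<integral>\<theta>. (\<chi> i. f i \<theta>) \<partial>M) $ j = (\<integral>\<theta>. f j \<theta> \<partial>M)"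
proof -
  show I: "integrable M (\<lambda>\<theta>. \<chi> i. f i \<theta>)"
    unfolding vec_eq_sum_axis by (intro Bochner_Integration.integrable_sum integrable_scaleR_left assms)
  show "(\<integral>\<theta>. (\<chi> i. f i \<theta>) \<partial>M) $ j = (\<integral>\<theta>. f j \<theta> \<partial>M)"
    using integral_bounded_linear[OF bounded_linear_vec_nth[of j] I] by simp
qed

lemma measurable_vec3:
  fixes f :: "3 \<Rightarrow> 'a \<Rightarrow> real"
  assumes "\<And>i. f i \<in> borel_measurable M"
  shows "(\<lambda>\<theta>. \<chi> i. f i \<theta>) \<in> borel_measurable M"
  unfolding vec_eq_sum_axis by (intro borel_measurable_sum borel_measurable_scaleR assms) auto

lemma measurable_ev:
  assumes "measurable_series M W"
  shows "(\<lambda>\<theta>. ev (W \<theta>) t x) \<in> borel_measurable M"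
  unfolding ev_conv_series_comb series_comb_def
  using assms by (intro borel_measurable_suminf borel_measurable_times) (auto simp: measurable_series_def)

lemma curl_vec3:
  fixes f :: "3 \<Rightarrow> real ^ 3 \<Rightarrow> real"
  shows "curl (\<lambda>y. \<chi> j. f j y) x = (\<chi> i. if i = 1 then pderiv_x 2 (f 3) x - pderiv_x 3 (f 2) x
     else if i = 2 then pderiv_x 3 (f 1) x - pderiv_x 1 (f 3) x
     else pderiv_x 1 (f 2) x - pderiv_x 2 (f 1) x)"
  by (simp add: curl_def vec_eq_iff forall_3)

lemma (in time_weight) ev_curl_series:
  assumes W: "\<And>j. bounded_series 1 (W j) (d j)" and t: "t \<in> {0..T}" "T < R"
  shows "curl (\<lambda>y. \<chi> j. ev (W j) t y) x = (\<chi> i. ev (curl_series W i) t x)"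
proof -
  have g: "analytic_upto T (W j)" for j by (rule bounded_series_imp_analytic_upto[OF W t(2)])
  have c: "converges_at t (lift_op (pderiv_x i) (W j) x)" for i j
    by (rule analytic_upto_converges_at[OF analytic_upto_pderiv[OF g] t(1)])
  have "ev (curl_series W i) t x = (if i = 1 then pderiv_x 2 (ev (W 3) t) x - pderiv_x 3 (ev (W 2) t) x
     else if i = 2 then pderiv_x 3 (ev (W 1) t) x - pderiv_x 1 (ev (W 3) t) x
     else pderiv_x 1 (ev (W 2) t) x - pderiv_x 2 (ev (W 1) t) x)" for i
    unfolding ev_pderiv(2)[OF g t(1)] by (auto simp: curl_series_def ev_def eval_fps_ops c)
  then show ?thesis unfolding curl_vec3 by simp
qed

text \<open>For \<open>t < R\<close> the terms satisfy the geometric bound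
  \<open>d * (t / R) ^ n\<close> uniformly in \<theta>, which permits exchanging the series with the
  average.\<close>

lemma (in time_weight) ev_average:
  assumes M: "prob_space M" and W: "\<And>\<theta>. \<theta> \<in> space M \<Longrightarrow> bounded_series j (W \<theta>) d" and meas: "measurable_series M W"
    and t: "t \<in> {0..T}" "T < R"
  shows "integrable M (\<lambda>\<theta>. ev (W \<theta>) t x)" "(\<integral>\<theta>. ev (W \<theta>) t x \<partial>M) = ev (average M W) t x"
proof -
  interpret prob_space M by fact
  have b: "\<bar>coeff (W \<theta>) n x\<bar> * t ^ n \<le> \<bar>d\<bar> * (t / R) ^ n" if "\<theta> \<in> space M" for \<theta> n
  proof -
    have d: "d \<ge> 0" by (rule bounded_seriesD(1)[OF W[OF that]])
    have "ennreal \<bar>coeff (W \<theta>) n x\<bar> \<le> fsum (\<lambda>_. 1) (coeff (W \<theta>) n)"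
      by (rule abs_le_fsum[OF bounded_seriesD(2)[OF W[OF that]] bounded_series_summable(3)[OF W[OF that]]])
    also have "\<dots> \<le> ennreal (d / R ^ n)" by (rule bounded_series_fsum_1(2)[OF W[OF that]])
    finally have "\<bar>coeff (W \<theta>) n x\<bar> \<le> d / R ^ n" using d R_pos by (simp add: ennreal_le_iff)
    then have "\<bar>coeff (W \<theta>) n x\<bar> * t ^ n \<le> d / R ^ n * t ^ n" using t by (intro mult_right_mono) auto
    then show ?thesis using d by (simp add: power_divide)
  qed
  have "\<bar>t / R\<bar> < 1" using t R_pos by simp
  then have s: "summable (\<lambda>n. \<bar>d\<bar> * (t / R) ^ n)" by (intro summable_mult summable_geometric) simp
  have m: "(\<lambda>\<theta>. coeff (W \<theta>) n x * t ^ n) \<in> borel_measurable M" for n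
    using meas by (auto simp: measurable_series_def intro!: borel_measurable_times)
  have i: "integrable M (\<lambda>\<theta>. coeff (W \<theta>) n x * t ^ n)" for n
    by (rule integrable_const_bound[of _ "\<bar>d\<bar> * (t / R) ^ n"]) (use b m t in \<open>auto intro!: AE_I2 simp: abs_mult\<close>)
  have s1: "AE \<theta> in M. summable (\<lambda>n. norm (coeff (W \<theta>) n x * t ^ n))"
    using b t by (auto intro!: AE_I2 summable_comparison_test'[OF s, of 0] simp: abs_mult)
  have s2: "summable (\<lambda>n. \<integral>\<theta>. norm (coeff (W \<theta>) n x * t ^ n) \<partial>M)"
  proof (rule summable_comparison_test'[OF s, of 0])
    fix n
    have "(\<integral>\<theta>. norm (coeff (W \<theta>) n x * t ^ n) \<partial>M) \<le> (\<integral>\<theta>. \<bar>d\<bar> * (t / R) ^ n \<partial>M)"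
    proof (rule integral_mono)
      show "integrable M (\<lambda>\<theta>. norm (coeff (W \<theta>) n x * t ^ n))" by (intro integrable_norm i)
    qed (use b t in \<open>auto simp: abs_mult\<close>)
    then show "norm (\<integral>\<theta>. norm (coeff (W \<theta>) n x * t ^ n) \<partial>M) \<le> \<bar>d\<bar> * (t / R) ^ n"
      by (simp add: prob_space)
  qed
  show "integrable M (\<lambda>\<theta>. ev (W \<theta>) t x)"
    using integrable_suminf[OF i s1 s2] by (simp add: ev_conv_series_comb series_comb_def)
  show "(\<integral>\<theta>. ev (W \<theta>) t x \<partial>M) = ev (average M W) t x"
    using integral_suminf[OF i s1 s2] by (simp add: ev_conv_series_comb series_comb_def coeff_average)
qed

context mf_data
begin

section \<open>Verification of the equations on a shorter time interval\<close>

context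
  fixes T :: real
  assumes T: "0 < T" "T < R" and B0c: "continuous_on UNIV B0"
begin

lemma analytic_upto_sol: "valid_var M s \<Longrightarrow> analytic_upto T (sol s)"
  by (rule bounded_series_imp_analytic_upto[OF state T(2)])

lemmas analytic_upto_fields = analytic_upto_sol bounded_series_imp_analytic_upto[OF velocity_bound T(2)] bounded_series_imp_analytic_upto[OF flux_bound T(2)]
  bounded_series_imp_analytic_upto[OF potential_bound T(2)] bounded_series_imp_analytic_upto[OF vpot_bounded T(2)]
  bounded_series_imp_analytic_upto[OF charge_bound T(2)] bounded_series_imp_analytic_upto[OF current_bound T(2)]
  bounded_series_imp_analytic_upto[OF curl_bound[OF mag_bound] T(2)] bounded_series_imp_analytic_upto[OF accel_bound T(2)]

abbreviation "dens \<equiv> \<lambda>\<theta>. ev (sol (Density \<theta>))"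
abbreviation "mom \<equiv> \<lambda>\<theta> t x. \<chi> i. ev (sol (Momentum \<theta> i)) t x"
abbreviation "epot \<equiv> ev (potential_series M sol)"
abbreviation "mpot \<equiv> \<lambda>t x. \<chi> i. ev (vpot i) t x"

text \<open>\<open>lorentz_identity\<close> fixes the Lorentz factor only up to sign; the sign is
  positive at time zero and cannot change, since the factor is continuous and never
  vanishes.\<close>

lemma velocity_mom:
  assumes \<theta>: "\<theta> \<in> space M" and t: "t \<in> {0..T}"
  shows "velocity \<epsilon> (mom \<theta> t x) = (\<chi> i. ev (velocity_series sol \<theta> i) t x)"
proof -
  define g where "g s = ev (sol (Lorentz \<theta>)) s x" for s
  define N where "N s = (norm (mom \<theta> s x))\<^sup>2" for s
  have N: "N s = (\<Sum>i\<in>UNIV. ev (sol (Momentum \<theta> i)) s x * ev (sol (Momentum \<theta> i)) s x)" for s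
    by (simp add: N_def power2_norm_eq_inner inner_vec_def)
  have id: "g s * g s * (1 + \<epsilon>\<^sup>2 * N s) = 1" if s: "s \<in> {0..T}" for s
  proof -
    have c: "converges_at s (sol v x)" if "valid_var M v" for v
      by (rule analytic_upto_converges_at[OF analytic_upto_sol[OF that] s])
    have "eval_fps (sol (Lorentz \<theta>) x * sol (Lorentz \<theta>) x *
     (1 + fps_const (\<epsilon>\<^sup>2) * (\<Sum>i\<in>UNIV. sol (Momentum \<theta> i) x * sol (Momentum \<theta> i) x))) s = eval_fps 1 s"
      by (simp only: lorentz_identity)
    then show ?thesis
      using \<theta> by (simp add: eval_fps_ops eval_fps_sum3 converges_at_intros converges_at_sum c g_def N ev_def)
  qed
  have gc: "continuous_on {0..T} g"
    unfolding g_def using ev_has_time_derivative[OF analytic_upto_sol[of "Lorentz \<theta>"]] \<theta>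
    by (intro continuous_on_vector_derivative) auto
  have nz: "g s \<noteq> 0" if "s \<in> {0..T}" for s using id[OF that] by auto
  have "g 0 = u0" if "u0 = (1 + \<epsilon>\<^sup>2 * (norm (\<xi>0 \<theta> x))\<^sup>2) powr (- 1 / 2)" for u0
    using fun_cong[OF coeff_sol_0[of "Lorentz \<theta>"], of x] that by (simp add: g_def ev_def eval_fps_at_0 coeff_def)
  moreover have "1 + \<epsilon>\<^sup>2 * (norm (\<xi>0 \<theta> x))\<^sup>2 > 0" by (simp add: add_pos_nonneg)
  ultimately have g0: "g 0 > 0" by simp
  have pos: "g t > 0"
  proof (rule ccontr)
    assume "\<not> g t > 0"
    then have "g t \<le> 0" by simp
    have "continuous_on {0..t} g" by (rule continuous_on_subset[OF gc]) (use t in auto)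
    then obtain s where "0 \<le> s" "s \<le> t" "g s = 0"
      using IVT2'[of g t 0 0] \<open>g t \<le> 0\<close> g0 t by auto
    then show False using nz[of s] t by auto
  qed
  have p: "1 + \<epsilon>\<^sup>2 * N t > 0" by (simp add: N_def add_pos_nonneg)
  have "(g t)\<^sup>2 = inverse (1 + \<epsilon>\<^sup>2 * N t)" using id[OF t] p by (simp add: power2_eq_square field_simps)
  then have "g t = sqrt (inverse (1 + \<epsilon>\<^sup>2 * N t))" using pos by (metis real_sqrt_unique less_imp_le)
  then have gt: "inverse (sqrt (1 + \<epsilon>\<^sup>2 * (norm (mom \<theta> t x))\<^sup>2)) = g t" by (simp add: real_sqrt_inverse N_def)
  have c: "converges_at t (sol v x)" if "valid_var M v" for v
    by (rule analytic_upto_converges_at[OF analytic_upto_sol[OF that] t])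
  show ?thesis
    unfolding velocity_def gt using \<theta>
    by (simp add: vec_eq_iff g_def ev_def velocity_series_def eval_fps_ops c)
qed

lemma pderiv_t_sol:
  assumes "valid_var M s" "t \<in> {0..T}"
  shows "pderiv_t T (ev (sol s)) t x = ev (mf_rhs M \<epsilon> sol s) t x"
  by (simp add: ev_pderiv_t[OF analytic_upto_sol[OF assms(1)] assms(2) T(1)] ev_def sol_deriv)

lemma continuity_equation:
  assumes \<theta>: "\<theta> \<in> space M" and t: "t \<in> {0..T}"
  shows "pderiv_t T (dens \<theta>) t x + divergence (\<lambda>y. dens \<theta> t y *\<^sub>R velocity \<epsilon> (mom \<theta> t y)) x = 0"
proof -
  let ?F = "\<lambda>i x. sol (Density \<theta>) x * velocity_series sol \<theta> i x"
  have g: "analytic_upto T (?F i)" for i by (rule analytic_upto_fields(3)[OF \<theta>])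
  have c: "converges_at t (lift_op (pderiv_x i) (?F i) x)" for i
    by (rule analytic_upto_converges_at[OF analytic_upto_pderiv[OF g] t])
  have "(\<lambda>y. (dens \<theta> t y *\<^sub>R velocity \<epsilon> (mom \<theta> t y)) $ i) = ev (?F i) t" for i
    using analytic_upto_converges_at[OF analytic_upto_fields(1) t] analytic_upto_converges_at[OF analytic_upto_fields(2)[OF \<theta>] t] \<theta>
    by (simp only: velocity_mom[OF \<theta> t]) (simp add: fun_eq_iff ev_def eval_fps_ops)
  then have "divergence (\<lambda>y. dens \<theta> t y *\<^sub>R velocity \<epsilon> (mom \<theta> t y)) x = (\<Sum>i\<in>UNIV. ev (lift_op (pderiv_x i) (?F i)) t x)"
    unfolding divergence_def by (simp add: ev_pderiv(2)[OF g t])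
  moreover have "pderiv_t T (dens \<theta>) t x = - (\<Sum>i\<in>UNIV. ev (lift_op (pderiv_x i) (?F i)) t x)"
    using \<theta> by (simp add: pderiv_t_sol[OF _ t] ev_def eval_fps_ops eval_fps_sum3 converges_at_sum c)
  ultimately show ?thesis by simp
qed

lemma grad_epot: "t \<in> {0..T} \<Longrightarrow> grad (epot t) x = (\<chi> i. ev (lift_op (pderiv_x i) (potential_series M sol)) t x)"
  unfolding grad_def by (simp add: ev_pderiv(2)[OF analytic_upto_fields(4)])

lemma pderiv_t_mpot: "t \<in> {0..T} \<Longrightarrow> pderiv_t T mpot t x = (\<chi> i. ev (rate i) t x)"
  using ev_vec_pderiv_t[OF analytic_upto_fields(5) _ T(1)] by (simp add: vpot_deriv)

lemma magnetic_mpot: "t \<in> {0..T} \<Longrightarrow> curl (mpot t) x + torus_mean B0 = (\<chi> i. ev (mag i) t x)"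
proof -
  assume t: "t \<in> {0..T}"
  have c: "converges_at t (mag i x)" for i by (rule analytic_upto_converges_at[OF analytic_upto_sol t]) simp
  show ?thesis
    unfolding ev_curl_series[OF vpot_bounded t T(2)] curl_vpot_series[OF B0c]
    by (simp add: vec_eq_iff ev_def eval_fps_ops c converges_at_intros)
qed

lemma momentum_equation:
  assumes \<theta>: "\<theta> \<in> space M" and t: "t \<in> {0..T}"
  shows "pderiv_t T (mom \<theta>) t x + dir_deriv (velocity \<epsilon> (mom \<theta> t x)) (mom \<theta> t) x
          = - grad (epot t) x - \<epsilon> *\<^sub>R pderiv_t T mpot t x
            + \<epsilon> *\<^sub>R cross3 (velocity \<epsilon> (mom \<theta> t x)) (curl (mpot t) x + torus_mean B0)"
proof -
  let ?v = "\<lambda>i. velocity_series sol \<theta> i"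
  have gm: "analytic_upto T (sol (Momentum \<theta> i))" for i using \<theta> by (intro analytic_upto_sol) simp
  have cv: "converges_at t (?v i x)" for i by (rule analytic_upto_converges_at[OF analytic_upto_fields(2)[OF \<theta>] t])
  have cm: "converges_at t (mag i x)" "converges_at t (rate i x)" for i by (rule analytic_upto_converges_at[OF analytic_upto_sol t], simp)+
  have cd: "converges_at t (lift_op (pderiv_x j) (sol (Momentum \<theta> i)) x)" for i j
    by (rule analytic_upto_converges_at[OF analytic_upto_pderiv[OF gm] t])
  have cp: "converges_at t (lift_op (pderiv_x j) (potential_series M sol) x)" for j
    by (rule analytic_upto_converges_at[OF analytic_upto_pderiv[OF analytic_upto_fields(4)] t])
  have cc: "converges_at t (cross_series ?v mag i x)" for i
    unfolding cross_series_def by (simp add: converges_at_intros cv cm)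
  have cross: "cross3 (\<chi> i. ev (?v i) t x) (\<chi> i. ev (mag i) t x) = (\<chi> i. ev (cross_series ?v mag i) t x)"
    by (simp add: vec_eq_iff forall_3 cross3_def cross_series_def ev_def eval_fps_ops converges_at_intros cv cm)
  have dd: "dir_deriv (\<chi> i. ev (?v i) t x) (mom \<theta> t) x = (\<chi> i. \<Sum>j\<in>UNIV. ev (?v j) t x * ev (lift_op (pderiv_x j) (sol (Momentum \<theta> i))) t x)"
    unfolding dir_deriv_def
    by (simp add: vec_eq_iff pderiv_x_vec(2)[OF ev_pderiv(1)[OF gm t]] ev_pderiv(2)[OF gm t])
  have pt: "pderiv_t T (mom \<theta>) t x = (\<chi> i. ev (accel_series M \<epsilon> sol \<theta> i) t x)"
    by (subst ev_vec_pderiv_t[OF gm t T(1)]) (simp add: sol_deriv)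
  have acc: "ev (accel_series M \<epsilon> sol \<theta> i) t x =
     - ev (lift_op (pderiv_x i) (potential_series M sol)) t x - \<epsilon> * ev (rate i) t x
     + \<epsilon> * ev (cross_series ?v mag i) t x
     - (\<Sum>j\<in>UNIV. ev (?v j) t x * ev (lift_op (pderiv_x j) (sol (Momentum \<theta> i))) t x)" for i
    by (simp add: accel_series_def ev_def eval_fps_ops eval_fps_sum3 converges_at_sum converges_at_intros cv cm cd cp cc)
  show ?thesis
    unfolding velocity_mom[OF \<theta> t] grad_epot[OF t] pderiv_t_mpot[OF t] magnetic_mpot[OF t] cross dd pt
    by (simp add: vec_eq_iff acc)
qed

lemma laplacian_ev:
  assumes "bounded_series 1 U d" and t: "t \<in> {0..T}"
  shows "laplacian (ev U t) x = ev (\<lambda>x. \<Sum>i\<in>UNIV. lift_op (pderiv_x i) (lift_op (pderiv_x i) U) x) t x"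
proof -
  have g: "analytic_upto T U" by (rule bounded_series_imp_analytic_upto[OF assms(1) T(2)])
  show ?thesis
    unfolding laplacian_def ev_pderiv(2)[OF g t] ev_pderiv(2)[OF analytic_upto_pderiv[OF g] t]
    by (simp add: ev_def eval_fps_sum3 analytic_upto_converges_at[OF analytic_upto_pderiv[OF analytic_upto_pderiv[OF g]] t])
qed

lemma laplacian_mpot:
  assumes t: "t \<in> {0..T}"
  shows "laplacian (mpot t) x = (\<chi> i. - ev (curl_series mag i) t x)"
proof -
  note g = analytic_upto_fields(5)
  have 1: "pderiv_x i (mpot t) = (\<lambda>x. \<chi> j. ev (lift_op (pderiv_x i) (vpot j)) t x)" for i
    by (rule ext) (simp add: pderiv_x_vec(2)[OF ev_pderiv(1)[OF g t]] ev_pderiv(2)[OF g t])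
  have 2: "pderiv_x i (\<lambda>x. \<chi> j. ev (lift_op (pderiv_x i) (vpot j)) t x) x
      = (\<chi> j. pderiv_x i (pderiv_x i (ev (vpot j) t)) x)" for i
    using pderiv_x_vec(2)[OF ev_pderiv(1)[OF analytic_upto_pderiv[OF g] t]] by (simp add: ev_pderiv(2)[OF g t])
  have "laplacian (mpot t) x = (\<chi> j. laplacian (ev (vpot j) t) x)"
    by (simp add: laplacian_def 1 2 vec_eq_iff)
  also have "\<dots> = (\<chi> i. - ev (curl_series mag i) t x)"
    unfolding laplacian_ev[OF vpot_bounded t] laplace_vpot_series
    by (simp add: ev_def eval_fps_ops analytic_upto_converges_at[OF analytic_upto_fields(8) t])
  finally show ?thesis .
qed

lemma measurable_flux: "measurable_series M (\<lambda>\<theta> x. sol (Density \<theta>) x * velocity_series sol \<theta> i x)"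
  using measurable_sol by (intro measurable_series_intros measurable_velocity) (simp add: measurable_state_def)

lemma measurable_dens: "measurable_series M (\<lambda>\<theta>. sol (Density \<theta>))"
  using measurable_sol by (simp add: measurable_state_def)

lemma charge_dens:
  assumes t: "t \<in> {0..T}"
  shows "integrable M (\<lambda>\<theta>. dens \<theta> t x)" "charge_density M (\<lambda>\<theta>. dens \<theta> t) x = ev (charge_series M sol) t x"
proof -
  have b: "bounded_series 1 (sol (Density \<theta>)) K" if "\<theta> \<in> space M" for \<theta> using that by (intro state) simp
  show "integrable M (\<lambda>\<theta>. dens \<theta> t x)" "charge_density M (\<lambda>\<theta>. dens \<theta> t) x = ev (charge_series M sol) t x"
    unfolding charge_density_def charge_series_def
    using ev_average[OF prob_space_axioms b measurable_dens t T(2)] by auto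
qed

lemma current_flux:
  assumes t: "t \<in> {0..T}"
  shows "integrable M (\<lambda>\<theta>. dens \<theta> t x *\<^sub>R velocity \<epsilon> (mom \<theta> t x))"
    "current_density M \<epsilon> (\<lambda>\<theta>. dens \<theta> t) (\<lambda>\<theta>. mom \<theta> t) x = (\<chi> i. ev (current_series M sol i) t x)"
proof -
  let ?F = "\<lambda>i \<theta> x. sol (Density \<theta>) x * velocity_series sol \<theta> i x"
  have eq: "dens \<theta> t x *\<^sub>R velocity \<epsilon> (mom \<theta> t x) = (\<chi> i. ev (?F i \<theta>) t x)" if \<theta>: "\<theta> \<in> space M" for \<theta>
    using analytic_upto_converges_at[OF analytic_upto_fields(1) t] analytic_upto_converges_at[OF analytic_upto_fields(2)[OF \<theta>] t] \<theta>
    by (simp only: velocity_mom[OF \<theta> t]) (simp add: vec_eq_iff ev_def eval_fps_ops)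
  note A = ev_average[OF prob_space_axioms flux_bound measurable_flux t T(2)]
  show "integrable M (\<lambda>\<theta>. dens \<theta> t x *\<^sub>R velocity \<epsilon> (mom \<theta> t x))"
    using integrable_vec3(1)[OF A(1)] eq by (simp cong: Bochner_Integration.integrable_cong)
  have "current_density M \<epsilon> (\<lambda>\<theta>. dens \<theta> t) (\<lambda>\<theta>. mom \<theta> t) x = (\<integral>\<theta>. (\<chi> i. ev (?F i \<theta>) t x) \<partial>M)"
    unfolding current_density_def by (intro Bochner_Integration.integral_cong refl eq)
  also have "\<dots> = (\<chi> i. ev (current_series M sol i) t x)"
    using integrable_vec3(2)[OF A(1)] A(2) by (simp add: vec_eq_iff current_series_def)
  finally show "current_density M \<epsilon> (\<lambda>\<theta>. dens \<theta> t) (\<lambda>\<theta>. mom \<theta> t) x = (\<chi> i. ev (current_series M sol i) t x)" .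
qed

text \<open>Evaluation in time commutes with Fourier multipliers, so the current may be projected
  before or after it.\<close>

lemma leray_current:
  assumes t: "t \<in> {0..T}"
  shows "leray (current_density M \<epsilon> (\<lambda>\<theta>. dens \<theta> t) (\<lambda>\<theta>. mom \<theta> t)) x $ i =
    (\<Sum>j\<in>UNIV. ev (lift_op (mult_op (leray_entry i j)) (current_series M sol j)) t x)"
proof -
  have J: "current_density M \<epsilon> (\<lambda>\<theta>. dens \<theta> t) (\<lambda>\<theta>. mom \<theta> t) = (\<lambda>x. \<chi> i. ev (current_series M sol i) t x)"
    using current_flux(2)[OF t] by auto
  have b: "bounded_series 0 (current_series M sol j) (K ^ 3)" for j by (rule bounded_series_1_0[OF current_bound])
  have "\<bar>leray_entry i j k\<bar> * (1 + norm (int_vec k)) ^ 0 \<le> 2 * (1 + norm (int_vec k)) ^ 0" for k j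
    using even_bounded_leray[of i j] by (simp add: even_bounded_def)
  note L = bounded_series_mult_op[OF b even_bounded_leray this]
  have s: "(\<lambda>k. cmod (fourier (ev (current_series M sol j) t) k)) summable_on UNIV" for j
  proof -
    have "ev (current_series M sol j) t \<in> B_space (exp (a - b * R))"
      by (rule B_space_ev[OF bounded_series_imp_decay[OF b] t]) (use T in auto)
    then have "fsum (exp_weight (a - b * R)) (ev (current_series M sol j) t) < \<infinity>"
      by (simp add: B_space_def B_norm_eq_fsum exp_weight_def[abs_def] powr_def mult.commute)
    then show ?thesis using bR by (intro fsum_exp_weight_summable(2)[of "a - b * R"]) auto
  qed
  have "leray (\<lambda>x. \<chi> i. ev (current_series M sol i) t x) x $ i = (\<Sum>j\<in>UNIV. mult_op (leray_entry i j) (ev (current_series M sol j) t) x)"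
    by (subst leray_component) (simp_all add: s)
  then show ?thesis
    unfolding J
    by (simp add: ev_mult_op[OF bounded_series_imp_decay[OF b] bounded_series_imp_decay[OF L] even_bounded_leray t less_imp_le[OF T(2)]])
qed

lemma wave_equation:
  assumes t: "t \<in> {0..T}"
  shows "\<epsilon>\<^sup>2 *\<^sub>R pderiv_t T (pderiv_t T mpot) t x - laplacian (mpot t) x
          = \<epsilon> *\<^sub>R leray (current_density M \<epsilon> (\<lambda>\<theta>. dens \<theta> t) (\<lambda>\<theta>. mom \<theta> t)) x"
proof -
  have gr: "analytic_upto T (rate i)" for i by (rule analytic_upto_sol) simp
  have "pderiv_t T (pderiv_t T mpot) t x = pderiv_t T (\<lambda>t x. \<chi> i. ev (rate i) t x) t x"
  proof -
    \<comment> \<open>The inner time derivative is known to be an evaluated series only on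
      \<open>{0..T}\<close>, so derivatives are compared relative to that interval.\<close>
    have "((\<lambda>s. pderiv_t T mpot s x) has_vector_derivative d) (at t within {0..T}) \<longleftrightarrow>
        ((\<lambda>s. \<chi> i. ev (rate i) s x) has_vector_derivative d) (at t within {0..T})" for d
      using has_vector_derivative_transform[OF t, of "\<lambda>s. pderiv_t T mpot s x" "\<lambda>s. \<chi> i. ev (rate i) s x" d]
        has_vector_derivative_transform[OF t, of "\<lambda>s. \<chi> i. ev (rate i) s x" "\<lambda>s. pderiv_t T mpot s x" d]
        pderiv_t_mpot by auto
    then show ?thesis unfolding pderiv_t_def[of T "pderiv_t T mpot"] pderiv_t_def[of T "\<lambda>t x. \<chi> i. ev (rate i) t x"] vector_derivative_def by simp
  qed
  also have "\<dots> = (\<chi> i. ev (mf_rhs M \<epsilon> sol (Potential_Rate i)) t x)"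
    by (subst ev_vec_pderiv_t[OF gr t T(1)]) (simp only: sol_deriv)
  finally have 1: "pderiv_t T (pderiv_t T mpot) t x = (\<chi> i. ev (mf_rhs M \<epsilon> sol (Potential_Rate i)) t x)" .
  have b: "bounded_series 0 (current_series M sol j) (K ^ 3)" for j by (rule bounded_series_1_0[OF current_bound])
  have "\<bar>leray_entry i j k\<bar> * (1 + norm (int_vec k)) ^ 0 \<le> 2 * (1 + norm (int_vec k)) ^ 0" for i k j
    using even_bounded_leray[of i j] by (simp add: even_bounded_def)
  note L = bounded_series_mult_op[OF b even_bounded_leray this]
  have cl: "converges_at t (lift_op (mult_op (leray_entry i j)) (current_series M sol j) x)" for i j
    by (rule analytic_upto_converges_at[OF bounded_series_imp_analytic_upto[OF L T(2)] t]) simp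
  have cc: "converges_at t (curl_series mag i x)" for i by (rule analytic_upto_converges_at[OF analytic_upto_fields(8) t])
  have 2: "\<epsilon>\<^sup>2 * ev (mf_rhs M \<epsilon> sol (Potential_Rate i)) t x =
     \<epsilon> * (\<Sum>j\<in>UNIV. ev (lift_op (mult_op (leray_entry i j)) (current_series M sol j)) t x) - ev (curl_series mag i) t x" for i
    using \<epsilon> by (simp add: ev_def eval_fps_ops eval_fps_sum3 converges_at_intros converges_at_sum cl cc)
  show ?thesis
    unfolding 1 laplacian_mpot[OF t] by (simp add: vec_eq_iff leray_current[OF t] 2 del: mf_rhs.simps)
qed

lemma poisson_equation:
  assumes t: "t \<in> {0..T}"
  shows "- laplacian (epot t) x = charge_density M (\<lambda>\<theta>. dens \<theta> t) x - 1"
proof -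
  note b = bounded_series_imp_analytic_upto[OF potential_bound T(2)]
  have c: "converges_at t (lift_op (pderiv_x i) (lift_op (pderiv_x i) (potential_series M sol)) x)" for i
    by (rule analytic_upto_converges_at[OF analytic_upto_pderiv[OF analytic_upto_pderiv[OF b]] t])
  have "- laplacian (epot t) x = ev (\<lambda>x. - (\<Sum>i\<in>UNIV. lift_op (pderiv_x i) (lift_op (pderiv_x i) (potential_series M sol)) x)) t x"
    unfolding laplacian_ev[OF potential_bound t] by (simp add: ev_def eval_fps_ops converges_at_sum c)
  also have "\<dots> = ev (charge_series M sol) t x - 1"
    unfolding poisson_series by (simp add: ev_def eval_fps_ops analytic_upto_converges_at[OF analytic_upto_fields(6) t] converges_at_intros)
  finally show ?thesis by (simp add: charge_dens(2)[OF t])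
qed

lemma coulomb_gauge:
  assumes t: "t \<in> {0..T}"
  shows "divergence (mpot t) x = 0"
proof -
  have "divergence (mpot t) x = ev (\<lambda>x. \<Sum>i\<in>UNIV. lift_op (pderiv_x i) (vpot i) x) t x"
    unfolding divergence_def
    by (simp add: ev_pderiv(2)[OF analytic_upto_fields(5) t]) (simp add: ev_def eval_fps_sum3 analytic_upto_converges_at[OF analytic_upto_pderiv[OF analytic_upto_fields(5)] t])
  then show ?thesis unfolding div_vpot_series by (simp add: ev_def)
qed

lemma ev_0: "ev U 0 x = coeff U 0 x"
  by (simp add: ev_def eval_fps_at_0 coeff_def)

theorem mf_solution: "MF_solution M \<epsilon> T \<rho>0 \<xi>0 E0 B0 dens mom epot mpot"
  unfolding MF_solution_def
proof (intro conjI ballI allI)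
  show "C1_tx T (dens \<theta>)" if "\<theta> \<in> space M" for \<theta> using that by (intro ev_C1_tx T analytic_upto_sol) simp
  show "C1_tx T (mom \<theta>)" if "\<theta> \<in> space M" for \<theta> using that by (intro C1_tx_vec T analytic_upto_sol) simp
  show "C2_x T epot" by (intro ev_C2_x analytic_upto_fields)
  show "C2_tx T mpot" by (intro C2_tx_vec T analytic_upto_fields)
  fix t assume t: "t \<in> {0..T}"
  show "measurable_family M (\<lambda>\<theta>. dens \<theta> t)"
    unfolding measurable_family_def by (intro allI measurable_ev measurable_dens)
  show "measurable_family M (\<lambda>\<theta>. mom \<theta> t)"
    unfolding measurable_family_def using measurable_sol
    by (intro allI measurable_vec3 measurable_ev) (simp add: measurable_state_def)
  fix x
  show "integrable M (\<lambda>\<theta>. dens \<theta> t x)" by (rule charge_dens[OF t])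
  show "integrable M (\<lambda>\<theta>. dens \<theta> t x *\<^sub>R velocity \<epsilon> (mom \<theta> t x))" by (rule current_flux[OF t])
next
  fix \<theta> t x assume "\<theta> \<in> space M" and t: "t \<in> {0..T}"
  then show "pderiv_t T (dens \<theta>) t x + divergence (\<lambda>y. dens \<theta> t y *\<^sub>R velocity \<epsilon> (mom \<theta> t y)) x = 0"
    by (rule continuity_equation)
  show "pderiv_t T (mom \<theta>) t x + dir_deriv (velocity \<epsilon> (mom \<theta> t x)) (mom \<theta> t) x
          = - grad (epot t) x - \<epsilon> *\<^sub>R pderiv_t T mpot t x
            + \<epsilon> *\<^sub>R cross3 (velocity \<epsilon> (mom \<theta> t x)) (curl (mpot t) x + torus_mean B0)"
    by (rule momentum_equation) fact+
next
  fix t x assume t: "t \<in> {0..T}"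
  show "\<epsilon>\<^sup>2 *\<^sub>R pderiv_t T (pderiv_t T mpot) t x - laplacian (mpot t) x
          = \<epsilon> *\<^sub>R leray (current_density M \<epsilon> (\<lambda>\<theta>. dens \<theta> t) (\<lambda>\<theta>. mom \<theta> t)) x" by (rule wave_equation[OF t])
  show "- laplacian (epot t) x = charge_density M (\<lambda>\<theta>. dens \<theta> t) x - 1" by (rule poisson_equation[OF t])
  show "divergence (mpot t) x = 0" by (rule coulomb_gauge[OF t])
next
  fix \<theta> x
  show "dens \<theta> 0 x = \<rho>0 \<theta> x" by (simp add: ev_0 coeff_sol_0)
  show "mom \<theta> 0 x = \<xi>0 \<theta> x" by (simp add: ev_0 coeff_sol_0 vec_eq_iff)
next
  fix x
  have t0: "0 \<in> {0..T}" using T by simp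
  have p0: "mult_op inv_laplace_symbol (charge_density M \<rho>0) = coeff (potential_series M sol) 0"
    by (simp add: potential_series_def charge_0)
  show "\<epsilon> *\<^sub>R pderiv_t T mpot 0 x = - (E0 x + grad (epot 0) x)"
    unfolding pderiv_t_mpot[OF t0] grad_epot[OF t0]
    using \<epsilon> by (simp add: vec_eq_iff ev_0 coeff_sol_0 p0)
  show "curl (mpot 0) x = B0 x - torus_mean B0"
    using magnetic_mpot[OF t0, of x] by (simp add: vec_eq_iff ev_0 coeff_sol_0 eq_diff_eq)
next
  have t0: "0 \<in> {0..T}" using T by simp
  \<comment> \<open>The mean vanishes because the inverse Laplacian has symbol 0 at the zero
    mode.\<close>
  have "pot0 i = (\<lambda>x. ev (vpot i) 0 x)" for i by (simp add: fun_eq_iff ev_0 coeff_vpot)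
  then have "torus_mean (\<lambda>x. ev (vpot i) 0 x) = 0" for i
    using fourier_pot0[of i 0] unfolding fourier_zero_mode by (simp add: inv_laplace_symbol_def)
  moreover have "continuous_on UNIV (\<lambda>x. ev (vpot i) 0 x)" for i
    using bounded_seriesD(3)[OF vpot_bounded, of UNIV i 0] by (simp add: ev_0[abs_def])
  then have "torus_mean (mpot 0) $ i = torus_mean (\<lambda>x. ev (vpot i) 0 x)" for i
    unfolding torus_mean_eq by (intro integrable_vec3(2) integrable_cube)
  ultimately show "torus_mean (mpot 0) = 0" by (simp add: vec_eq_iff)
qed

end

end

subsection \<open>Local solutions with uniform bounds\<close>

text \<open>Bound for the index 1 weight at order zero that involves neither \<open>b\<close> nor
  \<open>R\<close>: the initial data must be measured before these two are chosen from their
  size.\<close>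

definition grown_weight :: "real \<Rightarrow> int ^ 3 \<Rightarrow> ennreal" where
  "grown_weight a k = ennreal ((1 + norm (int_vec k)) * exp (a * norm (int_vec k)))"

lemma (in time_weight) jweight_le_grown_weight: "jweight 1 0 k \<le> grown_weight a k"
proof -
  have "jweight 1 0 k \<le> ennreal (1 + norm (int_vec k)) * ennreal (exp (a * norm (int_vec k)))"
    unfolding jweight_def power_one_right by (intro mult_left_mono weight_0) auto
  then show ?thesis by (simp add: grown_weight_def ennreal_mult)
qed

lemma grown_weight_submult:
  assumes "a \<ge> 0"
  shows "grown_weight a (i + j) \<le> grown_weight a i * grown_weight a j"
proof -
  let ?x = "norm (int_vec i)" and ?y = "norm (int_vec j)" and ?z = "norm (int_vec (i + j))"
  have z: "?z \<le> ?x + ?y" using norm_triangle_ineq[of "int_vec i" "int_vec j"] by simp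
  have "0 \<le> ?x * ?y" by simp
  moreover have "(1 + ?x) * (1 + ?y) = 1 + ?x + ?y + ?x * ?y" by (simp add: algebra_simps)
  ultimately have 1: "1 + ?z \<le> (1 + ?x) * (1 + ?y)" using z by linarith
  have "a * ?z \<le> a * ?x + a * ?y" using mult_left_mono[OF z assms] by (simp add: distrib_left)
  then have 2: "exp (a * ?z) \<le> exp (a * ?x) * exp (a * ?y)" by (simp flip: exp_add)
  have "(1 + ?z) * exp (a * ?z) \<le> ((1 + ?x) * (1 + ?y)) * (exp (a * ?x) * exp (a * ?y))"
    by (rule mult_mono[OF 1 2]) auto
  then have "(1 + ?z) * exp (a * ?z) \<le> ((1 + ?x) * exp (a * ?x)) * ((1 + ?y) * exp (a * ?y))"
    by (simp only: mult_ac)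
  from ennreal_leI[OF this] show ?thesis unfolding grown_weight_def by (simp add: ennreal_mult)
qed

lemma grown_weight_0 [simp]: "grown_weight a 0 = 1"
  by (simp add: grown_weight_def)

lemma exp_weight_le_grown_weight: "exp_weight a k \<le> grown_weight a k"
  unfolding exp_weight_def grown_weight_def by (intro ennreal_leI) simp

lemma one_le_grown_weight: "a \<ge> 0 \<Longrightarrow> 1 \<le> grown_weight a k"
  using ennreal_leI[of 1 "(1 + norm (int_vec k)) * exp (a * norm (int_vec k))"]
    mult_mono[of 1 "1 + norm (int_vec k)" 1 "exp (a * norm (int_vec k))"]
  by (simp add: grown_weight_def)

lemma fsum_cmult_fun: "fsum \<omega> (\<lambda>x. r * f x) \<le> ennreal \<bar>r\<bar> * fsum \<omega> f"
  by (rule fsum_le_multiplier) (simp add: fourier_cmult norm_mult ennreal_mult mult.assoc)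

lemma B_norm_conv_exp_weight: "\<delta> > 0 \<Longrightarrow> B_norm \<delta> f = fsum (exp_weight (ln \<delta>)) f"
  by (simp add: B_norm_eq_fsum exp_weight_def[abs_def] powr_def mult.commute)

text \<open>The gap between \<open>a\<close> and \<open>ln \<delta>\<close> absorbs the factor
  \<open>1 + |k|\<close>; \<open>K0\<close> can be taken to depend on this gap alone.\<close>

lemma fsum_grown_weight_le:
  assumes K0: "\<And>x. x \<ge> 0 \<Longrightarrow> (1 + x) ^ 1 \<le> K0 * exp ((ln \<delta> - a) * x)" "K0 > 0" and "\<delta> > 0"
    and "B_norm \<delta> f \<le> ennreal c" "c \<ge> 0"
  shows "fsum (grown_weight a) f \<le> ennreal (K0 * c)"
proof -
  have "grown_weight a k \<le> ennreal K0 * exp_weight (ln \<delta>) k" for k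
  proof -
    let ?x = "norm (int_vec k)"
    have "(1 + ?x) * exp (a * ?x) \<le> K0 * exp ((ln \<delta> - a) * ?x) * exp (a * ?x)"
      using K0(1)[of ?x] by (intro mult_right_mono) auto
    also have "\<dots> = K0 * exp (ln \<delta> * ?x)" by (simp add: left_diff_distrib exp_diff)
    finally show ?thesis
      unfolding grown_weight_def exp_weight_def using \<open>K0 > 0\<close>
      by (subst ennreal_mult[symmetric]) (auto intro: ennreal_leI)
  qed
  then have "fsum (grown_weight a) f \<le> fsum (\<lambda>k. ennreal K0 * exp_weight (ln \<delta>) k) f" by (rule fsum_mono)
  also have "\<dots> = ennreal K0 * B_norm \<delta> f" by (simp add: fsum_cmult B_norm_conv_exp_weight[OF \<open>\<delta> > 0\<close>])
  also have "\<dots> \<le> ennreal K0 * ennreal c" by (intro mult_left_mono assms) auto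
  also have "\<dots> = ennreal (K0 * c)" using assms by (simp add: ennreal_mult)
  finally show ?thesis .
qed

text \<open>The gradient of the inverse Laplacian has a symbol bounded by
  \<open>1 / (2 * pi * |k|)\<close>, hence by 1, so the charge contributes no more than its own
  bound \<open>r\<close>.\<close>

lemma initial_rate_bound:
  fixes \<rho>0 :: "'a \<Rightarrow> real ^ 3 \<Rightarrow> real" and i :: 3
  assumes "prob_space M" and meas: "\<And>x. (\<lambda>\<theta>. \<rho>0 \<theta> x) \<in> borel_measurable M" and a: "a > 0"
    and \<rho>0: "\<And>\<theta>. \<theta> \<in> space M \<Longrightarrow> periodic_continuous (\<rho>0 \<theta>)" "\<And>\<theta>. \<theta> \<in> space M \<Longrightarrow> fsum (grown_weight a) (\<rho>0 \<theta>) \<le> ennreal r"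
      "r \<ge> 0"
    and E0: "periodic_continuous e0" "fsum (grown_weight a) e0 \<le> ennreal e" "e \<ge> 0" and "\<epsilon> > 0"
  defines "f \<equiv> \<lambda>x. - (1 / \<epsilon>) * (e0 x + pderiv_x i (mult_op inv_laplace_symbol (charge_density M \<rho>0)) x)"
  shows "periodic_continuous f" "fsum (grown_weight a) f \<le> ennreal ((e + r) / \<epsilon>)"
proof -
  interpret prob_space M by fact
  define n where "n = charge_density M \<rho>0"
  have n: "n = (\<lambda>x. \<integral>\<theta>. \<rho>0 \<theta> x \<partial>M)" by (simp add: n_def charge_density_def[abs_def])
  have one: "fsum (\<lambda>_. 1) g \<le> fsum (grown_weight a) g" for g
    using a by (intro fsum_mono one_le_grown_weight) auto
  note A = fourier_average[OF \<open>prob_space M\<close> meas \<rho>0(1) order_trans[OF one \<rho>0(2)] \<open>r \<ge> 0\<close>, folded n]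
  have fn: "fsum (grown_weight a) n \<le> ennreal r"
  proof -
    have "fsum (grown_weight a) n \<le> (\<integral>\<^sup>+\<theta>. fsum (grown_weight a) (\<rho>0 \<theta>) \<partial>M)" by (rule A(3))
    also have "\<dots> \<le> (\<integral>\<^sup>+\<theta>. ennreal r \<partial>M)" by (intro nn_integral_mono \<rho>0(2))
    also have "\<dots> = ennreal r" by (simp add: emeasure_space_1)
    finally show ?thesis .
  qed
  have en: "fsum (exp_weight a) n < \<infinity>"
    unfolding infinity_ennreal_def
    by (rule le_less_trans[OF order_trans[OF fsum_mono[OF exp_weight_le_grown_weight] fn] ennreal_less_top])
  define p where "p = mult_op inv_laplace_symbol n"
  note P = mult_op[OF even_bounded_inv_laplace fsum_exp_weight_summable(2)[OF a en], folded p_def]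
  have "fsum (exp_weight a) p \<le> 1 * fsum (exp_weight a) n"
  proof (rule fsum_le_multiplier)
    fix k
    have "\<bar>inv_laplace_symbol k\<bar> \<le> 1" using even_bounded_inv_laplace by (simp add: even_bounded_def)
    then have "cmod (fourier p k) \<le> cmod (fourier n k)" unfolding P(2) norm_mult by (simp add: mult_left_le_one_le)
    then show "ennreal (cmod (fourier p k)) * exp_weight a k \<le> 1 * (ennreal (cmod (fourier n k)) * exp_weight a k)"
      by (simp add: mult_right_mono ennreal_leI)
  qed
  then have ep: "fsum (exp_weight a) p < \<infinity>" using en by (simp add: le_less_trans)
  note D = pderiv_fourier[OF P(1) fsum_exp_weight_summable(1)[OF a ep]]
  have fd: "fsum (grown_weight a) (pderiv_x i p) \<le> 1 * fsum (grown_weight a) n"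
  proof (rule fsum_le_multiplier)
    fix k
    have "cmod (deriv_symbol i k) * \<bar>inv_laplace_symbol k\<bar> \<le> 1"
    proof (cases "k = 0")
      case False
      let ?N = "norm (int_vec k)"
      have N: "1 \<le> ?N" by (rule norm_int_vec_ge_1[OF False])
      have "cmod (deriv_symbol i k) * \<bar>inv_laplace_symbol k\<bar> \<le> (2 * pi * ?N) * (1 / (4 * pi\<^sup>2 * ?N\<^sup>2))"
        unfolding inv_laplace_symbol_def by (intro mult_mono deriv_symbol_bound) auto
      also have "\<dots> = 1 / (2 * pi * ?N)" using N by (simp add: power2_eq_square field_simps)
      also have "\<dots> \<le> 1"
        using mult_mono[of 1 "2 * pi" 1 ?N] pi_ge_two N by (simp add: divide_le_eq)
      finally show ?thesis .
    qed simp
    then have "cmod (fourier (pderiv_x i p) k) \<le> cmod (fourier n k)"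
      using mult_right_mono[of "cmod (deriv_symbol i k) * \<bar>inv_laplace_symbol k\<bar>" 1 "cmod (fourier n k)"]
      by (simp add: D(3) P(2) norm_mult mult.assoc)
    then show "ennreal (cmod (fourier (pderiv_x i p) k)) * grown_weight a k \<le> 1 * (ennreal (cmod (fourier n k)) * grown_weight a k)"
      by (simp add: mult_right_mono ennreal_leI)
  qed
  have f: "f = (\<lambda>x. - (1 / \<epsilon>) * (e0 x + pderiv_x i p x))" by (simp add: f_def p_def n_def)
  show "periodic_continuous f" unfolding f by (intro periodic_continuous_intros E0 D)
  have "fsum (grown_weight a) f \<le> ennreal \<bar>- (1 / \<epsilon>)\<bar> * fsum (grown_weight a) (\<lambda>x. e0 x + pderiv_x i p x)"
    unfolding f by (rule fsum_cmult_fun)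
  also have "\<dots> \<le> ennreal \<bar>- (1 / \<epsilon>)\<bar> * (ennreal e + ennreal r)"
  proof (rule mult_left_mono)
    have "fsum (grown_weight a) (\<lambda>x. e0 x + pderiv_x i p x) \<le> fsum (grown_weight a) e0 + fsum (grown_weight a) (pderiv_x i p)"
      by (intro fsum_add periodic_continuousD E0 D)
    also have "\<dots> \<le> ennreal e + ennreal r" using fd fn by (intro add_mono E0) auto
    finally show "fsum (grown_weight a) (\<lambda>x. e0 x + pderiv_x i p x) \<le> ennreal e + ennreal r" .
  qed simp
  also have "\<dots> = ennreal (\<bar>- (1 / \<epsilon>)\<bar> * (e + r))"
    using E0(3) \<open>r \<ge> 0\<close> by (subst ennreal_mult) (auto simp: ennreal_plus)
  also have "\<bar>- (1 / \<epsilon>)\<bar> * (e + r) = (e + r) / \<epsilon>" using \<open>\<epsilon> > 0\<close> by simp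
  finally show "fsum (grown_weight a) f \<le> ennreal ((e + r) / \<epsilon>)" .
qed

text \<open>Three squared components of norm at most \<open>r\<close> give
  \<open>3 * r\<^sup>2\<close>; the threshold 1/2 is the one under which the binomial series was
  summed.\<close>

lemma initial_lorentz_bound:
  fixes \<xi> :: "real ^ 3 \<Rightarrow> real ^ 3"
  assumes \<xi>: "\<And>i. periodic_continuous (\<lambda>x. \<xi> x $ i)" "\<And>i. fsum (grown_weight a) (\<lambda>x. \<xi> x $ i) \<le> ennreal r" "r \<ge> 0"
    and a: "a > 0" and small: "\<epsilon>\<^sup>2 * (3 * r\<^sup>2) \<le> 1 / 2"
  shows "periodic_continuous (\<lambda>x. (1 + \<epsilon>\<^sup>2 * (norm (\<xi> x))\<^sup>2) powr (- 1 / 2))"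
    "fsum (grown_weight a) (\<lambda>x. (1 + \<epsilon>\<^sup>2 * (norm (\<xi> x))\<^sup>2) powr (- 1 / 2)) \<le> ennreal 2"
proof -
  define z where "z x = \<epsilon>\<^sup>2 * (norm (\<xi> x))\<^sup>2" for x
  have z: "z = (\<lambda>x. \<epsilon>\<^sup>2 * (\<Sum>i\<in>UNIV. \<xi> x $ i * \<xi> x $ i))"
    by (simp add: fun_eq_iff z_def power2_norm_eq_inner inner_vec_def)
  have zp: "periodic_continuous z" unfolding z by (intro periodic_continuous_intros periodic_continuous_sum \<xi>)
  have fin: "fsum (exp_weight a) (\<lambda>x. \<xi> x $ i) < \<infinity>" for i
    unfolding infinity_ennreal_def
    by (rule le_less_trans[OF order_trans[OF fsum_mono[OF exp_weight_le_grown_weight] \<xi>(2)] ennreal_less_top])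
  have "fsum (grown_weight a) (\<lambda>x. \<xi> x $ i * \<xi> x $ i) \<le> ennreal (r\<^sup>2)" for i
  proof -
    have "fsum (grown_weight a) (\<lambda>x. \<xi> x $ i * \<xi> x $ i) \<le> fsum (grown_weight a) (\<lambda>x. \<xi> x $ i) * fsum (grown_weight a) (\<lambda>x. \<xi> x $ i)"
      using a by (intro fsum_mult \<xi> fsum_exp_weight_summable(2)[OF a fin] periodic_continuousD grown_weight_submult) auto
    also have "\<dots> \<le> ennreal r * ennreal r" by (intro mult_mono \<xi>) auto
    also have "\<dots> = ennreal (r\<^sup>2)" using \<xi>(3) by (simp add: power2_eq_square ennreal_mult)
    finally show ?thesis .
  qed
  then have "(\<Sum>i\<in>(UNIV::3 set). fsum (grown_weight a) (\<lambda>x. \<xi> x $ i * \<xi> x $ i)) \<le> (\<Sum>i\<in>(UNIV::3 set). ennreal (r\<^sup>2))"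
    by (intro sum_mono)
  then have S: "fsum (grown_weight a) (\<lambda>x. \<Sum>i\<in>UNIV. \<xi> x $ i * \<xi> x $ i) \<le> (\<Sum>i\<in>(UNIV::3 set). ennreal (r\<^sup>2))"
    by (rule order_trans[OF fsum_sum, rotated]) (intro continuous_intros periodic_continuousD \<xi>)
  have "fsum (grown_weight a) z \<le> ennreal \<bar>\<epsilon>\<^sup>2\<bar> * fsum (grown_weight a) (\<lambda>x. \<Sum>i\<in>UNIV. \<xi> x $ i * \<xi> x $ i)"
    unfolding z by (rule fsum_cmult_fun)
  also have "\<dots> \<le> ennreal \<bar>\<epsilon>\<^sup>2\<bar> * (\<Sum>i\<in>(UNIV::3 set). ennreal (r\<^sup>2))" by (intro mult_left_mono S) auto
  also have "(\<Sum>i\<in>(UNIV::3 set). ennreal (r\<^sup>2)) = ennreal (3 * r\<^sup>2)" by (subst sum_ennreal) auto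
  also have "ennreal \<bar>\<epsilon>\<^sup>2\<bar> * ennreal (3 * r\<^sup>2) = ennreal (\<epsilon>\<^sup>2 * (3 * r\<^sup>2))" by (subst ennreal_mult) auto
  also have "\<dots> \<le> ennreal (1 / 2)" by (rule ennreal_leI[OF small])
  finally have fz: "fsum (grown_weight a) z \<le> ennreal (1 / 2)" .
  from lorentz_factor[OF zp a exp_weight_le_grown_weight grown_weight_submult grown_weight_0 fz] a
  show "periodic_continuous (\<lambda>x. (1 + \<epsilon>\<^sup>2 * (norm (\<xi> x))\<^sup>2) powr (- 1 / 2))"
    "fsum (grown_weight a) (\<lambda>x. (1 + \<epsilon>\<^sup>2 * (norm (\<xi> x))\<^sup>2) powr (- 1 / 2)) \<le> ennreal 2"
    by (auto simp: z_def)
qed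

text \<open>\<epsilon> and the field strength \<open>e\<close> occur only in the last two entries;
  this separates the bounds that are uniform in \<epsilon> from the others.\<close>

fun mf_size :: "real \<Rightarrow> real \<Rightarrow> real \<Rightarrow> 'a field_var \<Rightarrow> real" where
  "mf_size \<epsilon> r e (Density \<theta>) = r"
| "mf_size \<epsilon> r e (Momentum \<theta> i) = r"
| "mf_size \<epsilon> r e (Lorentz \<theta>) = 2"
| "mf_size \<epsilon> r e (Potential_Rate i) = (e + r) / \<epsilon>"
| "mf_size \<epsilon> r e (Magnetic i) = e"

lemma B_space_imp_periodic_continuous: "f \<in> B_space \<delta> \<Longrightarrow> periodic_continuous f"
  by (simp add: B_space_def periodic_continuous_def)

lemma B_space_vec_imp_periodic_continuous: "F \<in> B_space_vec \<delta> \<Longrightarrow> periodic_continuous (\<lambda>x. F x $ i)"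
  by (auto simp: B_space_vec_def periodic_continuous_def periodic_def intro!: continuous_intros)

text \<open>The statement for a single \<epsilon>, with \<open>m\<close> in place of
  \<open>\<epsilon> powr (- \<gamma>)\<close>. The bounds contain only \<open>K0\<close>,
  \<open>C0\<close> and \<open>m\<close>; any further dependence on \<epsilon> goes into the time
  \<open>T\<close>.\<close>

lemma local_solution:
  fixes M :: "'a measure" and \<delta>0 \<delta>1 C0 K0 \<epsilon> m :: real
    and \<rho>0 :: "'a \<Rightarrow> real ^ 3 \<Rightarrow> real" and \<xi>0 :: "'a \<Rightarrow> real ^ 3 \<Rightarrow> real ^ 3" and E0 B0 :: "real ^ 3 \<Rightarrow> real ^ 3"
  assumes M: "prob_space M" and \<delta>: "\<delta>0 > \<delta>1" "\<delta>1 > 1" and C0: "C0 > 0"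
    and meas: "measurable_family M \<rho>0" "measurable_family M \<xi>0"
    and \<rho>0: "\<And>\<theta>. \<theta> \<in> space M \<Longrightarrow> \<rho>0 \<theta> \<in> B_space \<delta>0" "\<And>\<theta>. \<theta> \<in> space M \<Longrightarrow> B_norm \<delta>0 (\<rho>0 \<theta>) \<le> ennreal C0"
    and \<xi>0: "\<And>\<theta>. \<theta> \<in> space M \<Longrightarrow> \<xi>0 \<theta> \<in> B_space_vec \<delta>0" "\<And>\<theta>. \<theta> \<in> space M \<Longrightarrow> B_norm_vec \<delta>0 (\<xi>0 \<theta>) \<le> ennreal C0"
    and E0: "E0 \<in> B_space_vec \<delta>0" "\<And>x. divergence E0 x = charge_density M \<rho>0 x - 1"
    and B0: "B0 \<in> B_space_vec \<delta>0" "\<And>x. divergence B0 x = 0"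
    and EB: "B_norm_vec \<delta>0 E0 + B_norm_vec \<delta>0 B0 \<le> ennreal (C0 * m)" and m: "m \<ge> 1"
    and \<epsilon>: "0 < \<epsilon>" "\<epsilon> \<le> 1" and K0: "K0 > 0" "\<And>x. x \<ge> 0 \<Longrightarrow> (1 + x) ^ 1 \<le> K0 * exp ((ln \<delta>0 - (ln \<delta>0 + ln \<delta>1) / 2) * x)"
    and small: "\<epsilon>\<^sup>2 * (3 * (K0 * C0)\<^sup>2) \<le> 1 / 2"
  shows "\<exists>T \<rho> \<xi> \<phi> A. T > 0 \<and>
     (\<forall>\<theta>\<in>space M. continuous_curve (B_norm \<delta>1) (B_space \<delta>1) T (\<rho> \<theta>) \<and>
         continuous_curve (B_norm_vec \<delta>1) (B_space_vec \<delta>1) T (\<xi> \<theta>)) \<and>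
     MF_solution M \<epsilon> T \<rho>0 \<xi>0 E0 B0 \<rho> \<xi> \<phi> A \<and>
     (SUP \<theta>\<in>space M. Linf_norm (B_norm \<delta>1) T (\<rho> \<theta>)) + (SUP \<theta>\<in>space M. Linf_norm (B_norm_vec \<delta>1) T (\<xi> \<theta>))
       \<le> ennreal (100 * (K0 * C0 + 1)) \<and>
     Linf_norm (B_norm_vec \<delta>1) T (electric_field \<epsilon> T \<phi> A) + Linf_norm (B_norm_vec \<delta>1) T (magnetic_field B0 A)
       \<le> ennreal (100 * (K0 * C0 + 1) * m)"
proof -
  \<comment> \<open>The midpoint between the logarithms of the two radii: the upper half of the gap
    absorbs the additional factor \<open>1 + |k|\<close>, the lower half, of length
    \<open>d\<close>, is spent while time runs.\<close>
  define a where "a = (ln \<delta>0 + ln \<delta>1) / 2"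
  define d where "d = (ln \<delta>0 - ln \<delta>1) / 2"
  define r where "r = K0 * C0"
  define e where "e = K0 * (C0 * m)"
  \<comment> \<open>Exceeds \<open>c s + 1\<close> for each of the five kinds of unknowns; the
    summand 4 covers the Lorentz factor, whose bound is 2 + 1.\<close>
  define K where "K = 4 + r + e + (e + r) / \<epsilon>"
  define Q where "Q = 105 * K ^ 7 / \<epsilon>\<^sup>2"
  \<comment> \<open>With \<open>Q\<close> the size of the right-hand side, \<open>1 / b\<close> and
    \<open>R\<close> are both at most \<open>1 / (2 * Q)\<close>, so the gain times \<open>Q\<close>
    is at most 1; the second entry of the minimum ensures \<open>b * R \<le> d\<close>.\<close>
  define b where "b = 2 * Q"
  define R where "R = min (1 / (2 * Q)) (d / (2 * Q))"
  \<comment> \<open>Strictly below \<open>R\<close>, which leaves room for the time derivatives up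
    to the end point.\<close>
  define T where "T = R / 2"
  have ln: "0 < ln \<delta>1" "ln \<delta>1 < ln \<delta>0" using \<delta> by auto
  have d: "d > 0" and a: "a > 0" using ln by (auto simp: d_def a_def)
  have r: "r > 0" and e: "e > 0" using K0(1) C0 m by (auto simp: r_def e_def)
  have er: "(e + r) / \<epsilon> > 0" using r e \<epsilon> by (intro divide_pos_pos) auto
  have K: "K \<ge> 1" using r e er by (simp add: K_def)
  have Q: "Q > 0" using K \<epsilon> by (simp add: Q_def)
  have b: "b > 0" using Q by (simp add: b_def)
  have R: "R > 0" using Q d by (simp add: R_def)
  have bR: "b * R \<le> d"
  proof -
    have "b * R \<le> b * (d / (2 * Q))" using b by (intro mult_left_mono) (auto simp: R_def)
    then show ?thesis using Q by (simp add: b_def)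
  qed
  have abR: "ln \<delta>1 \<le> a - b * R" using bR by (simp add: a_def d_def field_simps)
  have T: "0 < T" "T < R" using R by (auto simp: T_def)
  interpret TW: time_weight a b R using R b abR ln(1) by unfold_locales auto
  interpret P: prob_space M by fact
  have gain: "TW.gain * Q \<le> 1"
  proof -
    have "TW.gain \<le> 1 / (2 * Q) + 1 / (2 * Q)" unfolding TW.gain_def by (intro add_mono) (auto simp: R_def b_def)
    then have "TW.gain * Q \<le> (1 / (2 * Q) + 1 / (2 * Q)) * Q" using Q by (intro mult_right_mono) auto
    then show ?thesis using Q by (simp add: distrib_right)
  qed
  have \<delta>0: "\<delta>0 > 0" and \<delta>1: "\<delta>1 > 0" using \<delta> by auto
  note gw = fsum_grown_weight_le[OF K0(2)[folded a_def] K0(1) \<delta>0]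
  have f\<rho>: "fsum (grown_weight a) (\<rho>0 \<theta>) \<le> ennreal r" if "\<theta> \<in> space M" for \<theta>
    unfolding r_def using C0 by (intro gw \<rho>0 that) auto
  have f\<xi>: "fsum (grown_weight a) (\<lambda>x. \<xi>0 \<theta> x $ i) \<le> ennreal r" if "\<theta> \<in> space M" for \<theta> i
    unfolding r_def using C0 by (intro gw order_trans[OF B_norm_le_vec \<xi>0(2)[OF that]]) auto
  have E0n: "B_norm_vec \<delta>0 E0 \<le> ennreal (C0 * m)" and B0n: "B_norm_vec \<delta>0 B0 \<le> ennreal (C0 * m)"
    by (rule order_trans[OF _ EB], simp)+
  have fE: "fsum (grown_weight a) (\<lambda>x. E0 x $ i) \<le> ennreal e" and fB: "fsum (grown_weight a) (\<lambda>x. B0 x $ i) \<le> ennreal e" for i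
    unfolding e_def using C0 m by (intro gw order_trans[OF B_norm_le_vec E0n] order_trans[OF B_norm_le_vec B0n]; simp)+
  have m\<rho>: "(\<lambda>\<theta>. \<rho>0 \<theta> x) \<in> borel_measurable M" and m\<xi>: "(\<lambda>\<theta>. \<xi>0 \<theta> x) \<in> borel_measurable M" for x
    using meas by (auto simp: measurable_family_def)
  have m\<xi>i: "(\<lambda>\<theta>. \<xi>0 \<theta> x $ i) \<in> borel_measurable M" for x i
  proof -
    have "(\<lambda>v. v $ i) \<in> borel_measurable (borel :: (real ^ 3) measure)"
      by (intro borel_measurable_continuous_onI continuous_intros)
    then show ?thesis using measurable_compose[OF m\<xi>] by blast
  qed
  let ?u = "mf_init M \<epsilon> \<rho>0 \<xi>0 E0 B0" and ?c = "mf_size \<epsilon> r e :: 'a field_var \<Rightarrow> real"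
  have init: "periodic_continuous (?u s) \<and> fsum (grown_weight a) (?u s) \<le> ennreal (?c s) \<and> 0 \<le> ?c s \<and> ?c s + 1 \<le> K"
    if s: "valid_var M s" for s
  proof (cases s)
    case (Density \<theta>)
    then show ?thesis
      using s B_space_imp_periodic_continuous[OF \<rho>0(1)] f\<rho> r e er by (simp add: K_def)
  next
    case (Momentum \<theta> i)
    then show ?thesis
      using s B_space_vec_imp_periodic_continuous[OF \<xi>0(1)] f\<xi> r e er by (simp add: K_def)
  next
    case (Lorentz \<theta>)
    then show ?thesis
      using s initial_lorentz_bound[of "\<xi>0 \<theta>" a r \<epsilon>, OF B_space_vec_imp_periodic_continuous[OF \<xi>0(1)] f\<xi> less_imp_le[OF r] a small[folded r_def]]
        r e er by (simp add: K_def)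
  next
    case (Potential_Rate i)
    then show ?thesis
      using initial_rate_bound[OF M m\<rho> a B_space_imp_periodic_continuous[OF \<rho>0(1)] f\<rho> less_imp_le[OF r]
          B_space_vec_imp_periodic_continuous[OF E0(1)] fE less_imp_le[OF e] \<epsilon>(1), of i i] r e er
      by (simp add: K_def less_imp_le)
  next
    case (Magnetic i)
    then show ?thesis
      using B_space_vec_imp_periodic_continuous[OF B0(1)] fB r e er by (simp add: K_def)
  qed
  have jle: "fsum (TW.jweight 1 0) f \<le> fsum (grown_weight a) f" for f
    by (rule fsum_mono[OF TW.jweight_le_grown_weight])
  have "mf_data a b R M \<epsilon> K \<rho>0 \<xi>0 E0 B0 ?c (ln \<delta>0)"
  proof unfold_locales
    show "periodic_continuous (?u s) \<and> fsum (TW.jweight 1 0) (?u s) \<le> ennreal (?c s) \<and> 0 \<le> ?c s \<and> ?c s + 1 \<le> K"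
      if "valid_var M s" for s
      using init[OF that] jle order_trans by blast
    show "(\<lambda>\<theta>. ?u (Lorentz \<theta>) x) \<in> borel_measurable M" for x
    proof -
      have [measurable]: "(\<lambda>\<theta>. \<xi>0 \<theta> x) \<in> borel_measurable M" by (rule m\<xi>)
      show ?thesis unfolding mf_init.simps by measurable
    qed
    show "fsum (exp_weight (ln \<delta>0)) (\<lambda>x. E0 x $ i) < \<infinity>" for i
      unfolding B_norm_conv_exp_weight[OF \<delta>0, symmetric] infinity_ennreal_def
      by (rule le_less_trans[OF order_trans[OF B_norm_le_vec E0n] ennreal_less_top])
    show "TW.gain * (105 * K ^ 7 / \<epsilon>\<^sup>2) \<le> 1" using gain by (simp add: Q_def)
    show "0 < ln \<delta>0" using ln by simp
  qed (use \<epsilon> K m\<rho> m\<xi>i E0 B0 B_space_vec_imp_periodic_continuous[OF E0(1)] in simp_all)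
  then interpret D: mf_data a b R M \<epsilon> K \<rho>0 \<xi>0 E0 B0 ?c "ln \<delta>0" .
  have B0c: "continuous_on UNIV B0" using B0(1) by (simp add: B_space_vec_def)
  let ?\<rho> = "\<lambda>\<theta>. ev (D.sol (Density \<theta>))" and ?\<xi> = "\<lambda>\<theta> t x. \<chi> i. ev (D.sol (Momentum \<theta> i)) t x"
  let ?\<phi> = "ev (potential_series M D.sol)" and ?A = "\<lambda>t x. \<chi> i. ev (D.vpot i) t x"
  note dec = TW.bounded_series_imp_decay
  have TR: "T \<le> R" using T by simp
  have bd: "TW.bounded_series 1 (D.sol s) (?c s + 1)" if "valid_var M s" for s by (rule D.sol_bound[OF that])
  have b\<rho>: "TW.bounded_series 1 (D.sol (Density \<theta>)) (r + 1)" if "\<theta> \<in> space M" for \<theta>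
    using bd[of "Density \<theta>"] that by simp
  have b\<xi>: "TW.bounded_series 1 (D.sol (Momentum \<theta> i)) (r + 1)" if "\<theta> \<in> space M" for \<theta> i
    using bd[of "Momentum \<theta> i"] that by simp
  have b\<phi>: "TW.bounded_series 1 (potential_series M D.sol) (r + 1)"
    using r by (intro D.potential_bound' b\<rho>) auto
  have bD: "TW.bounded_series 1 (D.sol (Potential_Rate i)) ((e + r) / \<epsilon> + 1)" for i using bd[of "Potential_Rate i"] by simp
  have bB: "TW.bounded_series 1 (D.sol (Magnetic i)) (e + 1)" for i using bd[of "Magnetic i"] by simp
  \<comment> \<open>The electric field as one series: its bound combines \<epsilon> with the bound
    \<open>(e + r) / \<epsilon> + 1\<close> of the rate, and the negative power of \<epsilon>
    cancels.\<close>
  define E where "E i = (\<lambda>x. - lift_op (pderiv_x i) (potential_series M D.sol) x - fps_const \<epsilon> * D.sol (Potential_Rate i) x)" for i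
  have bE: "TW.bounded_series 0 (E i) (2 * pi * (r + 1) + \<bar>\<epsilon>\<bar> * ((e + r) / \<epsilon> + 1))" for i
    unfolding E_def by (intro TW.bounded_series_diff TW.bounded_series_uminus TW.bounded_series_pderiv b\<phi> TW.bounded_series_cmult TW.bounded_series_1_0 bD)
  have \<epsilon>e: "\<bar>\<epsilon>\<bar> * ((e + r) / \<epsilon> + 1) = e + r + \<epsilon>" using \<epsilon> by (simp add: field_simps)
  have fE: "electric_field \<epsilon> T ?\<phi> ?A t = (\<lambda>x. \<chi> i. ev (E i) t x)" if t: "t \<in> {0..T}" for t
  proof
    fix x
    have c1: "converges_at t (lift_op (pderiv_x i) (potential_series M D.sol) x)" for i
      by (rule analytic_upto_converges_at[OF analytic_upto_pderiv[OF D.analytic_upto_fields(4)[OF T B0c]] t])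
    have c2: "converges_at t (D.sol (Potential_Rate i) x)" for i
      by (rule analytic_upto_converges_at[OF D.analytic_upto_sol[OF T B0c] t]) simp
    show "electric_field \<epsilon> T ?\<phi> ?A t x = (\<chi> i. ev (E i) t x)"
      unfolding electric_field_def D.grad_epot[OF T B0c t] D.pderiv_t_mpot[OF T B0c t]
      by (simp add: vec_eq_iff E_def ev_def eval_fps_ops converges_at_intros c1 c2)
  qed
  have fB: "magnetic_field B0 ?A t = (\<lambda>x. \<chi> i. ev (D.sol (Magnetic i)) t x)" if t: "t \<in> {0..T}" for t
    using D.magnetic_mpot[OF T B0c t] by (simp add: magnetic_field_def fun_eq_iff)
  note le = TW.B_norm_ev_bounded_series[OF _ _ TR \<delta>1 abR]
  show ?thesis
  proof (intro exI[of _ T] exI[of _ ?\<rho>] exI[of _ ?\<xi>] exI[of _ ?\<phi>] exI[of _ ?A] conjI ballI)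
    show "0 < T" by fact
    show "continuous_curve (B_norm \<delta>1) (B_space \<delta>1) T (?\<rho> \<theta>)" if "\<theta> \<in> space M" for \<theta>
      by (rule continuous_curve_ev[OF dec[OF b\<rho>[OF that]] TR \<delta>1 abR])
    show "continuous_curve (B_norm_vec \<delta>1) (B_space_vec \<delta>1) T (?\<xi> \<theta>)" if "\<theta> \<in> space M" for \<theta>
      by (rule continuous_curve_ev_vec[OF dec[OF b\<xi>[OF that]] TR \<delta>1 abR])
    show "MF_solution M \<epsilon> T \<rho>0 \<xi>0 E0 B0 ?\<rho> ?\<xi> ?\<phi> ?A" by (rule D.mf_solution[OF T B0c])
    have "Linf_norm (B_norm \<delta>1) T (?\<rho> \<theta>) \<le> ennreal (r + 1)" if "\<theta> \<in> space M" for \<theta>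
      by (rule Linf_norm_ev_le[OF dec[OF b\<rho>[OF that]] TR le[OF b\<rho>[OF that]]])
    then have s1: "(SUP \<theta>\<in>space M. Linf_norm (B_norm \<delta>1) T (?\<rho> \<theta>)) \<le> ennreal (r + 1)" by (rule SUP_least)
    have "Linf_norm (B_norm_vec \<delta>1) T (?\<xi> \<theta>) \<le> (\<Sum>j\<in>(UNIV::3 set). ennreal (r + 1))" if "\<theta> \<in> space M" for \<theta>
      by (rule Linf_norm_ev_vec_le[OF dec[OF b\<xi>[OF that]] TR le[OF b\<xi>[OF that]] refl])
    then have s2: "(SUP \<theta>\<in>space M. Linf_norm (B_norm_vec \<delta>1) T (?\<xi> \<theta>)) \<le> (\<Sum>j\<in>(UNIV::3 set). ennreal (r + 1))" by (rule SUP_least)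
    have "(SUP \<theta>\<in>space M. Linf_norm (B_norm \<delta>1) T (?\<rho> \<theta>)) + (SUP \<theta>\<in>space M. Linf_norm (B_norm_vec \<delta>1) T (?\<xi> \<theta>))
       \<le> ennreal (r + 1) + (\<Sum>j\<in>(UNIV::3 set). ennreal (r + 1))" by (rule add_mono[OF s1 s2])
    also have "\<dots> = ennreal ((r + 1) + (\<Sum>j\<in>(UNIV::3 set). r + 1))"
      using r by (subst sum_ennreal, simp, subst ennreal_plus) auto
    also have "\<dots> \<le> ennreal (100 * (K0 * C0 + 1))" using r by (intro ennreal_leI) (simp add: r_def[symmetric])
    finally show "(SUP \<theta>\<in>space M. Linf_norm (B_norm \<delta>1) T (?\<rho> \<theta>)) + (SUP \<theta>\<in>space M. Linf_norm (B_norm_vec \<delta>1) T (?\<xi> \<theta>))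
       \<le> ennreal (100 * (K0 * C0 + 1))" .
    have s3: "Linf_norm (B_norm_vec \<delta>1) T (electric_field \<epsilon> T ?\<phi> ?A) \<le> (\<Sum>j\<in>(UNIV::3 set). ennreal (2 * pi * (r + 1) + (e + r + \<epsilon>)))"
      by (rule Linf_norm_ev_vec_le[OF dec[OF bE] TR le[OF bE, unfolded \<epsilon>e] fE])
    have s4: "Linf_norm (B_norm_vec \<delta>1) T (magnetic_field B0 ?A) \<le> (\<Sum>j\<in>(UNIV::3 set). ennreal (e + 1))"
      by (rule Linf_norm_ev_vec_le[OF dec[OF bB] TR le[OF bB] fB])
    have "Linf_norm (B_norm_vec \<delta>1) T (electric_field \<epsilon> T ?\<phi> ?A) + Linf_norm (B_norm_vec \<delta>1) T (magnetic_field B0 ?A)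
       \<le> (\<Sum>j\<in>(UNIV::3 set). ennreal (2 * pi * (r + 1) + (e + r + \<epsilon>))) + (\<Sum>j\<in>(UNIV::3 set). ennreal (e + 1))"
      by (rule add_mono[OF s3 s4])
    also have "\<dots> = ennreal ((\<Sum>j\<in>(UNIV::3 set). 2 * pi * (r + 1) + (e + r + \<epsilon>)) + (\<Sum>j\<in>(UNIV::3 set). e + 1))"
    proof -
      have p: "0 \<le> 2 * pi * (r + 1) + (e + r + \<epsilon>)" "0 \<le> e + 1" using r e \<epsilon> by (auto intro!: add_nonneg_nonneg)
      show ?thesis by (subst (1 2) sum_ennreal) (use p in \<open>simp_all add: ennreal_plus[symmetric] del: ennreal_plus\<close>)
    qed
    also have "\<dots> \<le> ennreal (100 * (K0 * C0 + 1) * m)"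
    proof (rule ennreal_leI)
      have em: "e = r * m" by (simp add: e_def r_def)
      have rm: "r \<le> r * m" using r m by simp
      \<comment> \<open>Applied with \<open>p = r * m\<close>, where \<open>r \<le> p\<close> holds
        since \<open>m \<ge> 1\<close>; every summand is then dominated by a multiple of
        \<open>p\<close> or of \<open>m\<close>.\<close>
      have linear: "24 * (r + 1) + 3 * p + 3 * r + 3 + 3 * p + 3 \<le> 100 * p + 100 * m" if "r \<le> p" for p
        using that m r by argo
      have "pi * (r + 1) \<le> 4 * (r + 1)" using pi_less_4 r by (intro mult_right_mono) auto
      then have "3 * (2 * pi * (r + 1) + (e + r + \<epsilon>)) + 3 * (e + 1) \<le> 24 * (r + 1) + 3 * e + 3 * r + 3 + 3 * e + 3"
        using \<epsilon> by (simp add: algebra_simps)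
      also have "\<dots> \<le> 100 * (r * m) + 100 * m" using linear[OF rm] unfolding em .
      also have "\<dots> = 100 * (r + 1) * m" by (simp add: algebra_simps)
      finally show "(\<Sum>j\<in>(UNIV::3 set). 2 * pi * (r + 1) + (e + r + \<epsilon>)) + (\<Sum>j\<in>(UNIV::3 set). e + 1) \<le> 100 * (K0 * C0 + 1) * m"
        by (simp add: r_def)
    qed
    finally show "Linf_norm (B_norm_vec \<delta>1) T (electric_field \<epsilon> T ?\<phi> ?A) + Linf_norm (B_norm_vec \<delta>1) T (magnetic_field B0 ?A)
       \<le> ennreal (100 * (K0 * C0 + 1) * m)" .
  qed
qed

theorem theorem4p4:
  fixes M :: "'a measure"
    and \<delta>0 \<delta>1 C0 \<gamma> :: real
    and \<rho>0 :: "'a \<Rightarrow> real ^ 3 \<Rightarrow> real"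
    and \<xi>0 :: "'a \<Rightarrow> real ^ 3 \<Rightarrow> real ^ 3"
    and E0 B0 :: "real \<Rightarrow> real ^ 3 \<Rightarrow> real ^ 3"
  assumes "prob_space M"
    and "\<delta>0 > \<delta>1" and "\<delta>1 > 1"
    and "C0 > 0"
    and "measurable_family M \<rho>0" and "measurable_family M \<xi>0"
    and "\<And>\<theta>. \<theta> \<in> space M \<Longrightarrow> \<rho>0 \<theta> \<in> B_space \<delta>0"
    and "\<And>\<theta>. \<theta> \<in> space M \<Longrightarrow> \<xi>0 \<theta> \<in> B_space_vec \<delta>0"
    and "\<And>\<epsilon>. \<epsilon> \<in> {0<..1} \<Longrightarrow> E0 \<epsilon> \<in> B_space_vec \<delta>0"
    and "\<And>\<epsilon>. \<epsilon> \<in> {0<..1} \<Longrightarrow> B0 \<epsilon> \<in> B_space_vec \<delta>0"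
    and "\<And>\<epsilon> x. \<epsilon> \<in> {0<..1} \<Longrightarrow> divergence (E0 \<epsilon>) x = charge_density M \<rho>0 x - 1"
    and "\<And>\<epsilon> x. \<epsilon> \<in> {0<..1} \<Longrightarrow> divergence (B0 \<epsilon>) x = 0"
    and "(SUP \<theta>\<in>space M. B_norm \<delta>0 (\<rho>0 \<theta>)) \<le> ennreal C0"
    and "(SUP \<theta>\<in>space M. B_norm_vec \<delta>0 (\<xi>0 \<theta>)) \<le> ennreal C0"
    and "\<gamma> \<in> {0..1}"
    and "\<And>\<epsilon>. \<epsilon> \<in> {0<..1} \<Longrightarrow>
           B_norm_vec \<delta>0 (E0 \<epsilon>) + B_norm_vec \<delta>0 (B0 \<epsilon>) \<le> ennreal (C0 * \<epsilon> powr (- \<gamma>))"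
  shows "\<exists>\<epsilon>0. 0 < \<epsilon>0 \<and> \<epsilon>0 \<le> 1 \<and>
    (\<exists>(T :: real \<Rightarrow> real)
      (\<rho> :: real \<Rightarrow> 'a \<Rightarrow> real \<Rightarrow> real ^ 3 \<Rightarrow> real)
      (\<xi> :: real \<Rightarrow> 'a \<Rightarrow> real \<Rightarrow> real ^ 3 \<Rightarrow> real ^ 3)
      (\<phi> :: real \<Rightarrow> real \<Rightarrow> real ^ 3 \<Rightarrow> real)
      (A :: real \<Rightarrow> real \<Rightarrow> real ^ 3 \<Rightarrow> real ^ 3).
      (\<forall>\<epsilon>\<in>{0<..<\<epsilon>0}.
         T \<epsilon> > 0 \<and>
         (\<forall>\<theta>\<in>space M.
            continuous_curve (B_norm \<delta>1) (B_space \<delta>1) (T \<epsilon>) (\<rho> \<epsilon> \<theta>) \<and>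
            continuous_curve (B_norm_vec \<delta>1) (B_space_vec \<delta>1) (T \<epsilon>) (\<xi> \<epsilon> \<theta>)) \<and>
         MF_solution M \<epsilon> (T \<epsilon>) \<rho>0 \<xi>0 (E0 \<epsilon>) (B0 \<epsilon>) (\<rho> \<epsilon>) (\<xi> \<epsilon>) (\<phi> \<epsilon>) (A \<epsilon>)) \<and>
      (\<exists>C>0. \<forall>\<epsilon>\<in>{0<..<\<epsilon>0}.
         (SUP \<theta>\<in>space M. Linf_norm (B_norm \<delta>1) (T \<epsilon>) (\<rho> \<epsilon> \<theta>))
           + (SUP \<theta>\<in>space M. Linf_norm (B_norm_vec \<delta>1) (T \<epsilon>) (\<xi> \<epsilon> \<theta>)) \<le> ennreal C \<and>
         Linf_norm (B_norm_vec \<delta>1) (T \<epsilon>) (electric_field \<epsilon> (T \<epsilon>) (\<phi> \<epsilon>) (A \<epsilon>))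
           + Linf_norm (B_norm_vec \<delta>1) (T \<epsilon>) (magnetic_field (B0 \<epsilon>) (A \<epsilon>))
           \<le> ennreal (C * \<epsilon> powr (- \<gamma>))))"
proof -
  have "ln \<delta>0 - (ln \<delta>0 + ln \<delta>1) / 2 > 0" using assms(2,3) by simp
  then obtain K0 where K0: "K0 > 0" "\<And>x. x \<ge> 0 \<Longrightarrow> (1 + x) ^ 1 \<le> K0 * exp ((ln \<delta>0 - (ln \<delta>0 + ln \<delta>1) / 2) * x)"
    using exp_dominates_power[of _ 1] by metis
  define P where "P = K0 * C0 + 1"
  have P: "P > 1" "K0 * C0 > 0" using K0(1) assms(4) by (auto simp: P_def)
  \<comment> \<open>This makes \<open>\<epsilon> * (3 * (K0 * C0)) \<le> 1\<close>, whose square is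
    stronger than the condition of \<open>local_solution\<close>: \<open>9 * x \<le> 1\<close>
    implies \<open>3 * x \<le> 1 / 2\<close>.\<close>
  define \<epsilon>0 where "\<epsilon>0 = 1 / (1 + 3 * P)"
  have \<epsilon>0: "0 < \<epsilon>0" "\<epsilon>0 \<le> 1" using P by (auto simp: \<epsilon>0_def)
  let ?good = "\<lambda>\<epsilon> (T, \<rho>, \<xi>, \<phi>, A). T > 0 \<and>
     (\<forall>\<theta>\<in>space M. continuous_curve (B_norm \<delta>1) (B_space \<delta>1) T (\<rho> \<theta>) \<and>
         continuous_curve (B_norm_vec \<delta>1) (B_space_vec \<delta>1) T (\<xi> \<theta>)) \<and>
     MF_solution M \<epsilon> T \<rho>0 \<xi>0 (E0 \<epsilon>) (B0 \<epsilon>) \<rho> \<xi> \<phi> A \<and>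
     (SUP \<theta>\<in>space M. Linf_norm (B_norm \<delta>1) T (\<rho> \<theta>)) + (SUP \<theta>\<in>space M. Linf_norm (B_norm_vec \<delta>1) T (\<xi> \<theta>))
       \<le> ennreal (100 * P) \<and>
     Linf_norm (B_norm_vec \<delta>1) T (electric_field \<epsilon> T \<phi> A) + Linf_norm (B_norm_vec \<delta>1) T (magnetic_field (B0 \<epsilon>) A)
       \<le> ennreal (100 * P * \<epsilon> powr (- \<gamma>))"
  have "\<exists>p. ?good \<epsilon> p" if \<epsilon>: "\<epsilon> \<in> {0<..<\<epsilon>0}" for \<epsilon>
  proof -
    have \<epsilon>1: "0 < \<epsilon>" "\<epsilon> \<le> 1" "\<epsilon> \<in> {0<..1}" using \<epsilon> \<epsilon>0 by auto
    have m: "\<epsilon> powr (- \<gamma>) \<ge> 1"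
      using powr_mono'[of "- \<gamma>" 0 \<epsilon>] \<epsilon>1 assms(15) by simp
    have small: "\<epsilon>\<^sup>2 * (3 * (K0 * C0)\<^sup>2) \<le> 1 / 2"
    proof -
      have "\<epsilon> * (1 + 3 * P) \<le> 1" using \<epsilon> P by (simp add: \<epsilon>0_def field_simps)
      moreover have "\<epsilon> * (3 * (K0 * C0)) \<le> \<epsilon> * (1 + 3 * P)" using \<epsilon>1 by (intro mult_left_mono) (auto simp: P_def)
      ultimately have "\<epsilon> * (3 * (K0 * C0)) \<le> 1" by linarith
      then have "(\<epsilon> * (3 * (K0 * C0)))\<^sup>2 \<le> 1" using \<epsilon>1 P(2) by (intro power_le_one) auto
      then show ?thesis by (simp add: power_mult_distrib)
    qed
    have \<rho>b: "B_norm \<delta>0 (\<rho>0 \<theta>) \<le> ennreal C0" and \<xi>b: "B_norm_vec \<delta>0 (\<xi>0 \<theta>) \<le> ennreal C0" if "\<theta> \<in> space M" for \<theta>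
      using assms(13,14) that by (auto simp: SUP_le_iff)
    from local_solution[OF assms(1-6) assms(7) \<rho>b assms(8) \<xi>b assms(9)[OF \<epsilon>1(3)] assms(11)[OF \<epsilon>1(3)]
        assms(10)[OF \<epsilon>1(3)] assms(12)[OF \<epsilon>1(3)] assms(16)[OF \<epsilon>1(3)] m \<epsilon>1(1,2) K0 small]
    show ?thesis unfolding P_def split_paired_Ex prod.case by blast
  qed
  \<comment> \<open>Choice over \<epsilon>: the theorem asks for the solutions as functions of
    \<epsilon> with one constant for all of them, and \<open>100 * P\<close> is independent of
    \<epsilon>.\<close>
  then have "\<exists>f. \<forall>\<epsilon>\<in>{0<..<\<epsilon>0}. ?good \<epsilon> (f \<epsilon>)" by (intro bchoice ballI)
  then obtain f where f: "\<forall>\<epsilon>\<in>{0<..<\<epsilon>0}. ?good \<epsilon> (f \<epsilon>)" by (elim exE)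
  define T \<rho> \<xi> \<phi> A where "T \<epsilon> = fst (f \<epsilon>)" and "\<rho> \<epsilon> = fst (snd (f \<epsilon>))" and "\<xi> \<epsilon> = fst (snd (snd (f \<epsilon>)))"
    and "\<phi> \<epsilon> = fst (snd (snd (snd (f \<epsilon>))))" and "A \<epsilon> = snd (snd (snd (snd (f \<epsilon>))))" for \<epsilon>
  have fe: "f \<epsilon> = (T \<epsilon>, \<rho> \<epsilon>, \<xi> \<epsilon>, \<phi> \<epsilon>, A \<epsilon>)" for \<epsilon>
    by (simp add: T_def \<rho>_def \<xi>_def \<phi>_def A_def)
  note f' = f[unfolded fe prod.case, rule_format]
  show ?thesis
  proof (rule exI[of _ \<epsilon>0], intro conjI \<epsilon>0 exI[of _ T] exI[of _ \<rho>] exI[of _ \<xi>] exI[of _ \<phi>] exI[of _ A] exI[of _ "100 * P"] ballI)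
    show "0 < 100 * P" using P by simp
  qed (use f' in blast)+
qed

end
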